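(* Let $k\ge 2$ and $r\ge 2$ be integers and let $l_i(x)=a_ix+b_i\in\mathbb Z[x]$ for $i=1,\dots,r$ be such that $a_i\ne 0$ for all $i$ and $a_ib_j-a_jb_i\ne 0$ for all $1\le i,j\le r$ with $i\ne j$. For each prime $p$ define $$\rho(p)=\#\{n\ (\mathrm{mod}\ p^k):\ p^k\mid l_i(n)\text{ for some }i\},$$ and let $$c=\prod_p\left(1-\frac{\rho(p)}{p^k}\right),$$ the product being over all primes. Let $N(x)$ be the number of positive integers $n\le x$ such that $l_1(n),\dots,l_r(n)$ are all $k$-free. Then for any $\epsilon>0$ and any sufficiently large $x$, $$N(x)=cx+O_\epsilon\bigl(x^{3/(2k+1)+\epsilon}\bigr),$$ where the implied constant may also depend on $k$, $r$ and the choice of the $l_i$.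
   Context: For an integer $k\ge 2$, an integer $n$ is called $k$-free if there is no prime $p$ such that $p^k\mid n$. *)

theory Defs
  imports
    "HOL-Analysis.Infinite_Products"
    "HOL-Computational_Algebra.Computational_Algebra"
    "HOL-Library.Landau_Symbols"
begin

text \<open>In particular \<^term>\<open>0 :: int\<close> is not \<open>k\<close>-free.\<close>
definition k_free :: "nat \<Rightarrow> int \<Rightarrow> bool" where
  "k_free k n \<longleftrightarrow> \<not> (\<exists>p::nat. prime p \<and> int p ^ k dvd n)"

definition rho :: "nat \<Rightarrow> nat \<Rightarrow> (nat \<Rightarrow> int poly) \<Rightarrow> nat \<Rightarrow> nat" where
  "rho k r l p = card {n \<in> {0..<int p ^ k}. \<exists>i\<in>{1..r}. int p ^ k dvd poly (l i) n}"

text \<open>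
  The product over all primes, in increasing order. The library's infinite product tolerates
  finitely many vanishing factors, in which case its value is 0; such factors do occur here
  when \<open>\<rho>(p) = p ^ k\<close>.
\<close>
definition density_const :: "nat \<Rightarrow> nat \<Rightarrow> (nat \<Rightarrow> int poly) \<Rightarrow> real" where
  "density_const k r l =
     (\<Prod>p. if prime p then 1 - real (rho k r l p) / real p ^ k else 1)"

definition count_k_free :: "nat \<Rightarrow> nat \<Rightarrow> (nat \<Rightarrow> int poly) \<Rightarrow> real \<Rightarrow> nat" where
  "count_k_free k r l x =
     card {n::nat. 0 < n \<and> real n \<le> x \<and> (\<forall>i\<in>{1..r}. k_free k (poly (l i) (int n)))}"

end

theory Submission
  imports Defs "HOL-Analysis.Analysis"
begin

text \<open>
  Put \<open>x = u ^ (2 * k + 1)\<close>. Inclusion-exclusion over sets of primes with product at most \<open>u ^ 3\<close>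
  gives the main term, and Rankin's trick bounds the tail of the Euler product. The remaining \<open>n\<close>
  have more than this product of bad primes: either some subproduct lies between \<open>u ^ 2\<close> and a
  multiple of \<open>u ^ 3\<close>, which is again counted trivially, or two primes \<open>p\<close>, \<open>q\<close> in \<open>(u, u ^ 2]\<close>
  with \<open>p * q > u ^ 3\<close> have \<open>k\<close>-th powers dividing two different forms.

  In the last case eliminating \<open>n\<close> gives \<open>e * p ^ k - f * q ^ k = h\<close> with \<open>h\<close> fixed and nonzero, so
  \<open>p / q\<close> is close to a \<open>k\<close>-th root of \<open>f / e\<close>. Pad\'e approximations to \<open>X ^ k\<close> of degree \<open>b\<close> about
  \<open>k / 3\<close> attach to any two solutions with nearby \<open>p / q\<close> an integer, antisymmetric in them and of rank 2
  up to a small error; the four-point Pfaffians are then integers of absolute value below 1, hence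
  zero. Thus all solutions in a short interval satisfy one relation \<open>e * G1 (p, q) + f * G2 (p, q) = 0\<close>
  with forms of degree \<open>b\<close>. Together with the original equation and a B\'ezout identity for
  \<open>G1\<close>, \<open>G2\<close>, this puts the points \<open>(p, q)\<close> on \<open>u ^ \<epsilon>\<close> algebraic curves, on which integer points are
  counted by a convexity argument.
\<close>

section \<open>Divisor bounds\<close>

text \<open>The exponent comes from a balance. Inclusion-exclusion over products up to
  \<open>u ^ 3\<close> costs \<open>u powr \<epsilon>\<close> per product; counting the multiples of
  products \<open>m > u ^ 2\<close> costs \<open>x / m ^ k\<close> each, and
  \<open>x / u ^ (2 * (k - 1)) = u ^ 3\<close> again. For a pair with \<open>p * q > u ^ 3\<close> a
  single form is too small, once \<open>u\<close> is large, to be divisible by both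
  \<open>k\<close>-th powers. For \<open>p\<close> near \<open>D1\<close> and \<open>q\<close> near
  \<open>D2\<close> put \<open>W = sqrt (D1 * D2 / u ^ 3)\<close> and cut the range of
  \<open>p / q\<close> into intervals of relative length \<open>c0 * W / u ^ 3\<close>. At this
  scale the mixed term of the Pfaffian bound has exponent of \<open>u\<close> exactly 0 for every
  \<open>b\<close>, so a small constant \<open>c0\<close> suffices; the convexity bound gives order
  \<open>W\<close> points per interval, and \<open>u ^ 3 / W\<close> intervals give
  \<open>u ^ 3\<close>. The term caused by \<open>h\<close> is not small. Only its being nearly the
  exterior product of two vectors keeps its square out of the Pfaffians. Convexity fails when the
  form defining the curve is a multiple of a power of a linear form. The gap between the degrees
  \<open>b\<close> and \<open>k\<close> excludes this for \<open>k > 2\<close>.\<close>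

lemma power_card_primes_le:
  fixes A \<epsilon> :: real
  assumes "A \<ge> 1" "\<epsilon> > 0"
  obtains C where "C > 0" "\<And>S :: nat set. finite S \<Longrightarrow> (\<And>p. p \<in> S \<Longrightarrow> prime p) \<Longrightarrow> A ^ card S \<le> C * real (\<Prod>S) powr \<epsilon>"
proof
  \<comment> \<open>Chosen so that \<open>A = B powr \<epsilon>\<close>: each prime above
    \<open>B\<close> pays for its own factor \<open>A\<close>, and the at most
    \<open>nat \<lfloor>B\<rfloor> + 1\<close> others go into \<open>C\<close>.\<close>
  define B where "B = A powr (1 / \<epsilon>)"
  define C where "C = A ^ (nat \<lfloor>B\<rfloor> + 1)"
  show "C > 0" unfolding C_def using assms by simp
  fix S :: "nat set" assume S: "finite S" and pr: "\<And>p. p \<in> S \<Longrightarrow> prime p"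
  define S1 where "S1 = {p\<in>S. real p \<le> B}"
  define S2 where "S2 = {p\<in>S. \<not> real p \<le> B}"
  have SU: "S = S1 \<union> S2" "S1 \<inter> S2 = {}" "finite S1" "finite S2" unfolding S1_def S2_def using S by auto
  have "S1 \<subseteq> {..nat \<lfloor>B\<rfloor>}" unfolding S1_def by (auto simp: le_nat_floor)
  then have c1: "card S1 \<le> nat \<lfloor>B\<rfloor> + 1" using card_mono[of "{..nat \<lfloor>B\<rfloor>}" S1] by simp
  have p1: "1 \<le> real p powr \<epsilon>" if "p \<in> S" for p
    using pr[OF that] assms prime_ge_1_nat[of p] by (intro ge_one_powr_ge_zero) auto
  have p2: "A \<le> real p powr \<epsilon>" if "p \<in> S2" for p
  proof -
    have "A = B powr \<epsilon>" unfolding B_def using assms by (simp add: powr_powr)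
    also have "\<dots> \<le> real p powr \<epsilon>" using that assms unfolding S2_def B_def by (intro powr_mono2) auto
    finally show ?thesis .
  qed
  have "A ^ card S = A ^ card S1 * A ^ card S2" using SU by (simp add: card_Un_disjoint power_add)
  also have "\<dots> \<le> C * (\<Prod>p\<in>S2. real p powr \<epsilon>)"
  proof (intro mult_mono)
    show "A ^ card S1 \<le> C" unfolding C_def using c1 assms by (intro power_increasing) auto
    have "A ^ card S2 = (\<Prod>p\<in>S2. A)" by simp
    also have "\<dots> \<le> (\<Prod>p\<in>S2. real p powr \<epsilon>)" using p2 assms by (intro prod_mono) auto
    finally show "A ^ card S2 \<le> (\<Prod>p\<in>S2. real p powr \<epsilon>)" .
  qed (use assms in \<open>auto simp: C_def\<close>)
  also have "\<dots> \<le> C * (\<Prod>p\<in>S. real p powr \<epsilon>)"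
  proof (intro mult_left_mono)
    show "(\<Prod>p\<in>S2. real p powr \<epsilon>) \<le> (\<Prod>p\<in>S. real p powr \<epsilon>)"
      using SU p1 S by (intro prod_mono2) auto
  qed (use assms in \<open>auto simp: C_def\<close>)
  also have "(\<Prod>p\<in>S. real p powr \<epsilon>) = real (\<Prod>S) powr \<epsilon>"
    using S by (induction S rule: finite_induct) (auto simp: powr_mult)
  finally show "A ^ card S \<le> C * real (\<Prod>S) powr \<epsilon>" .
qed

lemma divisors_prime_power_mult:
  fixes p m :: nat
  assumes "prime p" "m > 0"
  shows "card {d. d dvd p ^ a * m} \<le> (a + 1) * card {d. d dvd m}"
proof -
  have fin: "finite {d. d dvd m}" using assms by simp
  have "{d. d dvd p ^ a * m} \<subseteq> (\<lambda>(i, d). p ^ i * d) ` ({..a} \<times> {d. d dvd m})"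
  proof
    fix d assume "d \<in> {d. d dvd p ^ a * m}"
    then obtain x y where xy: "d = x * y" "x dvd p ^ a" "y dvd m" by (auto elim: dvd_productE)
    then obtain i where "i \<le> a" "x = p ^ i" using divides_primepow_nat[OF assms(1)] by auto
    then show "d \<in> (\<lambda>(i, d). p ^ i * d) ` ({..a} \<times> {d. d dvd m})" using xy by auto
  qed
  then have "card {d. d dvd p ^ a * m} \<le> card ({..a} \<times> {d. d dvd m})"
    using fin by (meson card_image_le card_mono finite_SigmaI finite_atMost finite_imageI order_trans)
  then show ?thesis by (simp add: card_cartesian_product)
qed

text \<open>A prime power \<open>p ^ a\<close> exactly dividing \<open>n\<close> contributes at most
  a factor \<open>a + 1\<close> to the left side and \<open>(p powr \<epsilon>) ^ a\<close> to the
  right side. The second dominates once \<open>p powr \<epsilon> \<ge> 2\<close>; each of the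
  finitely many smaller primes costs a factor \<open>c\<close>.\<close>

lemma card_divisors_le:
  fixes \<epsilon> :: real
  assumes "\<epsilon> > 0"
  obtains C where "C > 0" "\<And>n :: nat. n > 0 \<Longrightarrow> real (card {d. d dvd n}) \<le> C * real n powr \<epsilon>"
proof
  define B where "B = 2 powr (1 / \<epsilon>)"
  \<comment> \<open>Makes \<open>a + 1 \<le> c * exp (a * (\<epsilon> * ln 2))\<close> a consequence
    of \<open>exp t \<ge> 1 + t\<close>.\<close>
  define c where "c = max 1 (1 / (\<epsilon> * ln 2))"
  have c1: "c \<ge> 1" unfolding c_def by simp
  define P where "P = {p. prime p \<and> real p \<le> B}"
  have finP: "finite P"
    by (rule finite_subset[of _ "{..nat \<lfloor>B\<rfloor>}"]) (auto simp: P_def le_nat_floor)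
  have small: "real a + 1 \<le> c * (real p powr \<epsilon>) ^ a" if "p \<ge> 2" for p a :: nat
  proof -
    have "1 + real a * (\<epsilon> * ln 2) \<le> exp (real a * (\<epsilon> * ln 2))" by (rule exp_ge_add_one_self)
    also have "\<dots> = (2 powr \<epsilon>) ^ a" by (simp add: powr_def exp_of_nat_mult[symmetric])
    also have "\<dots> \<le> (real p powr \<epsilon>) ^ a" using that assms by (intro power_mono powr_mono2) auto
    finally have 1: "1 + real a * (\<epsilon> * ln 2) \<le> (real p powr \<epsilon>) ^ a" .
    have "c * (\<epsilon> * ln 2) \<ge> 1"
    proof -
      have "1 / (\<epsilon> * ln 2) * (\<epsilon> * ln 2) \<le> c * (\<epsilon> * ln 2)" unfolding c_def using assms by (intro mult_right_mono) auto
      then show ?thesis using assms by simp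
    qed
    then have "real a * 1 \<le> real a * (c * (\<epsilon> * ln 2))" by (intro mult_left_mono) auto
    then have "real a + 1 \<le> c * (1 + real a * (\<epsilon> * ln 2))" using c1 by (simp add: algebra_simps)
    also have "\<dots> \<le> c * (real p powr \<epsilon>) ^ a" using 1 c1 by (intro mult_left_mono) auto
    finally show ?thesis .
  qed
  have big: "real a + 1 \<le> (real p powr \<epsilon>) ^ a" if "\<not> real p \<le> B" for p a :: nat
  proof -
    have "2 = B powr \<epsilon>" unfolding B_def using assms by (simp add: powr_powr)
    also have "\<dots> \<le> real p powr \<epsilon>" using that assms unfolding B_def by (intro powr_mono2) auto
    finally have "2 \<le> real p powr \<epsilon>" .
    then have "2 ^ a \<le> (real p powr \<epsilon>) ^ a" by (intro power_mono) auto
    moreover have "real a + 1 \<le> 2 ^ a"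
    proof (induction a)
      case (Suc a)
      then have "real (Suc a) + 1 \<le> 2 ^ a + 1" by simp
      also have "\<dots> \<le> 2 ^ Suc a" by simp
      finally show ?case .
    qed simp
    ultimately show ?thesis by linarith
  qed
  \<comment> \<open>Induction on \<open>n\<close>, splitting off the full power of one prime
    divisor. The exponent of \<open>c\<close> counts the small primes dividing \<open>n\<close>, so
    it grows whenever the removed prime is small.\<close>
  have main: "n > 0 \<Longrightarrow> real (card {d. d dvd n}) \<le> c ^ card {p\<in>P. p dvd n} * real n powr \<epsilon>" for n
  proof (induction n rule: less_induct)
    case (less n)
    show ?case
    proof (cases "n = 1")
      case True
      have e: "{p\<in>P. p dvd n} = {}" unfolding True P_def by auto
      show ?thesis unfolding e using True by simp
    next
      case False
      then obtain p where p: "prime p" "p dvd n" using prime_factor_nat by blast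
      define a where "a = multiplicity p n"
      obtain m where nm: "n = p ^ a * m" "\<not> p dvd m"
        unfolding a_def using less.prems p(1) multiplicity_decompose'[of n p] by (metis not_prime_unit gr_implies_not0)
      have m0: "m > 0" using nm less.prems by (cases m) auto
      have a0: "a \<ge> 1" using p nm by (cases a) auto
      have pa: "p ^ a \<ge> 2" using p(1) a0 self_le_power[of p a] prime_ge_2_nat[of p] prime_ge_1_nat[of p] by linarith
      have "m < n" unfolding nm(1) using pa m0 by simp
      then have IH: "real (card {d. d dvd m}) \<le> c ^ card {p\<in>P. p dvd m} * real m powr \<epsilon>" using less.IH m0 by blast
      have pw: "real (p ^ a) powr \<epsilon> = (real p powr \<epsilon>) ^ a"
        using prime_gt_0_nat[OF p(1)] by (simp add: powr_realpow[symmetric] powr_powr mult.commute)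
      have e: "real n powr \<epsilon> = (real p powr \<epsilon>) ^ a * real m powr \<epsilon>"
        unfolding nm(1) pw[symmetric] by (simp add: powr_mult)
      have "card {d. d dvd n} \<le> (a + 1) * card {d. d dvd m}"
        using divisors_prime_power_mult[OF p(1) m0, of a] unfolding nm(1)[symmetric] .
      then have "real (card {d. d dvd n}) \<le> real ((a + 1) * card {d. d dvd m})" by (simp only: of_nat_le_iff)
      then have "real (card {d. d dvd n}) \<le> (real a + 1) * real (card {d. d dvd m})"
        by (simp only: of_nat_mult of_nat_add of_nat_1)
      also have "\<dots> \<le> (real a + 1) * (c ^ card {p\<in>P. p dvd m} * real m powr \<epsilon>)" using IH by (intro mult_left_mono) auto
      also have "\<dots> \<le> c ^ card {p\<in>P. p dvd n} * real n powr \<epsilon>"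
      proof (cases "p \<in> P")
        case True
        have "insert p {q\<in>P. q dvd m} \<subseteq> {q\<in>P. q dvd n}" using True p nm(1) by auto
        then have "card (insert p {q\<in>P. q dvd m}) \<le> card {q\<in>P. q dvd n}" using finP by (intro card_mono) auto
        then have "Suc (card {q\<in>P. q dvd m}) \<le> card {q\<in>P. q dvd n}" using finP nm(2) by simp
        then have cc: "c ^ Suc (card {q\<in>P. q dvd m}) \<le> c ^ card {q\<in>P. q dvd n}" using c1 by (intro power_increasing) auto
        have "(real a + 1) * (c ^ card {p\<in>P. p dvd m} * real m powr \<epsilon>) \<le> (c * (real p powr \<epsilon>) ^ a) * (c ^ card {p\<in>P. p dvd m} * real m powr \<epsilon>)"
          using small[of p a] prime_ge_2_nat[OF p(1)] c1 by (intro mult_right_mono) auto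
        also have "\<dots> = c ^ Suc (card {q\<in>P. q dvd m}) * real n powr \<epsilon>" unfolding e by simp
        also have "\<dots> \<le> c ^ card {q\<in>P. q dvd n} * real n powr \<epsilon>" using cc by (intro mult_right_mono) auto
        finally show ?thesis .
      next
        case False
        then have nB: "\<not> real p \<le> B" using p unfolding P_def by auto
        have "card {q\<in>P. q dvd m} \<le> card {q\<in>P. q dvd n}" using finP nm(1) by (intro card_mono) auto
        then have cc: "c ^ card {q\<in>P. q dvd m} \<le> c ^ card {q\<in>P. q dvd n}" using c1 by (intro power_increasing) auto
        have "(real a + 1) * (c ^ card {p\<in>P. p dvd m} * real m powr \<epsilon>) \<le> (real p powr \<epsilon>) ^ a * (c ^ card {p\<in>P. p dvd m} * real m powr \<epsilon>)"
          using big[OF nB, of a] c1 by (intro mult_right_mono) auto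
        also have "\<dots> = c ^ card {q\<in>P. q dvd m} * real n powr \<epsilon>" unfolding e by simp
        also have "\<dots> \<le> c ^ card {q\<in>P. q dvd n} * real n powr \<epsilon>" using cc by (intro mult_right_mono) auto
        finally show ?thesis .
      qed
      finally show ?thesis .
    qed
  qed
  show "c ^ card P > 0" using c1 by simp
  fix n :: nat assume n: "n > 0"
  have "c ^ card {p\<in>P. p dvd n} \<le> c ^ card P" using c1 finP by (intro power_increasing card_mono) auto
  then have "c ^ card {p\<in>P. p dvd n} * real n powr \<epsilon> \<le> c ^ card P * real n powr \<epsilon>" by (intro mult_right_mono) auto
  then show "real (card {d. d dvd n}) \<le> c ^ card P * real n powr \<epsilon>" using main[OF n] by linarith
qed

lemma card_int_divisors_le:
  fixes \<epsilon> :: real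
  assumes "\<epsilon> > 0"
  obtains C where "C > 0" "\<And>n :: int. n \<noteq> 0 \<Longrightarrow> finite {d. d dvd n}"
    "\<And>n :: int. n \<noteq> 0 \<Longrightarrow> real (card {d. d dvd n}) \<le> C * real_of_int \<bar>n\<bar> powr \<epsilon>"
proof -
  obtain C where C: "C > 0" "\<And>n :: nat. n > 0 \<Longrightarrow> real (card {d. d dvd n}) \<le> C * real n powr \<epsilon>"
    by (rule card_divisors_le[OF assms]) blast
  show ?thesis
  proof (rule that[of "2 * C"])
    show "2 * C > 0" using C by simp
    fix n :: int assume n: "n \<noteq> 0"
    define D where "D = {d. d dvd nat \<bar>n\<bar>}"
    have finD: "finite D" unfolding D_def using n by (intro finite_divisors_nat) auto
    have sub: "{d. d dvd n} \<subseteq> int ` D \<union> (\<lambda>d. - int d) ` D"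
    proof
      fix d assume "d \<in> {d. d dvd n}"
      then have "nat \<bar>d\<bar> \<in> D" unfolding D_def by (simp add: nat_abs_dvd_iff dvd_nat_abs_iff)
      moreover have "d = int (nat \<bar>d\<bar>) \<or> d = - int (nat \<bar>d\<bar>)" by auto
      ultimately show "d \<in> int ` D \<union> (\<lambda>d. - int d) ` D" by blast
    qed
    show "finite {d. d dvd n}" using sub finD finite_subset by blast
    have "card {d. d dvd n} \<le> card (int ` D) + card ((\<lambda>d. - int d) ` D)"
      using card_mono[OF _ sub] card_Un_le[of "int ` D" "(\<lambda>d. - int d) ` D"] finD by (meson finite_UnI finite_imageI order_trans)
    also have "\<dots> \<le> card D + card D" by (intro add_mono card_image_le finD)
    finally have "real (card {d. d dvd n}) \<le> 2 * real (card D)" by simp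
    also have "\<dots> \<le> 2 * (C * real (nat \<bar>n\<bar>) powr \<epsilon>)" unfolding D_def using C(2)[of "nat \<bar>n\<bar>"] n by simp
    finally show "real (card {d. d dvd n}) \<le> 2 * C * real_of_int \<bar>n\<bar> powr \<epsilon>" by simp
  qed
qed

section \<open>Pad\'e forms and Pfaffians\<close>

lemma alternating_binomial_sum_Suc:
  fixes f :: "nat \<Rightarrow> real"
  shows "(\<Sum>j\<le>Suc b. real (Suc b choose j) * (-1) ^ j * f j) =
    (\<Sum>j\<le>b. real (b choose j) * (-1) ^ j * f j) - (\<Sum>j\<le>b. real (b choose j) * (-1) ^ j * f (Suc j))"
proof -
  have 1: "(\<Sum>j\<le>Suc b. real (Suc b choose j) * (-1) ^ j * f j) =
     f 0 - (\<Sum>j\<le>b. (real (b choose j) + real (b choose Suc j)) * (-1) ^ j * f (Suc j))"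
  proof -
    have "(\<Sum>j\<le>b. real (Suc b choose Suc j) * (-1) ^ Suc j * f (Suc j)) =
      - (\<Sum>j\<le>b. (real (b choose j) + real (b choose Suc j)) * (-1) ^ j * f (Suc j))"
      unfolding sum_negf[symmetric] by (intro sum.cong refl) simp
    then show ?thesis by (subst sum.atMost_Suc_shift) (simp del: binomial_Suc_Suc)
  qed
  have 2: "(\<Sum>j\<le>b. real (b choose j) * (-1) ^ j * f j) =
     f 0 - (\<Sum>j\<le>b. real (b choose Suc j) * (-1) ^ j * f (Suc j))"
  proof -
    have "(\<Sum>j\<le>b. real (b choose j) * (-1) ^ j * f j) = (\<Sum>j\<le>Suc b. real (b choose j) * (-1) ^ j * f j)" by simp
    also have "\<dots> = f 0 + (\<Sum>j\<le>b. real (b choose Suc j) * (-1) ^ Suc j * f (Suc j))"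
      by (subst sum.atMost_Suc_shift) simp
    also have "\<dots> = f 0 - (\<Sum>j\<le>b. real (b choose Suc j) * (-1) ^ j * f (Suc j))"
      by (simp add: sum_negf)
    finally show ?thesis .
  qed
  show ?thesis unfolding 1 2 by (simp add: distrib_right sum.distrib)
qed

text \<open>The sum is the Beta integral of \<open>t ^ (m - 1) * (1 - t) ^ b\<close> over the unit
  interval. Induction on \<open>b\<close> avoids the integral: Pascal's rule turns the left side
  into the difference of the values at \<open>m\<close> and \<open>m + 1\<close>.\<close>

lemma alternating_binomial_sum_inverse:
  assumes "m \<ge> 1"
  shows "(\<Sum>j\<le>b. real (b choose j) * (-1) ^ j * (1 / real (m + j))) = fact b * fact (m - 1) / fact (m + b)"
  using assms
proof (induction b arbitrary: m)
  case 0
  then obtain n where "m = Suc n" by (cases m) auto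
  then show ?case by (simp add: fact_Suc field_simps del: of_nat_Suc)
next
  case (Suc b)
  obtain n where m: "m = Suc n" using Suc.prems by (cases m) auto
  have "(\<Sum>j\<le>Suc b. real (Suc b choose j) * (-1) ^ j * (1 / real (m + j))) =
    fact b * fact (m - 1) / fact (m + b) - fact b * fact m / fact (Suc m + b)"
    unfolding alternating_binomial_sum_Suc[of b "\<lambda>j. 1 / real (m + j)"]
    using Suc.IH[of m] Suc.IH[of "Suc m"] Suc.prems by simp
  also have "\<dots> = fact (Suc b) * fact (m - 1) / fact (m + Suc b)"
  proof -
    have aux: "X / F - X * c / (M * F) = X * (M - c) / (M * F)" if "F \<noteq> 0" "M \<noteq> 0" for X F c M :: real
      using that by (simp add: field_simps)
    have 1: "fact (Suc m + b) = (real m + real b + 1) * fact (m + b)" by simp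
    have 2: "fact m = fact (m - 1) * real m" unfolding m by (simp add: mult.commute)
    have "fact b * fact (m - 1) / fact (m + b) - fact b * fact m / fact (Suc m + b)
      = (fact b * fact (m - 1)) * ((real m + real b + 1) - real m) / ((real m + real b + 1) * fact (m + b))"
      unfolding 1 2 mult.assoc[symmetric] by (rule aux) auto
    also have "\<dots> = fact (Suc b) * fact (m - 1) / fact (m + Suc b)" by (simp add: ac_simps)
    finally show ?thesis .
  qed
  finally show ?case .
qed

text \<open>The coefficients of the Pade approximation to \<open>X ^ k\<close>: the signed binomials
  times the Beta values \<open>fact b * fact (k - 1 - i) / fact (k + b - i)\<close>, multiplied by
  \<open>fact (k + b) / fact b\<close> to become integers. The \<open>div\<close> is exact, and
  \<open>k - 1 - i\<close> is a genuine difference for \<open>i \<le> b < k\<close>.\<close>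

definition pade_coeff :: "nat \<Rightarrow> nat \<Rightarrow> nat \<Rightarrow> int" where
  "pade_coeff k b i = (-1) ^ i * int (b choose i) * fact (k - 1 - i) * (fact (k + b) div fact (k + b - i))"

lemma real_pade_coeff:
  "real_of_int (pade_coeff k b i) = (-1) ^ i * real (b choose i) * fact (k - 1 - i) * fact (k + b) / fact (k + b - i)"
proof -
  have "(fact (k + b - i) :: int) dvd fact (k + b)" by (rule fact_dvd) simp
  then have "real_of_int (fact (k + b) div fact (k + b - i)) = fact (k + b) / fact (k + b - i)"
    by (simp add: real_of_int_div)
  then show ?thesis unfolding pade_coeff_def by simp
qed

lemma pade_coeff_nonzero: "i \<le> b \<Longrightarrow> pade_coeff k b i \<noteq> 0"
proof -
  assume "i \<le> b"
  then have "real_of_int (pade_coeff k b i) \<noteq> 0" unfolding real_pade_coeff by simp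
  then show ?thesis by auto
qed

text \<open>The same form with its arguments exchanged serves as numerator and as denominator of the
  approximation. This symmetry is what later makes the pairing of two points antisymmetric.\<close>

definition pade_form :: "nat \<Rightarrow> nat \<Rightarrow> real \<Rightarrow> real \<Rightarrow> real" where
  "pade_form k b X Y = (\<Sum>i\<le>b. real_of_int (pade_coeff k b i) * X ^ i * Y ^ (b - i))"

text \<open>
  Up to a constant the Pad\'e remainder is the integral of
  \<open>(s - \<tau>) ^ b * (\<tau> - s') ^ b * \<tau> ^ (k - b - 1)\<close> from \<open>s'\<close> to \<open>s\<close>, here in the form of
  an increment of an explicit antiderivative.
\<close>
lemma pade_remainder_le:
  fixes s s' :: real
  assumes b: "b < k" and s: "1/2 \<le> s" "s \<le> 2" "1/2 \<le> s'" "s' \<le> 2"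
  shows "\<bar>s ^ k * pade_form k b s' s - s' ^ k * pade_form k b s s'\<bar> \<le> fact (k + b) * 2 ^ k * \<bar>s - s'\<bar> ^ (2 * b + 1)"
proof -
  \<comment> \<open>The termwise antiderivative of \<open>\<phi>\<close> after expanding both
    binomial powers. At \<open>t = s\<close> the sum over \<open>j\<close> is a Beta sum, at
    \<open>t = s'\<close> the sum over \<open>i\<close> is, so each end produces one of the two Pade
    products.\<close>
  define T where "T = (\<lambda>t::real. \<Sum>i\<le>b. \<Sum>j\<le>b. real (b choose i) * real (b choose j) * (-1) ^ (i + j)
     * s ^ (b - j) * s' ^ i * (t ^ (k + j - i) / real (k + j - i)))"
  define \<phi> where "\<phi> = (\<lambda>t::real. t ^ (k - b - 1) * (s - t) ^ b * (t - s') ^ b)"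
  have der: "(T has_real_derivative \<phi> t) (at t)" for t
  proof -
    have A: "(s - t) ^ b = (\<Sum>j\<le>b. real (b choose j) * (-1) ^ j * t ^ j * s ^ (b - j))"
    proof -
      have "(s - t) ^ b = (- t + s) ^ b" by simp
      also have "\<dots> = (\<Sum>j\<le>b. real (b choose j) * (- t) ^ j * s ^ (b - j))" by (rule binomial_ring)
      finally show ?thesis by (simp add: power_minus[of t] mult.assoc)
    qed
    have B: "(t - s') ^ b = (\<Sum>i\<le>b. real (b choose i) * (-1) ^ i * s' ^ i * t ^ (b - i))"
    proof -
      have "(t - s') ^ b = (- s' + t) ^ b" by simp
      also have "\<dots> = (\<Sum>j\<le>b. real (b choose j) * (- s') ^ j * t ^ (b - j))" by (rule binomial_ring)
      finally show ?thesis by (simp add: power_minus[of s'] mult.assoc)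
    qed
    have pw: "t ^ (k - b - 1) * (t ^ j * t ^ (b - i)) = t ^ (k + j - i - 1)" if "i \<le> b" for i j
      unfolding power_add[symmetric] using that b by (intro arg_cong[of _ _ "\<lambda>n. t ^ n"]) auto
    have "\<phi> t = t ^ (k - b - 1) * ((t - s') ^ b * (s - t) ^ b)"
      unfolding \<phi>_def by (simp only: ac_simps)
    also have "\<dots> = (\<Sum>i\<le>b. \<Sum>j\<le>b. t ^ (k - b - 1) * ((real (b choose i) * (-1) ^ i * s' ^ i * t ^ (b - i)) * (real (b choose j) * (-1) ^ j * t ^ j * s ^ (b - j))))"
      unfolding A B sum_product unfolding sum_distrib_left ..
    also have "\<dots> = (\<Sum>i\<le>b. \<Sum>j\<le>b. real (b choose i) * real (b choose j) * (-1) ^ (i + j)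
     * s ^ (b - j) * s' ^ i * t ^ (k + j - i - 1))"
    proof (intro sum.cong refl)
      fix i j assume "i \<in> {..b}"
      then have "i \<le> b" by simp
      show "t ^ (k - b - 1) * ((real (b choose i) * (-1) ^ i * s' ^ i * t ^ (b - i)) * (real (b choose j) * (-1) ^ j * t ^ j * s ^ (b - j)))
        = real (b choose i) * real (b choose j) * (-1) ^ (i + j) * s ^ (b - j) * s' ^ i * t ^ (k + j - i - 1)"
        unfolding pw[OF \<open>i \<le> b\<close>, of j, symmetric] power_add by (simp only: ac_simps)
    qed
    finally have \<phi>eq: "\<phi> t = \<dots>" .
    have d1: "((\<lambda>t. t ^ n / real n) has_real_derivative t ^ (n - 1)) (at t)" if "n \<ge> 1" for n
      using that by (auto intro!: derivative_eq_intros)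
    show ?thesis unfolding \<phi>eq T_def
      by (intro DERIV_sum DERIV_cmult d1) (use b in auto)
  qed
  have Ts: "T s = fact b / fact (k + b) * (s ^ k * pade_form k b s' s)"
  proof -
    have "T s = (\<Sum>i\<le>b. real (b choose i) * (-1) ^ i * s' ^ i * s ^ (k + b - i) * (\<Sum>j\<le>b. real (b choose j) * (-1) ^ j * (1 / real (k - i + j))))"
      unfolding T_def sum_distrib_left
    proof (intro sum.cong refl)
      fix i j assume ij: "i \<in> {..b}" "j \<in> {..b}"
      have e: "s ^ (k + b - i) = s ^ (b - j) * s ^ (k + j - i)"
        unfolding power_add[symmetric] using ij b by (intro arg_cong[of _ _ "\<lambda>n. s ^ n"]) auto
      have e2: "k + j - i = k - i + j" using ij b by auto
      show "real (b choose i) * real (b choose j) * (- 1) ^ (i + j) * s ^ (b - j) * s' ^ i * (s ^ (k + j - i) / real (k + j - i)) =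
        real (b choose i) * (- 1) ^ i * s' ^ i * s ^ (k + b - i) * (real (b choose j) * (- 1) ^ j * (1 / real (k - i + j)))"
        unfolding e power_add unfolding e2 by (simp add: ac_simps)
    qed
    also have "\<dots> = (\<Sum>i\<le>b. real (b choose i) * (-1) ^ i * s' ^ i * s ^ (k + b - i) * (fact b * fact (k - i - 1) / fact (k - i + b)))"
      using b by (intro sum.cong refl arg_cong2[of _ _ _ _ "(*)"] alternating_binomial_sum_inverse) auto
    also have "\<dots> = fact b / fact (k + b) * (s ^ k * pade_form k b s' s)"
      unfolding pade_form_def sum_distrib_left real_pade_coeff
    proof (intro sum.cong refl)
      fix i assume i: "i \<in> {..b}"
      have e: "s ^ (k + b - i) = s ^ k * s ^ (b - i)" unfolding power_add[symmetric]
        using i b by (intro arg_cong[of _ _ "\<lambda>n. s ^ n"]) auto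
      have e2: "k - i + b = k + b - i" "k - i - 1 = k - 1 - i" using i b by auto
      show "real (b choose i) * (- 1) ^ i * s' ^ i * s ^ (k + b - i) * (fact b * fact (k - i - 1) / fact (k - i + b)) =
         fact b / fact (k + b) * (s ^ k * ((- 1) ^ i * real (b choose i) * fact (k - 1 - i) * fact (k + b) / fact (k + b - i) * s' ^ i * s ^ (b - i)))"
        unfolding e e2 by (simp add: field_simps)
    qed
    finally show ?thesis .
  qed
  have Ts': "T s' = fact b / fact (k + b) * (s' ^ k * pade_form k b s s')"
  proof -
    have "T s' = (\<Sum>j\<le>b. \<Sum>i\<le>b. real (b choose i) * real (b choose j) * (-1) ^ (i + j)
     * s ^ (b - j) * s' ^ i * (s' ^ (k + j - i) / real (k + j - i)))"
      unfolding T_def by (rule sum.swap)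
    also have "\<dots> = (\<Sum>j\<le>b. real (b choose j) * (-1) ^ j * s ^ (b - j) * s' ^ (k + j) * (\<Sum>i\<le>b. real (b choose i) * (-1) ^ i * (1 / real (k + j - i))))"
      unfolding sum_distrib_left
    proof (intro sum.cong refl)
      fix i j assume ij: "i \<in> {..b}" "j \<in> {..b}"
      have e: "s' ^ (k + j) = s' ^ i * s' ^ (k + j - i)"
        unfolding power_add[symmetric] using ij b by (intro arg_cong[of _ _ "\<lambda>n. s' ^ n"]) auto
      show "real (b choose i) * real (b choose j) * (- 1) ^ (i + j) * s ^ (b - j) * s' ^ i * (s' ^ (k + j - i) / real (k + j - i)) =
         real (b choose j) * (- 1) ^ j * s ^ (b - j) * s' ^ (k + j) * (real (b choose i) * (- 1) ^ i * (1 / real (k + j - i)))"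
        unfolding e power_add[of "-1"] by (simp add: ac_simps)
    qed
    also have "\<dots> = (\<Sum>j\<le>b. real (b choose j) * (-1) ^ j * s ^ (b - j) * s' ^ (k + j) * ((-1) ^ b * (fact b * fact (k + j - b - 1) / fact (k + j))))"
    proof (intro sum.cong refl arg_cong2[of _ _ _ _ "(*)"])
      fix j assume "j \<in> {..b}"
      \<comment> \<open>The denominators descend in \<open>i\<close>. Reversing the summation makes
        them ascend from \<open>k + j - b\<close>, at the price of a sign \<open>(-1) ^ b\<close>
        that the reversal of the outer sum cancels.\<close>
      have "(\<Sum>i\<le>b. real (b choose i) * (-1) ^ i * (1 / real (k + j - i))) =
        (\<Sum>i\<le>b. real (b choose (b - i)) * (-1) ^ (b - i) * (1 / real (k + j - (b - i))))"
        by (rule sum.reindex_bij_witness[of _ "\<lambda>i. b - i" "\<lambda>i. b - i"]) auto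
      also have "\<dots> = (\<Sum>i\<le>b. (-1) ^ b * (real (b choose i) * (-1) ^ i * (1 / real (k + j - b + i))))"
      proof (intro sum.cong refl)
        fix i assume i: "i \<in> {..b}"
        have "(-1::real) ^ (b - i) = (-1) ^ b * (-1) ^ i" using i
          by (simp add: minus_one_power_iff)
        moreover have "b choose (b - i) = b choose i" using i by (simp add: binomial_symmetric[symmetric])
        moreover have "k + j - (b - i) = k + j - b + i" using i b by auto
        ultimately show "real (b choose (b - i)) * (-1) ^ (b - i) * (1 / real (k + j - (b - i))) =
           (-1) ^ b * (real (b choose i) * (-1) ^ i * (1 / real (k + j - b + i)))" by simp
      qed
      also have "\<dots> = (-1) ^ b * (fact b * fact (k + j - b - 1) / fact (k + j - b + b))"
        unfolding sum_distrib_left[symmetric] using b by (subst alternating_binomial_sum_inverse) auto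
      finally show "(\<Sum>i\<le>b. real (b choose i) * (-1) ^ i * (1 / real (k + j - i))) = (-1) ^ b * (fact b * fact (k + j - b - 1) / fact (k + j))"
        using b by simp
    qed
    also have "\<dots> = (\<Sum>j\<le>b. real (b choose (b - j)) * (-1) ^ (b - j) * s ^ (b - (b - j)) * s' ^ (k + (b - j)) * ((-1) ^ b * (fact b * fact (k + (b - j) - b - 1) / fact (k + (b - j)))))"
      by (rule sum.reindex_bij_witness[of _ "\<lambda>i. b - i" "\<lambda>i. b - i"]) auto
    also have "\<dots> = fact b / fact (k + b) * (s' ^ k * pade_form k b s s')"
      unfolding pade_form_def sum_distrib_left real_pade_coeff
    proof (intro sum.cong refl)
      fix j assume j: "j \<in> {..b}"
      have e1: "(-1::real) ^ (b - j) * (-1) ^ b = (-1) ^ j" using j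
        by (simp add: minus_one_power_iff)
      have e2: "b choose (b - j) = b choose j" using j by (simp add: binomial_symmetric[symmetric])
      have e3: "b - (b - j) = j" "k + (b - j) = k + b - j" "k + b - j - b - 1 = k - 1 - j" using j b by auto
      have e4: "s' ^ (k + b - j) = s' ^ k * s' ^ (b - j)" unfolding power_add[symmetric]
        using j b by (intro arg_cong[of _ _ "\<lambda>n. s' ^ n"]) auto
      have "real (b choose (b - j)) * (-1) ^ (b - j) * s ^ (b - (b - j)) * s' ^ (k + (b - j)) * ((-1) ^ b * (fact b * fact (k + (b - j) - b - 1) / fact (k + (b - j))))
        = ((-1) ^ (b - j) * (-1) ^ b) * real (b choose j) * s ^ j * (s' ^ k * s' ^ (b - j)) * (fact b * fact (k - 1 - j) / fact (k + b - j))"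
        unfolding e2 e3 e4 by (simp only: ac_simps)
      also have "\<dots> = fact b / fact (k + b) * (s' ^ k * ((- 1) ^ j * real (b choose j) * fact (k - 1 - j) * fact (k + b) / fact (k + b - j) * s ^ j * s' ^ (b - j)))"
        unfolding e1 by (simp add: field_simps)
      finally show "real (b choose (b - j)) * (-1) ^ (b - j) * s ^ (b - (b - j)) * s' ^ (k + (b - j)) * ((-1) ^ b * (fact b * fact (k + (b - j) - b - 1) / fact (k + (b - j))))
        = \<dots>" .
    qed
    finally show ?thesis .
  qed
  \<comment> \<open>Mean value theorem between \<open>s\<close> and \<open>s'\<close>: the two
    factors of \<open>\<phi>\<close> that vanish at the ends contribute
    \<open>\<bar>s - s'\<bar> ^ b\<close> each, and the length of the interval contributes one more
    factor.\<close>
  have bound: "\<bar>T s - T s'\<bar> \<le> 2 ^ k * \<bar>s - s'\<bar> ^ (2 * b + 1)"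
  proof (cases "s = s'")
    case False
    define lo where "lo = min s s'"
    define hi where "hi = max s s'"
    have "lo < hi" using False unfolding lo_def hi_def by auto
    then obtain z where z: "lo < z" "z < hi" "T hi - T lo = (hi - lo) * \<phi> z"
      using MVT2[of lo hi T \<phi>] der by auto
    have zr: "1/2 \<le> z" "z \<le> 2" "\<bar>s - z\<bar> \<le> \<bar>s - s'\<bar>" "\<bar>z - s'\<bar> \<le> \<bar>s - s'\<bar>"
      using z s unfolding lo_def hi_def by auto
    have "\<bar>\<phi> z\<bar> \<le> 2 ^ (k - b - 1) * \<bar>s - s'\<bar> ^ b * \<bar>s - s'\<bar> ^ b"
      unfolding \<phi>_def abs_mult power_abs using zr by (intro mult_mono power_mono) auto
    also have "\<dots> \<le> 2 ^ k * \<bar>s - s'\<bar> ^ b * \<bar>s - s'\<bar> ^ b"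
      by (intro mult_right_mono power_increasing) auto
    finally have "\<bar>\<phi> z\<bar> \<le> 2 ^ k * \<bar>s - s'\<bar> ^ b * \<bar>s - s'\<bar> ^ b" .
    then have "\<bar>s - s'\<bar> * \<bar>\<phi> z\<bar> \<le> \<bar>s - s'\<bar> * (2 ^ k * \<bar>s - s'\<bar> ^ b * \<bar>s - s'\<bar> ^ b)" by (intro mult_left_mono) auto
    also have "\<dots> = 2 ^ k * \<bar>s - s'\<bar> ^ (2 * b + 1)" by (simp add: power_add mult_2)
    also have "\<bar>s - s'\<bar> * \<bar>\<phi> z\<bar> = \<bar>T hi - T lo\<bar>"
    proof -
      have "\<bar>hi - lo\<bar> = \<bar>s - s'\<bar>" unfolding hi_def lo_def by auto
      then show ?thesis by (simp only: z(3) abs_mult)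
    qed
    also have "\<bar>T hi - T lo\<bar> = \<bar>T s - T s'\<bar>" unfolding hi_def lo_def by (auto simp: min_def max_def)
    finally show ?thesis .
  qed auto
  have "T s - T s' = fact b / fact (k + b) * (s ^ k * pade_form k b s' s - s' ^ k * pade_form k b s s')"
    unfolding Ts Ts' by (simp add: algebra_simps)
  then have "s ^ k * pade_form k b s' s - s' ^ k * pade_form k b s s' = fact (k + b) / fact b * (T s - T s')"
    by (simp add: field_simps)
  then have "\<bar>s ^ k * pade_form k b s' s - s' ^ k * pade_form k b s s'\<bar> = fact (k + b) / fact b * \<bar>T s - T s'\<bar>"
    by (simp add: abs_mult)
  also have "\<dots> \<le> fact (k + b) * \<bar>T s - T s'\<bar>"
    by (intro mult_right_mono) (auto simp: divide_le_eq fact_ge_1)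
  also have "\<dots> \<le> fact (k + b) * (2 ^ k * \<bar>s - s'\<bar> ^ (2 * b + 1))" using bound by (intro mult_left_mono) auto
  finally show ?thesis by (simp only: mult.assoc)
qed

section \<open>Size of the Pade forms and of their two-by-two minors\<close>

lemma abs_power_diff_le:
  fixes x y :: real
  assumes "0 \<le> x" "x \<le> 2" "0 \<le> y" "y \<le> 2"
  shows "\<bar>x ^ n - y ^ n\<bar> \<le> real n * 2 ^ n * \<bar>x - y\<bar>"
proof (induction n)
  case (Suc n)
  have "x ^ Suc n - y ^ Suc n = x * (x ^ n - y ^ n) + (x - y) * y ^ n" by (simp add: algebra_simps)
  then have "\<bar>x ^ Suc n - y ^ Suc n\<bar> \<le> \<bar>x\<bar> * \<bar>x ^ n - y ^ n\<bar> + \<bar>x - y\<bar> * \<bar>y ^ n\<bar>"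
    by (metis abs_mult abs_triangle_ineq)
  also have "\<dots> \<le> 2 * (real n * 2 ^ n * \<bar>x - y\<bar>) + \<bar>x - y\<bar> * 2 ^ n"
    using Suc.IH assms by (intro add_mono mult_mono) (auto intro: power_mono)
  also have "\<dots> \<le> real (Suc n) * 2 ^ Suc n * \<bar>x - y\<bar>" by (simp add: algebra_simps)
  finally show ?case .
qed simp

text \<open>The determinant vanishes on the diagonal \<open>x = y\<close>, which is where the factor
  \<open>\<bar>x - y\<bar>\<close> comes from.\<close>

lemma abs_power_det_le:
  fixes x y :: real
  assumes "0 \<le> x" "x \<le> 2" "0 \<le> y" "y \<le> 2" "i \<le> b" "j \<le> b"
  shows "\<bar>x ^ i * y ^ j - x ^ j * y ^ i\<bar> \<le> 2 * real b * 4 ^ b * \<bar>x - y\<bar>"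
proof -
  have p2: "(2::real) ^ i \<le> 2 ^ b" "(2::real) ^ j \<le> 2 ^ b" using assms by (auto intro: power_increasing)
  have pd: "\<bar>x ^ n - y ^ n\<bar> \<le> real b * 2 ^ b * \<bar>x - y\<bar>" if "n \<le> b" for n
  proof -
    have "\<bar>x ^ n - y ^ n\<bar> \<le> real n * 2 ^ n * \<bar>x - y\<bar>" by (rule abs_power_diff_le) (use assms in auto)
    also have "\<dots> \<le> real b * 2 ^ b * \<bar>x - y\<bar>" using that by (intro mult_mono power_increasing) auto
    finally show ?thesis .
  qed
  have yb: "\<bar>y ^ n\<bar> \<le> 2 ^ b" if "n \<le> b" for n
  proof -
    have "\<bar>y ^ n\<bar> \<le> 2 ^ n" using assms by (auto intro: power_mono)
    also have "\<dots> \<le> (2::real) ^ b" using that by (intro power_increasing) auto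
    finally show ?thesis .
  qed
  have "x ^ i * y ^ j - x ^ j * y ^ i = (x ^ i - y ^ i) * y ^ j - y ^ i * (x ^ j - y ^ j)" by (simp add: algebra_simps)
  then have "\<bar>x ^ i * y ^ j - x ^ j * y ^ i\<bar> \<le> \<bar>x ^ i - y ^ i\<bar> * \<bar>y ^ j\<bar> + \<bar>y ^ i\<bar> * \<bar>x ^ j - y ^ j\<bar>"
    by (metis abs_mult abs_triangle_ineq4)
  also have "\<dots> \<le> real b * 2 ^ b * \<bar>x - y\<bar> * 2 ^ b + 2 ^ b * (real b * 2 ^ b * \<bar>x - y\<bar>)"
    using pd[OF assms(5)] pd[OF assms(6)] yb[OF assms(5)] yb[OF assms(6)]
    by (intro add_mono mult_mono) auto
  also have "\<dots> = 2 * real b * 4 ^ b * \<bar>x - y\<bar>"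
  proof -
    have "(4::real) ^ b = 2 ^ b * 2 ^ b" by (simp add: power_mult_distrib[symmetric])
    then show ?thesis by simp
  qed
  finally show ?thesis .
qed

lemma pade_form_le:
  obtains C where "C > 0" "\<And>X Y. 0 \<le> X \<Longrightarrow> X \<le> 2 \<Longrightarrow> 0 \<le> Y \<Longrightarrow> Y \<le> 2 \<Longrightarrow> \<bar>pade_form k b X Y\<bar> \<le> C"
proof
  define C where "C = 1 + (\<Sum>i\<le>b. \<bar>real_of_int (pade_coeff k b i)\<bar> * 2 ^ i * 2 ^ (b - i))"
  show "C > 0" unfolding C_def by (intro add_pos_nonneg sum_nonneg) auto
  fix X Y :: real assume XY: "0 \<le> X" "X \<le> 2" "0 \<le> Y" "Y \<le> 2"
  have "\<bar>pade_form k b X Y\<bar> \<le> (\<Sum>i\<le>b. \<bar>real_of_int (pade_coeff k b i) * X ^ i * Y ^ (b - i)\<bar>)"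
    unfolding pade_form_def by (rule sum_abs)
  also have "\<dots> \<le> (\<Sum>i\<le>b. \<bar>real_of_int (pade_coeff k b i)\<bar> * 2 ^ i * 2 ^ (b - i))"
    unfolding abs_mult using XY by (intro sum_mono mult_mono power_mono) (auto intro: power_mono)
  finally show "\<bar>pade_form k b X Y\<bar> \<le> C" unfolding C_def by simp
qed

text \<open>A minor of the matrix with entries \<open>pade_form k b y x\<close> vanishes both when
  its rows and when its columns coincide. Expanding into monomials and antisymmetrising over the two
  exponents exhibits both differences as factors.\<close>

lemma pade_form_det_le:
  obtains C where "C > 0" "\<And>x x' y y'. 0 \<le> x \<Longrightarrow> x \<le> 2 \<Longrightarrow> 0 \<le> x' \<Longrightarrow> x' \<le> 2 \<Longrightarrow>
     0 \<le> y \<Longrightarrow> y \<le> 2 \<Longrightarrow> 0 \<le> y' \<Longrightarrow> y' \<le> 2 \<Longrightarrow>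
    \<bar>pade_form k b y x * pade_form k b y' x' - pade_form k b y' x * pade_form k b y x'\<bar> \<le> C * (\<bar>x - x'\<bar> * \<bar>y - y'\<bar>)"
proof
  define q where "q = (\<lambda>i. real_of_int (pade_coeff k b i))"
  define c where "c = 2 * real b * 4 ^ b"
  define C where "C = 1 + (\<Sum>i\<le>b. \<Sum>j\<le>b. \<bar>q i * q j\<bar> * (c * c))"
  show "C > 0" unfolding C_def c_def by (intro add_pos_nonneg sum_nonneg) auto
  fix x x' y y' :: real
  assume xy: "0 \<le> x" "x \<le> 2" "0 \<le> x'" "x' \<le> 2" "0 \<le> y" "y \<le> 2" "0 \<le> y'" "y' \<le> 2"
  define W where "W = pade_form k b y x * pade_form k b y' x' - pade_form k b y' x * pade_form k b y x'"
  have W1: "W = (\<Sum>i\<le>b. \<Sum>j\<le>b. q i * q j * (x ^ (b - i) * x' ^ (b - j)) * (y ^ i * y' ^ j - y ^ j * y' ^ i))"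
    unfolding W_def pade_form_def q_def sum_product sum_subtractf[symmetric]
    by (intro sum.cong refl) (simp add: algebra_simps)
  also have "\<dots> = (\<Sum>j\<le>b. \<Sum>i\<le>b. q i * q j * (x ^ (b - i) * x' ^ (b - j)) * (y ^ i * y' ^ j - y ^ j * y' ^ i))"
    by (rule sum.swap)
  finally have W2: "W = (\<Sum>i\<le>b. \<Sum>j\<le>b. q j * q i * (x ^ (b - j) * x' ^ (b - i)) * (y ^ j * y' ^ i - y ^ i * y' ^ j))" .
  \<comment> \<open>The expansions \<open>W1\<close> and \<open>W2\<close> differ by exchanging
    \<open>i\<close> and \<open>j\<close>. Their sum splits into products of a determinant in
    \<open>x\<close>, \<open>x'\<close> and a determinant in \<open>y\<close>,
    \<open>y'\<close>.\<close>
  have "2 * W = (\<Sum>i\<le>b. \<Sum>j\<le>b. q i * q j * (x ^ (b - i) * x' ^ (b - j) - x ^ (b - j) * x' ^ (b - i)) * (y ^ i * y' ^ j - y ^ j * y' ^ i))"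
    unfolding mult_2 arg_cong2[OF W1 W2, of "(+)"] sum.distrib[symmetric]
    by (intro sum.cong refl) (simp add: algebra_simps)
  then have "\<bar>2 * W\<bar> = \<bar>\<Sum>i\<le>b. \<Sum>j\<le>b. q i * q j * (x ^ (b - i) * x' ^ (b - j) - x ^ (b - j) * x' ^ (b - i)) * (y ^ i * y' ^ j - y ^ j * y' ^ i)\<bar>"
    by (rule arg_cong)
  also have "\<dots> \<le> (\<Sum>i\<le>b. \<Sum>j\<le>b. \<bar>q i * q j * (x ^ (b - i) * x' ^ (b - j) - x ^ (b - j) * x' ^ (b - i)) * (y ^ i * y' ^ j - y ^ j * y' ^ i)\<bar>)"
    by (rule order_trans[OF sum_abs sum_mono[OF sum_abs]])
  also have "\<dots> \<le> (\<Sum>i\<le>b. \<Sum>j\<le>b. \<bar>q i * q j\<bar> * (c * c) * (\<bar>x - x'\<bar> * \<bar>y - y'\<bar>))"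
  proof (intro sum_mono)
    fix i j assume ij: "i \<in> {..b}" "j \<in> {..b}"
    have "\<bar>(x ^ (b - i) * x' ^ (b - j) - x ^ (b - j) * x' ^ (b - i)) * (y ^ i * y' ^ j - y ^ j * y' ^ i)\<bar>
        \<le> (c * \<bar>x - x'\<bar>) * (c * \<bar>y - y'\<bar>)"
      unfolding abs_mult c_def using xy ij by (intro mult_mono abs_power_det_le) auto
    then have "\<bar>q i * q j\<bar> * \<bar>(x ^ (b - i) * x' ^ (b - j) - x ^ (b - j) * x' ^ (b - i)) * (y ^ i * y' ^ j - y ^ j * y' ^ i)\<bar>
        \<le> \<bar>q i * q j\<bar> * ((c * \<bar>x - x'\<bar>) * (c * \<bar>y - y'\<bar>))" by (intro mult_left_mono) auto
    then show "\<bar>q i * q j * (x ^ (b - i) * x' ^ (b - j) - x ^ (b - j) * x' ^ (b - i)) * (y ^ i * y' ^ j - y ^ j * y' ^ i)\<bar>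
       \<le> \<bar>q i * q j\<bar> * (c * c) * (\<bar>x - x'\<bar> * \<bar>y - y'\<bar>)"
      by (simp only: abs_mult ac_simps)
  qed
  also have "\<dots> = (C - 1) * (\<bar>x - x'\<bar> * \<bar>y - y'\<bar>)" unfolding C_def by (simp add: sum_distrib_right)
  also have "\<dots> \<le> C * (\<bar>x - x'\<bar> * \<bar>y - y'\<bar>)" by (intro mult_right_mono) auto
  finally have "2 * \<bar>W\<bar> \<le> C * (\<bar>x - x'\<bar> * \<bar>y - y'\<bar>)" by simp
  then show "\<bar>pade_form k b y x * pade_form k b y' x' - pade_form k b y' x * pade_form k b y x'\<bar> \<le> C * (\<bar>x - x'\<bar> * \<bar>y - y'\<bar>)"
    unfolding W_def[symmetric] by linarith
qed

section \<open>Pfaffians of antisymmetric matrices that are nearly of rank 2\<close>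

lemma pfaffian_bound_aux:
  fixes S T :: "nat \<Rightarrow> nat \<Rightarrow> real"
  assumes S: "\<And>i j. \<bar>S i j\<bar> \<le> s" and T: "\<And>i j. \<bar>T i j\<bar> \<le> t"
    and P: "\<bar>T 0 1 * T 2 3 - T 0 2 * T 1 3 + T 0 3 * T 1 2\<bar> \<le> u"
  shows "\<bar>(S 0 1 - T 0 1) * (S 2 3 - T 2 3) - (S 0 2 - T 0 2) * (S 1 3 - T 1 3) + (S 0 3 - T 0 3) * (S 1 2 - T 1 2)\<bar>
    \<le> 3 * (s * s) + 6 * (s * t) + u"
proof -
  have s0: "s \<ge> 0" "t \<ge> 0" using S[of 0 0] T[of 0 0] by auto
  have SS: "\<bar>S i j * S i' j'\<bar> \<le> s * s" "\<bar>S i j * T i' j'\<bar> \<le> s * t" for i j i' j'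
    unfolding abs_mult using S T s0 by (auto intro!: mult_mono)
  have e: "(S 0 1 - T 0 1) * (S 2 3 - T 2 3) - (S 0 2 - T 0 2) * (S 1 3 - T 1 3) + (S 0 3 - T 0 3) * (S 1 2 - T 1 2)
    = S 0 1 * S 2 3 - S 0 2 * S 1 3 + S 0 3 * S 1 2
    - (S 0 1 * T 2 3 + S 2 3 * T 0 1 - S 0 2 * T 1 3 - S 1 3 * T 0 2 + S 0 3 * T 1 2 + S 1 2 * T 0 3)
    + (T 0 1 * T 2 3 - T 0 2 * T 1 3 + T 0 3 * T 1 2)"
    by (simp add: algebra_simps)
  note F = SS(1)[of 0 1 2 3] SS(1)[of 0 2 1 3] SS(1)[of 0 3 1 2]
    SS(2)[of 0 1 2 3] SS(2)[of 2 3 0 1] SS(2)[of 0 2 1 3] SS(2)[of 1 3 0 2] SS(2)[of 0 3 1 2] SS(2)[of 1 2 0 3] P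
  show ?thesis unfolding e
    by (rule abs_leI) (use F[THEN abs_le_D1] F[THEN abs_le_D2] in linarith)+
qed

text \<open>For constant \<open>Q\<close> the matrix \<open>T\<close> is a multiple of the exterior
  product of \<open>t\<close> and \<open>a\<close>, and its Pfaffians vanish by the Pluecker
  relation. In general each monomial \<open>t i * t j * (a l * a m)\<close> survives with a
  two-by-two minor of \<open>Q\<close> as coefficient; there are six choices for the pair of indices
  that carries \<open>t\<close>.\<close>

lemma pfaffian_rank_two_perturbation:
  fixes t a :: "nat \<Rightarrow> real"
  assumes t: "\<And>i. \<bar>t i\<bar> \<le> \<alpha>" and a: "\<And>i. \<bar>a i\<bar> \<le> \<alpha>"
    and Q: "\<And>i j l m. \<bar>Q i m * Q j l - Q i l * Q j m\<bar> \<le> c"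
  defines "T \<equiv> \<lambda>i j. t i * a j * Q i j - a i * t j * Q j i"
  shows "\<bar>T 0 1 * T 2 3 - T 0 2 * T 1 3 + T 0 3 * T 1 2\<bar> \<le> 6 * (\<alpha> ^ 4 * c)"
proof -
  have \<alpha>0: "\<alpha> \<ge> 0" using t[of 0] by auto
  have B: "\<bar>t i * t j * (a l * a m) * (Q i m * Q j l - Q i l * Q j m)\<bar> \<le> \<alpha> ^ 4 * c" for i j l m
  proof -
    have "\<bar>t i\<bar> * \<bar>t j\<bar> * (\<bar>a l\<bar> * \<bar>a m\<bar>) * \<bar>Q i m * Q j l - Q i l * Q j m\<bar> \<le> \<alpha> * \<alpha> * (\<alpha> * \<alpha>) * c"
      using t a Q \<alpha>0 by (intro mult_mono) auto
    then show ?thesis by (simp add: abs_mult power4_eq_xxxx mult.assoc)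
  qed
  have "T 0 1 * T 2 3 - T 0 2 * T 1 3 + T 0 3 * T 1 2 =
    t 0 * t 1 * (a 2 * a 3) * (Q 0 3 * Q 1 2 - Q 0 2 * Q 1 3)
  + t 0 * t 2 * (a 3 * a 1) * (Q 0 1 * Q 2 3 - Q 0 3 * Q 2 1)
  + t 0 * t 3 * (a 1 * a 2) * (Q 0 2 * Q 3 1 - Q 0 1 * Q 3 2)
  + t 1 * t 2 * (a 0 * a 3) * (Q 1 3 * Q 2 0 - Q 1 0 * Q 2 3)
  + t 1 * t 3 * (a 2 * a 0) * (Q 1 0 * Q 3 2 - Q 1 2 * Q 3 0)
  + t 2 * t 3 * (a 0 * a 1) * (Q 2 1 * Q 3 0 - Q 2 0 * Q 3 1)"
    unfolding T_def by (simp add: algebra_simps)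
  then show ?thesis
    using B[of 0 1 2 3] B[of 0 2 3 1] B[of 0 3 1 2] B[of 1 2 0 3] B[of 1 3 2 0] B[of 2 3 0 1] by linarith
qed

text \<open>\<open>A\<close> weighs the Pade remainders, \<open>B\<close> the part that comes from
  the inhomogeneous term \<open>h\<close>. That part has entries of size \<open>B\<close>, and
  \<open>B\<close> need not be small; being of rank 2 up to minors of size
  \<open>(B * \<mu>)\<^sup>2\<close>, it contributes only such a term and no
  \<open>B\<^sup>2\<close> to the Pfaffian.\<close>

lemma pfaffian_le:
  assumes "b < k" "\<alpha> > 0"
  obtains C :: real where "C > 0"
    "\<And>A B \<mu> (a :: nat \<Rightarrow> real) t \<sigma> J. 0 \<le> A \<Longrightarrow> 0 \<le> B \<Longrightarrow>
      (\<And>i. \<bar>a i\<bar> \<le> \<alpha> \<and> \<bar>t i\<bar> \<le> \<alpha> \<and> 1/2 \<le> \<sigma> i \<and> \<sigma> i \<le> 2) \<Longrightarrow> (\<And>i j. \<bar>\<sigma> i - \<sigma> j\<bar> \<le> \<mu>) \<Longrightarrow>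
      (\<And>i j. J i j = A * (a i * a j * (\<sigma> i ^ k * pade_form k b (\<sigma> j) (\<sigma> i) - \<sigma> j ^ k * pade_form k b (\<sigma> i) (\<sigma> j)))
         - B * (t i * a j * pade_form k b (\<sigma> j) (\<sigma> i) - a i * t j * pade_form k b (\<sigma> i) (\<sigma> j))) \<Longrightarrow>
      \<bar>J 0 1 * J 2 3 - J 0 2 * J 1 3 + J 0 3 * J 1 2\<bar>
        \<le> C * ((A * \<mu> ^ (2 * b + 1))\<^sup>2 + A * \<mu> ^ (2 * b + 1) * B + (B * \<mu>)\<^sup>2)"
proof -
  obtain c2 where c2: "c2 > 0" "\<And>X Y. 0 \<le> X \<Longrightarrow> X \<le> 2 \<Longrightarrow> 0 \<le> Y \<Longrightarrow> Y \<le> 2 \<Longrightarrow> \<bar>pade_form k b X Y\<bar> \<le> c2"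
    by (rule pade_form_le[of k b]) blast
  obtain c3 where c3: "c3 > 0" "\<And>x x' y y'. 0 \<le> x \<Longrightarrow> x \<le> 2 \<Longrightarrow> 0 \<le> x' \<Longrightarrow> x' \<le> 2 \<Longrightarrow>
     0 \<le> y \<Longrightarrow> y \<le> 2 \<Longrightarrow> 0 \<le> y' \<Longrightarrow> y' \<le> 2 \<Longrightarrow>
    \<bar>pade_form k b y x * pade_form k b y' x' - pade_form k b y' x * pade_form k b y x'\<bar> \<le> c3 * (\<bar>x - x'\<bar> * \<bar>y - y'\<bar>)"
    by (rule pade_form_det_le[of k b]) blast
  define c1 :: real where "c1 = \<alpha>\<^sup>2 * (fact (k + b) * 2 ^ k)"
  define c4 where "c4 = 2 * \<alpha>\<^sup>2 * c2"
  define C where "C = 3 * c1\<^sup>2 + 6 * c1 * c4 + 6 * \<alpha> ^ 4 * c3"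
  have pos: "c1 > 0" "c4 > 0" unfolding c1_def c4_def using assms c2 by auto
  show ?thesis
  proof (rule that)
    show "C > 0" unfolding C_def using pos c3 assms by (intro add_pos_pos mult_pos_pos) auto
    fix A B \<mu> :: real and a t \<sigma> :: "nat \<Rightarrow> real" and J :: "nat \<Rightarrow> nat \<Rightarrow> real"
    assume A: "0 \<le> A" and B: "0 \<le> B"
      and bd: "\<And>i. \<bar>a i\<bar> \<le> \<alpha> \<and> \<bar>t i\<bar> \<le> \<alpha> \<and> 1/2 \<le> \<sigma> i \<and> \<sigma> i \<le> 2"
      and l: "\<And>i j. \<bar>\<sigma> i - \<sigma> j\<bar> \<le> \<mu>"
      and J: "\<And>i j. J i j = A * (a i * a j * (\<sigma> i ^ k * pade_form k b (\<sigma> j) (\<sigma> i) - \<sigma> j ^ k * pade_form k b (\<sigma> i) (\<sigma> j)))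
         - B * (t i * a j * pade_form k b (\<sigma> j) (\<sigma> i) - a i * t j * pade_form k b (\<sigma> i) (\<sigma> j))"
    have \<sigma>: "1/2 \<le> \<sigma> i" "0 \<le> \<sigma> i" "\<sigma> i \<le> 2" for i using bd[of i] by auto
    have l0: "\<mu> \<ge> 0" using l[of 0 0] by simp
    define Z where "Z = A * \<mu> ^ (2 * b + 1)"
    define S where "S = (\<lambda>i j. A * (a i * a j * (\<sigma> i ^ k * pade_form k b (\<sigma> j) (\<sigma> i) - \<sigma> j ^ k * pade_form k b (\<sigma> i) (\<sigma> j))))"
    define Q where "Q = (\<lambda>i j. B * pade_form k b (\<sigma> j) (\<sigma> i))"
    define T where "T = (\<lambda>i j. t i * a j * Q i j - a i * t j * Q j i)"
    have JST: "J i j = S i j - T i j" for i j unfolding J S_def T_def Q_def by (simp add: algebra_simps)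
    have S: "\<bar>S i j\<bar> \<le> c1 * Z" for i j
    proof -
      have I: "\<bar>\<sigma> i ^ k * pade_form k b (\<sigma> j) (\<sigma> i) - \<sigma> j ^ k * pade_form k b (\<sigma> i) (\<sigma> j)\<bar> \<le> fact (k + b) * 2 ^ k * \<mu> ^ (2 * b + 1)"
      proof -
        have "\<bar>\<sigma> i - \<sigma> j\<bar> ^ (2 * b + 1) \<le> \<mu> ^ (2 * b + 1)" using l by (intro power_mono) auto
        then have "fact (k + b) * 2 ^ k * \<bar>\<sigma> i - \<sigma> j\<bar> ^ (2 * b + 1) \<le> fact (k + b) * 2 ^ k * \<mu> ^ (2 * b + 1)"
          by (intro mult_left_mono) auto
        then show ?thesis using pade_remainder_le[OF assms(1) \<sigma>(1,3) \<sigma>(1,3), of i j] by linarith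
      qed
      have "\<bar>S i j\<bar> \<le> A * (\<alpha> * \<alpha> * (fact (k + b) * 2 ^ k * \<mu> ^ (2 * b + 1)))"
        unfolding S_def abs_mult[of A] abs_mult[of "a i * a j"] abs_mult[of "a i"] using A bd[of i] bd[of j] I assms(2)
        by (intro mult_mono) auto
      then show ?thesis unfolding c1_def Z_def power2_eq_square by (simp only: ac_simps)
    qed
    have Q1: "\<bar>Q i j\<bar> \<le> B * c2" for i j
      unfolding Q_def abs_mult using B c2(2)[of "\<sigma> j" "\<sigma> i"] \<sigma> by (intro mult_mono) auto
    have T: "\<bar>T i j\<bar> \<le> c4 * B" for i j
    proof -
      have *: "\<bar>t i * a j * Q i' j'\<bar> \<le> \<alpha> * \<alpha> * (B * c2)" for i j i' j'
        unfolding abs_mult[of "t i * a j"] abs_mult[of "t i"] using bd[of i] bd[of j] Q1[of i' j'] assms(2)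
        by (intro mult_mono) auto
      have "\<bar>T i j\<bar> \<le> \<bar>t i * a j * Q i j\<bar> + \<bar>t j * a i * Q j i\<bar>" unfolding T_def
        using abs_triangle_ineq4[of "t i * a j * Q i j" "a i * t j * Q j i"] by (simp add: mult.commute)
      also have "\<dots> \<le> \<alpha> * \<alpha> * (B * c2) + \<alpha> * \<alpha> * (B * c2)" by (intro add_mono *)
      finally show ?thesis unfolding c4_def power2_eq_square by (simp add: algebra_simps)
    qed
    have Qd: "\<bar>Q i m * Q j l - Q i l * Q j m\<bar> \<le> B\<^sup>2 * (c3 * (\<mu> * \<mu>))" for i j l m
    proof -
      have "\<bar>pade_form k b (\<sigma> m) (\<sigma> i) * pade_form k b (\<sigma> l) (\<sigma> j) - pade_form k b (\<sigma> l) (\<sigma> i) * pade_form k b (\<sigma> m) (\<sigma> j)\<bar> \<le> c3 * (\<bar>\<sigma> i - \<sigma> j\<bar> * \<bar>\<sigma> m - \<sigma> l\<bar>)"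
        using \<sigma> by (intro c3(2)) auto
      also have "\<dots> \<le> c3 * (\<mu> * \<mu>)" using l c3 l0 by (intro mult_left_mono mult_mono) auto
      finally have *: "\<bar>pade_form k b (\<sigma> m) (\<sigma> i) * pade_form k b (\<sigma> l) (\<sigma> j) - pade_form k b (\<sigma> l) (\<sigma> i) * pade_form k b (\<sigma> m) (\<sigma> j)\<bar> \<le> c3 * (\<mu> * \<mu>)" .
      have "Q i m * Q j l - Q i l * Q j m = B\<^sup>2 * (pade_form k b (\<sigma> m) (\<sigma> i) * pade_form k b (\<sigma> l) (\<sigma> j) - pade_form k b (\<sigma> l) (\<sigma> i) * pade_form k b (\<sigma> m) (\<sigma> j))"
        unfolding Q_def by (simp add: power2_eq_square algebra_simps)
      then show ?thesis using * by (simp add: abs_mult mult_left_mono)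
    qed
    have PT: "\<bar>T 0 1 * T 2 3 - T 0 2 * T 1 3 + T 0 3 * T 1 2\<bar> \<le> 6 * (\<alpha> ^ 4 * (B\<^sup>2 * (c3 * (\<mu> * \<mu>))))"
      unfolding T_def by (rule pfaffian_rank_two_perturbation) (use bd Qd in auto)
    have "\<bar>J 0 1 * J 2 3 - J 0 2 * J 1 3 + J 0 3 * J 1 2\<bar> \<le> 3 * ((c1 * Z) * (c1 * Z)) + 6 * ((c1 * Z) * (c4 * B)) + 6 * (\<alpha> ^ 4 * (B\<^sup>2 * (c3 * (\<mu> * \<mu>))))"
      unfolding JST by (rule pfaffian_bound_aux[OF S T PT])
    also have "\<dots> = (3 * c1\<^sup>2) * Z\<^sup>2 + (6 * c1 * c4) * (Z * B) + (6 * \<alpha> ^ 4 * c3) * (B * \<mu>)\<^sup>2"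
      by (simp add: power2_eq_square algebra_simps)
    also have "\<dots> \<le> C * Z\<^sup>2 + C * (Z * B) + C * (B * \<mu>)\<^sup>2"
    proof -
      have "Z \<ge> 0" unfolding Z_def using A l0 by simp
      moreover have "3 * c1\<^sup>2 \<le> C" "6 * c1 * c4 \<le> C" "6 * \<alpha> ^ 4 * c3 \<le> C"
        unfolding C_def using pos c3 assms by auto
      ultimately show ?thesis using B by (intro add_mono mult_right_mono) auto
    qed
    finally show "\<bar>J 0 1 * J 2 3 - J 0 2 * J 1 3 + J 0 3 * J 1 2\<bar>
        \<le> C * ((A * \<mu> ^ (2 * b + 1))\<^sup>2 + A * \<mu> ^ (2 * b + 1) * B + (B * \<mu>)\<^sup>2)"
      unfolding Z_def[symmetric] by (simp add: algebra_simps)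
  qed
qed

text \<open>
  An antisymmetric integer matrix indexed by the points. If its four-point Pfaffians vanish, it has
  rank at most 2, and a combination of rows gives a linear relation between \<open>e v\<close> and \<open>f v\<close> valid at all points \<open>v\<close>.
\<close>
definition pade_pairing :: "nat \<Rightarrow> nat \<Rightarrow> (int \<times> int \<Rightarrow> int) \<Rightarrow> (int \<times> int \<Rightarrow> int) \<Rightarrow> int \<times> int \<Rightarrow> int \<times> int \<Rightarrow> int" where
  "pade_pairing k b e f v w = (\<Sum>i\<le>b. pade_coeff k b i *
     (f v * e w * (fst w ^ i * snd w ^ (b - i) * (fst v ^ (b - i) * snd v ^ i))
    - e v * f w * (fst v ^ i * snd v ^ (b - i) * (fst w ^ (b - i) * snd w ^ i))))"

lemma pade_form_homogeneous:
  fixes x y x' y' r :: real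
  assumes "y \<noteq> 0" "y' \<noteq> 0" "r \<noteq> 0"
  shows "(\<Sum>i\<le>b. real_of_int (pade_coeff k b i) * (x' ^ i * y' ^ (b - i) * (x ^ (b - i) * y ^ i)))
    = y ^ b * y' ^ b * r ^ b * pade_form k b (x' / y' / r) (x / y / r)"
  unfolding pade_form_def sum_distrib_left
proof (intro sum.cong refl)
  fix i assume "i \<in> {..b}"
  then have p: "z ^ b = z ^ i * z ^ (b - i)" for z :: real by (simp add: power_add[symmetric])
  show "real_of_int (pade_coeff k b i) * (x' ^ i * y' ^ (b - i) * (x ^ (b - i) * y ^ i)) =
    y ^ b * y' ^ b * r ^ b * (real_of_int (pade_coeff k b i) * (x' / y' / r) ^ i * (x / y / r) ^ (b - i))"
    unfolding p[of y] p[of y'] p[of r] power_divide using assms by simp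
qed

text \<open>Substituting \<open>f v = (e v * fst v ^ k - h) / snd v ^ k\<close> splits the pairing:
  the products \<open>e v * e w\<close> meet the Pade remainder, and the terms with \<open>h\<close>
  form the rank 2 part. The quantities \<open>\<sigma>\<close>, \<open>a\<close>, \<open>t\<close>
  are bounded when the points lie in a dyadic box and \<open>\<bar>e v\<bar> \<le> E\<close>, so
  that all sizes sit in the two prefactors.\<close>

lemma pade_pairing_normalised:
  fixes e f :: "int \<times> int \<Rightarrow> int" and b k :: nat and D1 D2 E :: real
  assumes pos: "D1 > 0" "D2 > 0" "E > 0" "snd v \<noteq> 0" "snd w \<noteq> 0"
    and eqv: "e v * fst v ^ k - f v * snd v ^ k = h" and eqw: "e w * fst w ^ k - f w * snd w ^ k = h"
  defines "\<sigma> \<equiv> \<lambda>v. real_of_int (fst v) / real_of_int (snd v) / (D1 / D2)"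
    and "a \<equiv> \<lambda>v. real_of_int (e v) * (real_of_int (snd v) / D2) ^ b / E"
    and "t \<equiv> \<lambda>v. real_of_int h * (real_of_int (snd v) / D2) ^ b * (D2 / real_of_int (snd v)) ^ k"
  shows "real_of_int (pade_pairing k b e f v w) =
    E\<^sup>2 * D2 ^ (2 * b) * (D1 / D2) ^ (k + b) * (a v * a w * (\<sigma> v ^ k * pade_form k b (\<sigma> w) (\<sigma> v) - \<sigma> w ^ k * pade_form k b (\<sigma> v) (\<sigma> w)))
     - E * D2 ^ (2 * b) / D2 ^ k * (D1 / D2) ^ b * (t v * a w * pade_form k b (\<sigma> w) (\<sigma> v) - a v * t w * pade_form k b (\<sigma> v) (\<sigma> w))"
proof -
  define r where "r = D1 / D2"
  have r: "r \<noteq> 0" unfolding r_def using pos by simp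
  define x y x' y' where "x = real_of_int (fst v)" "y = real_of_int (snd v)" "x' = real_of_int (fst w)" "y' = real_of_int (snd w)"
  note xy = x_y_x'_y'_def
  have y: "y \<noteq> 0" "y' \<noteq> 0" using pos xy by auto
  define q q' where "q = pade_form k b (\<sigma> w) (\<sigma> v)" "q' = pade_form k b (\<sigma> v) (\<sigma> w)"
  define e1 f1 e2 f2 where "e1 = real_of_int (e v)" "f1 = real_of_int (f v)" "e2 = real_of_int (e w)" "f2 = real_of_int (f w)"
  note ef = e1_f1_e2_f2_def
  have "real_of_int (pade_pairing k b e f v w) =
    f1 * e2 * (\<Sum>i\<le>b. real_of_int (pade_coeff k b i) * (x' ^ i * y' ^ (b - i) * (x ^ (b - i) * y ^ i)))
    - e1 * f2 * (\<Sum>i\<le>b. real_of_int (pade_coeff k b i) * (x ^ i * y ^ (b - i) * (x' ^ (b - i) * y' ^ i)))"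
    unfolding pade_pairing_def sum_distrib_left sum_subtractf[symmetric] of_int_sum xy ef
    by (intro sum.cong refl) (simp add: algebra_simps)
  also have "\<dots> = f1 * e2 * (y ^ b * y' ^ b * r ^ b * q) - e1 * f2 * (y' ^ b * y ^ b * r ^ b * q')"
  proof -
    have "q = pade_form k b (x' / y' / r) (x / y / r)" "q' = pade_form k b (x / y / r) (x' / y' / r)"
      unfolding q_q'_def \<sigma>_def xy r_def by (rule refl)+
    then show ?thesis
      by (simp only: pade_form_homogeneous[OF y(1) y(2) r] pade_form_homogeneous[OF y(2) y(1) r])
  qed
  finally have J: "real_of_int (pade_pairing k b e f v w) = \<dots>" .
  have f1: "f1 = (e1 * x ^ k - real_of_int h) / y ^ k" and f2: "f2 = (e2 * x' ^ k - real_of_int h) / y' ^ k"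
    using arg_cong[OF eqv, of real_of_int] arg_cong[OF eqw, of real_of_int] y unfolding xy ef by (auto simp: field_simps)
  have sig: "\<sigma> v ^ k = x ^ k / (y ^ k * r ^ k)" "\<sigma> w ^ k = x' ^ k / (y' ^ k * r ^ k)"
    unfolding \<sigma>_def xy r_def[symmetric] by (simp_all add: power_divide power_mult_distrib)
  have at: "a v = e1 * (y ^ b / D2 ^ b) / E" "a w = e2 * (y' ^ b / D2 ^ b) / E"
     "t v = real_of_int h * (y ^ b / D2 ^ b) * (D2 ^ k / y ^ k)" "t w = real_of_int h * (y' ^ b / D2 ^ b) * (D2 ^ k / y' ^ k)"
    unfolding a_def t_def xy ef power_divide by (rule refl)+
  have D2b: "D2 ^ (2 * b) = D2 ^ b * D2 ^ b" by (simp add: mult_2 power_add)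
  \<comment> \<open>The identity with every power replaced by an independent variable, so that only
    field arithmetic without exponents remains.\<close>
  have alg: "((e1 * X - H) / Y) * e2 * (Yb * Yb' * rb * q) - e1 * ((e2 * X' - H) / Y') * (Yb' * Yb * rb * q') =
    E\<^sup>2 * (Db * Db) * (rk * rb) * (e1 * (Yb / Db) / E * (e2 * (Yb' / Db) / E) * (X / (Y * rk) * q - X' / (Y' * rk) * q'))
     - E * (Db * Db) / Dk * rb * (H * (Yb / Db) * (Dk / Y) * (e2 * (Yb' / Db) / E) * q - e1 * (Yb / Db) / E * (H * (Yb' / Db) * (Dk / Y')) * q')"
    if "Y \<noteq> 0" "Y' \<noteq> 0" "rk \<noteq> 0" "Db \<noteq> 0" "Dk \<noteq> 0" "E \<noteq> 0"
    for X X' Y Y' H Yb Yb' rb rk Db Dk :: real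
  proof -
    have a1: "E * Db * (z * (w / Db) / E) = z * w" for z w using that by simp
    have a3: "rk * (X / (Y * rk) * q - X' / (Y' * rk) * q') = X / Y * q - X' / Y' * q'"
      using that by (simp add: right_diff_distrib)
    have "E\<^sup>2 * (Db * Db) * (rk * rb) * (e1 * (Yb / Db) / E * (e2 * (Yb' / Db) / E) * (X / (Y * rk) * q - X' / (Y' * rk) * q'))
       = (E * Db * (e1 * (Yb / Db) / E)) * (E * Db * (e2 * (Yb' / Db) / E)) * rb * (rk * (X / (Y * rk) * q - X' / (Y' * rk) * q'))"
      by (simp only: power2_eq_square ac_simps)
    then have 1: "E\<^sup>2 * (Db * Db) * (rk * rb) * (e1 * (Yb / Db) / E * (e2 * (Yb' / Db) / E) * (X / (Y * rk) * q - X' / (Y' * rk) * q'))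
       = (e1 * Yb) * (e2 * Yb') * rb * (X / Y * q - X' / Y' * q')" unfolding a1 a3 .
    have b1: "E * (Db * Db) / Dk * (H * (Yb / Db) * (Dk / Y) * (e2 * (Yb' / Db) / E)) = H * Yb * e2 * Yb' / Y"
      using that by simp
    have b2: "E * (Db * Db) / Dk * (e1 * (Yb / Db) / E * (H * (Yb' / Db) * (Dk / Y'))) = H * Yb * e1 * Yb' / Y'"
      using that by simp
    have "E * (Db * Db) / Dk * rb * (H * (Yb / Db) * (Dk / Y) * (e2 * (Yb' / Db) / E) * q - e1 * (Yb / Db) / E * (H * (Yb' / Db) * (Dk / Y')) * q')
       = rb * ((E * (Db * Db) / Dk * (H * (Yb / Db) * (Dk / Y) * (e2 * (Yb' / Db) / E))) * q - (E * (Db * Db) / Dk * (e1 * (Yb / Db) / E * (H * (Yb' / Db) * (Dk / Y')))) * q')"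
      by (simp only: right_diff_distrib mult.assoc mult.left_commute[of rb])
    then have 2: "E * (Db * Db) / Dk * rb * (H * (Yb / Db) * (Dk / Y) * (e2 * (Yb' / Db) / E) * q - e1 * (Yb / Db) / E * (H * (Yb' / Db) * (Dk / Y')) * q')
       = rb * (H * Yb * e2 * Yb' / Y * q - H * Yb * e1 * Yb' / Y' * q')" unfolding b1 b2 .
    show ?thesis unfolding 1 2 by (simp add: diff_divide_distrib algebra_simps)
  qed
  show ?thesis unfolding J unfolding q_q'_def[symmetric] f1 f2 sig at D2b r_def[symmetric] power_add[of r]
    by (rule alg) (use y r pos in auto)
qed

text \<open>The three summands in the smallness condition are those of \<open>pfaffian_le\<close>
  for the prefactors of \<open>pade_pairing_normalised\<close>. The Pfaffian is an integer, so a
  bound below 1 makes it vanish.\<close>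

lemma pade_pairing_pfaffian_eq_0:
  assumes "b < k"
  obtains C :: real where "C > 0"
    "\<And>D1 D2 E \<mu> T e f. D1 > 0 \<Longrightarrow> D2 > 0 \<Longrightarrow> E > 0 \<Longrightarrow>
      (\<And>v. v \<in> T \<Longrightarrow> D1 < real_of_int (fst v) \<and> real_of_int (fst v) \<le> 2 * D1 \<and> D2 < real_of_int (snd v) \<and>
          real_of_int (snd v) \<le> 2 * D2 \<and> \<bar>real_of_int (e v)\<bar> \<le> E \<and> e v * fst v ^ k - f v * snd v ^ k = h) \<Longrightarrow>
      (\<And>v w. v \<in> T \<Longrightarrow> w \<in> T \<Longrightarrow> \<bar>real_of_int (fst v) / real_of_int (snd v) - real_of_int (fst w) / real_of_int (snd w)\<bar> \<le> \<mu> * (D1 / D2)) \<Longrightarrow>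
      C * ((E\<^sup>2 * D2 ^ (2 * b) * (D1 / D2) ^ (k + b) * \<mu> ^ (2 * b + 1))\<^sup>2
         + (E\<^sup>2 * D2 ^ (2 * b) * (D1 / D2) ^ (k + b) * \<mu> ^ (2 * b + 1)) * (E * D2 ^ (2 * b) / D2 ^ k * (D1 / D2) ^ b)
         + (E * D2 ^ (2 * b) / D2 ^ k * (D1 / D2) ^ b * \<mu>)\<^sup>2) < 1 \<Longrightarrow>
      (\<And>v1 v2 v3 v4. v1 \<in> T \<Longrightarrow> v2 \<in> T \<Longrightarrow> v3 \<in> T \<Longrightarrow> v4 \<in> T \<Longrightarrow>
       pade_pairing k b e f v1 v2 * pade_pairing k b e f v3 v4
       - pade_pairing k b e f v1 v3 * pade_pairing k b e f v2 v4
       + pade_pairing k b e f v1 v4 * pade_pairing k b e f v2 v3 = 0)"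
proof -
  \<comment> \<open>\<open>2 ^ b\<close> bounds \<open>(snd v / D2) ^ b\<close> on the box; the
    other factor covers \<open>h\<close> in \<open>t\<close>.\<close>
  define \<alpha> :: real where "\<alpha> = 2 ^ b * (1 + \<bar>real_of_int h\<bar>)"
  have \<alpha>: "\<alpha> > 0" unfolding \<alpha>_def by (intro mult_pos_pos) auto
  obtain C where C: "C > 0" and main: "\<And>A B \<mu> (a :: nat \<Rightarrow> real) t \<sigma> J. 0 \<le> A \<Longrightarrow> 0 \<le> B \<Longrightarrow>
      (\<And>i. \<bar>a i\<bar> \<le> \<alpha> \<and> \<bar>t i\<bar> \<le> \<alpha> \<and> 1/2 \<le> \<sigma> i \<and> \<sigma> i \<le> 2) \<Longrightarrow> (\<And>i j. \<bar>\<sigma> i - \<sigma> j\<bar> \<le> \<mu>) \<Longrightarrow>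
      (\<And>i j. J i j = A * (a i * a j * (\<sigma> i ^ k * pade_form k b (\<sigma> j) (\<sigma> i) - \<sigma> j ^ k * pade_form k b (\<sigma> i) (\<sigma> j)))
         - B * (t i * a j * pade_form k b (\<sigma> j) (\<sigma> i) - a i * t j * pade_form k b (\<sigma> i) (\<sigma> j))) \<Longrightarrow>
      \<bar>J 0 1 * J 2 3 - J 0 2 * J 1 3 + J 0 3 * J 1 2\<bar>
        \<le> C * ((A * \<mu> ^ (2 * b + 1))\<^sup>2 + A * \<mu> ^ (2 * b + 1) * B + (B * \<mu>)\<^sup>2)"
    by (rule pfaffian_le[OF assms \<alpha>]) blast
  show ?thesis
  proof (rule that[OF C])
    fix D1 D2 E \<mu> :: real and T :: "(int \<times> int) set" and e f :: "int \<times> int \<Rightarrow> int" and v1 v2 v3 v4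
    assume pos: "D1 > 0" "D2 > 0" "E > 0"
      and T: "\<And>v. v \<in> T \<Longrightarrow> D1 < real_of_int (fst v) \<and> real_of_int (fst v) \<le> 2 * D1 \<and> D2 < real_of_int (snd v) \<and>
          real_of_int (snd v) \<le> 2 * D2 \<and> \<bar>real_of_int (e v)\<bar> \<le> E \<and> e v * fst v ^ k - f v * snd v ^ k = h"
      and close: "\<And>v w. v \<in> T \<Longrightarrow> w \<in> T \<Longrightarrow> \<bar>real_of_int (fst v) / real_of_int (snd v) - real_of_int (fst w) / real_of_int (snd w)\<bar> \<le> \<mu> * (D1 / D2)"
      and small: "C * ((E\<^sup>2 * D2 ^ (2 * b) * (D1 / D2) ^ (k + b) * \<mu> ^ (2 * b + 1))\<^sup>2
         + (E\<^sup>2 * D2 ^ (2 * b) * (D1 / D2) ^ (k + b) * \<mu> ^ (2 * b + 1)) * (E * D2 ^ (2 * b) / D2 ^ k * (D1 / D2) ^ b)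
         + (E * D2 ^ (2 * b) / D2 ^ k * (D1 / D2) ^ b * \<mu>)\<^sup>2) < 1"
      and v: "v1 \<in> T" "v2 \<in> T" "v3 \<in> T" "v4 \<in> T"
    \<comment> \<open>\<open>pfaffian_le\<close> takes points indexed by all natural numbers; from
      index 3 on the last point is repeated, so that the bounds hold for every index.\<close>
    define p where "p = (\<lambda>i::nat. if i = 0 then v1 else if i = 1 then v2 else if i = 2 then v3 else v4)"
    have pT: "p i \<in> T" for i unfolding p_def using v by auto
    define \<sigma> where "\<sigma> = (\<lambda>v. real_of_int (fst v) / real_of_int (snd v) / (D1 / D2))"
    define a where "a = (\<lambda>v. real_of_int (e v) * (real_of_int (snd v) / D2) ^ b / E)"
    define t where "t = (\<lambda>v::int \<times> int. real_of_int h * (real_of_int (snd v) / D2) ^ b * (D2 / real_of_int (snd v)) ^ k)"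
    define A where "A = E\<^sup>2 * D2 ^ (2 * b) * (D1 / D2) ^ (k + b)"
    define B where "B = E * D2 ^ (2 * b) / D2 ^ k * (D1 / D2) ^ b"
    define J where "J = (\<lambda>i j. real_of_int (pade_pairing k b e f (p i) (p j)))"
    have "\<bar>J 0 1 * J 2 3 - J 0 2 * J 1 3 + J 0 3 * J 1 2\<bar>
        \<le> C * ((A * \<mu> ^ (2 * b + 1))\<^sup>2 + A * \<mu> ^ (2 * b + 1) * B + (B * \<mu>)\<^sup>2)"
    proof (rule main[of A B "\<lambda>i. a (p i)" "\<lambda>i. t (p i)" "\<lambda>i. \<sigma> (p i)" \<mu> J])
      show "0 \<le> A" "0 \<le> B" unfolding A_def B_def using pos by auto
    next
      fix i
      have w: "D1 < real_of_int (fst (p i))" "real_of_int (fst (p i)) \<le> 2 * D1" "D2 < real_of_int (snd (p i))"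
          "real_of_int (snd (p i)) \<le> 2 * D2" "\<bar>real_of_int (e (p i))\<bar> \<le> E" using T[OF pT] by auto
      define X Y where "X = real_of_int (fst (p i))" "Y = real_of_int (snd (p i))"
      note XY = X_Y_def
      have Y: "0 < Y" "1 \<le> Y / D2" "Y / D2 \<le> 2" "0 \<le> D2 / Y" "D2 / Y \<le> 1" using w pos unfolding XY by (auto simp: field_simps)
      have s: "1/2 \<le> \<sigma> (p i)" "\<sigma> (p i) \<le> 2"
      proof -
        have "\<sigma> (p i) = (X / D1) / (Y / D2)" unfolding \<sigma>_def XY by simp
        moreover have "1 / 2 \<le> (X / D1) / (Y / D2)" using w pos Y unfolding XY
          by (intro frac_le) (auto simp: field_simps)
        moreover have "(X / D1) / (Y / D2) \<le> 2 / 1" using w pos Y unfolding XY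
          by (intro frac_le) (auto simp: field_simps)
        ultimately show "1/2 \<le> \<sigma> (p i)" "\<sigma> (p i) \<le> 2" by auto
      qed
      have Yb: "(Y / D2) ^ b \<le> 2 ^ b" "0 \<le> (Y / D2) ^ b" using Y pos by (auto intro!: power_mono)
      have "\<bar>a (p i)\<bar> = \<bar>real_of_int (e (p i))\<bar> / E * (Y / D2) ^ b" unfolding a_def XY using Yb[unfolded XY] pos
        using Y(1)[unfolded XY] by (simp add: abs_mult power_abs)
      also have "\<dots> \<le> 1 * 2 ^ b" using Yb w pos by (intro mult_mono) auto
      also have "\<dots> \<le> \<alpha>" unfolding \<alpha>_def by simp
      finally have a: "\<bar>a (p i)\<bar> \<le> \<alpha>" .
      have "\<bar>t (p i)\<bar> = \<bar>real_of_int h\<bar> * ((Y / D2) ^ b * (D2 / Y) ^ k)" unfolding t_def XY[symmetric] using Y pos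
        by (simp add: abs_mult)
      also have "\<dots> \<le> \<bar>real_of_int h\<bar> * (2 ^ b * 1)" using Yb Y by (intro mult_mono power_le_one) auto
      also have "\<dots> \<le> \<alpha>" unfolding \<alpha>_def by (simp add: algebra_simps)
      finally show "\<bar>a (p i)\<bar> \<le> \<alpha> \<and> \<bar>t (p i)\<bar> \<le> \<alpha> \<and> 1/2 \<le> \<sigma> (p i) \<and> \<sigma> (p i) \<le> 2" using a s by auto
    next
      fix i j
      have "\<bar>\<sigma> (p i) - \<sigma> (p j)\<bar> = \<bar>real_of_int (fst (p i)) / real_of_int (snd (p i)) - real_of_int (fst (p j)) / real_of_int (snd (p j))\<bar> / (D1 / D2)"
        unfolding \<sigma>_def diff_divide_distrib[symmetric] abs_divide using pos by simp
      also have "\<dots> \<le> (\<mu> * (D1 / D2)) / (D1 / D2)" using close[OF pT pT] pos by (intro divide_right_mono) auto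
      finally show "\<bar>\<sigma> (p i) - \<sigma> (p j)\<bar> \<le> \<mu>" using pos by simp
    next
      fix i j
      have "snd (p i) \<noteq> 0" for i using T[OF pT[of i]] pos by auto
      then show "J i j = A * (a (p i) * a (p j) * (\<sigma> (p i) ^ k * pade_form k b (\<sigma> (p j)) (\<sigma> (p i)) - \<sigma> (p j) ^ k * pade_form k b (\<sigma> (p i)) (\<sigma> (p j))))
         - B * (t (p i) * a (p j) * pade_form k b (\<sigma> (p j)) (\<sigma> (p i)) - a (p i) * t (p j) * pade_form k b (\<sigma> (p i)) (\<sigma> (p j)))"
        unfolding J_def A_def B_def a_def t_def \<sigma>_def using T[OF pT] pos
        by (intro pade_pairing_normalised) auto
    qed
    also have "\<dots> < 1" using small unfolding A_def B_def by simp
    finally have "\<bar>J 0 1 * J 2 3 - J 0 2 * J 1 3 + J 0 3 * J 1 2\<bar> < 1" .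
    moreover have "J 0 1 * J 2 3 - J 0 2 * J 1 3 + J 0 3 * J 1 2 = real_of_int (pade_pairing k b e f v1 v2 * pade_pairing k b e f v3 v4
       - pade_pairing k b e f v1 v3 * pade_pairing k b e f v2 v4
       + pade_pairing k b e f v1 v4 * pade_pairing k b e f v2 v3)" unfolding J_def p_def by simp
    ultimately have "\<bar>real_of_int (pade_pairing k b e f v1 v2 * pade_pairing k b e f v3 v4
       - pade_pairing k b e f v1 v3 * pade_pairing k b e f v2 v4
       + pade_pairing k b e f v1 v4 * pade_pairing k b e f v2 v3)\<bar> < 1" by simp
    then show "pade_pairing k b e f v1 v2 * pade_pairing k b e f v3 v4
       - pade_pairing k b e f v1 v3 * pade_pairing k b e f v2 v4
       + pade_pairing k b e f v1 v4 * pade_pairing k b e f v2 v3 = 0" by linarith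
  qed
qed

section \<open>Heights and pseudo-division\<close>

text \<open>A submultiplicative norm. With it a single division step is estimated without constants
  that depend on the degrees.\<close>

definition poly_length :: "int poly \<Rightarrow> int" where
  "poly_length p = sum_list (map abs (coeffs p))"

lemma poly_length_0 [simp]: "poly_length 0 = 0"
  by (simp add: poly_length_def)

lemma poly_length_pCons [simp]: "poly_length (pCons a p) = \<bar>a\<bar> + poly_length p"
  by (cases "a = 0 \<and> p = 0") (auto simp: poly_length_def cCons_def)

lemma poly_length_nonneg: "poly_length p \<ge> 0"
  by (induction p) auto

lemma poly_length_add: "poly_length (p + q) \<le> poly_length p + poly_length q"
proof (induction p arbitrary: q)
  case (pCons a p)
  obtain b q' where q: "q = pCons b q'" by (cases q)
  show ?case using pCons.IH[of q'] unfolding q by auto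
qed auto

lemma poly_length_minus [simp]: "poly_length (- p) = poly_length p"
  by (induction p) auto

lemma poly_length_diff: "poly_length (p - q) \<le> poly_length p + poly_length q"
  using poly_length_add[of p "- q"] by simp

lemma poly_length_smult [simp]: "poly_length (smult c p) = \<bar>c\<bar> * poly_length p"
  by (induction p) (auto simp: abs_mult algebra_simps)

lemma poly_length_mult: "poly_length (p * q) \<le> poly_length p * poly_length q"
proof (induction p)
  case (pCons a p)
  have "poly_length (pCons a p * q) \<le> poly_length (smult a q) + poly_length (pCons 0 (p * q))"
    using poly_length_add[of "smult a q" "pCons 0 (p * q)"] by simp
  also have "\<dots> \<le> \<bar>a\<bar> * poly_length q + poly_length p * poly_length q" using pCons.IH by simp
  finally show ?case by (simp add: algebra_simps)
qed auto

lemma poly_length_monom [simp]: "poly_length (monom c n) = \<bar>c\<bar>"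
  by (induction n) (auto simp: monom_0 monom_Suc)

lemma abs_coeff_le_poly_length: "\<bar>coeff p i\<bar> \<le> poly_length p"
proof (induction p arbitrary: i)
  case (pCons a p)
  show ?case using pCons.IH poly_length_nonneg[of p] by (cases i) (auto intro: add_increasing order_trans)
qed auto

lemma poly_length_le_sum:
  assumes "degree p \<le> n"
  shows "poly_length p \<le> (\<Sum>i\<le>n. \<bar>coeff p i\<bar>)"
  using assms
proof (induction p arbitrary: n)
  case (pCons a p)
  show ?case
  proof (cases "p = 0")
    case True
    have "\<bar>coeff (pCons a p) 0\<bar> \<le> (\<Sum>i\<le>n. \<bar>coeff (pCons a p) i\<bar>)" by (rule member_le_sum) auto
    then show ?thesis using True by simp
  next
    case False
    then obtain m where n: "n = Suc m" "degree p \<le> m" using pCons.prems by (cases n) auto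
    show ?thesis unfolding n using pCons.IH[OF n(2)] by (subst sum.atMost_Suc_shift) simp
  qed
qed auto

text \<open>One step of pseudo-division. The number of coefficients is the measure because it also
  drops when a nonzero constant is reduced to 0, where the degree stays the same.\<close>

lemma length_coeffs_pseudo_reduce:
  fixes f g :: "int poly"
  assumes "f \<noteq> 0" "g \<noteq> 0" "degree g \<le> degree f"
  defines "r \<equiv> smult (lead_coeff g) f - monom (lead_coeff f) (degree f - degree g) * g"
  shows "length (coeffs r) < length (coeffs f)"
proof (cases "r = 0")
  case True
  then show ?thesis using assms(1) by simp
next
  case False
  have d: "degree r \<le> degree f"
    unfolding r_def
  proof (rule degree_diff_le)
    show "degree (smult (lead_coeff g) f) \<le> degree f" by (rule degree_smult_le)
    have "degree (monom (lead_coeff f) (degree f - degree g) * g) \<le> degree (monom (lead_coeff f) (degree f - degree g)) + degree g"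
      by (rule degree_mult_le)
    also have "\<dots> \<le> degree f" using degree_monom_le[of "lead_coeff f" "degree f - degree g"] assms(3) by linarith
    finally show "degree (monom (lead_coeff f) (degree f - degree g) * g) \<le> degree f" .
  qed
  have "coeff r (degree f) = 0" unfolding r_def using assms(3) by (simp add: coeff_monom_mult)
  then have "degree r \<noteq> degree f" using False by (metis leading_coeff_0_iff)
  then show ?thesis using d False assms(1) by (simp add: length_coeffs_degree)
qed

text \<open>
  Euclid's algorithm with pseudo-division. Every division step is polynomial in the heights, so
  the common factor can be removed and a B\'ezout identity obtained with polynomial loss.
\<close>
lemma pseudo_euclid:
  "\<exists>K. \<forall>f g :: int poly. \<forall>M \<ge> 2. length (coeffs f) + length (coeffs g) \<le> n \<longrightarrow> f \<noteq> 0 \<or> g \<noteq> 0 \<longrightarrow>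
     poly_length f \<le> M \<longrightarrow> poly_length g \<le> M \<longrightarrow>
     (\<exists>C f' g' U V R. R \<noteq> 0 \<and> smult R f = C * f' \<and> smult R g = C * g' \<and> U * f' + V * g' = [:R:] \<and>
        \<bar>R\<bar> \<le> M ^ K \<and> poly_length f' \<le> M ^ K \<and> poly_length g' \<le> M ^ K)"
proof (induction n)
  case 0
  then show ?case by auto
next
  case (Suc n)
  then obtain K where IH: "\<And>f g M. M \<ge> 2 \<Longrightarrow> length (coeffs f) + length (coeffs g) \<le> n \<Longrightarrow> f \<noteq> 0 \<or> g \<noteq> 0 \<Longrightarrow>
     poly_length f \<le> M \<Longrightarrow> poly_length g \<le> M \<Longrightarrow>
     \<exists>C f' g' U V R. R \<noteq> 0 \<and> smult R f = C * f' \<and> smult R g = C * g' \<and> U * f' + V * g' = [:R:] \<and>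
        \<bar>R\<bar> \<le> M ^ K \<and> poly_length f' \<le> M ^ K \<and> poly_length g' \<le> M ^ K" by blast
  \<comment> \<open>The remainder \<open>r\<close> has length at most \<open>M ^ 3\<close>, so the
    induction hypothesis yields \<open>M ^ (3 * K)\<close>; undoing the division step costs at most
    a further \<open>M\<^sup>2\<close>.\<close>
  define K' where "K' = 3 * K + 2"
  have step: "\<exists>C f' g' U V R. R \<noteq> 0 \<and> smult R f = C * f' \<and> smult R g = C * g' \<and> U * f' + V * g' = [:R:] \<and>
        \<bar>R\<bar> \<le> M ^ K' \<and> poly_length f' \<le> M ^ K' \<and> poly_length g' \<le> M ^ K'"
    if M: "M \<ge> 2" and len: "length (coeffs f) + length (coeffs g) \<le> Suc n" and nz: "f \<noteq> 0 \<or> g \<noteq> 0"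
      and bd: "poly_length f \<le> M" "poly_length g \<le> M" and deg: "degree g \<le> degree f" for f g M
  proof (cases "f = 0 \<or> g = 0")
    case True
    have M1: "1 \<le> M ^ K'" using M by simp
    show ?thesis
    proof (cases "g = 0")
      case True
      show ?thesis by (rule exI[of _ f], rule exI[of _ 1], rule exI[of _ 0], rule exI[of _ 1], rule exI[of _ 0], rule exI[of _ 1])
          (use True M1 in \<open>auto simp: one_pCons\<close>)
    next
      case False
      then have "f = 0" using \<open>f = 0 \<or> g = 0\<close> by simp
      then show ?thesis by (intro exI[of _ g] exI[of _ 0] exI[of _ 1])
          (use M1 in \<open>auto simp: one_pCons intro!: exI[of _ 1]\<close>)
    qed
  next
    case False
    then have nz: "f \<noteq> 0" "g \<noteq> 0" by auto
    define m where "m = lead_coeff g"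
    define q where "q = monom (lead_coeff f) (degree f - degree g)"
    define r where "r = smult m f - q * g"
    have m: "m \<noteq> 0" unfolding m_def using nz by simp
    have lr: "length (coeffs r) < length (coeffs f)"
      unfolding r_def m_def q_def by (rule length_coeffs_pseudo_reduce) (use nz deg in auto)
    have mM: "\<bar>m\<bar> \<le> M" unfolding m_def using abs_coeff_le_poly_length[of g "degree g"] bd by linarith
    have qM: "poly_length q \<le> M" unfolding q_def using abs_coeff_le_poly_length[of f "degree f"] bd by simp
    have "poly_length r \<le> \<bar>m\<bar> * poly_length f + poly_length (q * g)"
      unfolding r_def using poly_length_diff[of "smult m f" "q * g"] by simp
    also have "\<dots> \<le> M * M + M * M"
    proof (rule add_mono)
      show "\<bar>m\<bar> * poly_length f \<le> M * M" using mM bd M poly_length_nonneg[of f] by (intro mult_mono) auto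
      have "poly_length (q * g) \<le> poly_length q * poly_length g" by (rule poly_length_mult)
      also have "\<dots> \<le> M * M" using qM bd M poly_length_nonneg[of g] by (intro mult_mono) auto
      finally show "poly_length (q * g) \<le> M * M" .
    qed
    also have "\<dots> = 2 * M\<^sup>2" by (simp add: power2_eq_square)
    also have "\<dots> \<le> M * M\<^sup>2" using M by (intro mult_right_mono) auto
    also have "\<dots> = M ^ 3" by (simp add: power3_eq_cube power2_eq_square)
    finally have rM: "poly_length r \<le> M ^ 3" .
    have M3: "M \<le> M ^ 3" "M ^ 3 \<ge> 2"
      using self_le_power[of M 3] M by auto
    obtain C g1 r1 U V R where R: "R \<noteq> 0" "smult R g = C * g1" "smult R r = C * r1" "U * g1 + V * r1 = [:R:]"
      "\<bar>R\<bar> \<le> (M ^ 3) ^ K" "poly_length g1 \<le> (M ^ 3) ^ K" "poly_length r1 \<le> (M ^ 3) ^ K"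
      using IH[of "M ^ 3" g r] M3 lr len nz bd rM by fastforce
    \<comment> \<open>Undoes \<open>m * f = q * g + r\<close> on the cofactors \<open>g1\<close>,
      \<open>r1\<close> of \<open>g\<close> and \<open>r\<close>. The constant \<open>R'\<close>
      takes up the factor \<open>m\<close>, so nothing has to be divided.\<close>
    define f' where "f' = q * g1 + r1"
    define g' where "g' = smult m g1"
    define R' where "R' = R * m"
    have "smult R' f = smult R (q * g + r)" unfolding R'_def r_def by (simp add: mult.commute)
    also have "\<dots> = q * smult R g + smult R r" by (simp add: smult_add_right)
    also have "\<dots> = C * f'" unfolding f'_def R by (simp add: algebra_simps)
    finally have 1: "smult R' f = C * f'" .
    have 2: "smult R' g = C * g'" unfolding R'_def g'_def using R(2) by (metis mult.commute mult_smult_right smult_smult)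
    have "smult m V * f' + (U - V * q) * g' = smult m (V * (q * g1 + r1) + (U - V * q) * g1)"
      unfolding f'_def g'_def by (simp add: smult_add_right)
    also have "\<dots> = smult m (U * g1 + V * r1)" by (simp add: algebra_simps)
    also have "\<dots> = [:R':]" unfolding R R'_def by simp
    finally have 3: "smult m V * f' + (U - V * q) * g' = [:R':]" .
    have pw: "(M ^ 3) ^ K = M ^ (3 * K)" by (simp add: power_mult)
    have K': "M ^ K' = M * M * M ^ (3 * K)" unfolding K'_def by (simp add: power_add power2_eq_square)
    define W where "W = M ^ (3 * K)"
    have W1: "W \<ge> 1" unfolding W_def using M by simp
    have MW: "M * W \<le> M * M * W" "M * W + W \<le> M * M * W"
    proof -
      have "M * W + W \<le> M * W + M * W" using M W1 by simp
      also have "\<dots> = 2 * (M * W)" by simp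
      also have "\<dots> \<le> M * (M * W)" using M W1 by (intro mult_right_mono) auto
      finally show "M * W + W \<le> M * M * W" by (simp add: mult.assoc)
      then show "M * W \<le> M * M * W" using W1 by linarith
    qed
    have b1: "\<bar>R'\<bar> \<le> M ^ K'"
    proof -
      have "\<bar>R'\<bar> \<le> W * M" unfolding R'_def abs_mult W_def using R(5) mM pw M by (intro mult_mono) auto
      then show ?thesis using MW unfolding K' W_def[symmetric] by (simp add: mult.commute)
    qed
    have b2: "poly_length g' \<le> M ^ K'"
    proof -
      have "poly_length g' \<le> M * W" unfolding g'_def poly_length_smult W_def using R(6) mM pw M poly_length_nonneg[of g1]
        by (intro mult_mono) auto
      then show ?thesis using MW unfolding K' W_def[symmetric] by linarith
    qed
    have b3: "poly_length f' \<le> M ^ K'"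
    proof -
      have "poly_length f' \<le> poly_length q * poly_length g1 + poly_length r1"
        unfolding f'_def using poly_length_add[of "q * g1" r1] poly_length_mult[of q g1] by linarith
      also have "\<dots> \<le> M * W + W" unfolding W_def using R(6,7) qM pw M poly_length_nonneg[of g1] poly_length_nonneg[of q]
        by (intro add_mono mult_mono) auto
      finally show ?thesis using MW unfolding K' W_def[symmetric] by linarith
    qed
    show ?thesis using R(1) m 1 2 3 b1 b2 b3 unfolding R'_def[symmetric]
      by (intro exI[of _ C] exI[of _ f'] exI[of _ g'] exI[of _ "smult m V"] exI[of _ "U - V * q"] exI[of _ R'])
        (auto simp: R'_def)
  qed
  show ?case
  proof (intro exI[of _ K'] allI impI)
    fix f g :: "int poly" and M :: int
    assume a: "M \<ge> 2" "length (coeffs f) + length (coeffs g) \<le> Suc n" "f \<noteq> 0 \<or> g \<noteq> 0"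
      "poly_length f \<le> M" "poly_length g \<le> M"
    show "\<exists>C f' g' U V R. R \<noteq> 0 \<and> smult R f = C * f' \<and> smult R g = C * g' \<and> U * f' + V * g' = [:R:] \<and>
        \<bar>R\<bar> \<le> M ^ K' \<and> poly_length f' \<le> M ^ K' \<and> poly_length g' \<le> M ^ K'"
    proof (cases "degree g \<le> degree f")
      case True
      show ?thesis by (rule step) (use a True in auto)
    next
      case False
      have "\<exists>C f' g' U V R. R \<noteq> 0 \<and> smult R g = C * f' \<and> smult R f = C * g' \<and> U * f' + V * g' = [:R:] \<and>
        \<bar>R\<bar> \<le> M ^ K' \<and> poly_length f' \<le> M ^ K' \<and> poly_length g' \<le> M ^ K'"
        by (rule step) (use a False in auto)
      then obtain C f' g' U V R where "R \<noteq> 0" "smult R g = C * f'" "smult R f = C * g'" "U * f' + V * g' = [:R:]"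
        "\<bar>R\<bar> \<le> M ^ K'" "poly_length f' \<le> M ^ K'" "poly_length g' \<le> M ^ K'" by blast
      then show ?thesis by (intro exI[of _ C] exI[of _ g'] exI[of _ f'] exI[of _ V] exI[of _ U] exI[of _ R])
        (auto simp: add.commute)
    qed
  qed
qed

section \<open>Binary forms: polynomials homogenised to a prescribed degree\<close>

definition hom_eval :: "nat \<Rightarrow> int poly \<Rightarrow> int \<Rightarrow> int \<Rightarrow> int" where
  "hom_eval n p x y = (\<Sum>i\<le>n. coeff p i * (x ^ i * y ^ (n - i)))"

lemma real_hom_eval:
  assumes "degree p \<le> n" "y \<noteq> 0"
  shows "real_of_int (hom_eval n p x y) = real_of_int y ^ n * poly (map_poly real_of_int p) (real_of_int x / real_of_int y)"
proof -
  have "poly (map_poly real_of_int p) z = (\<Sum>i\<le>n. real_of_int (coeff p i) * z ^ i)" for z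
  proof -
    have "degree (map_poly real_of_int p) = degree p" by (rule degree_map_poly) auto
    then show ?thesis unfolding poly_altdef
      using assms(1) by (intro sum.mono_neutral_cong_left) (auto simp: coeff_map_poly coeff_eq_0)
  qed
  moreover have "real_of_int y ^ n * (real_of_int (coeff p i) * (real_of_int x / real_of_int y) ^ i) =
     real_of_int (coeff p i * (x ^ i * y ^ (n - i)))" if "i \<le> n" for i
  proof -
    have "real_of_int y ^ n = real_of_int y ^ i * real_of_int y ^ (n - i)" using that by (simp add: power_add[symmetric])
    then have "real_of_int y ^ n * (real_of_int x / real_of_int y) ^ i = real_of_int x ^ i * real_of_int y ^ (n - i)"
      using assms(2) by (simp add: power_divide)
    then show ?thesis by (simp add: mult.left_commute)
  qed
  ultimately show ?thesis unfolding hom_eval_def of_int_sum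
    by (simp only: sum_distrib_left) (intro sum.cong refl, simp only: atMost_iff)
qed

lemma map_poly_real_of_int_mult: "map_poly real_of_int (p * q) = map_poly real_of_int p * map_poly real_of_int q"
  by (rule poly_eqI) (simp add: coeff_map_poly coeff_mult)

lemma hom_eval_mult:
  assumes "degree p \<le> m" "degree q \<le> n" "y \<noteq> 0"
  shows "hom_eval (m + n) (p * q) x y = hom_eval m p x y * hom_eval n q x y"
proof -
  have "degree (p * q) \<le> m + n" using degree_mult_le[of p q] assms by linarith
  then have "real_of_int (hom_eval (m + n) (p * q) x y) = real_of_int (hom_eval m p x y * hom_eval n q x y)"
    using assms by (simp add: real_hom_eval map_poly_real_of_int_mult power_add)
  then show ?thesis by (simp only: of_int_eq_iff)
qed

lemma hom_eval_add: "hom_eval n (p + q) x y = hom_eval n p x y + hom_eval n q x y"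
  unfolding hom_eval_def by (simp add: sum.distrib algebra_simps)

lemma hom_eval_const: "hom_eval n [:c:] x y = c * y ^ n"
proof -
  have "hom_eval n [:c:] x y = (\<Sum>i\<le>n. if i = 0 then c * y ^ n else 0)"
    unfolding hom_eval_def by (intro sum.cong refl) (auto simp: coeff_pCons split: nat.splits)
  then show ?thesis by simp
qed

lemma hom_eval_monom_mult: "hom_eval (k + n) (monom 1 k * p) x y = x ^ k * hom_eval n p x y"
proof -
  have "hom_eval (k + n) (monom 1 k * p) x y = (\<Sum>i\<in>{k..k + n}. coeff p (i - k) * (x ^ i * y ^ (k + n - i)))"
    unfolding hom_eval_def by (intro sum.mono_neutral_cong_right) (auto simp: coeff_monom_mult)
  also have "\<dots> = (\<Sum>i\<le>n. coeff p i * (x ^ (i + k) * y ^ (n - i)))"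
    by (rule sum.reindex_bij_witness[of _ "\<lambda>i. i + k" "\<lambda>i. i - k"]) (auto simp: add.commute)
  finally show ?thesis unfolding hom_eval_def by (simp add: power_add sum_distrib_left algebra_simps)
qed

lemma hom_eval_pad:
  assumes "degree p \<le> n"
  shows "hom_eval (n + m) p x y = y ^ m * hom_eval n p x y"
proof -
  have "hom_eval (n + m) p x y = (\<Sum>i\<le>n. coeff p i * (x ^ i * y ^ (n + m - i)))"
    unfolding hom_eval_def using assms by (intro sum.mono_neutral_right) (auto simp: coeff_eq_0)
  also have "\<dots> = (\<Sum>i\<le>n. y ^ m * (coeff p i * (x ^ i * y ^ (n - i))))"
  proof (intro sum.cong refl)
    fix i assume "i \<in> {..n}"
    then have "n + m - i = (n - i) + m" by auto
    then show "coeff p i * (x ^ i * y ^ (n + m - i)) = y ^ m * (coeff p i * (x ^ i * y ^ (n - i)))"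
      by (simp add: power_add)
  qed
  finally show ?thesis unfolding hom_eval_def by (simp add: sum_distrib_left)
qed

section \<open>Integer points on curves\<close>

lemma card_le_fibres:
  assumes "finite A" "\<And>y. y \<in> f ` A \<Longrightarrow> card {x\<in>A. f x = y} \<le> m"
  shows "card A \<le> m * card (f ` A)"
proof -
  have "A = (\<Union>y\<in>f ` A. {x\<in>A. f x = y})" by auto
  then have "card A \<le> (\<Sum>y\<in>f ` A. card {x\<in>A. f x = y})"
    using card_UN_le[of "f ` A" "\<lambda>y. {x\<in>A. f x = y}"] assms(1) by simp
  also have "\<dots> \<le> (\<Sum>y\<in>f ` A. m)" using assms(2) by (intro sum_mono) auto
  finally show ?thesis by (simp add: mult.commute)
qed

lemma card_spaced_le:
  fixes A :: "real set"
  assumes "finite A" "\<And>x. x \<in> A \<Longrightarrow> a \<le> x \<and> x \<le> b" "a \<le> b" "d > 0"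
    "\<And>x y. x \<in> A \<Longrightarrow> y \<in> A \<Longrightarrow> x \<noteq> y \<Longrightarrow> \<bar>x - y\<bar> \<ge> d"
  shows "real (card A) \<le> 1 + (b - a) / d"
proof -
  define g where "g = (\<lambda>x. nat \<lfloor>(x - a) / d\<rfloor>)"
  have inj: "inj_on g A"
  proof (rule inj_onI, rule ccontr)
    fix x y assume xy: "x \<in> A" "y \<in> A" "g x = g y" "x \<noteq> y"
    have "0 \<le> (x - a) / d" "0 \<le> (y - a) / d" using assms xy by auto
    then have "\<lfloor>(x - a) / d\<rfloor> = \<lfloor>(y - a) / d\<rfloor>"
      using xy(3) unfolding g_def by (metis eq_nat_nat_iff zero_le_floor)
    then have "\<bar>(x - a) / d - (y - a) / d\<bar> < 1" by linarith
    moreover have "(x - a) / d - (y - a) / d = (x - y) / d" by (simp add: diff_divide_distrib)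
    ultimately have "\<bar>x - y\<bar> < d" using assms(4) by (simp add: abs_divide)
    with assms(5)[OF xy(1,2,4)] show False by linarith
  qed
  have "g ` A \<subseteq> {0..nat \<lfloor>(b - a) / d\<rfloor>}"
    unfolding g_def using assms
    by (auto intro!: nat_mono floor_mono divide_right_mono)
  then have "card (g ` A) \<le> nat \<lfloor>(b - a) / d\<rfloor> + 1"
    using card_mono[of "{0..nat \<lfloor>(b - a) / d\<rfloor>}" "g ` A"] by simp
  then have "card A \<le> nat \<lfloor>(b - a) / d\<rfloor> + 1" by (simp add: card_image inj)
  moreover have "0 \<le> (b - a) / d" using assms by auto
  ultimately show ?thesis by linarith
qed

text \<open>Counts directions. Distinct slopes \<open>\<alpha> x / \<gamma> x\<close> differ by at
  least \<open>1 / \<Gamma>\<^sup>2\<close>, since the determinant is at least 1, and they lie in an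
  interval of length \<open>2 * \<A> / \<Gamma>\<close>, since \<open>\<gamma>\<close> dominates
  relative to the sides of the box. Each slope is taken at most \<open>m\<close> times.\<close>

lemma card_nonparallel_half:
  fixes \<alpha> \<gamma> :: "'a \<Rightarrow> real"
  assumes fin: "finite A" and pos: "\<A> > 0" "\<Gamma> > 0"
    and bd: "\<And>x. x \<in> A \<Longrightarrow> \<bar>\<gamma> x\<bar> \<le> \<Gamma> \<and> \<gamma> x \<noteq> 0 \<and> \<bar>\<alpha> x\<bar> * \<Gamma> \<le> \<bar>\<gamma> x\<bar> * \<A>"
    and det: "\<And>x y. x \<in> A \<Longrightarrow> y \<in> A \<Longrightarrow> \<alpha> x * \<gamma> y - \<alpha> y * \<gamma> x \<noteq> 0 \<Longrightarrow> \<bar>\<alpha> x * \<gamma> y - \<alpha> y * \<gamma> x\<bar> \<ge> 1"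
    and par: "\<And>x. x \<in> A \<Longrightarrow> card {y\<in>A. \<alpha> x * \<gamma> y - \<alpha> y * \<gamma> x = 0} \<le> m"
  shows "real (card A) \<le> m * (1 + 2 * \<A> * \<Gamma>)"
proof -
  let ?f = "\<lambda>x. \<alpha> x / \<gamma> x"
  have c1: "card A \<le> m * card (?f ` A)"
  proof (rule card_le_fibres[OF fin])
    fix z assume "z \<in> ?f ` A"
    then obtain x where x: "x \<in> A" "z = ?f x" by auto
    have "{y\<in>A. ?f y = z} \<subseteq> {y\<in>A. \<alpha> x * \<gamma> y - \<alpha> y * \<gamma> x = 0}"
      using bd x by (auto simp: field_simps)
    then show "card {y\<in>A. ?f y = z} \<le> m"
      using par[OF x(1)] card_mono[of "{y\<in>A. \<alpha> x * \<gamma> y - \<alpha> y * \<gamma> x = 0}" "{y\<in>A. ?f y = z}"] fin by fastforce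
  qed
  have "real (card (?f ` A)) \<le> 1 + (\<A> / \<Gamma> - (- (\<A> / \<Gamma>))) / (1 / \<Gamma>\<^sup>2)"
  proof (rule card_spaced_le)
    show "finite (?f ` A)" using fin by simp
    fix z assume "z \<in> ?f ` A"
    then obtain x where x: "x \<in> A" "z = ?f x" by auto
    have "\<bar>\<alpha> x\<bar> \<le> \<A> / \<Gamma> * \<bar>\<gamma> x\<bar>" using bd[OF x(1)] pos by (simp add: field_simps)
    then have "\<bar>z\<bar> \<le> \<A> / \<Gamma>" unfolding x(2) abs_divide
      using bd[OF x(1)] by (intro mult_imp_div_pos_le) auto
    then show "- (\<A> / \<Gamma>) \<le> z \<and> z \<le> \<A> / \<Gamma>" by linarith
  next
    show "- (\<A> / \<Gamma>) \<le> \<A> / \<Gamma>" using divide_pos_pos[OF pos] by linarith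
    show "1 / \<Gamma>\<^sup>2 > 0" using pos by simp
  next
    fix z z' assume z: "z \<in> ?f ` A" "z' \<in> ?f ` A" "z \<noteq> z'"
    obtain x y where x: "x \<in> A" "z = ?f x" and y: "y \<in> A" "z' = ?f y" using z by auto
    have nz: "\<gamma> x \<noteq> 0" "\<gamma> y \<noteq> 0" using bd x y by auto
    have eq: "z - z' = (\<alpha> x * \<gamma> y - \<alpha> y * \<gamma> x) / (\<gamma> x * \<gamma> y)"
      unfolding x(2) y(2) using nz by (simp add: diff_frac_eq)
    have "\<alpha> x * \<gamma> y - \<alpha> y * \<gamma> x \<noteq> 0" using eq z(3) nz by auto
    then have "1 \<le> \<bar>\<alpha> x * \<gamma> y - \<alpha> y * \<gamma> x\<bar>" using det x y by auto
    moreover have "\<bar>\<gamma> x * \<gamma> y\<bar> \<le> \<Gamma>\<^sup>2" unfolding power2_eq_square abs_mult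
      using bd[OF x(1)] bd[OF y(1)] pos by (intro mult_mono) auto
    moreover have "\<bar>\<gamma> x * \<gamma> y\<bar> > 0" using nz by simp
    ultimately show "1 / \<Gamma>\<^sup>2 \<le> \<bar>z - z'\<bar>" unfolding eq abs_divide
      by (intro frac_le) auto
  qed
  also have "\<dots> = 1 + 2 * \<A> * \<Gamma>" using pos by (simp add: field_simps power2_eq_square)
  finally have "real (card (?f ` A)) \<le> 1 + 2 * \<A> * \<Gamma>" .
  then have "real m * real (card (?f ` A)) \<le> real m * (1 + 2 * \<A> * \<Gamma>)" by (intro mult_left_mono) auto
  moreover have "real (card A) \<le> real m * real (card (?f ` A))" using c1 by (metis of_nat_le_iff of_nat_mult)
  ultimately show ?thesis by linarith
qed

text \<open>Relative to the sides of the box one of the two coordinates dominates. Exchanging the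
  coordinates leaves the product of the sides, and hence the bound, unchanged.\<close>

lemma card_nonparallel:
  fixes \<alpha> \<gamma> :: "'a \<Rightarrow> real"
  assumes fin: "finite A" and pos: "\<A> > 0" "\<Gamma> > 0"
    and bd: "\<And>x. x \<in> A \<Longrightarrow> \<bar>\<gamma> x\<bar> \<le> \<Gamma> \<and> \<bar>\<alpha> x\<bar> \<le> \<A> \<and> (\<alpha> x \<noteq> 0 \<or> \<gamma> x \<noteq> 0)"
    and det: "\<And>x y. x \<in> A \<Longrightarrow> y \<in> A \<Longrightarrow> \<alpha> x * \<gamma> y - \<alpha> y * \<gamma> x \<noteq> 0 \<Longrightarrow> \<bar>\<alpha> x * \<gamma> y - \<alpha> y * \<gamma> x\<bar> \<ge> 1"
    and par: "\<And>x. x \<in> A \<Longrightarrow> card {y\<in>A. \<alpha> x * \<gamma> y - \<alpha> y * \<gamma> x = 0} \<le> m"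
  shows "real (card A) \<le> m * (2 + 4 * \<A> * \<Gamma>)"
proof -
  define A1 where "A1 = {x\<in>A. \<bar>\<alpha> x\<bar> * \<Gamma> \<le> \<bar>\<gamma> x\<bar> * \<A>}"
  define A2 where "A2 = {x\<in>A. \<not> \<bar>\<alpha> x\<bar> * \<Gamma> \<le> \<bar>\<gamma> x\<bar> * \<A>}"
  have A: "A = A1 \<union> A2" unfolding A1_def A2_def by auto
  have sub: "A1 \<subseteq> A" "A2 \<subseteq> A" using A by auto
  have par': "card {y\<in>B. \<alpha> x * \<gamma> y - \<alpha> y * \<gamma> x = 0} \<le> m" if "x \<in> A" "B \<subseteq> A" for x B
    using par[OF that(1)] card_mono[of "{y\<in>A. \<alpha> x * \<gamma> y - \<alpha> y * \<gamma> x = 0}" "{y\<in>B. \<alpha> x * \<gamma> y - \<alpha> y * \<gamma> x = 0}"] fin that(2)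
    by fastforce
  have 1: "real (card A1) \<le> m * (1 + 2 * \<A> * \<Gamma>)"
  proof (rule card_nonparallel_half)
    show "finite A1" using sub fin finite_subset by blast
    fix x assume x: "x \<in> A1"
    then have xA: "x \<in> A" and le: "\<bar>\<alpha> x\<bar> * \<Gamma> \<le> \<bar>\<gamma> x\<bar> * \<A>" unfolding A1_def by auto
    have "\<gamma> x \<noteq> 0"
    proof
      assume "\<gamma> x = 0"
      then have "\<bar>\<alpha> x\<bar> * \<Gamma> \<le> 0" using le by simp
      then have "\<alpha> x = 0" using pos by (simp add: mult_le_0_iff)
      then show False using bd[OF xA] \<open>\<gamma> x = 0\<close> by simp
    qed
    then show "\<bar>\<gamma> x\<bar> \<le> \<Gamma> \<and> \<gamma> x \<noteq> 0 \<and> \<bar>\<alpha> x\<bar> * \<Gamma> \<le> \<bar>\<gamma> x\<bar> * \<A>" using bd[OF xA] le by auto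
  qed (use subsetD[OF sub(1)] sub det par' pos in auto)
  have 2: "real (card A2) \<le> m * (1 + 2 * \<Gamma> * \<A>)"
  proof (rule card_nonparallel_half[of A2 \<Gamma> \<A> \<alpha> \<gamma>])
    show "finite A2" using sub fin finite_subset by blast
    fix x assume x: "x \<in> A2"
    then have xA: "x \<in> A" and le: "\<bar>\<alpha> x\<bar> * \<Gamma> > \<bar>\<gamma> x\<bar> * \<A>" unfolding A2_def by auto
    have "\<bar>\<gamma> x\<bar> * \<A> \<ge> 0" using pos by simp
    then have "\<alpha> x \<noteq> 0" using le by auto
    then show "\<bar>\<alpha> x\<bar> \<le> \<A> \<and> \<alpha> x \<noteq> 0 \<and> \<bar>\<gamma> x\<bar> * \<A> \<le> \<bar>\<alpha> x\<bar> * \<Gamma>" using bd[OF xA] le by auto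
  next
    fix x y assume xy: "x \<in> A2" "y \<in> A2" "\<gamma> x * \<alpha> y - \<gamma> y * \<alpha> x \<noteq> 0"
    then have "\<alpha> y * \<gamma> x - \<alpha> x * \<gamma> y \<noteq> 0" by (simp add: mult.commute)
    then show "1 \<le> \<bar>\<gamma> x * \<alpha> y - \<gamma> y * \<alpha> x\<bar>" using det[of y x] xy sub by (auto simp: mult.commute)
  next
    fix x assume x: "x \<in> A2"
    have "{y\<in>A2. \<gamma> x * \<alpha> y - \<gamma> y * \<alpha> x = 0} = {y\<in>A2. \<alpha> x * \<gamma> y - \<alpha> y * \<gamma> x = 0}" by (auto simp: mult.commute)
    then show "card {y\<in>A2. \<gamma> x * \<alpha> y - \<gamma> y * \<alpha> x = 0} \<le> m" using par'[OF subsetD[OF sub(2) x] sub(2)] by simp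
  qed (use pos in auto)
  have "card A \<le> card A1 + card A2" unfolding A by (rule card_Un_le)
  then have "real (card A) \<le> real (card A1) + real (card A2)" by linarith
  also have "\<dots> \<le> m * (1 + 2 * \<A> * \<Gamma>) + m * (1 + 2 * \<Gamma> * \<A>)" using 1 2 by linarith
  finally show ?thesis by (simp add: algebra_simps)
qed

text \<open>Every real number lies strictly inside at most one gap between consecutive terms.\<close>
lemma card_gaps_le:
  fixes s :: "nat \<Rightarrow> real"
  assumes mono: "\<And>i j. i < j \<Longrightarrow> j \<le> N \<Longrightarrow> s i < s j"
    and fin: "finite Z" and I: "I \<subseteq> {..<N}"
    and ex: "\<And>i. i \<in> I \<Longrightarrow> \<exists>z\<in>Z. s i < z \<and> z < s (Suc i)"
  shows "card I \<le> card Z"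
proof -
  obtain g where g: "\<And>i. i \<in> I \<Longrightarrow> g i \<in> Z \<and> s i < g i \<and> g i < s (Suc i)"
    using ex by metis
  have "inj_on g I"
  proof (rule inj_onI, rule ccontr)
    fix i j assume ij: "i \<in> I" "j \<in> I" "g i = g j" "i \<noteq> j"
    have *: False if "i \<in> I" "j \<in> I" "g i = g j" "i < j" for i j
    proof -
      have "s (Suc i) \<le> s j"
        using mono[of "Suc i" j] that I by (cases "Suc i = j") (auto simp: less_imp_le)
      then show False using g[of i] g[of j] that by linarith
    qed
    show False using *[of i j] *[of j i] ij by (cases "i < j") auto
  qed
  moreover have "g ` I \<subseteq> Z" using g by auto
  ultimately show ?thesis using card_inj_on_le fin by blast
qed

lemma enumerate_increasing:
  fixes g :: "'a \<Rightarrow> real"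
  assumes fin: "finite V" and inj: "inj_on g V"
  obtains v where "bij_betw v {..<card V} V" "\<And>i j. i < j \<Longrightarrow> j < card V \<Longrightarrow> g (v i) < g (v j)"
proof -
  define L where "L = sorted_list_of_set (g ` V)"
  have L: "distinct L" "set L = g ` V" "length L = card V" "sorted L"
    unfolding L_def using fin inj by (auto simp: card_image)
  have inL: "L ! i \<in> g ` V" if "i < card V" for i using L that by (metis nth_mem)
  define v where "v = (\<lambda>i. inv_into V g (L ! i))"
  have gv: "g (v i) = L ! i" if "i < card V" for i
    unfolding v_def using inL[OF that] by (rule f_inv_into_f)
  have vV: "v i \<in> V" if "i < card V" for i
    unfolding v_def using inL[OF that] by (rule inv_into_into)
  have lt: "g (v i) < g (v j)" if "i < j" "j < card V" for i j
  proof -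
    have "L ! i < L ! j" using L that
      by (metis strict_sorted_iff sorted_wrt_iff_nth_less)
    then show ?thesis using gv that by simp
  qed
  have inj: "inj_on v {..<card V}"
  proof (rule inj_onI, rule ccontr)
    fix i j assume "i \<in> {..<card V}" "j \<in> {..<card V}" "v i = v j" "i \<noteq> j"
    then show False using lt[of i j] lt[of j i] by (cases "i < j") auto
  qed
  have "v ` {..<card V} = V"
    by (rule card_subset_eq[OF fin]) (use vV card_image[OF inj] in auto)
  then show ?thesis using that[of v] inj lt unfolding bij_betw_def by blast
qed

lemma card_proots_le:
  fixes p :: "real poly"
  assumes "p \<noteq> 0" "degree p \<le> n"
  shows "finite {x. poly p x = 0}" "card {x. poly p x = 0} \<le> n"
  using poly_roots_finite[OF assms(1)] card_poly_roots_bound[OF assms(1)] assms(2) by auto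

text \<open>
  The edges of the polygonal line through the points, ordered by slope, are either long, of
  which there are few, or short; a short direction is repeated boundedly often by Rolle's
  theorem, and non-parallel edges have determinant at least 1.
\<close>
lemma card_integer_points_on_curve:
  fixes f :: "real poly" and V :: "(int \<times> int) set"
  assumes n: "degree f = n" "n \<ge> 1" and c: "c \<noteq> 0" and fin: "finite V"
    and D: "D > 0" and \<Lambda>: "\<Lambda> > 0"
    and pts: "\<And>x y. (x, y) \<in> V \<Longrightarrow> D < real_of_int y \<and> real_of_int y \<le> 2 * D \<and>
       real_of_int y ^ n * poly f (real_of_int x / real_of_int y) = c \<and>
       a \<le> real_of_int x / real_of_int y \<and> real_of_int x / real_of_int y \<le> a + \<Lambda>"
    and nopow: "\<And>p q. p \<noteq> 0 \<Longrightarrow> smult (real n * p) f \<noteq> [:q, p:] * pderiv f"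
  shows "real (card V) \<le> 17 * (real n + 1) * (1 + (D\<^sup>2 * \<Lambda>) powr (1 / 3))"
proof -
  define X where "X = (\<lambda>v::int \<times> int. real_of_int (fst v))"
  define Y where "Y = (\<lambda>v::int \<times> int. real_of_int (snd v))"
  define g where "g = (\<lambda>v. X v / Y v)"
  have P: "D < Y v" "Y v \<le> 2 * D" "Y v ^ n * poly f (g v) = c" "a \<le> g v" "g v \<le> a + \<Lambda>"
    if "v \<in> V" for v
    using pts[of "fst v" "snd v"] that unfolding X_def Y_def g_def by auto
  \<comment> \<open>The ratio determines the point: \<open>poly f\<close> is nonzero there because
    \<open>c \<noteq> 0\<close>, so the equation fixes the \<open>n\<close>-th power of the positive
    number \<open>Y v\<close>.\<close>
  have Yeq: "Y v = Y w" if "v \<in> V" "w \<in> V" "g v = g w" for v w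
  proof -
    have "poly f (g w) \<noteq> 0"
    proof
      assume "poly f (g w) = 0"
      then show False using P(3)[OF that(2)] c by simp
    qed
    moreover have "Y v ^ n * poly f (g w) = Y w ^ n * poly f (g w)"
      using P(3)[OF that(1)] P(3)[OF that(2)] unfolding that(3) by (rule trans[OF _ sym])
    ultimately have "Y v ^ n = Y w ^ n" by simp
    moreover have "0 \<le> Y v" "0 \<le> Y w" using P(1)[OF that(1)] P(1)[OF that(2)] D by linarith+
    moreover have "0 < n" using n(2) by linarith
    ultimately show ?thesis by (rule power_eq_imp_eq_base)
  qed
  have inj: "inj_on g V"
  proof (rule inj_onI)
    fix v w assume vw: "v \<in> V" "w \<in> V" "g v = g w"
    have Y: "Y v = Y w" by (rule Yeq[OF vw])
    have "X v / Y w = X w / Y w" using vw(3) unfolding g_def Y .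
    moreover have "Y w \<noteq> 0" using P(1)[OF vw(2)] D by simp
    ultimately have "X v = X w" by simp
    then show "v = w" using Y unfolding X_def Y_def by (simp add: prod_eq_iff)
  qed
  obtain v where v: "bij_betw v {..<card V} V" "\<And>i j. i < j \<Longrightarrow> j < card V \<Longrightarrow> g (v i) < g (v j)"
    using enumerate_increasing[OF fin inj] by blast
  define N where "N = card V - 1"
  define s where "s = (\<lambda>i. g (v i))"
  define y where "y = (\<lambda>i. Y (v i))"
  define x where "x = (\<lambda>i. X (v i))"
  show ?thesis
  proof (cases "card V = 0")
    case True
    then show ?thesis by simp
  next
    case False
    have vV: "v i \<in> V" if "i \<le> N" for i using v(1) that False unfolding bij_betw_def N_def by auto
    have sm: "s i < s j" if "i < j" "j \<le> N" for i j using v(2) that False unfolding s_def N_def by auto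
    have p1: "D < y i" "y i \<le> 2 * D" "y i ^ n * poly f (s i) = c" "a \<le> s i" "s i \<le> a + \<Lambda>"
      if "i \<le> N" for i using P[OF vV[OF that]] unfolding y_def s_def by auto
    have xs: "x i = s i * y i" if "i \<le> N" for i
      using p1(1)[OF that] D unfolding x_def s_def y_def g_def by auto
    define \<gamma> where "\<gamma> = (\<lambda>i. y (Suc i) - y i)"
    define \<epsilon> where "\<epsilon> = (\<lambda>i. x (Suc i) - x i)"
    define \<delta> where "\<delta> = (\<lambda>i. s (Suc i) - s i)"
    \<comment> \<open>The threshold between long and short edges. There are of order
      \<open>K\<close> long edges and of order \<open>D\<^sup>2 * \<Lambda> / K\<^sup>2\<close>
      directions of short ones; the cube root balances the two, and the added 1 keeps
      \<open>K\<close> away from 0.\<close>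
    define K where "K = 1 + (D\<^sup>2 * \<Lambda>) powr (1 / 3)"
    have K1: "K \<ge> 1" unfolding K_def by simp
    have Q: "D\<^sup>2 * \<Lambda> \<le> K ^ 3"
    proof -
      have p: "D\<^sup>2 * \<Lambda> > 0" using D \<Lambda> by simp
      then have "((D\<^sup>2 * \<Lambda>) powr (1 / 3)) ^ 3 = ((D\<^sup>2 * \<Lambda>) powr (1 / 3)) powr real 3"
        using D \<Lambda> by (intro powr_realpow[symmetric]) simp
      also have "\<dots> = D\<^sup>2 * \<Lambda>" using D \<Lambda> by (simp add: powr_powr)
      finally have "D\<^sup>2 * \<Lambda> = ((D\<^sup>2 * \<Lambda>) powr (1 / 3)) ^ 3" ..
      also have "\<dots> \<le> K ^ 3" unfolding K_def by (intro power_mono) auto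
      finally show ?thesis .
    qed
    have fc: "poly f (s i) = c / y i ^ n" if "i \<le> N" for i
      using p1(1,3)[OF that] D by (simp add: field_simps)
    \<comment> \<open>Edges with a large step in \<open>y\<close>, edges with a large step in the
      slope, and edges whose gap of slopes contains a root of \<open>f\<close>. On the remaining
      ones, \<open>I4\<close>, Rolle's theorem applies to quotients with denominator
      \<open>f\<close>.\<close>
    define I1 where "I1 = {i. i < N \<and> \<bar>\<gamma> i\<bar> > D / K}"
    define I2 where "I2 = {i. i < N \<and> \<delta> i > \<Lambda> / K}"
    define I3 where "I3 = {i. i < N \<and> (\<exists>z. s i < z \<and> z < s (Suc i) \<and> poly f z = 0)}"
    define I4 where "I4 = {..<N} - I1 - I2 - I3"
    have f0: "f \<noteq> 0" using n by auto
    have c1: "real (card I1) \<le> 2 * K * real n"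
    proof -
      \<comment> \<open>A step of more than \<open>D / K\<close> in \<open>y\<close> passes one of
        about \<open>2 * K\<close> equally spaced levels. Since \<open>y ^ n * poly f s = c\<close>
        at both ends, \<open>f - [:c / lev j ^ n:]\<close> then changes sign between the two slopes
        and has a root in the gap.\<close>
      define lev where "lev = (\<lambda>j::nat. real j * D / K)"
      define Z where "Z = (\<Union>j\<in>{1..nat \<lfloor>2 * K\<rfloor>}. {z. poly (f - [:c / lev j ^ n:]) z = 0})"
      have nz: "f - [:C:] \<noteq> 0" "degree (f - [:C:]) \<le> n" for C
        using n by (auto simp: degree_diff_le)
      have finZ: "finite Z" unfolding Z_def using card_proots_le(1)[OF nz] by auto
      have cZ: "card Z \<le> nat \<lfloor>2 * K\<rfloor> * n"
      proof -
        have "card Z \<le> (\<Sum>j\<in>{1..nat \<lfloor>2 * K\<rfloor>}. card {z. poly (f - [:c / lev j ^ n:]) z = 0})"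
          unfolding Z_def by (rule card_UN_le) auto
        also have "\<dots> \<le> (\<Sum>j\<in>{1..nat \<lfloor>2 * K\<rfloor>}. n)" using card_proots_le(2)[OF nz] by (intro sum_mono) auto
        finally show ?thesis by simp
      qed
      have "card I1 \<le> card Z"
      proof (rule card_gaps_le[of N s Z])
        show "I1 \<subseteq> {..<N}" unfolding I1_def by auto
        fix i assume "i \<in> I1"
        then have i: "i < N" "\<bar>\<gamma> i\<bar> > D / K" unfolding I1_def by auto
        define lo where "lo = min (y i) (y (Suc i))"
        define hi where "hi = max (y i) (y (Suc i))"
        have lohi: "hi - lo > D / K" "lo > D" "hi \<le> 2 * D"
          using i p1(1,2)[of i] p1(1,2)[of "Suc i"] unfolding lo_def hi_def \<gamma>_def by auto
        define j where "j = nat (\<lfloor>lo * K / D\<rfloor> + 1)"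
        have loK: "lo * K / D > 0" using lohi D K1 by auto
        then have jr: "real j = of_int \<lfloor>lo * K / D\<rfloor> + 1" unfolding j_def by simp
        have b: "lo * K / D < real j" "real j \<le> lo * K / D + 1" unfolding jr by linarith+
        have l1: "lo < lev j" using b(1) D K1 unfolding lev_def by (simp add: field_simps)
        have "lev j \<le> (lo * K / D + 1) * (D / K)" unfolding lev_def using b(2) D K1
          by (simp only: times_divide_eq_right[symmetric]) (intro mult_right_mono, auto)
        also have "\<dots> = lo + D / K" using D K1 by (simp add: field_simps)
        also have "\<dots> < hi" using lohi by linarith
        finally have l2: "lev j < hi" .
        have "real j * D / K < 2 * D" using l2 lohi unfolding lev_def by linarith
        then have "real j < 2 * K" using D K1 by (simp add: field_simps)
        then have "j \<le> nat \<lfloor>2 * K\<rfloor>" by linarith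
        moreover have "j \<ge> 1" unfolding j_def using loK by (simp add: le_nat_iff)
        ultimately have jin: "j \<in> {1..nat \<lfloor>2 * K\<rfloor>}" by auto
        have lev0: "lev j > 0" using l1 lohi D by linarith
        define p where "p = f - [:c / lev j ^ n:]"
        have val: "poly p (s i') = c * (1 / y i' ^ n - 1 / lev j ^ n)" if "i' \<le> N" for i'
          unfolding p_def using fc[OF that] by (simp add: algebra_simps)
        have pw: "1 / w ^ n < 1 / z ^ n" if "0 < z" "z < w" for z w :: real
          using that n by (intro divide_strict_left_mono power_strict_mono) auto
        have "(1 / y i ^ n - 1 / lev j ^ n) * (1 / y (Suc i) ^ n - 1 / lev j ^ n) < 0"
        proof (cases "y i < y (Suc i)")
          case True
          then have "y i < lev j" "lev j < y (Suc i)" using l1 l2 unfolding lo_def hi_def by auto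
          then show ?thesis using pw[of "y i" "lev j"] pw[of "lev j" "y (Suc i)"] lev0 p1(1)[of i] D i
            by (intro mult_pos_neg) auto
        next
          case False
          then have "y (Suc i) < lev j" "lev j < y i" using l1 l2 unfolding lo_def hi_def by auto
          then show ?thesis using pw[of "y (Suc i)" "lev j"] pw[of "lev j" "y i"] lev0 p1(1)[of "Suc i"] D i
            by (intro mult_neg_pos) auto
        qed
        moreover have "poly p (s i) * poly p (s (Suc i)) = c\<^sup>2 * ((1 / y i ^ n - 1 / lev j ^ n) * (1 / y (Suc i) ^ n - 1 / lev j ^ n))"
      proof -
        have "i \<le> N" "Suc i \<le> N" using i by auto
        then show ?thesis by (simp only: val power2_eq_square ac_simps)
      qed
        ultimately have "poly p (s i) * poly p (s (Suc i)) < 0" using c by (simp add: mult_pos_neg)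
        then obtain z where z: "s i < z" "z < s (Suc i)" "poly p z = 0"
          using poly_IVT[of "s i" "s (Suc i)" p] sm[of i "Suc i"] i by auto
        then have "z \<in> Z" unfolding Z_def p_def using jin by blast
        then show "\<exists>z\<in>Z. s i < z \<and> z < s (Suc i)" using z by blast
      qed (use sm finZ in auto)
      with cZ have "card I1 \<le> nat \<lfloor>2 * K\<rfloor> * n" by linarith
      then have "real (card I1) \<le> real (nat \<lfloor>2 * K\<rfloor>) * real n" by (metis of_nat_le_iff of_nat_mult)
      also have "\<dots> \<le> 2 * K * real n" using K1 by (intro mult_right_mono) (auto simp: )
      finally show ?thesis .
    qed
    have c2: "real (card I2) \<le> K"
    proof -
      have \<delta>0: "\<delta> i > 0" if "i < N" for i unfolding \<delta>_def using sm[of i "Suc i"] that by auto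
      have "real (card I2) * (\<Lambda> / K) = (\<Sum>i\<in>I2. \<Lambda> / K)" by simp
      also have "\<dots> \<le> (\<Sum>i\<in>I2. \<delta> i)" by (intro sum_mono) (auto simp: I2_def)
      also have "\<dots> \<le> (\<Sum>i<N. \<delta> i)" by (intro sum_mono2) (auto simp: I2_def intro: less_imp_le[OF \<delta>0])
      also have "\<dots> = s N - s 0" unfolding \<delta>_def by (rule sum_lessThan_telescope)
      also have "\<dots> \<le> \<Lambda>" using p1(4)[of 0] p1(5)[of N] by linarith
      finally show ?thesis using \<Lambda> K1 by (simp add: field_simps)
    qed
    have c3: "card I3 \<le> n"
    proof -
      have "card I3 \<le> card {z. poly f z = 0}"
        by (rule card_gaps_le[of N s]) (use sm card_proots_le(1)[OF f0] n in \<open>auto simp: I3_def\<close>)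
      then show ?thesis using card_proots_le(2)[OF f0, of n] n by linarith
    qed
    \<comment> \<open>A shear by the left end \<open>a\<close> of the slopes. It preserves the
      determinants with \<open>\<gamma>\<close> and reduces the first coordinate of a short edge to
      order \<open>D * \<Lambda> / K\<close>.\<close>
    define \<alpha> where "\<alpha> = (\<lambda>i. \<epsilon> i - a * \<gamma> i)"
    define A where "A = 3 * D * \<Lambda> / K"
    define G where "G = D / K"
    have c4: "real (card I4) \<le> real (n + 1) * (2 + 4 * A * G)"
    proof (rule card_nonparallel[of I4 A G \<gamma> \<alpha>])
      show "finite I4" "A > 0" "G > 0" unfolding I4_def A_def G_def using D \<Lambda> K1 by auto
    next
      fix i assume "i \<in> I4"
      then have i: "i < N" "\<bar>\<gamma> i\<bar> \<le> G" "\<delta> i \<le> \<Lambda> / K" unfolding I4_def I1_def I2_def G_def by auto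
      have "\<epsilon> i = \<delta> i * y (Suc i) + s i * \<gamma> i"
        unfolding \<epsilon>_def \<delta>_def \<gamma>_def using xs[of i] xs[of "Suc i"] i by (simp add: algebra_simps)
      then have \<alpha>: "\<alpha> i = \<delta> i * y (Suc i) + (s i - a) * \<gamma> i" unfolding \<alpha>_def by (simp add: algebra_simps)
      have \<delta>0: "\<delta> i > 0" unfolding \<delta>_def using sm[of i "Suc i"] i by auto
      have "\<bar>\<alpha> i\<bar> \<le> \<bar>\<delta> i * y (Suc i)\<bar> + \<bar>(s i - a) * \<gamma> i\<bar>" unfolding \<alpha> by (rule abs_triangle_ineq)
      also have "\<dots> \<le> \<Lambda> / K * (2 * D) + \<Lambda> * G"
        unfolding abs_mult using i p1[of i] p1(1,2)[of "Suc i"] \<delta>0 D \<Lambda> by (intro add_mono mult_mono) auto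
      also have "\<dots> = A" unfolding A_def G_def by (simp add: field_simps)
      finally have "\<bar>\<alpha> i\<bar> \<le> A" .
      moreover have "\<alpha> i \<noteq> 0 \<or> \<gamma> i \<noteq> 0"
      proof (rule ccontr)
        assume "\<not> ?thesis"
        then have "\<delta> i * y (Suc i) = 0" using \<alpha> by auto
        then show False using \<delta>0 p1(1)[of "Suc i"] i D by auto
      qed
      ultimately show "\<bar>\<gamma> i\<bar> \<le> G \<and> \<bar>\<alpha> i\<bar> \<le> A \<and> (\<alpha> i \<noteq> 0 \<or> \<gamma> i \<noteq> 0)" using i by auto
    next
      fix i j assume nz: "\<alpha> i * \<gamma> j - \<alpha> j * \<gamma> i \<noteq> 0"
      define X' where "X' = (\<lambda>i. fst (v i))"
      define Y' where "Y' = (\<lambda>i. snd (v i))"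
      define m where "m = (X' (Suc i) - X' i) * (Y' (Suc j) - Y' j) - (X' (Suc j) - X' j) * (Y' (Suc i) - Y' i)"
      have "\<alpha> i * \<gamma> j - \<alpha> j * \<gamma> i = real_of_int m"
        unfolding \<alpha>_def \<epsilon>_def \<gamma>_def x_def y_def X_def Y_def m_def X'_def Y'_def by (simp add: algebra_simps)
      then show "\<bar>\<alpha> i * \<gamma> j - \<alpha> j * \<gamma> i\<bar> \<ge> 1" using nz by simp
    next
      fix i assume "i \<in> I4"
      then have i: "i < N" unfolding I4_def by auto
      define p where "p = \<gamma> i"
      define q where "q = - \<epsilon> i"
      \<comment> \<open>Away from the roots of \<open>f\<close>, the critical points of
        \<open>(p * z + q) ^ n / poly f z\<close> are among its roots. The hypothesis
        \<open>nopow\<close> keeps \<open>f\<close> from being a constant multiple of the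
        \<open>n\<close>-th power of this linear polynomial, for which the quotient would be
        constant and \<open>H\<close> zero.\<close>
      define H where "H = [:q, p:] * (smult (real n * p) f - [:q, p:] * pderiv f)"
      have pq: "p \<noteq> 0 \<or> q \<noteq> 0"
      proof (rule ccontr)
        assume "\<not> ?thesis"
        then have "x (Suc i) = x i" "y (Suc i) = y i" unfolding p_def q_def \<epsilon>_def \<gamma>_def by auto
        then have "s (Suc i) = s i" unfolding s_def g_def x_def y_def by simp
        then show False using sm[of i "Suc i"] i by auto
      qed
      have pd: "pderiv f \<noteq> 0" using n by (simp add: pderiv_eq_0_iff)
      have H0: "H \<noteq> 0"
      proof (cases "p = 0")
        case True
        then show ?thesis using pq pd unfolding H_def by auto
      next
        case False
        then have "[:q, p:] \<noteq> 0" by simp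
        moreover have "smult (real n * p) f - [:q, p:] * pderiv f \<noteq> 0"
          unfolding right_minus_eq by (rule nopow[OF False])
        ultimately show ?thesis unfolding H_def by (rule no_zero_divisors)
      qed
      have "degree (smult (real n * p) f - [:q, p:] * pderiv f) \<le> n"
      proof (rule degree_diff_le)
        show "degree (smult (real n * p) f) \<le> n" using n using degree_smult_le[of "real n * p" f] by simp
        have "degree ([:q, p:] * pderiv f) \<le> degree [:q, p:] + degree (pderiv f)" by (rule degree_mult_le)
        also have "\<dots> \<le> 1 + (n - 1)" using n by (intro add_mono) (auto simp: degree_pderiv)
        finally show "degree ([:q, p:] * pderiv f) \<le> n" using n by simp
      qed
      moreover have "degree H \<le> degree [:q, p:] + degree (smult (real n * p) f - [:q, p:] * pderiv f)"
        unfolding H_def by (rule degree_mult_le)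
      ultimately have Hd: "degree H \<le> n + 1" by (simp split: if_splits)
      \<comment> \<open>Each parallel edge has a root of \<open>H\<close> strictly inside its own
        gap, and \<open>H\<close> has at most \<open>n + 1\<close> roots.\<close>
      have "card {j\<in>I4. \<alpha> i * \<gamma> j - \<alpha> j * \<gamma> i = 0} \<le> card {z. poly H z = 0}"
      proof (rule card_gaps_le[of N s])
        show "{j\<in>I4. \<alpha> i * \<gamma> j - \<alpha> j * \<gamma> i = 0} \<subseteq> {..<N}" unfolding I4_def by auto
        fix j assume "j \<in> {j\<in>I4. \<alpha> i * \<gamma> j - \<alpha> j * \<gamma> i = 0}"
        then have j: "j < N" "j \<notin> I3" and par: "\<alpha> i * \<gamma> j - \<alpha> j * \<gamma> i = 0" unfolding I4_def by auto
        have nr: "poly f z \<noteq> 0" if "s j \<le> z" "z \<le> s (Suc j)" for z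
        proof (cases "z = s j \<or> z = s (Suc j)")
          case True
          then show ?thesis using p1(3)[of j] p1(3)[of "Suc j"] j c by auto
        next
          case False
          then show ?thesis using j that unfolding I3_def by force
        qed
        have "\<epsilon> i * \<gamma> j = \<epsilon> j * \<gamma> i" using par unfolding \<alpha>_def by (simp add: algebra_simps)
        moreover have "\<epsilon> j = x (Suc j) - x j" "\<gamma> j = y (Suc j) - y j" unfolding \<epsilon>_def \<gamma>_def by auto
        ultimately have "p * x j + q * y j = p * x (Suc j) + q * y (Suc j)"
          unfolding p_def q_def by (simp add: algebra_simps)
        then have eq: "(p * s j + q) * y j = (p * s (Suc j) + q) * y (Suc j)"
          using xs[of j] xs[of "Suc j"] j by (simp add: algebra_simps)
        \<comment> \<open>At a point of the curve \<open>\<phi>\<close> is the \<open>n\<close>-th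
          power of \<open>p * x + q * y\<close> divided by \<open>c\<close>, and this linear form
          takes the same value at both ends of an edge parallel to the edge
          \<open>i\<close>.\<close>
        define \<phi> where "\<phi> = (\<lambda>z. (p * z + q) ^ n / poly f z)"
        have ph: "\<phi> (s j') = ((p * s j' + q) * y j') ^ n / c" if "j' \<le> N" for j'
          unfolding \<phi>_def fc[OF that] by (simp add: power_mult_distrib)
        have "\<phi> (s j) = \<phi> (s (Suc j))" using ph[of j] ph[of "Suc j"] j eq by simp
        moreover have der: "(\<phi> has_real_derivative
            (real n * (p * z + q) ^ (n - 1) * p * poly f z - (p * z + q) ^ n * poly (pderiv f) z) / (poly f z * poly f z)) (at z)"
          if "s j \<le> z" "z \<le> s (Suc j)" for z
          unfolding \<phi>_def using nr[OF that]
          by (auto intro!: derivative_eq_intros poly_DERIV simp: algebra_simps)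
        moreover have "continuous_on {s j..s (Suc j)} \<phi>"
        proof (rule DERIV_continuous_on)
          fix z assume "z \<in> {s j..s (Suc j)}"
          then show "(\<phi> has_real_derivative (real n * (p * z + q) ^ (n - 1) * p * poly f z - (p * z + q) ^ n * poly (pderiv f) z) / (poly f z * poly f z)) (at z within {s j..s (Suc j)})"
            using der[of z] by (intro DERIV_subset[OF der]) auto
        qed
        moreover have "s j < s (Suc j)" using sm[of j "Suc j"] j by simp
        moreover have "\<phi> differentiable (at z)" if "s j < z" "z < s (Suc j)" for z
          using der[of z] that unfolding real_differentiable_def by (meson less_imp_le)
        ultimately have "\<exists>z. s j < z \<and> z < s (Suc j) \<and> DERIV \<phi> z :> 0"
          by (intro Rolle)
        then obtain z where z: "s j < z" "z < s (Suc j)" "DERIV \<phi> z :> 0" by blast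
        have "(real n * (p * z + q) ^ (n - 1) * p * poly f z - (p * z + q) ^ n * poly (pderiv f) z) / (poly f z * poly f z) = 0"
          using DERIV_unique[OF z(3) der[of z]] z by simp
        then have e0: "real n * (p * z + q) ^ (n - 1) * p * poly f z - (p * z + q) ^ n * poly (pderiv f) z = 0"
          using nr[of z] z by simp
        have nS: "(p * z + q) ^ n = (p * z + q) ^ (n - 1) * (p * z + q)" using n by (cases n) auto
        have "(p * z + q) ^ (n - 1) * (real n * p * poly f z - (p * z + q) * poly (pderiv f) z) = 0"
          using e0 unfolding nS by (simp add: algebra_simps)
        then have "(p * z + q) * (real n * p * poly f z - (p * z + q) * poly (pderiv f) z) = 0" by auto
        moreover have "poly H z = (p * z + q) * (real n * p * poly f z - (p * z + q) * poly (pderiv f) z)"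
          unfolding H_def by (simp add: algebra_simps)
        ultimately have "poly H z = 0" by simp
        then show "\<exists>z\<in>{z. poly H z = 0}. s j < z \<and> z < s (Suc j)" using z by blast
      qed (use sm card_proots_le(1)[OF H0 Hd] in auto)
      also have "\<dots> \<le> n + 1" using card_proots_le(2)[OF H0 Hd] .
      finally show "card {j\<in>I4. \<alpha> i * \<gamma> j - \<alpha> j * \<gamma> i = 0} \<le> n + 1" .
    qed
    have "A * G = 3 * (D\<^sup>2 * \<Lambda>) / K\<^sup>2" unfolding A_def G_def by (simp add: power2_eq_square)
    also have "\<dots> \<le> 3 * K" using Q K1 by (simp add: field_simps power2_eq_square power3_eq_cube)
    finally have AG: "A * G \<le> 3 * K" .
    have "{..<N} \<subseteq> I1 \<union> I2 \<union> I3 \<union> I4" unfolding I4_def by auto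
    moreover have fins: "finite I1" "finite I2" "finite I3" "finite I4" unfolding I1_def I2_def I3_def I4_def by auto
    ultimately have "N \<le> card (I1 \<union> I2 \<union> I3 \<union> I4)" using card_mono[of "I1 \<union> I2 \<union> I3 \<union> I4" "{..<N}"] by simp
    also have "\<dots> \<le> card I1 + card I2 + card I3 + card I4"
      by (meson add_mono card_Un_le le_refl order_trans)
    finally have "real N \<le> real (card I1) + real (card I2) + real (card I3) + real (card I4)" by linarith
    also have "\<dots> \<le> 2 * K * real n + K + real n + real (n + 1) * (2 + 4 * A * G)" using c1 c2 c3 c4 by linarith
    also have "\<dots> \<le> 2 * K * real n + K + real n + real (n + 1) * (2 + 12 * K)"
      using AG by (intro add_mono mult_left_mono order_refl) auto
    also have "\<dots> \<le> 17 * (real n + 1) * K - 1"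
    proof -
      have "real n * K \<ge> real n" using K1 mult_left_mono[of 1 K "real n"] by simp
      then show ?thesis using K1 by (simp add: algebra_simps)
    qed
    finally show ?thesis using False unfolding N_def K_def by linarith
  qed
qed

section \<open>Points satisfying a common linear relation\<close>

definition poly_of :: "nat \<Rightarrow> (nat \<Rightarrow> int) \<Rightarrow> int poly" where
  "poly_of b g = (\<Sum>j\<le>b. monom (g j) j)"

lemma coeff_poly_of: "coeff (poly_of b g) j = (if j \<le> b then g j else 0)"
  unfolding poly_of_def by (simp add: coeff_sum)

lemma degree_poly_of: "degree (poly_of b g) \<le> b"
  by (rule degree_le) (simp add: coeff_poly_of)

lemma hom_eval_poly_of: "hom_eval b (poly_of b g) x y = (\<Sum>j\<le>b. g j * (x ^ j * y ^ (b - j)))"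
  unfolding hom_eval_def by (intro sum.cong refl) (simp add: coeff_poly_of)

lemma pade_pairing_antisym: "pade_pairing k b e f w v = - pade_pairing k b e f v w"
  unfolding pade_pairing_def sum_negf[symmetric] by (intro sum.cong refl) (simp add: algebra_simps)

lemma pade_pairing_self [simp]: "pade_pairing k b e f v v = 0"
  using pade_pairing_antisym[of k b e f v v] by simp

text \<open>As a function of \<open>v\<close>, the pairing with a fixed point is linear in
  \<open>e v\<close> and \<open>f v\<close>, with forms of degree \<open>b\<close> in
  \<open>v\<close> as coefficients. A vanishing combination of columns is therefore a single
  relation between \<open>e v\<close> and \<open>f v\<close>.\<close>

lemma sum_pade_pairing:
  assumes "finite L"
  shows "(\<Sum>m\<in>L. c m * pade_pairing k b e f v m) =
    e v * hom_eval b (poly_of b (\<lambda>j. - pade_coeff k b j * (\<Sum>m\<in>L. c m * f m * (fst m ^ (b - j) * snd m ^ j)))) (fst v) (snd v)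
  + f v * hom_eval b (poly_of b (\<lambda>j. pade_coeff k b (b - j) * (\<Sum>m\<in>L. c m * e m * (fst m ^ (b - j) * snd m ^ j)))) (fst v) (snd v)"
proof -
  have A: "(\<Sum>m\<in>L. c m * pade_pairing k b e f v m) =
     (\<Sum>i\<le>b. \<Sum>m\<in>L. f v * (pade_coeff k b i * (c m * e m * (fst m ^ i * snd m ^ (b - i))) * (fst v ^ (b - i) * snd v ^ i)))
   + (\<Sum>i\<le>b. \<Sum>m\<in>L. e v * (- pade_coeff k b i * (c m * f m * (fst m ^ (b - i) * snd m ^ i)) * (fst v ^ i * snd v ^ (b - i))))"
    unfolding pade_pairing_def sum_distrib_left sum.swap[of _ L] sum.distrib[symmetric]
    by (intro sum.cong refl) (simp add: algebra_simps)
  have B: "(\<Sum>i\<le>b. \<Sum>m\<in>L. f v * (pade_coeff k b i * (c m * e m * (fst m ^ i * snd m ^ (b - i))) * (fst v ^ (b - i) * snd v ^ i)))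
    = (\<Sum>j\<le>b. \<Sum>m\<in>L. f v * (pade_coeff k b (b - j) * (c m * e m * (fst m ^ (b - j) * snd m ^ j)) * (fst v ^ j * snd v ^ (b - j))))"
    by (rule sum.reindex_bij_witness[of _ "\<lambda>i. b - i" "\<lambda>i. b - i"]) auto
  show ?thesis unfolding A B hom_eval_poly_of sum_distrib_left sum_distrib_right
    by (simp add: add.commute)
qed

lemma abs_sum_le_int:
  fixes g :: "'a \<Rightarrow> int"
  assumes "\<And>i. i \<in> A \<Longrightarrow> \<bar>g i\<bar> \<le> B"
  shows "\<bar>\<Sum>i\<in>A. g i\<bar> \<le> int (card A) * B"
proof -
  have "\<bar>\<Sum>i\<in>A. g i\<bar> \<le> (\<Sum>i\<in>A. \<bar>g i\<bar>)" by (rule sum_abs)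
  also have "\<dots> \<le> (\<Sum>i\<in>A. B)" using assms by (rule sum_mono)
  finally show ?thesis by simp
qed

text \<open>If the pairing of \<open>v1\<close> and \<open>v2\<close> is nonzero, the Pfaffian
  relation says that the combination of \<open>v1\<close>, \<open>v2\<close>, \<open>v3\<close> with
  coefficients \<open>J v2 v3\<close>, \<open>- J v1 v3\<close>, \<open>J v1 v2\<close> pairs to
  zero with every point. The forms obtained are not both zero because distinct points have neither
  proportional \<open>(e, f)\<close> nor equal ratio. The exponent \<open>3 * b + 3\<close> is
  \<open>2 * b + 2\<close> from a coefficient and \<open>b + 1\<close> from a point.\<close>

lemma vanishing_form:
  assumes b: "1 \<le> b"
  obtains W :: int where "W \<ge> 1"
   "\<And>T e f X. finite T \<Longrightarrow> card T \<ge> 3 \<Longrightarrow> X \<ge> 1 \<Longrightarrow>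
      (\<And>v. v \<in> T \<Longrightarrow> \<bar>fst v\<bar> \<le> X \<and> \<bar>snd v\<bar> \<le> X \<and> \<bar>e v\<bar> \<le> X \<and> \<bar>f v\<bar> \<le> X \<and> snd v \<noteq> 0 \<and> e v \<noteq> 0) \<Longrightarrow>
      (\<And>v w. v \<in> T \<Longrightarrow> w \<in> T \<Longrightarrow> v \<noteq> w \<Longrightarrow> e v * f w \<noteq> e w * f v \<and> fst v * snd w \<noteq> fst w * snd v) \<Longrightarrow>
      (\<And>v1 v2 v3 v4. v1 \<in> T \<Longrightarrow> v2 \<in> T \<Longrightarrow> v3 \<in> T \<Longrightarrow> v4 \<in> T \<Longrightarrow>
       pade_pairing k b e f v1 v2 * pade_pairing k b e f v3 v4
       - pade_pairing k b e f v1 v3 * pade_pairing k b e f v2 v4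
       + pade_pairing k b e f v1 v4 * pade_pairing k b e f v2 v3 = 0) \<Longrightarrow>
      \<exists>G1 G2. degree G1 \<le> b \<and> degree G2 \<le> b \<and> (G1 \<noteq> 0 \<or> G2 \<noteq> 0) \<and>
        poly_length G1 \<le> W * X ^ (3 * b + 3) \<and> poly_length G2 \<le> W * X ^ (3 * b + 3) \<and>
        (\<forall>v\<in>T. e v * hom_eval b G1 (fst v) (snd v) + f v * hom_eval b G2 (fst v) (snd v) = 0)"
proof -
  define w where "w = 1 + (\<Sum>i\<le>b. \<bar>pade_coeff k b i\<bar>)"
  have w: "\<bar>pade_coeff k b i\<bar> \<le> w" if "i \<le> b" for i
    unfolding w_def using member_le_sum[of i "{..b}" "\<lambda>i. \<bar>pade_coeff k b i\<bar>"] that by simp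
  have w1: "w \<ge> 1" unfolding w_def by (simp add: sum_nonneg)
  define B where "B = int (b + 1)"
  have B1: "B \<ge> 1" unfolding B_def by simp
  define W where "W = B * (w * (3 * (B * (w * 2))))"
  show ?thesis
  proof (rule that)
    show W1: "W \<ge> 1" unfolding W_def using w1 B1 by (smt (verit) mult_le_cancel_left1 mult_pos_pos pos_zmult_eq_1_iff_lemma mult_less_cancel_right2)
    fix T :: "(int \<times> int) set" and e f :: "int \<times> int \<Rightarrow> int" and X :: int
    assume finT: "finite T" and cT: "card T \<ge> 3" and X: "X \<ge> 1"
      and bd: "\<And>v. v \<in> T \<Longrightarrow> \<bar>fst v\<bar> \<le> X \<and> \<bar>snd v\<bar> \<le> X \<and> \<bar>e v\<bar> \<le> X \<and> \<bar>f v\<bar> \<le> X \<and> snd v \<noteq> 0 \<and> e v \<noteq> 0"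
      and dist: "\<And>v w. v \<in> T \<Longrightarrow> w \<in> T \<Longrightarrow> v \<noteq> w \<Longrightarrow> e v * f w \<noteq> e w * f v \<and> fst v * snd w \<noteq> fst w * snd v"
      and pf: "\<And>v1 v2 v3 v4. v1 \<in> T \<Longrightarrow> v2 \<in> T \<Longrightarrow> v3 \<in> T \<Longrightarrow> v4 \<in> T \<Longrightarrow>
       pade_pairing k b e f v1 v2 * pade_pairing k b e f v3 v4
       - pade_pairing k b e f v1 v3 * pade_pairing k b e f v2 v4
       + pade_pairing k b e f v1 v4 * pade_pairing k b e f v2 v3 = 0"
    define J where "J = pade_pairing k b e f"
    have mono: "\<bar>fst v ^ i * snd v ^ (b - i)\<bar> \<le> X ^ b" "\<bar>fst v ^ (b - i) * snd v ^ i\<bar> \<le> X ^ b" if "v \<in> T" "i \<le> b" for v i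
    proof -
      have "\<bar>fst v\<bar> ^ i' * \<bar>snd v\<bar> ^ j' \<le> X ^ i' * X ^ j'" for i' j'
        using bd[OF that(1)] X by (intro mult_mono power_mono) auto
      moreover have "X ^ i * X ^ (b - i) = X ^ b" "X ^ (b - i) * X ^ i = X ^ b" using that by (simp_all add: power_add[symmetric])
      ultimately show "\<bar>fst v ^ i * snd v ^ (b - i)\<bar> \<le> X ^ b" "\<bar>fst v ^ (b - i) * snd v ^ i\<bar> \<le> X ^ b"
        unfolding abs_mult power_abs by metis+
    qed
    have JX: "\<bar>J v u\<bar> \<le> B * (w * 2) * X ^ (2 * b + 2)" if v: "v \<in> T" "u \<in> T" for v u
    proof -
      have "\<bar>J v u\<bar> \<le> int (card {..b}) * (w * (2 * X ^ (2 * b + 2)))"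
        unfolding J_def pade_pairing_def
      proof (rule abs_sum_le_int)
        fix i assume "i \<in> {..b}"
        then have i: "i \<le> b" by simp
        have t: "\<bar>p * q * (r * s)\<bar> \<le> X ^ (2 * b + 2)" if "\<bar>p\<bar> \<le> X" "\<bar>q\<bar> \<le> X" "\<bar>r\<bar> \<le> X ^ b" "\<bar>s\<bar> \<le> X ^ b" for p q r s
        proof -
          have "\<bar>p * q * (r * s)\<bar> \<le> X * X * (X ^ b * X ^ b)" unfolding abs_mult using that X by (intro mult_mono) auto
          also have "\<dots> = X ^ (2 * b + 2)" by (simp add: power_add mult_2 power2_eq_square)
          finally show ?thesis .
        qed
        have "\<bar>f v * e u * (fst u ^ i * snd u ^ (b - i) * (fst v ^ (b - i) * snd v ^ i)) - e v * f u * (fst v ^ i * snd v ^ (b - i) * (fst u ^ (b - i) * snd u ^ i))\<bar> \<le> X ^ (2 * b + 2) + X ^ (2 * b + 2)"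
          using bd[OF v(1)] bd[OF v(2)] mono[OF v(1) i] mono[OF v(2) i]
          by (intro order_trans[OF abs_triangle_ineq4] add_mono t) auto
        then show "\<bar>pade_coeff k b i * (f v * e u * (fst u ^ i * snd u ^ (b - i) * (fst v ^ (b - i) * snd v ^ i)) - e v * f u * (fst v ^ i * snd v ^ (b - i) * (fst u ^ (b - i) * snd u ^ i)))\<bar> \<le> w * (2 * X ^ (2 * b + 2))"
          unfolding abs_mult[of "pade_coeff k b i"] using w[OF i] w1 by (intro mult_mono) auto
      qed
      then show ?thesis unfolding B_def by (simp add: mult.assoc)
    qed
    define Y where "Y = B * (w * 2) * X ^ (2 * b + 2)"
    have Y1: "Y \<ge> 1"
    proof -
      have "1 * 1 \<le> w * (2::int)" using w1 by linarith
      then have "1 * (1 * 1) \<le> B * (w * 2)" using B1 by (intro mult_mono) auto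
      then have h1: "1 \<le> B * (w * 2)" by simp
      have h2: "1 \<le> X ^ (2 * b + 2)" using X by (rule one_le_power)
      have "1 * 1 \<le> B * (w * 2) * X ^ (2 * b + 2)" by (rule mult_mono[OF h1 h2]) (use h1 in auto)
      then show ?thesis unfolding Y_def by simp
    qed
    define G1 where "G1 = (\<lambda>L c. poly_of b (\<lambda>j. - pade_coeff k b j * (\<Sum>m\<in>L. c m * f m * (fst m ^ (b - j) * snd m ^ j))))"
    define G2 where "G2 = (\<lambda>L c. poly_of b (\<lambda>j. pade_coeff k b (b - j) * (\<Sum>m\<in>L. c m * e m * (fst m ^ (b - j) * snd m ^ j))))"
    have len: "poly_length (G1 L c) \<le> W * X ^ (3 * b + 3)" "poly_length (G2 L c) \<le> W * X ^ (3 * b + 3)"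
      if L: "L \<subseteq> T" "card L \<le> 3" and c: "\<And>m. m \<in> L \<Longrightarrow> \<bar>c m\<bar> \<le> Y" for L c
    proof -
      have S: "\<bar>\<Sum>m\<in>L. c m * q m * (fst m ^ (b - j) * snd m ^ j)\<bar> \<le> 3 * (Y * X * X ^ b)"
        if "\<And>m. m \<in> T \<Longrightarrow> \<bar>q m\<bar> \<le> X" "j \<le> b" for q j
      proof -
        have "\<bar>\<Sum>m\<in>L. c m * q m * (fst m ^ (b - j) * snd m ^ j)\<bar> \<le> int (card L) * (Y * X * X ^ b)"
        proof (rule abs_sum_le_int)
          fix m assume m: "m \<in> L"
          then have mT: "m \<in> T" using L by auto
          show "\<bar>c m * q m * (fst m ^ (b - j) * snd m ^ j)\<bar> \<le> Y * X * X ^ b"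
            unfolding abs_mult[of "c m * q m"] abs_mult[of "c m"]
            using c[OF m] that(1)[OF mT] mono(2)[OF mT that(2)] Y1 X by (intro mult_mono) auto
        qed
        also have "\<dots> \<le> 3 * (Y * X * X ^ b)" using L Y1 X by (intro mult_right_mono) auto
        finally show ?thesis .
      qed
      have WY: "B * (w * (3 * (Y * X * X ^ b))) = W * X ^ (3 * b + 3)"
      proof -
        have "X ^ (3 * b + 3) = X ^ (2 * b + 2) * (X * X ^ b)"
          unfolding power_Suc[symmetric] power_add[symmetric] by (simp add: numeral_3_eq_3)
        then show ?thesis unfolding W_def Y_def by (simp add: ac_simps)
      qed
      have g: "poly_length (poly_of b g) \<le> W * X ^ (3 * b + 3)" if "\<And>j. j \<le> b \<Longrightarrow> \<bar>g j\<bar> \<le> w * (3 * (Y * X * X ^ b))" for g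
      proof -
        have "poly_length (poly_of b g) \<le> (\<Sum>j\<le>b. \<bar>coeff (poly_of b g) j\<bar>)" by (rule poly_length_le_sum[OF degree_poly_of])
        also have "\<dots> \<le> (\<Sum>j\<le>b. w * (3 * (Y * X * X ^ b)))" using that by (intro sum_mono) (simp add: coeff_poly_of)
        also have "\<dots> = W * X ^ (3 * b + 3)" unfolding WY[symmetric] B_def by simp
        finally show ?thesis .
      qed
      show "poly_length (G1 L c) \<le> W * X ^ (3 * b + 3)" unfolding G1_def
      proof (rule g)
        fix j assume "j \<le> b"
        then show "\<bar>- pade_coeff k b j * (\<Sum>m\<in>L. c m * f m * (fst m ^ (b - j) * snd m ^ j))\<bar> \<le> w * (3 * (Y * X * X ^ b))"
          unfolding abs_mult using w[of j] w1 S[of f j] bd by (intro mult_mono) auto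
      qed
      show "poly_length (G2 L c) \<le> W * X ^ (3 * b + 3)" unfolding G2_def
      proof (rule g)
        fix j assume "j \<le> b"
        then show "\<bar>pade_coeff k b (b - j) * (\<Sum>m\<in>L. c m * e m * (fst m ^ (b - j) * snd m ^ j))\<bar> \<le> w * (3 * (Y * X * X ^ b))"
          unfolding abs_mult using w[of "b - j"] w1 S[of e j] bd by (intro mult_mono) auto
      qed
    qed
    have rel: "e v * hom_eval b (G1 L c) (fst v) (snd v) + f v * hom_eval b (G2 L c) (fst v) (snd v) = (\<Sum>m\<in>L. c m * J v m)"
      if "finite L" for v L c unfolding G1_def G2_def J_def sum_pade_pairing[OF that] ..
    have deg: "degree (G1 L c) \<le> b" "degree (G2 L c) \<le> b" for L c unfolding G1_def G2_def by (rule degree_poly_of)+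
    \<comment> \<open>No Pade coefficient vanishes, so if both forms are zero then all moments of
      the combination are zero, with weights \<open>e\<close> as well as \<open>f\<close>.\<close>
    have zero: "(\<Sum>m\<in>L. c m * f m * (fst m ^ (b - j) * snd m ^ j)) = 0" "(\<Sum>m\<in>L. c m * e m * (fst m ^ (b - j) * snd m ^ j)) = 0"
      if "G1 L c = 0" "G2 L c = 0" "j \<le> b" for L c j
    proof -
      have "coeff (G1 L c) j = 0" "coeff (G2 L c) j = 0" using that by simp_all
      then show "(\<Sum>m\<in>L. c m * f m * (fst m ^ (b - j) * snd m ^ j)) = 0" "(\<Sum>m\<in>L. c m * e m * (fst m ^ (b - j) * snd m ^ j)) = 0"
        unfolding G1_def G2_def coeff_poly_of using that pade_coeff_nonzero[of _ b k] by auto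
    qed
    show "\<exists>G1 G2. degree G1 \<le> b \<and> degree G2 \<le> b \<and> (G1 \<noteq> 0 \<or> G2 \<noteq> 0) \<and>
        poly_length G1 \<le> W * X ^ (3 * b + 3) \<and> poly_length G2 \<le> W * X ^ (3 * b + 3) \<and>
        (\<forall>v\<in>T. e v * hom_eval b G1 (fst v) (snd v) + f v * hom_eval b G2 (fst v) (snd v) = 0)"
    proof (cases "\<forall>v\<in>T. \<forall>u\<in>T. J v u = 0")
      case True
      \<comment> \<open>If the pairing vanishes identically on \<open>T\<close>, pairing with a
        single point already gives the relation.\<close>
      obtain v1 where v1: "v1 \<in> T" using cT by (cases "T = {}") auto
      have "\<not> (G1 {v1} (\<lambda>_. 1) = 0 \<and> G2 {v1} (\<lambda>_. 1) = 0)"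
        using zero(2)[of "{v1}" "\<lambda>_. 1" b] bd[OF v1] by auto
      then show ?thesis using True v1 deg len[of "{v1}" "\<lambda>_. 1"] rel[of "{v1}" _ "\<lambda>_. 1"] Y1
        by (intro exI[of _ "G1 {v1} (\<lambda>_. 1)"] exI[of _ "G2 {v1} (\<lambda>_. 1)"]) auto
    next
      case False
      then obtain v1 v2 where v12: "v1 \<in> T" "v2 \<in> T" "J v1 v2 \<noteq> 0" by auto
      then have ne: "v1 \<noteq> v2" unfolding J_def by auto
      have "\<not> T \<subseteq> {v1, v2}" using cT card_mono[of "{v1, v2}" T] ne by auto
      then obtain v3 where v3: "v3 \<in> T" "v3 \<noteq> v1" "v3 \<noteq> v2" by auto
      define L where "L = {v1, v2, v3}"
      define c where "c = (\<lambda>m. if m = v1 then J v2 v3 else if m = v2 then - J v1 v3 else J v1 v2)"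
      have finL: "finite L" unfolding L_def by simp
      have LT: "L \<subseteq> T" "card L \<le> 3" unfolding L_def using v12 v3 by (auto simp: card_insert_if)
      have sumL: "(\<Sum>m\<in>L. g m) = g v1 + g v2 + g v3" for g :: "int \<times> int \<Rightarrow> int"
        unfolding L_def using ne v3 by auto
      have cv: "c v1 = J v2 v3" "c v2 = - J v1 v3" "c v3 = J v1 v2" unfolding c_def using ne v3 by auto
      have cY: "\<bar>c m\<bar> \<le> Y" if "m \<in> L" for m
        using that JX[OF v12(1,2)] JX[OF v12(1) v3(1)] JX[OF v12(2) v3(1)] unfolding Y_def[symmetric] c_def by auto
      have van: "(\<Sum>m\<in>L. c m * J v m) = 0" if "v \<in> T" for v
      proof -
        have "J v1 v2 * J v3 v - J v1 v3 * J v2 v + J v1 v * J v2 v3 = 0"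
          using pf[OF v12(1,2) v3(1) that] unfolding J_def .
        then show ?thesis unfolding sumL cv
          using pade_pairing_antisym[of k b e f v v1] pade_pairing_antisym[of k b e f v v2] pade_pairing_antisym[of k b e f v v3]
          unfolding J_def[symmetric] by (simp add: algebra_simps)
      qed
      have "\<not> (G1 L c = 0 \<and> G2 L c = 0)"
      proof
        assume z: "G1 L c = 0 \<and> G2 L c = 0"
        define a where "a = (\<lambda>m. fst m * snd v1 - snd m * fst v1)"
        \<comment> \<open>The moments \<open>j = b\<close> and \<open>j = b - 1\<close>, multiplied
          by \<open>fst v1\<close> and \<open>snd v1\<close>, are subtracted to eliminate
          \<open>v1\<close>. Doing so with the weights \<open>e\<close> and \<open>f\<close> leaves
          two linear equations for \<open>v2\<close> and \<open>v3\<close>, whose determinant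
          contains \<open>e v3 * f v2 - e v2 * f v3\<close>.\<close>
        have key: "c v2 * q v2 * snd v2 ^ (b - 1) * a v2 + c v3 * q v3 * snd v3 ^ (b - 1) * a v3 = 0"
          if q: "\<And>j. j \<le> b \<Longrightarrow> (\<Sum>m\<in>L. c m * q m * (fst m ^ (b - j) * snd m ^ j)) = 0" for q
        proof -
          have "(\<Sum>m\<in>L. c m * q m * (fst m * snd m ^ (b - 1))) = 0" using q[of "b - 1"] b by simp
          then have A: "(c v1 * q v1 * (fst v1 * snd v1 ^ (b - 1)) + c v2 * q v2 * (fst v2 * snd v2 ^ (b - 1)) + c v3 * q v3 * (fst v3 * snd v3 ^ (b - 1))) * snd v1 = 0"
            unfolding sumL by simp
          have "(\<Sum>m\<in>L. c m * q m * (snd m * snd m ^ (b - 1))) = 0" using q[of b] b by (simp add: power_Suc[symmetric] del: power_Suc)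
          then have B: "(c v1 * q v1 * (snd v1 * snd v1 ^ (b - 1)) + c v2 * q v2 * (snd v2 * snd v2 ^ (b - 1)) + c v3 * q v3 * (snd v3 * snd v3 ^ (b - 1))) * fst v1 = 0"
            unfolding sumL by simp
          show ?thesis using A B unfolding a_def by (simp add: algebra_simps)
        qed
        have Ke: "c v2 * e v2 * snd v2 ^ (b - 1) * a v2 + c v3 * e v3 * snd v3 ^ (b - 1) * a v3 = 0"
          by (rule key) (use zero(2)[of L c] z in auto)
        have Kf: "c v2 * f v2 * snd v2 ^ (b - 1) * a v2 + c v3 * f v3 * snd v3 ^ (b - 1) * a v3 = 0"
          by (rule key) (use zero(1)[of L c] z in auto)
        have "(c v3 * snd v3 ^ (b - 1) * a v3) * (e v3 * f v2 - e v2 * f v3)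
          = (c v2 * e v2 * snd v2 ^ (b - 1) * a v2 + c v3 * e v3 * snd v3 ^ (b - 1) * a v3) * f v2
          - (c v2 * f v2 * snd v2 ^ (b - 1) * a v2 + c v3 * f v3 * snd v3 ^ (b - 1) * a v3) * e v2"
          by (simp add: algebra_simps)
        also have "\<dots> = 0" unfolding Ke Kf by simp
        finally have "(c v3 * snd v3 ^ (b - 1) * a v3) * (e v3 * f v2 - e v2 * f v3) = 0" .
        moreover have "c v3 \<noteq> 0" unfolding cv using v12 by simp
        moreover have "snd v3 \<noteq> 0" using bd[OF v3(1)] by simp
        moreover have "a v3 \<noteq> 0" unfolding a_def using dist[OF v3(1) v12(1) v3(2)] by (simp add: mult.commute)
        moreover have "e v3 * f v2 \<noteq> e v2 * f v3" using dist[OF v3(1) v12(2) v3(3)] by simp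
        ultimately show False by simp
      qed
      then show ?thesis using deg len[OF LT cY] rel[OF finL] van
        by (intro exI[of _ "G1 L c"] exI[of _ "G2 L c"]) auto
    qed
  qed
qed

text \<open>
  For \<open>k = 2\<close> the form attached to an interval may be the cube of a linear form. Its points lie on
  few parallel lines and can be too many for a single interval; they are counted over all intervals
  at once.
\<close>
definition line_point :: "int \<Rightarrow> (int \<times> int \<Rightarrow> int) \<Rightarrow> real \<Rightarrow> real \<Rightarrow> int \<times> int \<Rightarrow> bool" where
  "line_point h e D J v \<longleftrightarrow> (\<exists>m1 m2 j. coprime m1 m2 \<and> 0 < m2 \<and> real_of_int m2 \<le> D \<and> j \<noteq> 0 \<and> \<bar>real_of_int j\<bar> \<le> J \<and>
     m2 * fst v - m1 * snd v = j \<and> e v * j ^ 3 = h * m2 ^ 2 * (m2 * fst v - 3 * m1 * snd v))"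

section \<open>Elimination, and points on the level sets of a form\<close>

lemma hom_eval_bezout:
  assumes "U * H1 + V * H2 = [:R:]" "degree H1 \<le> b" "degree H2 \<le> b" "y \<noteq> 0"
  obtains N u v where "R * y ^ N = u * hom_eval b H1 x y + v * hom_eval b H2 x y"
proof -
  \<comment> \<open>Any bound for the degrees of the cofactors will do, since the identity matters
    only up to powers of \<open>y\<close>, which at the points is a prime.\<close>
  define d where "d = max (degree U) (degree V)"
  have "R * y ^ (d + b) = hom_eval (d + b) (U * H1 + V * H2) x y" unfolding assms(1) hom_eval_const ..
  also have "\<dots> = hom_eval d U x y * hom_eval b H1 x y + hom_eval d V x y * hom_eval b H2 x y"
    unfolding hom_eval_add using assms by (simp add: hom_eval_mult d_def)
  finally show ?thesis by (rule that)
qed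

lemma hom_eval_combined:
  assumes "degree H1 \<le> b"
  shows "hom_eval (k + b) (monom 1 k * H2 + H1) x y = x ^ k * hom_eval b H2 x y + y ^ k * hom_eval b H1 x y"
proof -
  have p: "hom_eval (k + b) H1 x y = y ^ k * hom_eval b H1 x y"
    using hom_eval_pad[OF assms, of k x y] by (simp only: add.commute)
  show ?thesis by (simp only: hom_eval_add hom_eval_monom_mult p)
qed

text \<open>Cramer's rule for the two linear equations in \<open>e\<close> and \<open>f\<close>; the
  combined form \<open>x ^ k * hom_eval b H2 x y + y ^ k * hom_eval b H1 x y\<close> is their
  determinant.\<close>

lemma combined_form_times:
  fixes e f h :: int
  assumes "degree H1 \<le> b" "e * hom_eval b H1 x y + f * hom_eval b H2 x y = 0" "e * x ^ k - f * y ^ k = h"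
  shows "hom_eval (k + b) (monom 1 k * H2 + H1) x y * e = h * hom_eval b H2 x y"
    "hom_eval (k + b) (monom 1 k * H2 + H1) x y * f = - (h * hom_eval b H1 x y)"
proof -
  define p q where "p = hom_eval b H1 x y" "q = hom_eval b H2 x y"
  have r: "e * p = - (f * q)" using assms(2) unfolding p_q_def by simp
  have "(x ^ k * q + y ^ k * p) * e = x ^ k * q * e + y ^ k * (e * p)" by (simp add: algebra_simps)
  also have "\<dots> = h * q" unfolding r assms(3)[symmetric] by (simp add: algebra_simps)
  finally show "hom_eval (k + b) (monom 1 k * H2 + H1) x y * e = h * hom_eval b H2 x y"
    unfolding hom_eval_combined[OF assms(1)] p_q_def .
  have "(x ^ k * q + y ^ k * p) * f = x ^ k * (f * q) + y ^ k * p * f" by (simp add: algebra_simps)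
  also have "\<dots> = x ^ k * (- (e * p)) + y ^ k * p * f" unfolding r by simp
  also have "\<dots> = - (h * p)" unfolding assms(3)[symmetric] by (simp add: algebra_simps)
  finally show "hom_eval (k + b) (monom 1 k * H2 + H1) x y * f = - (h * hom_eval b H1 x y)"
    unfolding hom_eval_combined[OF assms(1)] p_q_def .
qed

text \<open>As \<open>b < k\<close>, the terms of \<open>H1\<close> lie below those of
  \<open>monom 1 k * H2\<close>, and no two coefficients mix.\<close>

lemma degree_combined:
  fixes H1 H2 :: "int poly"
  assumes "H2 \<noteq> 0" "degree H1 \<le> b" "b < k"
  shows "degree (monom 1 k * H2 + H1) = k + degree H2"
    "lead_coeff (monom 1 k * H2 + H1) = lead_coeff H2"
    "coeff (monom 1 k * H2 + H1) j = (if k \<le> j then coeff H2 (j - k) else coeff H1 j)"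
proof -
  have d: "degree (monom 1 k * H2) = k + degree H2" using assms(1) by (simp add: degree_mult_eq degree_monom_eq)
  then show D: "degree (monom 1 k * H2 + H1) = k + degree H2" using assms by (subst degree_add_eq_left) auto
  show C: "coeff (monom 1 k * H2 + H1) j = (if k \<le> j then coeff H2 (j - k) else coeff H1 j)" for j
    using assms by (auto simp: coeff_monom_mult coeff_eq_0)
  show "lead_coeff (monom 1 k * H2 + H1) = lead_coeff H2" unfolding D C by simp
qed

text \<open>Two points of the line differ by an integer multiple \<open>t\<close> of
  \<open>(m1, m2)\<close>, and their ratios then differ by \<open>t * j / (y * y')\<close> up to
  sign. A large \<open>j\<close> therefore lets only few points into a short interval.\<close>

lemma card_points_on_line:
  fixes m1 m2 j :: int and V :: "(int \<times> int) set"
  assumes fin: "finite V" and m: "coprime m1 m2" "m2 > 0" and D: "D > 0" and \<Lambda>: "\<Lambda> > 0" and J: "J > 0"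
    and j: "\<bar>real_of_int j\<bar> > J" and line: "\<And>v. v \<in> V \<Longrightarrow> m2 * fst v - m1 * snd v = j"
    and bd: "\<And>v. v \<in> V \<Longrightarrow> D < real_of_int (snd v) \<and> real_of_int (snd v) \<le> 2 * D \<and> a \<le> real_of_int (fst v) / real_of_int (snd v)
      \<and> real_of_int (fst v) / real_of_int (snd v) \<le> a + \<Lambda>"
  shows "real (card V) \<le> 1 + 8 * (D\<^sup>2 * \<Lambda>) / J"
proof (cases "V = {}")
  case True
  then show ?thesis using D \<Lambda> J by simp
next
  case False
  then obtain w where w: "w \<in> V" by auto
  define T where "T = 4 * (D\<^sup>2 * \<Lambda>) / J"
  have ex: "\<exists>t. fst v = fst w + t * m1 \<and> snd v = snd w + t * m2 \<and> \<bar>real_of_int t\<bar> \<le> T" if v: "v \<in> V" for v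
  proof -
    have e: "m2 * (fst v - fst w) = m1 * (snd v - snd w)" using line[OF v] line[OF w] by (simp add: algebra_simps)
    then have "m2 dvd m1 * (snd v - snd w)" by (metis dvd_triv_left)
    then have "m2 dvd snd v - snd w" using m(1) by (metis coprime_commute coprime_dvd_mult_right_iff)
    then obtain t where t: "snd v - snd w = m2 * t" by (auto elim: dvdE)
    then have "m2 * (fst v - fst w) = m2 * (m1 * t)" using e by (simp add: algebra_simps)
    then have t2: "fst v - fst w = m1 * t" using m(2) by simp
    define x y x' y' where "x = real_of_int (fst v)" "y = real_of_int (snd v)" "x' = real_of_int (fst w)" "y' = real_of_int (snd w)"
    note xy = x_y_x'_y'_def
    have b: "D < y" "y \<le> 2 * D" "D < y'" "y' \<le> 2 * D" "\<bar>x / y - x' / y'\<bar> \<le> \<Lambda>" using bd[OF v] bd[OF w] unfolding xy by auto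
    have "fst v * snd w - fst w * snd v = - t * (m2 * fst w - m1 * snd w)"
    proof -
      have "fst v = fst w + m1 * t" "snd v = snd w + m2 * t" using t t2 by auto
      then show ?thesis by (simp add: algebra_simps)
    qed
    then have "fst v * snd w - fst w * snd v = - t * j" unfolding line[OF w] .
    then have "x * y' - x' * y = - real_of_int t * real_of_int j" unfolding xy by (metis of_int_diff of_int_minus of_int_mult)
    moreover have "x / y - x' / y' = (x * y' - x' * y) / (y * y')" using b D by (intro diff_frac_eq) auto
    ultimately have "x / y - x' / y' = (- real_of_int t * real_of_int j) / (y * y')" by simp
    then have "\<bar>real_of_int t\<bar> * \<bar>real_of_int j\<bar> / (y * y') \<le> \<Lambda>" using b D by (simp add: abs_mult abs_divide)
    then have "\<bar>real_of_int t\<bar> * \<bar>real_of_int j\<bar> \<le> \<Lambda> * (y * y')" using b D by (simp add: field_simps)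
    also have "\<dots> \<le> \<Lambda> * ((2 * D) * (2 * D))" using b D \<Lambda> by (intro mult_left_mono mult_mono) auto
    finally have "\<bar>real_of_int t\<bar> * \<bar>real_of_int j\<bar> \<le> 4 * (D\<^sup>2 * \<Lambda>)" by (simp add: power2_eq_square algebra_simps)
    moreover have "\<bar>real_of_int t\<bar> * J \<le> \<bar>real_of_int t\<bar> * \<bar>real_of_int j\<bar>" using j by (intro mult_left_mono) auto
    ultimately have "\<bar>real_of_int t\<bar> \<le> T" unfolding T_def using J by (simp add: field_simps)
    then show ?thesis using t t2 by (intro exI[of _ t]) (simp add: algebra_simps)
  qed
  then obtain t where t: "\<And>v. v \<in> V \<Longrightarrow> fst v = fst w + t v * m1 \<and> snd v = snd w + t v * m2 \<and> \<bar>real_of_int (t v)\<bar> \<le> T" by metis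
  have inj: "inj_on t V" by (rule inj_onI) (use t in \<open>metis prod_eqI\<close>)
  have "t ` V \<subseteq> {-\<lfloor>T\<rfloor>..\<lfloor>T\<rfloor>}"
  proof
    fix z assume "z \<in> t ` V"
    then have "\<bar>real_of_int z\<bar> \<le> T" using t by auto
    then have "z \<le> \<lfloor>T\<rfloor>" "- z \<le> \<lfloor>T\<rfloor>" by (simp_all add: le_floor_iff)
    then show "z \<in> {-\<lfloor>T\<rfloor>..\<lfloor>T\<rfloor>}" by auto
  qed
  then have "card V \<le> card {-\<lfloor>T\<rfloor>..\<lfloor>T\<rfloor>}" using card_image[OF inj] card_mono[of "{-\<lfloor>T\<rfloor>..\<lfloor>T\<rfloor>}" "t ` V"] by simp
  also have "card {-\<lfloor>T\<rfloor>..\<lfloor>T\<rfloor>} = nat (2 * \<lfloor>T\<rfloor> + 1)" by simp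
  finally have "card V \<le> nat (2 * \<lfloor>T\<rfloor> + 1)" .
  moreover have "T \<ge> 0" unfolding T_def using D \<Lambda> J by simp
  ultimately have "real (card V) \<le> 2 * T + 1" by linarith
  then show ?thesis unfolding T_def by simp
qed

text \<open>The level set of \<open>F = monom 1 k * H2 + H1\<close> is a curve covered by
  \<open>card_integer_points_on_curve\<close>, unless \<open>F\<close> is a multiple of the
  \<open>n\<close>-th power of a linear polynomial. Such a power with nonzero root has no vanishing
  coefficient, whereas \<open>F\<close> has no terms of degree strictly between \<open>b\<close> and
  \<open>k\<close>. So \<open>k = 2\<close> and \<open>b = 1\<close> remain: for
  \<open>n = 2\<close> a divisibility argument works, and for \<open>n = 3\<close> the level set is
  a line, which has few points if \<open>j\<close> is large and consists of
  \<open>line_point\<close>s otherwise.\<close>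

lemma card_fibre_le:
  fixes e f :: "int \<times> int \<Rightarrow> int" and V :: "(int \<times> int) set" and H1 H2 :: "int poly" and \<tau> :: real
  assumes bk: "b < k" "b + 2 \<le> k \<or> k = 2 \<and> b = 1"
    and H: "degree H1 \<le> b" "degree H2 \<le> b" "H2 \<noteq> 0" "U * H1 + U' * H2 = [:R:]" "R \<noteq> 0"
    and fin: "finite V" and h: "h \<noteq> 0" and c: "c \<noteq> 0" and D: "D > 0" and \<Lambda>: "\<Lambda> > 0" and J: "J > 0"
    and \<tau>0: "\<tau> \<ge> 0" and \<tau>: "\<And>z. z \<noteq> 0 \<Longrightarrow> \<bar>z\<bar> \<le> \<bar>h\<bar> * poly_length H1 * poly_length H2 \<Longrightarrow> finite {d::int. d dvd z} \<and> real (card {d. d dvd z}) \<le> \<tau>"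
    and V: "\<And>v. v \<in> V \<Longrightarrow> prime (fst v) \<and> prime (snd v) \<and> fst v \<noteq> snd v \<and> e v \<noteq> 0 \<and> f v \<noteq> 0 \<and>
       D < real_of_int (snd v) \<and> real_of_int (snd v) \<le> 2 * D \<and> a \<le> real_of_int (fst v) / real_of_int (snd v)
      \<and> real_of_int (fst v) / real_of_int (snd v) \<le> a + \<Lambda> \<and> e v * fst v ^ k - f v * snd v ^ k = h \<and>
      e v * hom_eval b H1 (fst v) (snd v) + f v * hom_eval b H2 (fst v) (snd v) = 0 \<and>
      hom_eval (k + degree H2) (monom 1 k * H2 + H1) (fst v) (snd v) = c"
    and inj: "inj_on snd V"
  shows "real (card {v\<in>V. \<not> (k = 2 \<and> line_point h e D J v)}) \<le>
     34 * real k * (1 + (D\<^sup>2 * \<Lambda>) powr (1 / 3)) + \<tau> + 1 + 8 * (D\<^sup>2 * \<Lambda>) / J"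
proof -
  define F where "F = monom 1 k * H2 + H1"
  define n where "n = k + degree H2"
  have dF: "degree F = n" "lead_coeff F = lead_coeff H2" and cF: "\<And>j. coeff F j = (if k \<le> j then coeff H2 (j - k) else coeff H1 j)"
    unfolding F_def n_def using degree_combined[OF H(3,1) bk(1)] by auto
  have Fn: "coeff F n \<noteq> 0" using dF H(3) by (metis leading_coeff_0_iff)
  define fR where "fR = map_poly real_of_int F"
  have cfR: "coeff fR j = real_of_int (coeff F j)" for j unfolding fR_def by (simp add: coeff_map_poly)
  have dfR: "degree fR = n" unfolding fR_def dF(1)[symmetric] by (rule degree_map_poly) auto
  have n1: "n \<ge> 1" "n \<le> 2 * k - 1" unfolding n_def using bk H(2) by auto
  have sub: "card {v\<in>V. \<not> (k = 2 \<and> line_point h e D J v)} \<le> card V" using fin by (intro card_mono) auto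
  have t1: "34 * real k * (1 + (D\<^sup>2 * \<Lambda>) powr (1 / 3)) \<ge> 0" by simp
  have t2: "8 * (D\<^sup>2 * \<Lambda>) / J \<ge> 0" using D \<Lambda> J by simp
  have Vp: "prime (fst v)" "prime (snd v)" "fst v \<noteq> snd v" "D < real_of_int (snd v)" "real_of_int (snd v) \<le> 2 * D"
      "e v * fst v ^ k - f v * snd v ^ k = h"
      "e v * hom_eval b H1 (fst v) (snd v) + f v * hom_eval b H2 (fst v) (snd v) = 0"
      "hom_eval n F (fst v) (snd v) = c" "f v \<noteq> 0"
    if "v \<in> V" for v using V[OF that] unfolding F_def n_def by blast+
  have y0: "snd v \<noteq> 0" if "v \<in> V" for v using Vp(2)[OF that] by auto
  have bez: "\<not> (hom_eval b H1 (fst v) (snd v) = 0 \<and> hom_eval b H2 (fst v) (snd v) = 0)" if vV: "v \<in> V" for v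
  proof
    assume z: "hom_eval b H1 (fst v) (snd v) = 0 \<and> hom_eval b H2 (fst v) (snd v) = 0"
    obtain N u w where "R * snd v ^ N = u * hom_eval b H1 (fst v) (snd v) + w * hom_eval b H2 (fst v) (snd v)"
      by (rule hom_eval_bezout[OF H(4,1,2) y0[OF vV]])
    then show False using z H(5) y0[OF vV] by simp
  qed
  show ?thesis
  proof (cases "\<forall>p q. p \<noteq> 0 \<longrightarrow> smult (real n * p) fR \<noteq> [:q, p:] * pderiv fR")
    case True
    have "real (card V) \<le> 17 * (real n + 1) * (1 + (D\<^sup>2 * \<Lambda>) powr (1 / 3))"
    proof (rule card_integer_points_on_curve[OF dfR n1(1) _ fin D \<Lambda>])
      show "real_of_int c \<noteq> 0" using c by simp
      fix x y assume xy: "(x, y) \<in> V"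
      show "D < real_of_int y \<and> real_of_int y \<le> 2 * D \<and> real_of_int y ^ n * poly fR (real_of_int x / real_of_int y) = real_of_int c \<and>
        a \<le> real_of_int x / real_of_int y \<and> real_of_int x / real_of_int y \<le> a + \<Lambda>"
        using V[OF xy] y0[OF xy] real_hom_eval[of F n y x] dF unfolding fR_def F_def n_def by auto
    qed (use True in auto)
    also have "\<dots> \<le> 17 * (2 * real k) * (1 + (D\<^sup>2 * \<Lambda>) powr (1 / 3))"
    proof -
      have "real n + 1 \<le> 2 * real k" using n1 by linarith
      then show ?thesis by (intro mult_right_mono mult_left_mono) auto
    qed
    finally show ?thesis using sub t2 \<tau>0 by simp
  next
    case False
    then obtain p q where p: "p \<noteq> 0" and pq: "smult (real n * p) fR = [:q, p:] * pderiv fR" by auto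
    \<comment> \<open>Comparison of coefficients in the differential equation
      \<open>n * p * F = (q + p * X) * F'\<close>. For \<open>q \<noteq> 0\<close> it propagates
      nonvanishing from the leading coefficient downwards.\<close>
    have rec: "p * (real n - real j) * real_of_int (coeff F j) = q * (real j + 1) * real_of_int (coeff F (Suc j))" for j
    proof -
      have "coeff (smult (real n * p) fR) j = coeff ([:q, p:] * pderiv fR) j" unfolding pq ..
      then show ?thesis by (cases j) (simp_all add: coeff_pderiv cfR algebra_simps)
    qed
    show ?thesis
    proof (cases "V = {}")
      case True
      then show ?thesis using t1 t2 \<tau>0 by simp
    next
      case Vne: False
      then obtain v0 where v0: "v0 \<in> V" by auto
      \<comment> \<open>Otherwise \<open>F\<close> is a monomial and \<open>H1 = 0\<close>; as
        \<open>f v \<noteq> 0\<close>, the linear relation makes \<open>H2\<close> vanish at the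
        points, against the Bezout identity.\<close>
      have q: "q \<noteq> 0"
      proof
        assume "q = 0"
        then have z: "coeff F j = 0" if "j < n" for j using rec[of j] p that by simp
        have "H1 = 0"
        proof (rule poly_eqI)
          fix j
          show "coeff H1 j = coeff 0 j"
          proof (cases "j \<le> b")
            case True
            then show ?thesis using z[of j] cF[of j] bk unfolding n_def by auto
          next
            case False
            then show ?thesis using H(1) by (simp add: coeff_eq_0)
          qed
        qed
        then have h1: "hom_eval b H1 (fst v0) (snd v0) = 0" by (simp add: hom_eval_def)
        then have "hom_eval b H2 (fst v0) (snd v0) = 0" using Vp(7,9)[OF v0] by simp
        then show False using bez[OF v0] h1 by simp
      qed
      have nz: "coeff F (n - i) \<noteq> 0" if "i \<le> n" for i
        using that
      proof (induction i)
        case 0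
        then show ?case using Fn by simp
      next
        case (Suc i)
        then have "coeff F (Suc (n - Suc i)) \<noteq> 0" by (simp add: Suc_diff_Suc)
        then have "q * (real (n - Suc i) + 1) * real_of_int (coeff F (Suc (n - Suc i))) \<noteq> 0" using q by simp
        then show ?case using rec[of "n - Suc i"] by auto
      qed
      have nz': "coeff F j \<noteq> 0" if "j \<le> n" for j using nz[of "n - j"] that by simp
      have k2: "k = 2" "b = 1"
      proof -
        have "\<not> b + 2 \<le> k"
        proof
          assume "b + 2 \<le> k"
          then have "coeff F (b + 1) = 0" using cF[of "b + 1"] H(1) by (simp add: coeff_eq_0)
          then show False using nz'[of "b + 1"] \<open>b + 2 \<le> k\<close> unfolding n_def by simp
        qed
        then show "k = 2" "b = 1" using bk by auto
      qed
      have hom1: "hom_eval b P x y = coeff P 0 * y + coeff P 1 * x" for P x y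
        unfolding hom_eval_def k2 by simp
      have rel: "e v * (coeff H1 0 * snd v + coeff H1 1 * fst v) + f v * (coeff H2 0 * snd v + coeff H2 1 * fst v) = 0"
        and Fe: "hom_eval 3 F (fst v) (snd v) * e v = h * (coeff H2 0 * snd v + coeff H2 1 * fst v)" if v: "v \<in> V" for v
      proof -
        show "e v * (coeff H1 0 * snd v + coeff H1 1 * fst v) + f v * (coeff H2 0 * snd v + coeff H2 1 * fst v) = 0"
          using Vp(7)[OF v] unfolding hom1 .
        have "hom_eval (k + b) F (fst v) (snd v) * e v = h * hom_eval b H2 (fst v) (snd v)"
          unfolding F_def by (rule combined_form_times(1)[OF H(1) Vp(7,6)[OF v]])
        then show "hom_eval 3 F (fst v) (snd v) * e v = h * (coeff H2 0 * snd v + coeff H2 1 * fst v)"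
          unfolding hom1 unfolding k2 by simp
      qed
      have F01: "coeff F 0 = coeff H1 0" "coeff F 1 = coeff H1 1" "coeff F 2 = coeff H2 0" "coeff F 3 = coeff H2 1"
        unfolding cF k2 by auto
      have "degree H2 = 0 \<or> degree H2 = 1" using H(2) k2 by auto
      then show ?thesis
      proof
        assume d0: "degree H2 = 0"
        then have n2: "n = 2" unfolding n_def k2 by simp
        have H21: "coeff H2 1 = 0" using d0 by (simp add: coeff_eq_0)
        \<comment> \<open>With \<open>H2\<close> constant, \<open>c * e v\<close> is the fixed
          integer \<open>h * coeff H2 0\<close>, and the linear relation modulo the prime
          \<open>snd v\<close> gives \<open>snd v dvd e v * coeff H1 1\<close>. So
          \<open>snd v\<close> divides \<open>z\<close>, and \<open>snd\<close> is injective on the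
          fibre.\<close>
        define z where "z = h * coeff H2 0 * coeff H1 1"
        have z0: "z \<noteq> 0" unfolding z_def using h nz'[of 2] nz'[of 1] n2 F01 by auto
        have "\<bar>z\<bar> = \<bar>h\<bar> * (\<bar>coeff H1 1\<bar> * \<bar>coeff H2 0\<bar>)" unfolding z_def by (simp add: abs_mult ac_simps)
        also have "\<dots> \<le> \<bar>h\<bar> * (poly_length H1 * poly_length H2)"
          by (intro mult_left_mono mult_mono abs_coeff_le_poly_length poly_length_nonneg) auto
        finally have zb: "\<bar>z\<bar> \<le> \<bar>h\<bar> * poly_length H1 * poly_length H2" by simp
        have "snd v dvd z" if v: "v \<in> V" for v
        proof -
          have "hom_eval 3 F (fst v) (snd v) = snd v * c"
            using hom_eval_pad[of F 2 1 "fst v" "snd v"] dF(1) Vp(8)[OF v] unfolding n2 by simp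
          then have "snd v * (c * e v) = snd v * (h * coeff H2 0)" using Fe[OF v] H21 by (simp add: algebra_simps)
          then have ce: "c * e v = h * coeff H2 0" using y0[OF v] by simp
          have "e v * coeff H1 1 * fst v = snd v * (- (e v * coeff H1 0) - f v * coeff H2 0)"
            using rel[OF v] H21 by (simp add: algebra_simps)
          then have "snd v dvd e v * coeff H1 1 * fst v" by simp
          moreover have "\<not> snd v dvd fst v" using primes_dvd_imp_eq[OF Vp(2,1)[OF v]] Vp(3)[OF v] by auto
          ultimately have "snd v dvd e v * coeff H1 1" using prime_dvd_multD[OF Vp(2)[OF v]] by blast
          then have "snd v dvd c * (e v * coeff H1 1)" by simp
          also have "c * (e v * coeff H1 1) = z" unfolding z_def ce[symmetric] by simp
          finally show ?thesis .
        qed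
        then have "snd ` V \<subseteq> {d. d dvd z}" by auto
        then have "card (snd ` V) \<le> card {d. d dvd z}" using \<tau>[OF z0 zb] by (intro card_mono) auto
        then have "card V \<le> card {d. d dvd z}" by (simp only: card_image[OF inj])
        then have "real (card V) \<le> \<tau>" using \<tau>[OF z0 zb] by linarith
        then show ?thesis using sub t1 t2 by linarith
      next
        assume d1: "degree H2 = 1"
        then have n3: "n = 3" unfolding n_def k2 by simp
        define F3 where "F3 = coeff F 3"
        have F3: "F3 \<noteq> 0" unfolding F3_def using nz'[of 3] n3 by simp
        define \<theta> where "\<theta> = q / p"
        have e2: "p * real_of_int (coeff F 2) = 3 * q * real_of_int F3"
          using rec[of 2] unfolding n3 F3_def by simp
        have e1: "p * real_of_int (coeff F 1) = q * real_of_int (coeff F 2)"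
          using rec[of 1] unfolding n3 by (simp add: numeral_2_eq_2)
        have e0: "3 * p * real_of_int (coeff F 0) = q * real_of_int (coeff F 1)"
          using rec[of 0] unfolding n3 by simp
        have r2: "real_of_int (coeff F 2) = 3 * \<theta> * real_of_int F3"
          using e2 p unfolding \<theta>_def by (simp add: field_simps)
        have "real_of_int (coeff F 1) = \<theta> * real_of_int (coeff F 2)"
          using e1 p unfolding \<theta>_def by (simp add: field_simps)
        then have r1: "real_of_int (coeff F 1) = 3 * \<theta>\<^sup>2 * real_of_int F3"
          unfolding r2 by (simp add: power2_eq_square)
        have "real_of_int (coeff F 0) = \<theta> * real_of_int (coeff F 1) / 3"
          using e0 p unfolding \<theta>_def by (simp add: field_simps)
        then have r0: "real_of_int (coeff F 0) = \<theta> ^ 3 * real_of_int F3"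
          unfolding r1 by (simp add: power2_eq_square power3_eq_cube)
        have "- \<theta> \<in> \<rat>"
        proof -
          have "- \<theta> = - (real_of_int (coeff F 2) / (3 * real_of_int F3))" using r2 F3 by simp
          moreover have "- (real_of_int (coeff F 2) / (3 * real_of_int F3)) \<in> \<rat>" by simp
          ultimately show ?thesis by (simp only:)
        qed
        \<comment> \<open>\<open>F\<close> is \<open>F3\<close> times the cube of
          \<open>X + \<theta>\<close>. Its root is rational because \<open>3 * \<theta> * F3\<close>
          is a coefficient of \<open>F\<close>.\<close>
        then obtain m1 m2 where m: "m2 > 0" "coprime m1 m2" "- \<theta> = real_of_int m1 / real_of_int m2"
          by (rule Rats_cases')
        have th: "\<theta> * real_of_int m2 = - real_of_int m1" using m(1,3) by (simp add: field_simps)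
        have h3: "hom_eval 3 F x y = coeff F 0 * y ^ 3 + coeff F 1 * (x * y ^ 2) + coeff F 2 * (x ^ 2 * y) + F3 * x ^ 3" for x y
          unfolding hom_eval_def F3_def by (simp add: numeral_3_eq_3 numeral_2_eq_2)
        have cub: "F3 * (m2 * fst v - m1 * snd v) ^ 3 = m2 ^ 3 * c" if v: "v \<in> V" for v
        proof -
          define x y where "x = real_of_int (fst v)" "y = real_of_int (snd v)"
          have cc: "hom_eval 3 F (fst v) (snd v) = c" using Vp(8)[OF v] unfolding n3 .
          have hc: "c = coeff F 0 * snd v ^ 3 + coeff F 1 * (fst v * snd v ^ 2) + coeff F 2 * (fst v ^ 2 * snd v) + F3 * fst v ^ 3"
            unfolding cc[symmetric] by (rule h3)
          have "real_of_int c = real_of_int (coeff F 0) * y ^ 3 + real_of_int (coeff F 1) * (x * y ^ 2)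
              + real_of_int (coeff F 2) * (x ^ 2 * y) + real_of_int F3 * x ^ 3"
            unfolding hc x_y_def of_int_add of_int_mult of_int_power ..
          also have "\<dots> = real_of_int F3 * (x + \<theta> * y) ^ 3"
            unfolding r0 r1 r2 by (simp add: power2_eq_square power3_eq_cube algebra_simps)
          finally have "real_of_int c = real_of_int F3 * (x + \<theta> * y) ^ 3" .
          then have "real_of_int (m2 ^ 3 * c) = real_of_int F3 * (real_of_int m2 * (x + \<theta> * y)) ^ 3"
            by (simp add: power_mult_distrib)
          also have "real_of_int m2 * (x + \<theta> * y) = real_of_int m2 * x + (\<theta> * real_of_int m2) * y" by (simp add: algebra_simps)
          also have "\<dots> = real_of_int (m2 * fst v - m1 * snd v)" unfolding th x_y_def by simp
          finally have "real_of_int (m2 ^ 3 * c) = real_of_int (F3 * (m2 * fst v - m1 * snd v) ^ 3)" by simp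
          then show ?thesis by (simp only: of_int_eq_iff)
        qed
        \<comment> \<open>Cubing is injective on the reals, so the whole fibre lies on one line
          \<open>m2 * x - m1 * y = j\<close>.\<close>
        define j where "j = m2 * fst v0 - m1 * snd v0"
        have jv: "m2 * fst v - m1 * snd v = j" if v: "v \<in> V" for v
        proof -
          have "F3 * (m2 * fst v - m1 * snd v) ^ 3 = F3 * j ^ 3" using cub[OF v] cub[OF v0] unfolding j_def by simp
          then have "(m2 * fst v - m1 * snd v) ^ 3 = j ^ 3" using F3 by simp
          then have "real_of_int ((m2 * fst v - m1 * snd v) ^ 3) = real_of_int (j ^ 3)" by (simp only:)
          then have "root 3 (real_of_int (m2 * fst v - m1 * snd v) ^ 3) = root 3 (real_of_int j ^ 3)"
            by (simp only: of_int_power)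
          moreover have "root 3 (z ^ 3) = z" for z by (rule odd_real_root_power_cancel) simp
          ultimately have "real_of_int (m2 * fst v - m1 * snd v) = real_of_int j" by (simp only:)
          then show ?thesis by (simp only: of_int_eq_iff)
        qed
        have j0: "j \<noteq> 0" using cub[OF v0] c m(1) unfolding j_def by auto
        show ?thesis
        proof (cases "\<bar>real_of_int j\<bar> > J")
          case True
          have "real (card V) \<le> 1 + 8 * (D\<^sup>2 * \<Lambda>) / J"
            by (rule card_points_on_line[OF fin m(2,1) D \<Lambda> J True jv]) (use V in auto)
          then show ?thesis using sub t1 \<tau>0 by linarith
        next
          case False
          show ?thesis
          proof (cases "card V \<le> 1")
            case True
            then show ?thesis using sub t1 t2 \<tau>0 by linarith
          next
            case False
            \<comment> \<open>The second point is what bounds \<open>m2\<close> by \<open>D\<close>: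
              \<open>m2\<close> divides the nonzero difference of two second coordinates, both
              between \<open>D\<close> and \<open>2 * D\<close>.\<close>
            then obtain v w where vw: "v \<in> V" "w \<in> V" "v \<noteq> w"
              using card_le_Suc0_iff_eq[OF fin] by auto
            have e: "m2 * (fst v - fst w) = m1 * (snd v - snd w)" using jv[OF vw(1)] jv[OF vw(2)] by (simp add: algebra_simps)
            then have "m2 dvd m1 * (snd v - snd w)" by (metis dvd_triv_left)
            then have dv: "m2 dvd snd v - snd w" using m(2) by (metis coprime_commute coprime_dvd_mult_right_iff)
            have "snd v - snd w \<noteq> 0" using inj vw by (auto dest: inj_onD)
            then have "m2 \<le> \<bar>snd v - snd w\<bar>" using dvd_imp_le_int[of "snd v - snd w" m2] dv m(1) by simp
            then have "real_of_int m2 \<le> real_of_int \<bar>snd v - snd w\<bar>" by (simp only: of_int_le_iff)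
            also have "\<dots> \<le> D" using Vp(4,5)[OF vw(1)] Vp(4,5)[OF vw(2)] by linarith
            finally have m2D: "real_of_int m2 \<le> D" .
            have "line_point h e D J v" if v: "v \<in> V" for v
            proof -
              have cc: "hom_eval 3 F (fst v) (snd v) = c" using Vp(8)[OF v] unfolding n3 .
              have "real_of_int (m2 * coeff F 2) = 3 * (\<theta> * real_of_int m2) * real_of_int F3" using r2 by simp
              also have "\<dots> = real_of_int (- 3 * m1 * F3)" unfolding th by simp
              finally have mF: "m2 * coeff F 2 = - 3 * m1 * F3" by (simp only: of_int_eq_iff)
              have "F3 * (e v * j ^ 3) = e v * (m2 ^ 3 * c)" using cub[OF v] unfolding jv[OF v] by (simp add: algebra_simps)
              also have "\<dots> = m2 ^ 3 * (c * e v)" by (simp only: ac_simps)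
              also have "c * e v = h * (coeff F 2 * snd v + F3 * fst v)" using Fe[OF v] unfolding cc F01[symmetric] F3_def .
              also have "m2 ^ 3 * (h * (coeff F 2 * snd v + F3 * fst v)) = m2 ^ 2 * (h * ((m2 * coeff F 2) * snd v + m2 * F3 * fst v))" by (simp add: power2_eq_square power3_eq_cube algebra_simps)
              also have "\<dots> = F3 * (h * m2 ^ 2 * (m2 * fst v - 3 * m1 * snd v))" unfolding mF by (simp add: algebra_simps)
              finally have "e v * j ^ 3 = h * m2 ^ 2 * (m2 * fst v - 3 * m1 * snd v)" using F3 by simp
              then show ?thesis unfolding line_point_def using m m2D j0 \<open>\<not> \<bar>real_of_int j\<bar> > J\<close> jv[OF v] by (intro exI[of _ m1] exI[of _ m2] exI[of _ j]) auto
            qed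
            then have "{v\<in>V. \<not> (k = 2 \<and> line_point h e D J v)} = {}" using k2 by auto
            then have c0: "card {v\<in>V. \<not> (k = 2 \<and> line_point h e D J v)} = 0" by (simp only: card.empty)
            show ?thesis unfolding c0 using t1 t2 \<tau>0 by linarith
          qed
        qed
      qed
    qed
  qed
qed

text \<open>The relation given by \<open>vanishing_form\<close> is freed from the common factor of
  \<open>G1\<close> and \<open>G2\<close>. Outside a few points the value of the combined form then
  divides \<open>R * h\<close>, so the divisor bound leaves of order
  \<open>X powr (\<epsilon> / 2)\<close> level sets; the other half of the exponent pays for the
  divisor counts within each of them.\<close>

lemma card_interval_le:
  fixes k b :: nat and h :: int and \<epsilon> :: real
  assumes b: "1 \<le> b" and bk: "b < k" "b + 2 \<le> k \<or> k = 2 \<and> b = 1" and h: "h \<noteq> 0" and \<epsilon>: "\<epsilon> > 0"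
  obtains C :: real where "C > 0"
    "\<And>T e f X D a \<Lambda> J. finite T \<Longrightarrow> X \<ge> 2 \<Longrightarrow> D > 0 \<Longrightarrow> \<Lambda> > 0 \<Longrightarrow> J > 0 \<Longrightarrow>
      (\<And>v. v \<in> T \<Longrightarrow> prime (fst v) \<and> prime (snd v) \<and> fst v \<noteq> snd v \<and> e v \<noteq> 0 \<and> f v \<noteq> 0 \<and>
        \<bar>fst v\<bar> \<le> X \<and> \<bar>snd v\<bar> \<le> X \<and> \<bar>e v\<bar> \<le> X \<and> \<bar>f v\<bar> \<le> X \<and>
        D < real_of_int (snd v) \<and> real_of_int (snd v) \<le> 2 * D \<and> a \<le> real_of_int (fst v) / real_of_int (snd v)
        \<and> real_of_int (fst v) / real_of_int (snd v) \<le> a + \<Lambda> \<and> e v * fst v ^ k - f v * snd v ^ k = h) \<Longrightarrow>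
      (\<And>v w. v \<in> T \<Longrightarrow> w \<in> T \<Longrightarrow> v \<noteq> w \<Longrightarrow> e v * f w \<noteq> e w * f v) \<Longrightarrow>
      inj_on snd T \<Longrightarrow>
      (\<And>v1 v2 v3 v4. v1 \<in> T \<Longrightarrow> v2 \<in> T \<Longrightarrow> v3 \<in> T \<Longrightarrow> v4 \<in> T \<Longrightarrow>
       pade_pairing k b e f v1 v2 * pade_pairing k b e f v3 v4
       - pade_pairing k b e f v1 v3 * pade_pairing k b e f v2 v4
       + pade_pairing k b e f v1 v4 * pade_pairing k b e f v2 v3 = 0) \<Longrightarrow>
      real (card {v\<in>T. \<not> (k = 2 \<and> line_point h e D J v)}) \<le>
        C * real_of_int X powr \<epsilon> * (1 + (D\<^sup>2 * \<Lambda>) powr (1 / 3) + D\<^sup>2 * \<Lambda> / J)"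
proof -
  obtain W :: int where W: "W \<ge> 1" and form:
   "\<And>T e f X. finite T \<Longrightarrow> card T \<ge> 3 \<Longrightarrow> X \<ge> 1 \<Longrightarrow>
      (\<And>v. v \<in> T \<Longrightarrow> \<bar>fst v\<bar> \<le> X \<and> \<bar>snd v\<bar> \<le> X \<and> \<bar>e v\<bar> \<le> X \<and> \<bar>f v\<bar> \<le> X \<and> snd v \<noteq> 0 \<and> e v \<noteq> 0) \<Longrightarrow>
      (\<And>v w. v \<in> T \<Longrightarrow> w \<in> T \<Longrightarrow> v \<noteq> w \<Longrightarrow> e v * f w \<noteq> e w * f v \<and> fst v * snd w \<noteq> fst w * snd v) \<Longrightarrow>
      (\<And>v1 v2 v3 v4. v1 \<in> T \<Longrightarrow> v2 \<in> T \<Longrightarrow> v3 \<in> T \<Longrightarrow> v4 \<in> T \<Longrightarrow>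
       pade_pairing k b e f v1 v2 * pade_pairing k b e f v3 v4
       - pade_pairing k b e f v1 v3 * pade_pairing k b e f v2 v4
       + pade_pairing k b e f v1 v4 * pade_pairing k b e f v2 v3 = 0) \<Longrightarrow>
      \<exists>G1 G2. degree G1 \<le> b \<and> degree G2 \<le> b \<and> (G1 \<noteq> 0 \<or> G2 \<noteq> 0) \<and>
        poly_length G1 \<le> W * X ^ (3 * b + 3) \<and> poly_length G2 \<le> W * X ^ (3 * b + 3) \<and>
        (\<forall>v\<in>T. e v * hom_eval b G1 (fst v) (snd v) + f v * hom_eval b G2 (fst v) (snd v) = 0)"
    by (rule vanishing_form[OF b, of k]) blast
  obtain K where K: "\<And>f g :: int poly. \<And>M. M \<ge> 2 \<Longrightarrow> length (coeffs f) + length (coeffs g) \<le> 2 * (b + 1) \<Longrightarrow> f \<noteq> 0 \<or> g \<noteq> 0 \<Longrightarrow>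
     poly_length f \<le> M \<Longrightarrow> poly_length g \<le> M \<Longrightarrow>
     \<exists>C f' g' U V R. R \<noteq> 0 \<and> smult R f = C * f' \<and> smult R g = C * g' \<and> U * f' + V * g' = [:R:] \<and>
        \<bar>R\<bar> \<le> M ^ K \<and> poly_length f' \<le> M ^ K \<and> poly_length g' \<le> M ^ K"
    using pseudo_euclid[of "2 * (b + 1)"] by blast
  \<comment> \<open>The exponent of \<open>X\<close> in \<open>M ^ (2 * K)\<close> for
    \<open>M = W * X ^ (3 * b + 3)\<close>. Up to constant factors this is the size of the largest
    integer whose divisors are counted.\<close>
  define m where "m = (3 * b + 3) * K * 2"
  define \<epsilon>' where "\<epsilon>' = \<epsilon> / (2 * (real m + 1))"
  have \<epsilon>': "\<epsilon>' > 0" unfolding \<epsilon>'_def using \<epsilon> by simp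
  obtain C0 where C0: "C0 > 0" "\<And>n :: int. n \<noteq> 0 \<Longrightarrow> finite {d. d dvd n}"
    "\<And>n :: int. n \<noteq> 0 \<Longrightarrow> real (card {d. d dvd n}) \<le> C0 * real_of_int \<bar>n\<bar> powr \<epsilon>'"
    by (rule card_int_divisors_le[OF \<epsilon>']) blast
  define C1 where "C1 = C0 * (real_of_int (\<bar>h\<bar> * W ^ (K * 2))) powr \<epsilon>' + 1"
  have C1: "C1 \<ge> 1" unfolding C1_def using C0 by simp
  define C where "C = 3 + real b + C1 + C1 * (34 * real k + C1 + 1 + 8)"
  have "0 \<le> C1 * (34 * real k + C1 + 1 + 8)" using C1 by (intro mult_nonneg_nonneg) auto
  then have Cge: "3 + real b \<le> C" unfolding C_def using C1 by linarith
  show ?thesis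
  proof (rule that)
    show "C > 0" unfolding C_def using C1 by (intro add_pos_nonneg mult_nonneg_nonneg) auto
    fix T :: "(int \<times> int) set" and e f :: "int \<times> int \<Rightarrow> int" and X :: int and D a \<Lambda> J :: real
    assume finT: "finite T" and X: "X \<ge> 2" and D: "D > 0" and \<Lambda>: "\<Lambda> > 0" and J: "J > 0"
      and T: "\<And>v. v \<in> T \<Longrightarrow> prime (fst v) \<and> prime (snd v) \<and> fst v \<noteq> snd v \<and> e v \<noteq> 0 \<and> f v \<noteq> 0 \<and>
        \<bar>fst v\<bar> \<le> X \<and> \<bar>snd v\<bar> \<le> X \<and> \<bar>e v\<bar> \<le> X \<and> \<bar>f v\<bar> \<le> X \<and>
        D < real_of_int (snd v) \<and> real_of_int (snd v) \<le> 2 * D \<and> a \<le> real_of_int (fst v) / real_of_int (snd v)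
        \<and> real_of_int (fst v) / real_of_int (snd v) \<le> a + \<Lambda> \<and> e v * fst v ^ k - f v * snd v ^ k = h"
      and dist: "\<And>v w. v \<in> T \<Longrightarrow> w \<in> T \<Longrightarrow> v \<noteq> w \<Longrightarrow> e v * f w \<noteq> e w * f v"
      and inj: "inj_on snd T"
      and pf: "\<And>v1 v2 v3 v4. v1 \<in> T \<Longrightarrow> v2 \<in> T \<Longrightarrow> v3 \<in> T \<Longrightarrow> v4 \<in> T \<Longrightarrow>
       pade_pairing k b e f v1 v2 * pade_pairing k b e f v3 v4
       - pade_pairing k b e f v1 v3 * pade_pairing k b e f v2 v4
       + pade_pairing k b e f v1 v4 * pade_pairing k b e f v2 v3 = 0"
    have Tp: "prime (fst v)" "prime (snd v)" "fst v \<noteq> snd v" "e v \<noteq> 0" "f v \<noteq> 0"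
        "e v * fst v ^ k - f v * snd v ^ k = h" if "v \<in> T" for v using T[OF that] by blast+
    define Q where "Q = D\<^sup>2 * \<Lambda>"
    define X1 where "X1 = real_of_int X powr \<epsilon>"
    define X2 where "X2 = real_of_int X powr (\<epsilon> / 2)"
    define B where "B = 1 + Q powr (1 / 3) + Q / J"
    have X2: "X2 \<ge> 1" unfolding X2_def using X \<epsilon> by (intro ge_one_powr_ge_zero) auto
    have X12: "X1 = X2 * X2" unfolding X1_def X2_def using X by (simp add: powr_add[symmetric])
    have Q0: "Q > 0" unfolding Q_def using D \<Lambda> by simp
    have B1: "B \<ge> 1" unfolding B_def using Q0 J by simp
    have \<tau>: "finite {d::int. d dvd z} \<and> real (card {d. d dvd z}) \<le> C1 * X2" if z: "z \<noteq> 0" "\<bar>z\<bar> \<le> \<bar>h\<bar> * (W * X ^ (3 * b + 3)) ^ (K * 2)" for z :: int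
    proof -
      have "\<bar>h\<bar> * (W * X ^ (3 * b + 3)) ^ (K * 2) = (\<bar>h\<bar> * W ^ (K * 2)) * X ^ m"
        unfolding m_def by (simp add: power_mult_distrib power_mult[symmetric] mult.assoc)
      then have "real_of_int \<bar>z\<bar> \<le> real_of_int ((\<bar>h\<bar> * W ^ (K * 2)) * X ^ m)" using z(2) by linarith
      then have "real_of_int \<bar>z\<bar> powr \<epsilon>' \<le> real_of_int ((\<bar>h\<bar> * W ^ (K * 2)) * X ^ m) powr \<epsilon>'"
        using \<epsilon>' by (intro powr_mono2) auto
      also have "\<dots> = real_of_int (\<bar>h\<bar> * W ^ (K * 2)) powr \<epsilon>' * (real_of_int X ^ m) powr \<epsilon>'"
        by (simp add: powr_mult)
      also have "(real_of_int X ^ m) powr \<epsilon>' = real_of_int X powr (real m * \<epsilon>')"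
        using X by (simp add: powr_realpow[symmetric] powr_powr)
      also have "\<dots> \<le> X2" unfolding X2_def
      proof (rule powr_mono)
        show "real m * \<epsilon>' \<le> \<epsilon> / 2" unfolding \<epsilon>'_def using \<epsilon> by (simp add: field_simps)
      qed (use X in auto)
      finally have "real_of_int \<bar>z\<bar> powr \<epsilon>' \<le> real_of_int (\<bar>h\<bar> * W ^ (K * 2)) powr \<epsilon>' * X2"
        by (simp add: mult_left_mono)
      then have "C0 * real_of_int \<bar>z\<bar> powr \<epsilon>' \<le> C0 * (real_of_int (\<bar>h\<bar> * W ^ (K * 2)) powr \<epsilon>' * X2)"
        using C0(1) by (intro mult_left_mono) auto
      also have "\<dots> \<le> C1 * X2" unfolding C1_def using X2 by (simp add: algebra_simps)
      finally show ?thesis using C0(2,3)[OF z(1)] by linarith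
    qed
    define T' where "T' = {v\<in>T. \<not> (k = 2 \<and> line_point h e D J v)}"
    have T'T: "T' \<subseteq> T" unfolding T'_def by auto
    have finT': "finite T'" using T'T finT finite_subset by blast
    have "real (card T') \<le> C * X1 * B"
    proof (cases "card T \<le> 2")
      case True
      then have "card T' \<le> 2" using card_mono[OF finT T'T] by linarith
      then have "real (card T') \<le> 2 * (X1 * B)"
      proof -
        have "1 * 1 \<le> X1 * B" unfolding X12 using X2 B1 mult_mono[of 1 X2 1 X2] by (intro mult_mono) auto
        then show ?thesis using \<open>card T' \<le> 2\<close> by linarith
      qed
      also have "\<dots> \<le> C * (X1 * B)"
      proof (rule mult_right_mono)
        show "2 \<le> C" using Cge by linarith
        show "0 \<le> X1 * B" unfolding X12 using X2 B1 by (intro mult_nonneg_nonneg) auto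
      qed
      finally show ?thesis by (simp add: mult.assoc)
    next
      case False
      then have c3: "card T \<ge> 3" by linarith
      have slope: "fst v * snd w \<noteq> fst w * snd v" if vw: "v \<in> T" "w \<in> T" "v \<noteq> w" for v w
      proof
        assume eq: "fst v * snd w = fst w * snd v"
        then have "fst v dvd fst w * snd v" by (metis dvd_triv_left)
        then have "fst v dvd fst w \<or> fst v dvd snd v" using prime_dvd_multD[OF Tp(1)[OF vw(1)]] by blast
        then have "fst v = fst w" using primes_dvd_imp_eq Tp(1,2,3) vw by metis
        then have "snd v = snd w" using eq Tp(1)[OF vw(1)] by auto
        then show False using inj vw by (auto dest: inj_onD)
      qed
      have "\<exists>G1 G2. degree G1 \<le> b \<and> degree G2 \<le> b \<and> (G1 \<noteq> 0 \<or> G2 \<noteq> 0) \<and>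
        poly_length G1 \<le> W * X ^ (3 * b + 3) \<and> poly_length G2 \<le> W * X ^ (3 * b + 3) \<and>
        (\<forall>v\<in>T. e v * hom_eval b G1 (fst v) (snd v) + f v * hom_eval b G2 (fst v) (snd v) = 0)"
      proof (rule form[OF finT c3])
        show "1 \<le> X" using X by simp
        fix v assume v: "v \<in> T"
        have "snd v \<noteq> 0" using Tp(2)[OF v] by auto
        then show "\<bar>fst v\<bar> \<le> X \<and> \<bar>snd v\<bar> \<le> X \<and> \<bar>e v\<bar> \<le> X \<and> \<bar>f v\<bar> \<le> X \<and> snd v \<noteq> 0 \<and> e v \<noteq> 0"
          using T[OF v] by blast
      qed (use dist slope pf in auto)
      then obtain G1 G2 where G: "degree G1 \<le> b" "degree G2 \<le> b" "G1 \<noteq> 0 \<or> G2 \<noteq> 0"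
        "poly_length G1 \<le> W * X ^ (3 * b + 3)" "poly_length G2 \<le> W * X ^ (3 * b + 3)"
        and Grel: "\<And>v. v \<in> T \<Longrightarrow> e v * hom_eval b G1 (fst v) (snd v) + f v * hom_eval b G2 (fst v) (snd v) = 0" by blast
      define M where "M = W * X ^ (3 * b + 3)"
      have M: "M \<ge> 2"
      proof -
        have "2 \<le> X ^ (3 * b + 3)" using self_le_power[of X "3 * b + 3"] X by linarith
        then have "1 * 2 \<le> W * X ^ (3 * b + 3)" using W by (intro mult_mono) auto
        then show ?thesis unfolding M_def by simp
      qed
      have len: "length (coeffs G1) + length (coeffs G2) \<le> 2 * (b + 1)"
        using G(1,2) by (cases "G1 = 0"; cases "G2 = 0") (auto simp: length_coeffs_degree)
      obtain Cp H1 H2 U V R where H: "R \<noteq> 0" "smult R G1 = Cp * H1" "smult R G2 = Cp * H2" "U * H1 + V * H2 = [:R:]"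
        "\<bar>R\<bar> \<le> M ^ K" "poly_length H1 \<le> M ^ K" "poly_length H2 \<le> M ^ K"
        using K[OF M len G(3)] G(4,5) unfolding M_def by blast
      have Cp0: "Cp \<noteq> 0" using H(1,2,3) G(3) by auto
      have dH: "degree H1 \<le> b" "degree H2 \<le> b" "degree Cp \<le> b"
      proof -
        have *: "degree P \<le> b \<and> (P \<noteq> 0 \<longrightarrow> degree Cp \<le> b)" if "smult R G = Cp * P" "degree G \<le> b" for G P
        proof (cases "P = 0")
          case False
          then have "degree Cp + degree P = degree (smult R G)" using that(1) Cp0 by (simp add: degree_mult_eq)
          then show ?thesis using that(2) H(1) by simp
        qed simp
        show "degree H1 \<le> b" "degree H2 \<le> b" using *[OF H(2) G(1)] *[OF H(3) G(2)] by auto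
        have "H1 \<noteq> 0 \<or> H2 \<noteq> 0" using H(1,4) by auto
        then show "degree Cp \<le> b" using *[OF H(2) G(1)] *[OF H(3) G(2)] by auto
      qed
      \<comment> \<open>The points at whose ratio the removed factor vanishes. Only there can the
        relation be lost on passing from \<open>G1\<close>, \<open>G2\<close> to \<open>H1\<close>,
        \<open>H2\<close>.\<close>
      define E1 where "E1 = {v\<in>T. poly (map_poly real_of_int Cp) (real_of_int (fst v) / real_of_int (snd v)) = 0}"
      have CR0: "map_poly real_of_int Cp \<noteq> 0"
      proof
        assume "map_poly real_of_int Cp = 0"
        then have "coeff (map_poly real_of_int Cp) (degree Cp) = 0" by simp
        then have "coeff Cp (degree Cp) = 0" by (simp add: coeff_map_poly)
        then show False using Cp0 by simp
      qed
      have cE1: "card E1 \<le> b"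
      proof -
        have "inj_on (\<lambda>v. real_of_int (fst v) / real_of_int (snd v)) E1"
        proof (rule inj_onI, rule ccontr)
          fix v w assume vw: "v \<in> E1" "w \<in> E1" "real_of_int (fst v) / real_of_int (snd v) = real_of_int (fst w) / real_of_int (snd w)" "v \<noteq> w"
          then have vT: "v \<in> T" "w \<in> T" unfolding E1_def by auto
          have "real_of_int (snd v) \<noteq> 0" "real_of_int (snd w) \<noteq> 0" using Tp(2)[OF vT(1)] Tp(2)[OF vT(2)] by auto
          then have "real_of_int (fst v) * real_of_int (snd w) = real_of_int (fst w) * real_of_int (snd v)" using vw(3) by (simp add: frac_eq_eq)
          then have "fst v * snd w = fst w * snd v" by (simp only: of_int_mult[symmetric] of_int_eq_iff)
          then show False using slope[OF vT vw(4)] by simp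
        qed
        then have "card E1 = card ((\<lambda>v. real_of_int (fst v) / real_of_int (snd v)) ` E1)" by (simp add: card_image)
        also have "\<dots> \<le> card {z. poly (map_poly real_of_int Cp) z = 0}"
          by (intro card_mono poly_roots_finite[OF CR0]) (auto simp: E1_def)
        also have "\<dots> \<le> degree (map_poly real_of_int Cp)" by (rule card_poly_roots_bound[OF CR0])
        also have "\<dots> \<le> b"
        proof -
          have "degree (map_poly real_of_int Cp) = degree Cp" by (rule degree_map_poly) auto
          then show ?thesis using dH(3) by simp
        qed
        finally show ?thesis .
      qed
      have Hrel: "e v * hom_eval b H1 (fst v) (snd v) + f v * hom_eval b H2 (fst v) (snd v) = 0" if v: "v \<in> T - E1" for v
      proof -
        have vT: "v \<in> T" using v by simp
        have y: "snd v \<noteq> 0" using Tp(2)[OF vT] by auto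
        define s where "s = real_of_int (fst v) / real_of_int (snd v)"
        define P where "P = (\<lambda>p. poly (map_poly real_of_int p) s)"
        have RG: "real_of_int R * P G1 = P Cp * P H1" "real_of_int R * P G2 = P Cp * P H2"
        proof -
          have sm: "map_poly real_of_int (smult R G) = smult (real_of_int R) (map_poly real_of_int G)" for G
            by (rule poly_eqI) (simp add: coeff_map_poly)
          show "real_of_int R * P G1 = P Cp * P H1" "real_of_int R * P G2 = P Cp * P H2"
            using arg_cong[OF H(2), of "\<lambda>p. poly (map_poly real_of_int p) s"] arg_cong[OF H(3), of "\<lambda>p. poly (map_poly real_of_int p) s"]
            unfolding P_def sm map_poly_real_of_int_mult by simp_all
        qed
        have hom: "real_of_int (hom_eval b p (fst v) (snd v)) = real_of_int (snd v) ^ b * P p" if "degree p \<le> b" for p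
          unfolding P_def s_def by (rule real_hom_eval[OF that y])
        have "real_of_int (e v * hom_eval b G1 (fst v) (snd v) + f v * hom_eval b G2 (fst v) (snd v)) = 0" using Grel[OF vT] by simp
        then have "real_of_int (snd v) ^ b * (real_of_int (e v) * P G1 + real_of_int (f v) * P G2) = 0"
          using hom[OF G(1)] hom[OF G(2)] by (simp add: algebra_simps)
        then have "real_of_int (e v) * P G1 + real_of_int (f v) * P G2 = 0" using y by simp
        then have "real_of_int R * (real_of_int (e v) * P G1 + real_of_int (f v) * P G2) = 0" by simp
        moreover have "real_of_int R * (real_of_int (e v) * P G1 + real_of_int (f v) * P G2) = P Cp * (real_of_int (e v) * P H1 + real_of_int (f v) * P H2)"
        proof -
          have "real_of_int R * (real_of_int (e v) * P G1 + real_of_int (f v) * P G2) = real_of_int (e v) * (real_of_int R * P G1) + real_of_int (f v) * (real_of_int R * P G2)"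
            by (simp add: algebra_simps)
          also have "\<dots> = P Cp * (real_of_int (e v) * P H1 + real_of_int (f v) * P H2)" unfolding RG by (simp add: algebra_simps)
          finally show ?thesis .
        qed
        moreover have "P Cp \<noteq> 0" using v unfolding E1_def P_def s_def by auto
        ultimately have z: "real_of_int (e v) * P H1 + real_of_int (f v) * P H2 = 0" by simp
        have "real_of_int (e v * hom_eval b H1 (fst v) (snd v) + f v * hom_eval b H2 (fst v) (snd v)) = real_of_int (snd v) ^ b * (real_of_int (e v) * P H1 + real_of_int (f v) * P H2)"
          using hom[OF dH(1)] hom[OF dH(2)] by (simp add: algebra_simps)
        also have "\<dots> = 0" unfolding z by simp
        finally show ?thesis by (simp only: of_int_eq_0_iff)
      qed
      show ?thesis
      proof (cases "H2 = 0")
        case True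
        \<comment> \<open>With \<open>H2 = 0\<close> the relation and \<open>e v \<noteq> 0\<close>
          make \<open>H1\<close> vanish at \<open>v\<close> too, against the Bezout
          identity.\<close>
        have "T - E1 = {}"
        proof (rule ccontr)
          assume "T - E1 \<noteq> {}"
          then obtain v where v: "v \<in> T - E1" by auto
          then have vT: "v \<in> T" by simp
          have y: "snd v \<noteq> 0" using Tp(2)[OF vT] by auto
          have h2: "hom_eval b H2 (fst v) (snd v) = 0" using True by (simp add: hom_eval_def)
          then have h1: "hom_eval b H1 (fst v) (snd v) = 0" using Hrel[OF v] Tp(4)[OF vT] by simp
          obtain N u w where "R * snd v ^ N = u * hom_eval b H1 (fst v) (snd v) + w * hom_eval b H2 (fst v) (snd v)"
            by (rule hom_eval_bezout[OF H(4) dH(1,2) y])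
          then show False using h1 h2 H(1) y by simp
        qed
        then have "T' \<subseteq> E1" using T'T by auto
        then have "card T' \<le> b" using cE1 card_mono[of E1 T'] finT unfolding E1_def by fastforce
        then have "real (card T') \<le> C * 1" using Cge by linarith
        also have "\<dots> \<le> C * (X1 * B)"
        proof (rule mult_left_mono)
          show "1 \<le> X1 * B" unfolding X12 using X2 B1 mult_mono[of 1 X2 1 X2] mult_mono[of 1 "X2 * X2" 1 B] by auto
        qed (use \<open>C > 0\<close> in auto)
        finally show ?thesis by (simp add: mult.assoc)
      next
        case False
        define F where "F = monom 1 k * H2 + H1"
        define n where "n = k + degree H2"
        have dF: "degree F = n" "lead_coeff F = lead_coeff H2"
          unfolding F_def n_def using degree_combined(1,2)[OF False dH(1) bk(1)] by auto
        define L where "L = lead_coeff H2"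
        have L0: "L \<noteq> 0" unfolding L_def using False by simp
        \<comment> \<open>If \<open>snd v\<close> divides the leading coefficient of
          \<open>F\<close>, it may divide the value of \<open>F\<close> at \<open>v\<close>. There
          are few such points because \<open>snd\<close> is injective.\<close>
        define E2 where "E2 = {v\<in>T. snd v dvd L}"
        define T3 where "T3 = T' - E1 - E2"
        have MK: "M ^ K \<ge> 1" using M by simp
        have MK2: "\<bar>h\<bar> * (M ^ K * M ^ K) = \<bar>h\<bar> * (W * X ^ (3 * b + 3)) ^ (K * 2)"
          unfolding M_def[symmetric] by (simp add: power_add[symmetric] mult_2_right)
        have \<tau>': "finite {d::int. d dvd z} \<and> real (card {d. d dvd z}) \<le> C1 * X2" if "z \<noteq> 0" "\<bar>z\<bar> \<le> \<bar>h\<bar> * p * q" "p \<le> M ^ K" "q \<le> M ^ K" "0 \<le> p" "0 \<le> q" for z p q :: int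
        proof (rule \<tau>[OF that(1)])
          have "\<bar>h\<bar> * (p * q) \<le> \<bar>h\<bar> * (M ^ K * M ^ K)" using that M by (intro mult_left_mono mult_mono) auto
          then show "\<bar>z\<bar> \<le> \<bar>h\<bar> * (W * X ^ (3 * b + 3)) ^ (K * 2)" using that(2) unfolding MK2[symmetric] by (simp add: mult.assoc)
        qed
        have h1: "\<bar>h\<bar> \<ge> 1" using h by auto
        have cE2: "real (card E2) \<le> C1 * X2"
        proof -
          have "\<bar>L\<bar> \<le> poly_length H2" unfolding L_def by (rule abs_coeff_le_poly_length)
          then have "\<bar>L\<bar> \<le> 1 * 1 * M ^ K" using H(7) by simp
          also have "\<dots> \<le> \<bar>h\<bar> * 1 * M ^ K" using h1 MK by (intro mult_right_mono) auto
          finally have lb: "\<bar>L\<bar> \<le> \<bar>h\<bar> * 1 * M ^ K" .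
          have t: "finite {d::int. d dvd L} \<and> real (card {d. d dvd L}) \<le> C1 * X2"
            by (rule \<tau>'[OF L0 lb]) (use MK in auto)
          have "card E2 = card (snd ` E2)" using inj_on_subset[OF inj, of E2] by (simp add: card_image E2_def)
          also have "\<dots> \<le> card {d. d dvd L}" using t by (intro card_mono) (auto simp: E2_def)
          finally show ?thesis using t by linarith
        qed
        define Fv where "Fv = (\<lambda>v. hom_eval n F (fst v) (snd v))"
        \<comment> \<open>The Bezout identity at the point, multiplied by \<open>h\<close> and
          rewritten by Cramer's rule, shows that the value divides \<open>R * h * snd v ^ N\<close>.
          It is coprime to the prime \<open>snd v\<close>, since modulo \<open>snd v\<close> only
          the leading term is left.\<close>
        have Fdvd: "Fv v dvd R * h" if v: "v \<in> T3" for v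
        proof -
          have vT: "v \<in> T" "v \<in> T - E1" "\<not> snd v dvd L" using v T'T unfolding T3_def E2_def by auto
          have y: "snd v \<noteq> 0" using Tp(2)[OF vT(1)] by auto
          define G where "G = hom_eval (k + b) F (fst v) (snd v)"
          have Ge: "G * e v = h * hom_eval b H2 (fst v) (snd v)" "G * f v = - (h * hom_eval b H1 (fst v) (snd v))"
            unfolding G_def F_def using combined_form_times[OF dH(1) Hrel[OF vT(2)] Tp(6)[OF vT(1)]] by auto
          have nb: "k + b = n + (b - degree H2)" unfolding n_def using dH(2) by simp
          have GF: "G = snd v ^ (b - degree H2) * Fv v"
            unfolding G_def Fv_def nb using hom_eval_pad[of F n "b - degree H2"] dF(1) by simp
          obtain N u w where N: "R * snd v ^ N = u * hom_eval b H1 (fst v) (snd v) + w * hom_eval b H2 (fst v) (snd v)"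
            by (rule hom_eval_bezout[OF H(4) dH(1,2) y])
          have "(R * h) * snd v ^ N = u * (h * hom_eval b H1 (fst v) (snd v)) + w * (h * hom_eval b H2 (fst v) (snd v))"
            using arg_cong[OF N, of "\<lambda>z. h * z"] by (simp add: algebra_simps)
          also have "\<dots> = G * (w * e v - u * f v)"
          proof -
            have "h * hom_eval b H1 (fst v) (snd v) = - (G * f v)" using Ge(2) by simp
            then show ?thesis unfolding Ge(1)[symmetric] by (simp add: algebra_simps)
          qed
          finally have "Fv v dvd (R * h) * snd v ^ N" unfolding GF by simp
          moreover have "coprime (Fv v) (snd v ^ N)"
          proof -
            have "\<not> snd v dvd Fv v"
            proof
              assume dv: "snd v dvd Fv v"
              have "Fv v = (\<Sum>i<n. coeff F i * (fst v ^ i * snd v ^ (n - i))) + L * fst v ^ n"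
                unfolding Fv_def hom_eval_def using dF unfolding L_def by (simp add: lessThan_Suc_atMost[symmetric])
              moreover have "snd v dvd (\<Sum>i<n. coeff F i * (fst v ^ i * snd v ^ (n - i)))"
              proof (rule dvd_sum)
                fix i assume "i \<in> {..<n}"
                then have "n - i \<noteq> 0" by auto
                then have "snd v dvd snd v ^ (n - i)" by (simp add: dvd_power)
                then show "snd v dvd coeff F i * (fst v ^ i * snd v ^ (n - i))" by (intro dvd_mult)
              qed
              ultimately have "snd v dvd L * fst v ^ n" using dv by (simp add: dvd_add_right_iff)
              then have "snd v dvd fst v ^ n" using vT(3) prime_dvd_multD[OF Tp(2)[OF vT(1)]] by blast
              then have "snd v dvd fst v" using prime_dvd_power[OF Tp(2)[OF vT(1)]] by blast
              then show False using primes_dvd_imp_eq[OF Tp(2,1)[OF vT(1)]] Tp(3)[OF vT(1)] by auto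
            qed
            then have "coprime (snd v) (Fv v)" using prime_imp_coprime[OF Tp(2)[OF vT(1)]] by blast
            then show ?thesis by (simp add: coprime_commute)
          qed
          ultimately show ?thesis by (simp add: coprime_dvd_mult_left_iff)
        qed
        have Rh: "R * h \<noteq> 0" using H(1) h by simp
        have tRh: "finite {d::int. d dvd R * h} \<and> real (card {d. d dvd R * h}) \<le> C1 * X2"
        proof (rule \<tau>'[OF Rh])
          show "\<bar>R * h\<bar> \<le> \<bar>h\<bar> * \<bar>R\<bar> * 1" by (simp add: abs_mult)
        qed (use H(5) MK in auto)
        define Bd where "Bd = 34 * real k * (1 + Q powr (1 / 3)) + C1 * X2 + 1 + 8 * Q / J"
        have Bd0: "Bd \<ge> 0" unfolding Bd_def using C1 X2 Q0 J by (intro add_nonneg_nonneg mult_nonneg_nonneg divide_nonneg_pos) auto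
        have fib: "real (card {v\<in>T3. Fv v = c}) \<le> Bd" if c: "c \<in> {d. d dvd R * h}" for c
        proof -
          define V' where "V' = {v\<in>T. v \<notin> E1 \<and> Fv v = c}"
          have V'T: "V' \<subseteq> T" unfolding V'_def by auto
          have "real (card {v\<in>V'. \<not> (k = 2 \<and> line_point h e D J v)}) \<le>
             34 * real k * (1 + (D\<^sup>2 * \<Lambda>) powr (1 / 3)) + C1 * X2 + 1 + 8 * (D\<^sup>2 * \<Lambda>) / J"
          proof (rule card_fibre_le[OF bk dH(1,2) False H(4,1)])
            show "finite V'" using V'T finT finite_subset by blast
            show "c \<noteq> 0" using c Rh by auto
            show "0 \<le> C1 * X2" using C1 X2 by simp
            fix z assume "z \<noteq> 0" "\<bar>z\<bar> \<le> \<bar>h\<bar> * poly_length H1 * poly_length H2"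
            then show "finite {d. d dvd z} \<and> real (card {d. d dvd z}) \<le> C1 * X2"
              by (rule \<tau>') (use H(6,7) poly_length_nonneg in auto)
          next
            fix v assume v: "v \<in> V'"
            then have "v \<in> T" "v \<in> T - E1" "Fv v = c" unfolding V'_def by auto
            then show "prime (fst v) \<and> prime (snd v) \<and> fst v \<noteq> snd v \<and> e v \<noteq> 0 \<and> f v \<noteq> 0 \<and>
               D < real_of_int (snd v) \<and> real_of_int (snd v) \<le> 2 * D \<and> a \<le> real_of_int (fst v) / real_of_int (snd v)
              \<and> real_of_int (fst v) / real_of_int (snd v) \<le> a + \<Lambda> \<and> e v * fst v ^ k - f v * snd v ^ k = h \<and>
              e v * hom_eval b H1 (fst v) (snd v) + f v * hom_eval b H2 (fst v) (snd v) = 0 \<and>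
              hom_eval (k + degree H2) (monom 1 k * H2 + H1) (fst v) (snd v) = c"
              using T[of v] Hrel[of v] unfolding Fv_def F_def n_def by blast
          qed (use h D \<Lambda> J inj_on_subset[OF inj V'T] in auto)
          then have "real (card {v\<in>V'. \<not> (k = 2 \<and> line_point h e D J v)}) \<le> Bd" unfolding Bd_def Q_def .
          moreover have "{v\<in>T3. Fv v = c} \<subseteq> {v\<in>V'. \<not> (k = 2 \<and> line_point h e D J v)}"
            unfolding T3_def V'_def T'_def by auto
          ultimately show ?thesis
            using card_mono[of "{v\<in>V'. \<not> (k = 2 \<and> line_point h e D J v)}" "{v\<in>T3. Fv v = c}"] finT V'T finite_subset[of V' T] by fastforce
        qed
        have cT3: "real (card T3) \<le> C1 * X2 * Bd"
        proof -
          have "T3 = (\<Union>c\<in>{d. d dvd R * h}. {v\<in>T3. Fv v = c})" using Fdvd by auto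
          then have "card T3 \<le> (\<Sum>c\<in>{d. d dvd R * h}. card {v\<in>T3. Fv v = c})"
            using card_UN_le[of "{d. d dvd R * h}" "\<lambda>c. {v\<in>T3. Fv v = c}"] tRh by simp
          then have "real (card T3) \<le> real (\<Sum>c\<in>{d. d dvd R * h}. card {v\<in>T3. Fv v = c})" by (simp only: of_nat_le_iff)
          also have "\<dots> = (\<Sum>c\<in>{d. d dvd R * h}. real (card {v\<in>T3. Fv v = c}))" by (simp only: of_nat_sum)
          also have "\<dots> \<le> (\<Sum>c\<in>{d. d dvd R * h}. Bd)" using fib by (rule sum_mono)
          also have "\<dots> = real (card {d. d dvd R * h}) * Bd" by simp
          also have "\<dots> \<le> C1 * X2 * Bd" using tRh Bd0 by (intro mult_right_mono) auto
          finally show ?thesis .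
        qed
        have "T' \<subseteq> E1 \<union> E2 \<union> T3" unfolding T3_def by auto
        moreover have "finite E1" "finite E2" "finite T3" using finT finT' unfolding E1_def E2_def T3_def by auto
        ultimately have "card T' \<le> card (E1 \<union> E2 \<union> T3)" by (intro card_mono) auto
        also have "\<dots> \<le> card E1 + card E2 + card T3" by (meson add_mono card_Un_le le_refl order_trans)
        finally have "real (card T') \<le> real b + C1 * X2 + C1 * X2 * Bd" using cE1 cE2 cT3 by linarith
        also have "\<dots> \<le> C * X1 * B"
        proof -
          have X2B: "1 \<le> X2 * B" using mult_mono[of 1 X2 1 B] X2 B1 by simp
          have q: "Q powr (1 / 3) \<ge> 0" "Q / J \<ge> 0" using Q0 J by auto
          have "34 * real k * (1 + Q powr (1 / 3)) \<le> 34 * real k * B" unfolding B_def using q by (intro mult_left_mono) auto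
          also have "\<dots> \<le> 34 * real k * (X2 * B)" using X2 B1 by (intro mult_left_mono) auto
          finally have a1: "34 * real k * (1 + Q powr (1 / 3)) \<le> 34 * real k * (X2 * B)" .
          have a2: "C1 * X2 \<le> C1 * (X2 * B)" using C1 X2 B1 by (intro mult_left_mono) auto
          have "8 * Q / J \<le> 8 * B" unfolding B_def using q by simp
          also have "\<dots> \<le> 8 * (X2 * B)" using X2 B1 by simp
          finally have a3: "8 * Q / J \<le> 8 * (X2 * B)" .
          have "Bd \<le> (34 * real k + C1 + 1 + 8) * (X2 * B)"
            unfolding Bd_def using a1 a2 a3 X2B by (simp add: algebra_simps)
          then have "C1 * X2 * Bd \<le> C1 * X2 * ((34 * real k + C1 + 1 + 8) * (X2 * B))" using C1 X2 by (intro mult_left_mono) auto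
          then have b1: "C1 * X2 * Bd \<le> C1 * (34 * real k + C1 + 1 + 8) * (X1 * B)" unfolding X12 by (simp add: ac_simps)
          have X1B: "X2 * B \<le> X1 * B" unfolding X12 using mult_right_mono[OF X2, of "X2 * B"] X2B by (simp add: mult.assoc)
          have X1B1: "1 \<le> X1 * B" using X1B X2B by linarith
          have b2: "C1 * X2 \<le> C1 * (X1 * B)" using a2 mult_left_mono[OF X1B, of C1] C1 by linarith
          have b3: "real b \<le> real b * (X1 * B)" using mult_left_mono[OF X1B1, of "real b"] by simp
          have b4: "0 \<le> 3 * (X1 * B)" using X1B1 by simp
          show ?thesis unfolding C_def using b1 b2 b3 b4 by (simp add: algebra_simps)
        qed
        finally show ?thesis .
      qed
    qed
    then show "real (card {v\<in>T. \<not> (k = 2 \<and> line_point h e D J v)}) \<le>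
        C * real_of_int X powr \<epsilon> * (1 + (D\<^sup>2 * \<Lambda>) powr (1 / 3) + D\<^sup>2 * \<Lambda> / J)"
      unfolding T'_def X1_def B_def Q_def .
  qed
qed

section \<open>Sizes of the parameters attached to a dyadic box\<close>

lemma power_le_power_four:
  fixes W :: real
  assumes "1/2 \<le> W" "i \<le> j" "j \<le> i + 2 * m"
  shows "W ^ i \<le> 4 ^ m * W ^ j"
proof -
  have "1 \<le> 4 ^ m * W ^ (j - i)"
  proof -
    have "(1/2) ^ (2 * m) \<le> (1/2::real) ^ (j - i)" using assms by (intro power_decreasing) auto
    also have "\<dots> \<le> W ^ (j - i)" using assms by (intro power_mono) auto
    finally have "4 ^ m * (1/2) ^ (2 * m) \<le> 4 ^ m * W ^ (j - i)" by (intro mult_left_mono) auto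
    moreover have "4 ^ m * (1/2::real) ^ (2 * m) = 1" by (simp add: power_mult power_mult_distrib[symmetric] power2_eq_square)
    ultimately show ?thesis by simp
  qed
  then have "W ^ i * 1 \<le> W ^ i * (4 ^ m * W ^ (j - i))" using assms by (intro mult_left_mono) auto
  also have "\<dots> = 4 ^ m * (W ^ i * W ^ (j - i))" by simp
  also have "W ^ i * W ^ (j - i) = W ^ j" using assms by (simp add: power_add[symmetric])
  finally show ?thesis by simp
qed

text \<open>Equal ratios would give \<open>e * e' * ((x * y') ^ k - (x' * y) ^ k) = h * (e' * y' ^ k
  - e * y ^ k)\<close> by elimination. The \<open>k\<close>-th powers of distinct integers of size
  at least \<open>D1 * D2\<close> differ by at least \<open>(D1 * D2) ^ (k - 1)\<close>, while the
  lower bounds for \<open>\<bar>e\<bar> * x ^ k\<close> keep the right side below what this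
  forces.\<close>

lemma distinct_ratios:
  fixes x y x' y' e f e' f' h :: int and K P D1 D2 :: real
  assumes k: "k \<ge> 1" and pos: "x > 0" "y > 0" "x' > 0" "y' > 0" and D: "D1 > 0" "D2 > 0"
    and r: "D1 < x" "x \<le> 2 * D1" "D2 < y" "y \<le> 2 * D2" "D1 < x'" "x' \<le> 2 * D1" "D2 < y'" "y' \<le> 2 * D2"
    and eq: "e * x ^ k - f * y ^ k = h" "e' * x' ^ k - f' * y' ^ k = h"
    and K: "K > 2 * \<bar>real_of_int h\<bar> * 4 ^ k"
    and lower: "\<bar>real_of_int e\<bar> * real_of_int x ^ k \<ge> K * (D1 * D2)" "\<bar>real_of_int e'\<bar> * real_of_int x' ^ k \<ge> K * (D1 * D2)"
    and slope: "x * y' \<noteq> x' * y"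
  shows "e * f' \<noteq> e' * f"
proof
  assume ef: "e * f' = e' * f"
  define H where "H = \<bar>real_of_int h\<bar>"
  have K0: "K > 0" using K order_le_less_trans[of 0 "2 * \<bar>real_of_int h\<bar> * 4 ^ k" K] by simp
  have P0: "D1 * D2 > 0" using D by simp
  have KP: "K * (D1 * D2) > 0" using K0 P0 by (rule mult_pos_pos)
  have e0: "e \<noteq> 0" "e' \<noteq> 0"
  proof -
    have "\<bar>real_of_int e\<bar> * real_of_int x ^ k > 0" "\<bar>real_of_int e'\<bar> * real_of_int x' ^ k > 0" using lower KP by linarith+
    then show "e \<noteq> 0" "e' \<noteq> 0" by auto
  qed
  have "e * e' * (x ^ k * y' ^ k - x' ^ k * y ^ k) = h * (e' * y' ^ k - e * y ^ k)"
  proof -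
    have 1: "e' * h = e * e' * x ^ k - (e' * f) * y ^ k" unfolding eq(1)[symmetric] by (simp add: algebra_simps)
    have 2: "e * h = e * e' * x' ^ k - (e * f') * y' ^ k" unfolding eq(2)[symmetric] by (simp add: algebra_simps)
    have "h * (e' * y' ^ k - e * y ^ k) = (e' * h) * y' ^ k - (e * h) * y ^ k" by (simp add: algebra_simps)
    also have "\<dots> = e * e' * (x ^ k * y' ^ k - x' ^ k * y ^ k) + (e * f' - e' * f) * (y ^ k * y' ^ k)"
      unfolding 1 2 by (simp add: algebra_simps)
    finally show ?thesis using ef by simp
  qed
  then have E: "\<bar>e\<bar> * \<bar>e'\<bar> * \<bar>(x * y') ^ k - (x' * y) ^ k\<bar> = \<bar>h\<bar> * \<bar>e' * y' ^ k - e * y ^ k\<bar>"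
    by (simp add: abs_mult[symmetric] power_mult_distrib)
  have pw: "(D1 * D2) ^ (k - 1) \<le> \<bar>real_of_int ((x * y') ^ k - (x' * y) ^ k)\<bar>"
  proof -
    define A B where "A = x * y'" "B = x' * y"
    have AB: "D1 * D2 \<le> real_of_int A" "D1 * D2 \<le> real_of_int B" unfolding A_B_def of_int_mult using r D by (auto intro!: mult_mono)
    have gen: "(D1 * D2) ^ (k - 1) \<le> real_of_int (A ^ k - B ^ k)" if "B < A" "D1 * D2 \<le> real_of_int B" for A B :: int
    proof -
      have B0: "real_of_int B > 0" using that P0 by linarith
      then have "B > 0" by simp
      have "(B + 1) ^ k \<le> A ^ k" using that \<open>B > 0\<close> by (intro power_mono) auto
      moreover have "B ^ k + B ^ (k - 1) \<le> (B + 1) ^ k"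
      proof -
        obtain n where n: "k = Suc n" using k by (cases k) auto
        have "(B + 1) ^ k = B * (B + 1) ^ n + (B + 1) ^ n" unfolding n by (simp add: algebra_simps)
        moreover have "B ^ n \<le> (B + 1) ^ n" using \<open>B > 0\<close> by (intro power_mono) auto
        then have "B * B ^ n + B ^ n \<le> B * (B + 1) ^ n + (B + 1) ^ n" using \<open>B > 0\<close> by (intro add_mono mult_left_mono) auto
        ultimately show ?thesis unfolding n by simp
      qed
      ultimately have "B ^ (k - 1) \<le> A ^ k - B ^ k" by linarith
      then have "real_of_int (B ^ (k - 1)) \<le> real_of_int (A ^ k - B ^ k)" by (simp only: of_int_le_iff)
      moreover have "(D1 * D2) ^ (k - 1) \<le> real_of_int (B ^ (k - 1))" unfolding of_int_power using that P0 by (intro power_mono) auto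
      ultimately show ?thesis by linarith
    qed
    have "A \<noteq> B" unfolding A_B_def by (rule slope)
    then have "(D1 * D2) ^ (k - 1) \<le> \<bar>real_of_int (A ^ k - B ^ k)\<bar>"
      using gen[of B A] gen[of A B] AB by (cases "B < A") auto
    then show ?thesis unfolding A_B_def .
  qed
  have up: "real_of_int z ^ k * K * (D1 * D2) \<le> 4 ^ k * (D1 * D2) ^ k * \<bar>real_of_int d\<bar>"
    if "0 < z" "z \<le> 2 * D2" "\<bar>real_of_int d\<bar> * real_of_int q ^ k \<ge> K * (D1 * D2)" "0 < q" "q \<le> 2 * D1" for z d q :: int
  proof -
    have "real_of_int z ^ k * (K * (D1 * D2)) \<le> (2 * D2) ^ k * (\<bar>real_of_int d\<bar> * (2 * D1) ^ k)"
    proof (rule mult_mono)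
      show "real_of_int z ^ k \<le> (2 * D2) ^ k" using that by (intro power_mono) auto
      have "\<bar>real_of_int d\<bar> * real_of_int q ^ k \<le> \<bar>real_of_int d\<bar> * (2 * D1) ^ k" using that by (intro mult_left_mono power_mono) auto
      then show "K * (D1 * D2) \<le> \<bar>real_of_int d\<bar> * (2 * D1) ^ k" using that(3) by linarith
    qed (use D K0 in auto)
    also have "\<dots> = ((2 * D2) ^ k * (2 * D1) ^ k) * \<bar>real_of_int d\<bar>" by (simp only: ac_simps)
    also have "(2 * D2) ^ k * (2 * D1) ^ k = 4 ^ k * (D1 * D2) ^ k"
      unfolding power_mult_distrib[symmetric] by (rule arg_cong[of _ _ "\<lambda>z. z ^ k"]) simp
    finally show ?thesis by (simp add: mult.assoc)
  qed
  define p where "p = D1 * D2"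
  have p0: "p > 0" unfolding p_def by (rule P0)
  have u1: "real_of_int y' ^ k * K * p \<le> 4 ^ k * p ^ k * \<bar>real_of_int e\<bar>"
    unfolding p_def by (rule up[OF pos(4) r(8) lower(1) pos(1) r(2)])
  have u2: "real_of_int y ^ k * K * p \<le> 4 ^ k * p ^ k * \<bar>real_of_int e'\<bar>"
    unfolding p_def by (rule up[OF pos(2) r(4) lower(2) pos(3) r(6)])
  define a a' where "a = \<bar>real_of_int e\<bar>" "a' = \<bar>real_of_int e'\<bar>"
  have a0: "a > 0" "a' > 0" unfolding a_a'_def using e0 by auto
  have "a * a' * p ^ (k - 1) \<le> a * a' * \<bar>real_of_int ((x * y') ^ k - (x' * y) ^ k)\<bar>"
    using pw a0 unfolding p_def by (intro mult_left_mono) auto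
  also have "\<dots> = real_of_int (\<bar>e\<bar> * \<bar>e'\<bar> * \<bar>(x * y') ^ k - (x' * y) ^ k\<bar>)" unfolding a_a'_def by simp
  also have "\<dots> = H * \<bar>real_of_int (e' * y' ^ k - e * y ^ k)\<bar>" unfolding E H_def by simp
  also have "\<dots> \<le> H * (a' * real_of_int y' ^ k + a * real_of_int y ^ k)"
  proof (rule mult_left_mono)
    have "\<bar>real_of_int (e' * y' ^ k - e * y ^ k)\<bar> \<le> \<bar>real_of_int (e' * y' ^ k)\<bar> + \<bar>real_of_int (e * y ^ k)\<bar>" by simp
    also have "\<dots> = a' * real_of_int y' ^ k + a * real_of_int y ^ k" unfolding a_a'_def using pos by (simp add: abs_mult)
    finally show "\<bar>real_of_int (e' * y' ^ k - e * y ^ k)\<bar> \<le> a' * real_of_int y' ^ k + a * real_of_int y ^ k" .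
  qed (simp add: H_def)
  finally have "a * a' * p ^ (k - 1) * (K * p) \<le> H * (a' * real_of_int y' ^ k + a * real_of_int y ^ k) * (K * p)"
    using K0 p0 by (intro mult_right_mono) auto
  also have "\<dots> = H * (a' * (real_of_int y' ^ k * K * p) + a * (real_of_int y ^ k * K * p))" by (simp add: algebra_simps)
  also have "\<dots> \<le> H * (a' * (4 ^ k * p ^ k * a) + a * (4 ^ k * p ^ k * a'))"
    using u1 u2 a0 unfolding a_a'_def[symmetric] by (intro mult_left_mono add_mono) (auto simp: H_def)
  also have "\<dots> = (2 * H * 4 ^ k) * (a * a' * p ^ k)" by (simp add: algebra_simps)
  finally have "K * (a * a' * p ^ k) \<le> (2 * H * 4 ^ k) * (a * a' * p ^ k)"
  proof -
    assume "a * a' * p ^ (k - 1) * (K * p) \<le> (2 * H * 4 ^ k) * (a * a' * p ^ k)"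
    moreover have "p ^ k = p ^ (k - 1) * p" using k by (cases k) auto
    ultimately show ?thesis by (simp add: algebra_simps)
  qed
  moreover have "a * a' * p ^ k > 0" using a0 p0 by simp
  ultimately have "K \<le> 2 * H * 4 ^ k" by (rule mult_right_le_imp_le)
  then show False using K unfolding H_def by simp
qed

text \<open>The exponent of \<open>u\<close> is \<open>k - 3 * b - 1\<close> in \<open>Z\<close>, 0
  in \<open>Z * Y\<close> and \<open>3 * b - k - 2\<close> in \<open>Y * \<mu>\<close>, so
  \<open>b\<close> has to be close to \<open>k / 3\<close>. Negative powers of \<open>W\<close> cost
  at most a power of 4 because \<open>W \<ge> 1/2\<close>. A positive power of \<open>W\<close> can
  occur only in \<open>Z\<close>, where \<open>W ^ 2 \<le> u\<close> absorbs it.\<close>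

lemma pade_parameters_small:
  fixes k b :: nat and A u W c0 :: real
  assumes b: "3 * b \<le> k + 1" "k \<le> 3 * b + 1" "b \<ge> 1" "b < k" and A: "A \<ge> 1" and u: "u \<ge> 1"
    and W: "1/2 \<le> W" "W ^ 2 \<le> u" and c0: "0 < c0" "c0 \<le> 1"
  defines "P \<equiv> u ^ 3 * W ^ 2" and "\<mu> \<equiv> c0 * W / u ^ 3"
  defines "Z \<equiv> A\<^sup>2 * u ^ (4 * k + 2) / P ^ (k - b) * \<mu> ^ (2 * b + 1)" and "Y \<equiv> A * u ^ (2 * k + 1) / P ^ (k - b)"
  shows "Z\<^sup>2 + Z * Y + (Y * \<mu>)\<^sup>2 \<le> c0 * (3 * A ^ 4 * 4 ^ (2 * k))"
proof -
  have W0: "W > 0" and u0: "u > 0" using W u by auto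
  \<comment> \<open>The exponent of \<open>1 / u\<close> in \<open>Z\<close>, a genuine difference
    by \<open>k \<le> 3 * b + 1\<close>.\<close>
  define d where "d = 3 * b + 1 - k"
  have cb: "c0 ^ (2 * b + 1) \<le> c0"
    using power_decreasing[of 1 "2 * b + 1" c0] c0 by simp
  have den: "P ^ (k - b) = u ^ (3 * (k - b)) * W ^ (2 * (k - b))" unfolding P_def by (simp add: power_mult_distrib power_mult)
  have muB: "\<mu> ^ (2 * b + 1) = c0 ^ (2 * b + 1) * W ^ (2 * b + 1) / u ^ (3 * (2 * b + 1))"
    unfolding \<mu>_def by (simp only: power_mult_distrib power_divide power_mult)
  have uu: "u ^ (3 * (k - b)) * u ^ (3 * (2 * b + 1)) = u ^ (4 * k + 2) * u ^ d"
    unfolding power_add[symmetric] d_def using b by (intro arg_cong[of _ _ "\<lambda>n. u ^ n"]) auto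
  have Zeq: "Z = A\<^sup>2 * c0 ^ (2 * b + 1) * (W ^ (2 * b + 1) / (u ^ d * W ^ (2 * (k - b))))"
  proof -
    have "Z = A\<^sup>2 * c0 ^ (2 * b + 1) * (u ^ (4 * k + 2) * W ^ (2 * b + 1) / ((u ^ (3 * (k - b)) * u ^ (3 * (2 * b + 1))) * W ^ (2 * (k - b))))"
    proof -
      have "a * U / (p * q) * (c * w / r) = a * c * (U * w / ((p * r) * q))" for a U p q c w r :: real by (simp add: ac_simps)
      then show ?thesis unfolding Z_def den muB .
    qed
    also have "\<dots> = A\<^sup>2 * c0 ^ (2 * b + 1) * (W ^ (2 * b + 1) / (u ^ d * W ^ (2 * (k - b))))"
      unfolding uu using u0 by simp
    finally show ?thesis .
  qed
  have Zw: "W ^ (2 * b + 1) / (u ^ d * W ^ (2 * (k - b))) \<le> 4 ^ k"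
  proof -
    have "W ^ (2 * b + 1) \<le> 4 ^ k * (u ^ d * W ^ (2 * (k - b)))"
    proof (cases "2 * b + 1 \<le> 2 * (k - b)")
      case True
      have "W ^ (2 * b + 1) \<le> 4 ^ k * W ^ (2 * (k - b))" by (rule power_le_power_four) (use W True in auto)
      also have "\<dots> \<le> 4 ^ k * (u ^ d * W ^ (2 * (k - b)))"
        using u W0 by (intro mult_left_mono) (auto simp: mult_le_cancel_right1)
      finally show ?thesis .
    next
      case False
      \<comment> \<open>The surplus power of \<open>W\<close> in \<open>Z\<close>. It is at most
        \<open>2 * d\<close>, so \<open>W ^ 2 \<le> u\<close> gives
        \<open>W ^ m \<le> u ^ d\<close>.\<close>
      define m where "m = 2 * b + 1 - 2 * (k - b)"
      have m: "m \<le> 2 * d" "2 * b + 1 = 2 * (k - b) + m" unfolding m_def d_def using False b by auto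
      have "W ^ m \<le> u ^ d"
      proof (cases "W \<ge> 1")
        case True
        then have "W ^ m \<le> W ^ (2 * d)" using m by (intro power_increasing) auto
        also have "\<dots> = (W ^ 2) ^ d" by (simp add: power_mult)
        also have "\<dots> \<le> u ^ d" using W by (intro power_mono) auto
        finally show ?thesis .
      next
        case False
        then have "W ^ m \<le> 1" using W0 by (intro power_le_one) auto
        also have "1 \<le> u ^ d" using u by simp
        finally show ?thesis .
      qed
      then have "W ^ (2 * (k - b)) * W ^ m \<le> W ^ (2 * (k - b)) * u ^ d" using W0 by (intro mult_left_mono) auto
      also have "\<dots> = 1 * (u ^ d * W ^ (2 * (k - b)))" by (simp only: mult.commute mult_1_left mult_1_right)
      also have "\<dots> \<le> 4 ^ k * (u ^ d * W ^ (2 * (k - b)))" using u0 W0 by (intro mult_right_mono) auto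
      finally show ?thesis unfolding m(2) power_add .
    qed
    then show ?thesis using u0 W0 by (simp add: field_simps)
  qed
  have A2: "A\<^sup>2 \<ge> 1" using A by simp
  have Z0: "Z \<ge> 0" unfolding Zeq using A c0 W0 u0 by simp
  have Y0: "Y \<ge> 0" unfolding Y_def den using A W0 u0 by simp
  have mu0: "\<mu> \<ge> 0" unfolding \<mu>_def using c0 W0 u0 by simp
  have ZB: "Z \<le> A\<^sup>2 * c0 * 4 ^ k"
    unfolding Zeq using cb Zw c0 A2 u0 W0 by (intro mult_mono) auto
  \<comment> \<open>Here the powers of \<open>u\<close> cancel exactly, for every \<open>b\<close>.
    This term dictates the factor \<open>1 / u ^ 3\<close> in \<open>\<mu>\<close>, and only the
    constant \<open>c0\<close> is left to make it small.\<close>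
  have YZ: "Z * Y \<le> A ^ 3 * c0 * 4 ^ (2 * k)"
  proof -
    have "Z * Y = A ^ 3 * c0 ^ (2 * b + 1) * ((u ^ (4 * k + 2) * u ^ (2 * k + 1)) * W ^ (2 * b + 1) / ((u ^ (3 * (k - b)) * u ^ (3 * (2 * b + 1)) * u ^ (3 * (k - b))) * (W ^ (2 * (k - b)) * W ^ (2 * (k - b)))))"
    proof -
      have "(A\<^sup>2 * U / (p * q) * (c * w / r)) * (A * U' / (p * q)) = A ^ 3 * c * ((U * U') * w / ((p * r * p) * (q * q)))" for U p q c w r U' :: real
        by (simp add: power2_eq_square power3_eq_cube ac_simps)
      then show ?thesis unfolding Z_def Y_def den muB .
    qed
    also have "u ^ (3 * (k - b)) * u ^ (3 * (2 * b + 1)) * u ^ (3 * (k - b)) = u ^ (4 * k + 2) * u ^ (2 * k + 1)"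
      unfolding power_add[symmetric] using b by (intro arg_cong[of _ _ "\<lambda>n. u ^ n"]) auto
    also have "W ^ (2 * (k - b)) * W ^ (2 * (k - b)) = W ^ (4 * (k - b))" unfolding power_add[symmetric] by simp
    also have "(u ^ (4 * k + 2) * u ^ (2 * k + 1)) * W ^ (2 * b + 1) / ((u ^ (4 * k + 2) * u ^ (2 * k + 1)) * W ^ (4 * (k - b))) = W ^ (2 * b + 1) / W ^ (4 * (k - b))"
      using u0 by simp
    finally have eq: "Z * Y = A ^ 3 * c0 ^ (2 * b + 1) * (W ^ (2 * b + 1) / W ^ (4 * (k - b)))" .
    have "W ^ (2 * b + 1) \<le> 4 ^ (2 * k) * W ^ (4 * (k - b))" by (rule power_le_power_four) (use W b in auto)
    then have "W ^ (2 * b + 1) / W ^ (4 * (k - b)) \<le> 4 ^ (2 * k)" using W0 by (simp add: field_simps)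
    then show ?thesis unfolding eq using cb c0 A W0 by (intro mult_mono) auto
  qed
  have Ymu: "Y * \<mu> \<le> A * c0 * 4 ^ k"
  proof -
    have "Y * \<mu> = A * c0 * (u ^ (2 * k + 1) * W / (u ^ (3 * (k - b) + 3) * W ^ (2 * (k - b))))"
    proof -
      have "A * U / (p * q) * (c0 * W / r) = A * c0 * (U * W / ((p * r) * q))" for U p q r :: real by (simp add: ac_simps)
      then show ?thesis unfolding Y_def \<mu>_def den power_add[of u "3 * (k - b)" 3] .
    qed
    moreover have "u ^ (2 * k + 1) * W / (u ^ (3 * (k - b) + 3) * W ^ (2 * (k - b))) \<le> 4 ^ k"
    proof -
      have "u ^ (2 * k + 1) * W ^ 1 \<le> u ^ (3 * (k - b) + 3) * (4 ^ k * W ^ (2 * (k - b)))"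
        using u W b W0 by (intro mult_mono power_increasing power_le_power_four) auto
      then show ?thesis using u0 W0 by (simp add: field_simps)
    qed
    ultimately show ?thesis using A c0 by (simp only:) (rule mult_left_mono, auto)
  qed
  have c2: "c0 * c0 \<le> c0" using c0 by (simp add: mult_le_cancel_right1)
  have A34: "A ^ 3 \<le> A ^ 4" "A\<^sup>2 \<le> A ^ 4" using A by (auto intro!: power_increasing)
  have k4: "(4 ^ k)\<^sup>2 = (4::real) ^ (2 * k)" by (simp add: power_mult[symmetric] mult.commute)
  have "Z\<^sup>2 \<le> (A\<^sup>2 * c0 * 4 ^ k)\<^sup>2" using ZB Z0 by (intro power_mono) auto
  also have "\<dots> = A ^ 4 * (c0 * c0) * 4 ^ (2 * k)" unfolding power_mult_distrib k4 by (simp add: power2_eq_square power4_eq_xxxx)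
  also have "\<dots> \<le> A ^ 4 * c0 * 4 ^ (2 * k)" using c2 A by (intro mult_right_mono mult_left_mono) auto
  finally have t1: "Z\<^sup>2 \<le> A ^ 4 * c0 * 4 ^ (2 * k)" .
  have "A ^ 3 * c0 * 4 ^ (2 * k) \<le> A ^ 4 * c0 * 4 ^ (2 * k)" using A34 c0 by (intro mult_right_mono) auto
  then have t2: "Z * Y \<le> A ^ 4 * c0 * 4 ^ (2 * k)" using YZ by linarith
  have "(Y * \<mu>)\<^sup>2 \<le> (A * c0 * 4 ^ k)\<^sup>2" using Ymu Y0 mu0 by (intro power_mono) auto
  also have "\<dots> = A\<^sup>2 * (c0 * c0) * 4 ^ (2 * k)" unfolding power_mult_distrib k4 by (simp add: power2_eq_square)
  also have "\<dots> \<le> A ^ 4 * c0 * 4 ^ (2 * k)" using c2 A34 c0 A by (intro mult_right_mono mult_mono) auto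
  finally have t3: "(Y * \<mu>)\<^sup>2 \<le> A ^ 4 * c0 * 4 ^ (2 * k)" .
  show ?thesis using t1 t2 t3 by (simp add: algebra_simps)
qed

text \<open>When \<open>E\<close> is the largest possible size \<open>A * X / D1 ^ k\<close> of the
  cofactors, the two prefactors depend on \<open>D1\<close> and \<open>D2\<close> only through their
  product.\<close>

lemma pade_scale_identity:
  fixes D1 D2 A X :: real
  assumes "D1 > 0" "D2 > 0" "b \<le> k"
  shows "(A * X / D1 ^ k)\<^sup>2 * D2 ^ (2 * b) * (D1 / D2) ^ (k + b) = A\<^sup>2 * X\<^sup>2 / (D1 * D2) ^ (k - b)"
    "A * X / D1 ^ k * D2 ^ (2 * b) / D2 ^ k * (D1 / D2) ^ b = A * X / (D1 * D2) ^ (k - b)"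
proof -
  have k: "D1 ^ k = D1 ^ b * D1 ^ (k - b)" "D2 ^ k = D2 ^ b * D2 ^ (k - b)" using assms by (simp_all add: power_add[symmetric])
  have e: "D1 ^ (k + b) = D1 ^ b * D1 ^ (k - b) * D1 ^ b" "D2 ^ (k + b) = D2 ^ b * D2 ^ (k - b) * D2 ^ b" "D2 ^ (2 * b) = D2 ^ b * D2 ^ b"
    unfolding k[symmetric] by (simp_all add: power_add mult_2)
  have nz: "D1 ^ b \<noteq> 0" "D1 ^ (k - b) \<noteq> 0" "D2 ^ b \<noteq> 0" "D2 ^ (k - b) \<noteq> 0" using assms by auto
  show "(A * X / D1 ^ k)\<^sup>2 * D2 ^ (2 * b) * (D1 / D2) ^ (k + b) = A\<^sup>2 * X\<^sup>2 / (D1 * D2) ^ (k - b)"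
  proof -
    have "(A * X / (p * q))\<^sup>2 * (r * r) * (p * q * p / (r * t * r)) = A\<^sup>2 * X\<^sup>2 / (q * t)"
      if "p \<noteq> 0" "q \<noteq> 0" "r \<noteq> 0" "t \<noteq> 0" for p q r t :: real
      using that by (simp add: power2_eq_square)
    from this[OF nz] show ?thesis unfolding power_divide[of D1 D2] e power_mult_distrib[of D1 D2] k .
  qed
  show "A * X / D1 ^ k * D2 ^ (2 * b) / D2 ^ k * (D1 / D2) ^ b = A * X / (D1 * D2) ^ (k - b)"
  proof -
    have "A * X / (p * q) * (r * r) / (r * t) * (p / r) = A * X / (q * t)" if "p \<noteq> 0" "r \<noteq> 0" for p q r t :: real
      using that by simp
    from this[OF nz(1,3)] show ?thesis unfolding power_divide[of D1 D2] e power_mult_distrib[of D1 D2] k .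
  qed
qed

section \<open>Dyadic families\<close>

text \<open>
  Here \<open>u ^ (2 * k + 1)\<close> is the range of the variable \<open>n\<close>, \<open>v\<close> is a pair of primes whose \<open>k\<close>-th
  powers divide the two linear forms, and \<open>e\<close>, \<open>f\<close> are the cofactors. The last condition
  excludes small \<open>n\<close> and makes the ratios \<open>e v / f v\<close> distinct.
\<close>
definition dyadic_family ::
  "nat \<Rightarrow> int \<Rightarrow> real \<Rightarrow> real \<Rightarrow> real \<Rightarrow> real \<Rightarrow> (int \<times> int \<Rightarrow> int) \<Rightarrow> (int \<times> int \<Rightarrow> int) \<Rightarrow> (int \<times> int) set \<Rightarrow> bool" where
  "dyadic_family k h A u D1 D2 e f S \<longleftrightarrow>
     finite S \<and> 1 \<le> u \<and> 0 < D1 \<and> 0 < D2 \<and> D1 \<le> u ^ 2 \<and> D2 \<le> u ^ 2 \<and> u ^ 3 / 4 \<le> D1 * D2 \<and>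
     (\<forall>v\<in>S. prime (fst v) \<and> prime (snd v) \<and> fst v \<noteq> snd v \<and>
        D1 < real_of_int (fst v) \<and> real_of_int (fst v) \<le> 2 * D1 \<and>
        D2 < real_of_int (snd v) \<and> real_of_int (snd v) \<le> 2 * D2 \<and>
        e v * fst v ^ k - f v * snd v ^ k = h \<and> e v \<noteq> 0 \<and> f v \<noteq> 0 \<and>
        \<bar>real_of_int (e v)\<bar> \<le> A * u ^ (2 * k + 1) / D1 ^ k \<and>
        \<bar>real_of_int (f v)\<bar> \<le> A * u ^ (2 * k + 1) / D2 ^ k \<and>
        (2 * \<bar>real_of_int h\<bar> * 4 ^ k + 1) * (D1 * D2) \<le> \<bar>real_of_int (e v)\<bar> * real_of_int (fst v) ^ k)"

lemma dyadic_familyD: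
  assumes "dyadic_family k h A u D1 D2 e f S"
  shows "finite S" "1 \<le> u" "0 < D1" "0 < D2" "D1 \<le> u ^ 2" "D2 \<le> u ^ 2" "u ^ 3 / 4 \<le> D1 * D2"
    "\<And>v. v \<in> S \<Longrightarrow> prime (fst v)" "\<And>v. v \<in> S \<Longrightarrow> prime (snd v)" "\<And>v. v \<in> S \<Longrightarrow> fst v \<noteq> snd v"
    "\<And>v. v \<in> S \<Longrightarrow> D1 < real_of_int (fst v)" "\<And>v. v \<in> S \<Longrightarrow> real_of_int (fst v) \<le> 2 * D1"
    "\<And>v. v \<in> S \<Longrightarrow> D2 < real_of_int (snd v)" "\<And>v. v \<in> S \<Longrightarrow> real_of_int (snd v) \<le> 2 * D2"
    "\<And>v. v \<in> S \<Longrightarrow> e v * fst v ^ k - f v * snd v ^ k = h" "\<And>v. v \<in> S \<Longrightarrow> e v \<noteq> 0" "\<And>v. v \<in> S \<Longrightarrow> f v \<noteq> 0"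
    "\<And>v. v \<in> S \<Longrightarrow> \<bar>real_of_int (e v)\<bar> \<le> A * u ^ (2 * k + 1) / D1 ^ k"
    "\<And>v. v \<in> S \<Longrightarrow> \<bar>real_of_int (f v)\<bar> \<le> A * u ^ (2 * k + 1) / D2 ^ k"
    "\<And>v. v \<in> S \<Longrightarrow> (2 * \<bar>real_of_int h\<bar> * 4 ^ k + 1) * (D1 * D2) \<le> \<bar>real_of_int (e v)\<bar> * real_of_int (fst v) ^ k"
  using assms unfolding dyadic_family_def by blast+

text \<open>The product \<open>D1 * D2\<close> is at least \<open>u ^ 3 / 4\<close>, while neither
  factor exceeds \<open>u ^ 2\<close>.\<close>

lemma dyadic_family_ge:
  assumes F: "dyadic_family k h A u D1 D2 e f S"
  shows "u / 4 \<le> D1" "u / 4 \<le> D2" "D1 * D2 \<le> u ^ 4"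
proof -
  note D = dyadic_familyD[OF F]
  have u: "u ^ 2 > 0" "u ^ 3 = u * u ^ 2" using D(2) by (auto simp: power2_eq_square power3_eq_cube)
  have "u ^ 3 / 4 \<le> D1 * u ^ 2" using D by (meson mult_left_mono order_trans less_imp_le)
  then have "(u / 4) * u ^ 2 \<le> D1 * u ^ 2" using u by simp
  then show "u / 4 \<le> D1" using u(1) by (rule mult_right_le_imp_le)
  have "u ^ 3 / 4 \<le> u ^ 2 * D2" using D by (meson mult_right_mono order_trans less_imp_le)
  then have "(u / 4) * u ^ 2 \<le> D2 * u ^ 2" using u by (simp add: mult.commute)
  then show "u / 4 \<le> D2" using u(1) by (rule mult_right_le_imp_le)
  have "D1 * D2 \<le> u ^ 2 * u ^ 2" using D by (intro mult_mono) auto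
  then show "D1 * D2 \<le> u ^ 4" by (simp add: power_add[symmetric])
qed

lemma dyadic_family_distinct_ratios:
  assumes F: "dyadic_family k h A u D1 D2 e f S" and k: "k \<ge> 1" and vw: "v \<in> S" "w \<in> S" "v \<noteq> w"
  shows "e v * f w \<noteq> e w * f v"
proof -
  note D = dyadic_familyD[OF F]
  have pos: "fst z > 0" "snd z > 0" if "z \<in> S" for z using D(8,9)[OF that] by (auto intro: prime_gt_0_int)
  have "fst v * snd w \<noteq> fst w * snd v"
  proof
    assume eq: "fst v * snd w = fst w * snd v"
    then have "fst v dvd fst w * snd v" by (metis dvd_triv_left)
    then have "fst v dvd fst w" using D(8,9,10)[OF vw(1)] prime_dvd_mult_iff primes_dvd_imp_eq by blast
    then have "fst v = fst w" using D(8) vw primes_dvd_imp_eq by blast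
    then show False using eq pos[OF vw(1)] vw(3) by (auto simp: prod_eq_iff)
  qed
  then show ?thesis
    using distinct_ratios[where K = "2 * \<bar>real_of_int h\<bar> * 4 ^ k + 1", OF k pos[OF vw(1)] pos[OF vw(2)] D(3,4)
        D(11-14)[OF vw(1)] D(11-14)[OF vw(2)] D(15)[OF vw(1)] D(15)[OF vw(2)] _ D(20)[OF vw(1)] D(20)[OF vw(2)]]
    by simp
qed

lemma card_int_abs_le:
  fixes E :: real
  assumes "E \<ge> 0"
  shows "finite {e::int. \<bar>real_of_int e\<bar> \<le> E}" "real (card {e::int. \<bar>real_of_int e\<bar> \<le> E}) \<le> 2 * E + 1"
proof -
  have eq: "{e::int. \<bar>real_of_int e\<bar> \<le> E} = {- \<lfloor>E\<rfloor>..\<lfloor>E\<rfloor>}"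
  proof (intro set_eqI iffI)
    fix e assume "e \<in> {e::int. \<bar>real_of_int e\<bar> \<le> E}"
    then have "e \<le> \<lfloor>E\<rfloor>" "- e \<le> \<lfloor>E\<rfloor>" unfolding le_floor_iff by auto
    then show "e \<in> {- \<lfloor>E\<rfloor>..\<lfloor>E\<rfloor>}" by auto
  next
    fix e assume "e \<in> {- \<lfloor>E\<rfloor>..\<lfloor>E\<rfloor>}"
    then have "e \<le> \<lfloor>E\<rfloor>" "- e \<le> \<lfloor>E\<rfloor>" by auto
    then show "e \<in> {e::int. \<bar>real_of_int e\<bar> \<le> E}" unfolding le_floor_iff by auto
  qed
  show "finite {e::int. \<bar>real_of_int e\<bar> \<le> E}" unfolding eq by simp
  have "\<lfloor>E\<rfloor> \<ge> 0" using assms by simp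
  then have "real (card {- \<lfloor>E\<rfloor>..\<lfloor>E\<rfloor>}) = 2 * real_of_int \<lfloor>E\<rfloor> + 1" by simp
  then show "real (card {e::int. \<bar>real_of_int e\<bar> \<le> E}) \<le> 2 * E + 1"
    unfolding eq using of_int_floor_le[of E] by linarith
qed

text \<open>By the distinct ratios \<open>(e v, f v)\<close> determines \<open>v\<close>, and the
  number of such pairs is of order \<open>u ^ 10 / (D1 * D2)\<^sup>2\<close>. This is at most
  \<open>u ^ 3\<close> when \<open>(D1 * D2 / u ^ 3)\<^sup>2 \<ge> u\<close>, which is the range
  that \<open>dyadic_family_card_line\<close> leaves open.\<close>

lemma dyadic_family_card_trivial:
  assumes F: "dyadic_family 2 h A u D1 D2 e f S" and A: "A \<ge> 1" and big: "(D1 * D2 / u ^ 3)\<^sup>2 \<ge> u"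
  shows "real (card S) \<le> 9 * A\<^sup>2 * u ^ 3"
proof (cases "S = {}")
  case False
  note D = dyadic_familyD[OF F]
  define E1 E2 where "E1 = A * u ^ 5 / D1\<^sup>2" "E2 = A * u ^ 5 / D2\<^sup>2"
  have E: "\<bar>real_of_int (e v)\<bar> \<le> E1" "\<bar>real_of_int (f v)\<bar> \<le> E2" if "v \<in> S" for v
    using D(18,19)[OF that] unfolding E1_E2_def by simp_all
  obtain v0 where v0: "v0 \<in> S" using False by blast
  have "1 \<le> \<bar>real_of_int (e v0)\<bar>" "1 \<le> \<bar>real_of_int (f v0)\<bar>"
    using D(16,17)[OF v0] by (metis of_int_1_le_iff of_int_abs zero_less_abs_iff int_one_le_iff_zero_less)+
  then have E1: "E1 \<ge> 1" "E2 \<ge> 1" using E[OF v0] by linarith+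
  have inj: "inj_on (\<lambda>v. (e v, f v)) S"
    using dyadic_family_distinct_ratios[OF F] by (intro inj_onI) (metis one_le_numeral prod.inject)
  have "card S = card ((\<lambda>v. (e v, f v)) ` S)" by (rule card_image[OF inj, symmetric])
  also have "\<dots> \<le> card ({e::int. \<bar>real_of_int e\<bar> \<le> E1} \<times> {e::int. \<bar>real_of_int e\<bar> \<le> E2})"
    using E E1 by (intro card_mono finite_cartesian_product card_int_abs_le) auto
  finally have "real (card S) \<le> real (card {e::int. \<bar>real_of_int e\<bar> \<le> E1}) * real (card {e::int. \<bar>real_of_int e\<bar> \<le> E2})"
    unfolding card_cartesian_product by (simp only: of_nat_le_iff of_nat_mult[symmetric])
  also have "\<dots> \<le> (3 * E1) * (3 * E2)"
    using card_int_abs_le(2)[of E1] card_int_abs_le(2)[of E2] E1 by (intro mult_mono) auto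
  also have "\<dots> = 9 * A\<^sup>2 * (u ^ 10 / (D1 * D2)\<^sup>2)"
  proof -
    have "u ^ 10 = u ^ 5 * u ^ 5" by (simp add: power_add[symmetric])
    then show ?thesis unfolding E1_E2_def by (simp add: power2_eq_square ac_simps)
  qed
  also have "\<dots> \<le> 9 * A\<^sup>2 * u ^ 3"
  proof (rule mult_left_mono)
    have u0: "u > 0" using D(2) by simp
    have "u * (u ^ 3)\<^sup>2 \<le> (D1 * D2)\<^sup>2" using big u0 unfolding power_divide by (simp add: pos_le_divide_eq)
    then have "u ^ 3 * (u * (u ^ 3)\<^sup>2) \<le> u ^ 3 * (D1 * D2)\<^sup>2" using u0 by (intro mult_left_mono) auto
    moreover have "u ^ 3 * (u * (u ^ 3)\<^sup>2) = u ^ 10" by (simp add: eval_nat_numeral)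
    ultimately show "u ^ 10 / (D1 * D2)\<^sup>2 \<le> u ^ 3" using D(3,4) by (simp add: pos_divide_le_eq)
  qed simp
  finally show ?thesis .
qed (use A dyadic_familyD(2)[OF F] in auto)

text \<open>For an interval of length \<open>\<Lambda> = c0 * W / u ^ 3 * (D1 / D2)\<close> one has
  \<open>D2\<^sup>2 * \<Lambda> = c0 * W ^ 3\<close>. So the curve term of
  \<open>card_interval_le\<close> is of order \<open>W\<close>, and the threshold
  \<open>J = W ^ 2\<close> for lines brings its last term to the same order.\<close>

lemma dyadic_family_card_interval:
  fixes k :: nat and h :: int and A \<epsilon> :: real
  assumes k: "k \<ge> 2" and h: "h \<noteq> 0" and A: "A \<ge> 1" and \<epsilon>: "\<epsilon> > 0"
  obtains c0 C :: real where "0 < c0" "c0 < 1/2" "C > 0"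
    "\<And>u D1 D2 e f S a W T. dyadic_family k h A u D1 D2 e f S \<Longrightarrow> W = sqrt (D1 * D2 / u ^ 3) \<Longrightarrow> T \<subseteq> S \<Longrightarrow>
       (\<And>v. v \<in> T \<Longrightarrow> a \<le> real_of_int (fst v) / real_of_int (snd v) \<and>
          real_of_int (fst v) / real_of_int (snd v) \<le> a + c0 * W / u ^ 3 * (D1 / D2)) \<Longrightarrow>
       real (card {v\<in>T. \<not> (k = 2 \<and> line_point h e D2 (D1 * D2 / u ^ 3) v)}) \<le> C * u powr \<epsilon> * W"
proof -
  \<comment> \<open>The integer nearest to \<open>k / 3\<close>. For \<open>k = 2\<close> it is 1,
    and this is the only case without the gap \<open>b + 2 \<le> k\<close>.\<close>
  define b where "b = (k + 1) div 3"
  have b: "3 * b \<le> k + 1" "k \<le> 3 * b + 1" "b \<ge> 1" "b < k" "b + 2 \<le> k \<or> k = 2 \<and> b = 1"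
    unfolding b_def using k by presburger+
  obtain C1 where C1: "C1 > 0" and pf: "\<And>D1 D2 E \<mu> T e f v1 v2 v3 v4. D1 > 0 \<Longrightarrow> D2 > 0 \<Longrightarrow> E > 0 \<Longrightarrow>
      (\<And>v. v \<in> T \<Longrightarrow> D1 < real_of_int (fst v) \<and> real_of_int (fst v) \<le> 2 * D1 \<and> D2 < real_of_int (snd v) \<and>
          real_of_int (snd v) \<le> 2 * D2 \<and> \<bar>real_of_int (e v)\<bar> \<le> E \<and> e v * fst v ^ k - f v * snd v ^ k = h) \<Longrightarrow>
      (\<And>v w. v \<in> T \<Longrightarrow> w \<in> T \<Longrightarrow> \<bar>real_of_int (fst v) / real_of_int (snd v) - real_of_int (fst w) / real_of_int (snd w)\<bar> \<le> \<mu> * (D1 / D2)) \<Longrightarrow>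
      C1 * ((E\<^sup>2 * D2 ^ (2 * b) * (D1 / D2) ^ (k + b) * \<mu> ^ (2 * b + 1))\<^sup>2
         + (E\<^sup>2 * D2 ^ (2 * b) * (D1 / D2) ^ (k + b) * \<mu> ^ (2 * b + 1)) * (E * D2 ^ (2 * b) / D2 ^ k * (D1 / D2) ^ b)
         + (E * D2 ^ (2 * b) / D2 ^ k * (D1 / D2) ^ b * \<mu>)\<^sup>2) < 1 \<Longrightarrow>
      v1 \<in> T \<Longrightarrow> v2 \<in> T \<Longrightarrow> v3 \<in> T \<Longrightarrow> v4 \<in> T \<Longrightarrow>
       pade_pairing k b e f v1 v2 * pade_pairing k b e f v3 v4
       - pade_pairing k b e f v1 v3 * pade_pairing k b e f v2 v4
       + pade_pairing k b e f v1 v4 * pade_pairing k b e f v2 v3 = 0"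
  proof (rule pade_pairing_pfaffian_eq_0[where h = h, OF b(4)], goal_cases)
    case (1 C)
    show ?case by (rule 1(1)) (fact 1)+
  qed
  \<comment> \<open>The integers attached to a family are of order at most
    \<open>u ^ (2 * k + 2)\<close>, and this power raised to \<open>\<delta>\<close> is
    \<open>u powr \<epsilon>\<close>.\<close>
  define \<delta> where "\<delta> = \<epsilon> / real (2 * k + 2)"
  have \<delta>: "\<delta> > 0" unfolding \<delta>_def using \<epsilon> by simp
  obtain C2 where C2: "C2 > 0" and interval: "\<And>T e f X D a \<Lambda> J. finite T \<Longrightarrow> X \<ge> 2 \<Longrightarrow> D > 0 \<Longrightarrow> \<Lambda> > 0 \<Longrightarrow> J > 0 \<Longrightarrow>
      (\<And>v. v \<in> T \<Longrightarrow> prime (fst v) \<and> prime (snd v) \<and> fst v \<noteq> snd v \<and> e v \<noteq> 0 \<and> f v \<noteq> 0 \<and>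
        \<bar>fst v\<bar> \<le> X \<and> \<bar>snd v\<bar> \<le> X \<and> \<bar>e v\<bar> \<le> X \<and> \<bar>f v\<bar> \<le> X \<and>
        D < real_of_int (snd v) \<and> real_of_int (snd v) \<le> 2 * D \<and> a \<le> real_of_int (fst v) / real_of_int (snd v)
        \<and> real_of_int (fst v) / real_of_int (snd v) \<le> a + \<Lambda> \<and> e v * fst v ^ k - f v * snd v ^ k = h) \<Longrightarrow>
      (\<And>v w. v \<in> T \<Longrightarrow> w \<in> T \<Longrightarrow> v \<noteq> w \<Longrightarrow> e v * f w \<noteq> e w * f v) \<Longrightarrow>
      inj_on snd T \<Longrightarrow>
      (\<And>v1 v2 v3 v4. v1 \<in> T \<Longrightarrow> v2 \<in> T \<Longrightarrow> v3 \<in> T \<Longrightarrow> v4 \<in> T \<Longrightarrow>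
       pade_pairing k b e f v1 v2 * pade_pairing k b e f v3 v4
       - pade_pairing k b e f v1 v3 * pade_pairing k b e f v2 v4
       + pade_pairing k b e f v1 v4 * pade_pairing k b e f v2 v3 = 0) \<Longrightarrow>
      real (card {v\<in>T. \<not> (k = 2 \<and> line_point h e D J v)}) \<le>
        C2 * real_of_int X powr \<delta> * (1 + (D\<^sup>2 * \<Lambda>) powr (1 / 3) + D\<^sup>2 * \<Lambda> / J)"
  proof (rule card_interval_le[OF b(3,4,5) h \<delta>], goal_cases)
    case (1 C)
    show ?case by (rule 1(1)) (fact 1)+
  qed
  define R where "R = 3 * A ^ 4 * 4 ^ (2 * k)"
  have R: "R > 0" unfolding R_def using A by simp
  \<comment> \<open>The bound \<open>1 / (2 * C1 * R)\<close> makes the Pfaffians smaller than 1;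
    the bound \<open>1/3\<close> makes \<open>2 * c0 < 1\<close>, which gives injectivity of
    \<open>snd\<close> on an interval.\<close>
  define c0 where "c0 = min (1/3) (1 / (2 * C1 * R))"
  have c0: "0 < c0" "c0 < 1/2" "c0 \<le> 1" unfolding c0_def using C1 R by auto
  have c0R: "C1 * (c0 * R) < 1"
  proof -
    have "C1 * (c0 * R) \<le> C1 * (1 / (2 * C1 * R) * R)" using C1 R unfolding c0_def by (intro mult_left_mono mult_right_mono) auto
    also have "\<dots> = 1/2" using C1 R by simp
    finally show ?thesis by simp
  qed
  define B where "B = A * 4 ^ k + 3"
  have B: "B \<ge> 3" unfolding B_def using A by simp
  define C where "C = C2 * B powr \<delta> * 4"
  have C: "C > 0" unfolding C_def using C2 B by simp
  show ?thesis
  proof (rule that[OF c0(1,2) C])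
    fix u D1 D2 a W :: real and e f S T
    assume F: "dyadic_family k h A u D1 D2 e f S" and W: "W = sqrt (D1 * D2 / u ^ 3)" and TS: "T \<subseteq> S"
      and TI: "\<And>v. v \<in> T \<Longrightarrow> a \<le> real_of_int (fst v) / real_of_int (snd v) \<and>
          real_of_int (fst v) / real_of_int (snd v) \<le> a + c0 * W / u ^ 3 * (D1 / D2)"
    note D = dyadic_familyD[OF F] and G = dyadic_family_ge[OF F]
    have u0: "u > 0" using D(2) by simp
    have W2: "W ^ 2 = D1 * D2 / u ^ 3" unfolding W using D u0 by simp
    have P: "D1 * D2 = u ^ 3 * W ^ 2" unfolding W2 using u0 by simp
    have Wh: "1/2 \<le> W"
    proof -
      have "(1/2)\<^sup>2 \<le> D1 * D2 / u ^ 3" using D(7) u0 by (simp add: pos_le_divide_eq power2_eq_square)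
      then show ?thesis unfolding W by (rule real_le_rsqrt)
    qed
    have Wu: "W ^ 2 \<le> u"
    proof -
      have "D1 * D2 \<le> u * u ^ 3" using G(3) by (simp add: power4_eq_xxxx power3_eq_cube)
      then show ?thesis unfolding W2 using u0 by (simp add: pos_divide_le_eq)
    qed
    have W0: "W > 0" using Wh by simp
    have WU: "W \<le> u"
    proof (rule power2_le_imp_le)
      have "u * 1 \<le> u * u" using D(2) u0 by (intro mult_left_mono) auto
      then show "W\<^sup>2 \<le> u\<^sup>2" using Wu unfolding power2_eq_square by linarith
    qed (use u0 in simp)
    define \<mu> where "\<mu> = c0 * W / u ^ 3"
    have mu: "\<mu> > 0" unfolding \<mu>_def using c0 W0 u0 by simp
    define E where "E = A * u ^ (2 * k + 1) / D1 ^ k"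
    have E0: "E > 0" unfolding E_def using A D(3) u0 by simp
    have small: "C1 * ((E\<^sup>2 * D2 ^ (2 * b) * (D1 / D2) ^ (k + b) * \<mu> ^ (2 * b + 1))\<^sup>2
         + (E\<^sup>2 * D2 ^ (2 * b) * (D1 / D2) ^ (k + b) * \<mu> ^ (2 * b + 1)) * (E * D2 ^ (2 * b) / D2 ^ k * (D1 / D2) ^ b)
         + (E * D2 ^ (2 * b) / D2 ^ k * (D1 / D2) ^ b * \<mu>)\<^sup>2) < 1" (is "C1 * ?Q < 1")
    proof -
      have u2: "(u ^ (2 * k + 1))\<^sup>2 = u ^ (4 * k + 2)" unfolding power_mult[symmetric] by (simp add: algebra_simps)
      have "?Q \<le> c0 * R"
        unfolding E_def pade_scale_identity[OF D(3,4) less_imp_le[OF b(4)], of A "u ^ (2 * k + 1)"] u2 P R_def \<mu>_def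
        by (rule pade_parameters_small[OF b(1-4) A D(2) Wh Wu c0(1,3)])
      then have "C1 * ?Q \<le> C1 * (c0 * R)" using C1 by (intro mult_left_mono) auto
      then show ?thesis using c0R by linarith
    qed
    have close: "\<bar>real_of_int (fst v) / real_of_int (snd v) - real_of_int (fst w) / real_of_int (snd w)\<bar> \<le> \<mu> * (D1 / D2)"
      if "v \<in> T" "w \<in> T" for v w
      using TI[OF that(1)] TI[OF that(2)] unfolding \<mu>_def abs_le_iff by linarith
    have pfaff: "pade_pairing k b e f v1 v2 * pade_pairing k b e f v3 v4
       - pade_pairing k b e f v1 v3 * pade_pairing k b e f v2 v4
       + pade_pairing k b e f v1 v4 * pade_pairing k b e f v2 v3 = 0"
      if "v1 \<in> T" "v2 \<in> T" "v3 \<in> T" "v4 \<in> T" for v1 v2 v3 v4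
    proof (rule pf[OF D(3,4) E0 _ close small that])
      fix v assume "v \<in> T"
      then have "v \<in> S" using TS by blast
      then show "D1 < real_of_int (fst v) \<and> real_of_int (fst v) \<le> 2 * D1 \<and> D2 < real_of_int (snd v) \<and>
          real_of_int (snd v) \<le> 2 * D2 \<and> \<bar>real_of_int (e v)\<bar> \<le> E \<and> e v * fst v ^ k - f v * snd v ^ k = h"
        using D unfolding E_def by blast
    qed
    \<comment> \<open>Equal second coordinates and close ratios force the first coordinates to
      differ by at most \<open>2 * c0 * (W * D1 / u ^ 3)\<close>, which is below 1 because
      \<open>W \<le> u\<close> and \<open>D1 \<le> u ^ 2\<close>.\<close>
    have inj: "inj_on snd T"
    proof (rule inj_onI)
      fix v w assume vw: "v \<in> T" "w \<in> T" "snd v = snd w"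
      have vS: "v \<in> S" using vw TS by blast
      define y where "y = real_of_int (snd v)"
      have y: "0 < y" "y \<le> 2 * D2" unfolding y_def using D(4) D(13,14)[OF vS] by linarith+
      have "\<bar>real_of_int (fst v) - real_of_int (fst w)\<bar> = y * \<bar>real_of_int (fst v) / y - real_of_int (fst w) / y\<bar>"
        using y by (simp add: diff_divide_distrib[symmetric])
      also have "\<dots> \<le> 2 * D2 * (\<mu> * (D1 / D2))"
        using close[OF vw(1,2)] y mu D(3,4) unfolding vw(3)[symmetric] y_def[symmetric] by (intro mult_mono) auto
      also have "\<dots> = 2 * c0 * (W * D1 / u ^ 3)" unfolding \<mu>_def using D(4) by simp
      also have "\<dots> \<le> 2 * c0 * 1"
      proof (rule mult_left_mono)
        have "W * D1 \<le> u * u ^ 2" using WU D(3,5) u0 by (intro mult_mono) auto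
        then show "W * D1 / u ^ 3 \<le> 1" using u0 by (simp add: power2_eq_square power3_eq_cube)
      qed (use c0 in simp)
      also have "\<dots> < 1" using c0 by simp
      finally have "\<bar>real_of_int (fst v - fst w)\<bar> < 1" by simp
      then have "fst v = fst w" by linarith
      then show "v = w" using vw(3) by (simp add: prod_eq_iff)
    qed
    \<comment> \<open>A common bound for all integers attached to the points. The factor
      \<open>4 ^ k\<close> comes from \<open>D1\<close>, \<open>D2\<close> being at least
      \<open>u / 4\<close>.\<close>
    define X where "X = \<lceil>A * 4 ^ k * u ^ (2 * k + 2)\<rceil> + 2"
    have AX: "A * 4 ^ k * u ^ (2 * k + 2) + 2 \<le> real_of_int X" unfolding X_def by simp
    have XB: "real_of_int X \<le> B * u ^ (2 * k + 2)"
    proof -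
      have "1 \<le> u ^ (2 * k + 2)" using D(2) by (rule one_le_power)
      moreover have "real_of_int (\<lceil>z\<rceil> + 2) \<le> z + 3 * w" if "1 \<le> w" for z w :: real using that by linarith
      ultimately show ?thesis unfolding X_def B_def distrib_right by blast
    qed
    have "0 \<le> A * 4 ^ k * u ^ (2 * k + 2)" using A u0 by simp
    then have X2: "X \<ge> 2" unfolding X_def by simp
    have coefle: "A * u ^ (2 * k + 1) / d ^ k \<le> A * 4 ^ k * u ^ (2 * k + 2)" if "u / 4 \<le> d" for d
    proof -
      have "1 \<le> (4 * d / u) ^ k" using that u0 by (intro one_le_power) simp
      then have "u ^ k \<le> 4 ^ k * d ^ k" using u0 by (simp add: power_divide power_mult_distrib)
      then have "1 \<le> 4 ^ k * d ^ k" using one_le_power[OF D(2), of k] by linarith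
      then have "u ^ (2 * k + 1) * 1 \<le> u ^ (2 * k + 2) * (4 ^ k * d ^ k)" using D(2) by (intro mult_mono power_increasing) auto
      then have "A * u ^ (2 * k + 1) \<le> A * (u ^ (2 * k + 2) * (4 ^ k * d ^ k))" using A by (intro mult_left_mono) auto
      moreover have "d > 0" using that u0 by linarith
      ultimately show ?thesis by (simp add: pos_divide_le_eq ac_simps)
    qed
    have smalle: "2 * u\<^sup>2 \<le> A * 4 ^ k * u ^ (2 * k + 2)"
    proof -
      have "(4::real) ^ 1 \<le> 4 ^ k" using k by (intro power_increasing) auto
      then have "1 * 2 \<le> A * 4 ^ k" using A by (intro mult_mono) auto
      then show ?thesis using D(2) by (intro mult_mono power_increasing) auto
    qed
    have intle: "\<bar>z\<bar> \<le> X" if "\<bar>real_of_int z\<bar> \<le> A * 4 ^ k * u ^ (2 * k + 2)" for z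
      using that AX by linarith
    have res: "real (card {v\<in>T. \<not> (k = 2 \<and> line_point h e D2 (W ^ 2) v)}) \<le>
        C2 * real_of_int X powr \<delta> * (1 + (D2\<^sup>2 * (\<mu> * (D1 / D2))) powr (1 / 3) + D2\<^sup>2 * (\<mu> * (D1 / D2)) / W ^ 2)"
    proof (rule interval[where f = f and a = a])
      show "finite T" using D(1) TS by (rule finite_subset[rotated])
      fix v assume vT: "v \<in> T"
      then have v: "v \<in> S" using TS by blast
      have pos: "fst v > 0" "snd v > 0" using D(8,9)[OF v] by (auto intro: prime_gt_0_int)
      have "\<bar>real_of_int (fst v)\<bar> \<le> A * 4 ^ k * u ^ (2 * k + 2)" "\<bar>real_of_int (snd v)\<bar> \<le> A * 4 ^ k * u ^ (2 * k + 2)"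
        using D(12,14)[OF v] D(5,6) smalle pos by auto
      moreover have "\<bar>real_of_int (e v)\<bar> \<le> A * 4 ^ k * u ^ (2 * k + 2)" "\<bar>real_of_int (f v)\<bar> \<le> A * 4 ^ k * u ^ (2 * k + 2)"
        using D(18,19)[OF v] coefle[OF G(1)] coefle[OF G(2)] by linarith+
      ultimately show "prime (fst v) \<and> prime (snd v) \<and> fst v \<noteq> snd v \<and> e v \<noteq> 0 \<and> f v \<noteq> 0 \<and>
        \<bar>fst v\<bar> \<le> X \<and> \<bar>snd v\<bar> \<le> X \<and> \<bar>e v\<bar> \<le> X \<and> \<bar>f v\<bar> \<le> X \<and>
        D2 < real_of_int (snd v) \<and> real_of_int (snd v) \<le> 2 * D2 \<and> a \<le> real_of_int (fst v) / real_of_int (snd v)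
        \<and> real_of_int (fst v) / real_of_int (snd v) \<le> a + \<mu> * (D1 / D2) \<and> e v * fst v ^ k - f v * snd v ^ k = h"
        using D(8-17)[OF v] intle TI[OF vT] unfolding \<mu>_def by blast
    next
      fix v w assume "v \<in> T" "w \<in> T" "v \<noteq> w"
      then show "e v * f w \<noteq> e w * f v" using dyadic_family_distinct_ratios[OF F, of v w] TS k by auto
    qed (use X2 D(3,4) mu W0 inj pfaff in auto)
    have Q: "D2\<^sup>2 * (\<mu> * (D1 / D2)) = c0 * W ^ 3"
    proof -
      have "D2\<^sup>2 * (\<mu> * (D1 / D2)) = \<mu> * (D1 * D2)" using D(4) by (simp add: power2_eq_square)
      also have "\<dots> = c0 * W ^ 3" unfolding P \<mu>_def using u0 by (simp add: power2_eq_square power3_eq_cube)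
      finally show ?thesis .
    qed
    have q1: "(D2\<^sup>2 * (\<mu> * (D1 / D2))) powr (1 / 3) \<le> W"
    proof -
      have "(c0 * W ^ 3) powr (1/3) \<le> (W ^ 3) powr (1/3)" using c0 W0 by (intro powr_mono2) (auto simp: mult_le_cancel_right1)
      also have "\<dots> = (W powr 3) powr (1/3)" using W0 by (simp add: powr_numeral)
      also have "\<dots> = W" using W0 by (simp only: powr_powr) simp
      finally show ?thesis unfolding Q .
    qed
    have q2: "D2\<^sup>2 * (\<mu> * (D1 / D2)) / W ^ 2 \<le> W"
    proof -
      have "c0 * W ^ 3 / W ^ 2 = c0 * W" using W0 by (simp add: power2_eq_square power3_eq_cube)
      also have "\<dots> \<le> W" using c0 W0 by (simp add: mult_le_cancel_right1)
      finally show ?thesis unfolding Q .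
    qed
    have bracket: "1 + (D2\<^sup>2 * (\<mu> * (D1 / D2))) powr (1 / 3) + D2\<^sup>2 * (\<mu> * (D1 / D2)) / W ^ 2 \<le> 4 * W"
      using q1 q2 Wh by linarith
    have Xp: "real_of_int X powr \<delta> \<le> B powr \<delta> * u powr \<epsilon>"
    proof -
      have "real_of_int X powr \<delta> \<le> (B * u ^ (2 * k + 2)) powr \<delta>" using XB X2 \<delta> by (intro powr_mono2) auto
      also have "\<dots> = B powr \<delta> * (u powr real (2 * k + 2)) powr \<delta>" using u0 by (simp only: powr_mult powr_realpow)
      also have "(u powr real (2 * k + 2)) powr \<delta> = u powr \<epsilon>" unfolding powr_powr \<delta>_def by simp
      finally show ?thesis .
    qed
    have "C2 * real_of_int X powr \<delta> * (1 + (D2\<^sup>2 * (\<mu> * (D1 / D2))) powr (1 / 3) + D2\<^sup>2 * (\<mu> * (D1 / D2)) / W ^ 2)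
      \<le> C2 * (B powr \<delta> * u powr \<epsilon>) * (4 * W)"
    proof (rule mult_mono)
      show "C2 * real_of_int X powr \<delta> \<le> C2 * (B powr \<delta> * u powr \<epsilon>)" using Xp C2 by (intro mult_left_mono) auto
      show "0 \<le> 1 + (D2\<^sup>2 * (\<mu> * (D1 / D2))) powr (1 / 3) + D2\<^sup>2 * (\<mu> * (D1 / D2)) / W ^ 2"
        unfolding Q using c0 W0 by simp
    qed (use bracket C2 in auto)
    also have "\<dots> = C * u powr \<epsilon> * W" unfolding C_def by simp
    finally show "real (card {v\<in>T. \<not> (k = 2 \<and> line_point h e D2 (D1 * D2 / u ^ 3) v)}) \<le> C * u powr \<epsilon> * W"
      using res unfolding W2[symmetric] by linarith
  qed
qed

text \<open>All ratios are within a factor 2 of \<open>D1 / D2\<close>. Of order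
  \<open>u ^ 3 / W\<close> intervals of relative length \<open>c0 * W / u ^ 3\<close> cover them,
  with order \<open>W\<close> points in each, up to \<open>u powr \<epsilon>\<close>.\<close>

lemma dyadic_family_card_nonline:
  fixes k :: nat and h :: int and A \<epsilon> :: real
  assumes k: "k \<ge> 2" and h: "h \<noteq> 0" and A: "A \<ge> 1" and \<epsilon>: "\<epsilon> > 0"
  obtains C :: real where "C > 0"
    "\<And>u D1 D2 e f S. dyadic_family k h A u D1 D2 e f S \<Longrightarrow>
       real (card {v\<in>S. \<not> (k = 2 \<and> line_point h e D2 (D1 * D2 / u ^ 3) v)}) \<le> C * u ^ 3 * u powr \<epsilon>"
proof -
  obtain c0 C where c0: "0 < c0" "c0 < 1/2" and C: "C > 0" and int:
    "\<And>u D1 D2 e f S a W T. dyadic_family k h A u D1 D2 e f S \<Longrightarrow> W = sqrt (D1 * D2 / u ^ 3) \<Longrightarrow> T \<subseteq> S \<Longrightarrow>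
       (\<And>v. v \<in> T \<Longrightarrow> a \<le> real_of_int (fst v) / real_of_int (snd v) \<and>
          real_of_int (fst v) / real_of_int (snd v) \<le> a + c0 * W / u ^ 3 * (D1 / D2)) \<Longrightarrow>
       real (card {v\<in>T. \<not> (k = 2 \<and> line_point h e D2 (D1 * D2 / u ^ 3) v)}) \<le> C * u powr \<epsilon> * W"
  proof (rule dyadic_family_card_interval[OF k h A \<epsilon>], goal_cases)
    case (1 c0 C)
    show ?case by (rule 1(1)) (fact 1)+
  qed
  define C' where "C' = C * (3 / 2 / c0 + 1)"
  have C': "C' > 0" unfolding C'_def using C c0 by (intro mult_pos_pos add_pos_pos) auto
  show ?thesis
  proof (rule that[OF C'])
    fix u D1 D2 :: real and e f S
    assume F: "dyadic_family k h A u D1 D2 e f S"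
    note D = dyadic_familyD[OF F] and G = dyadic_family_ge[OF F]
    have u0: "u > 0" using D(2) by simp
    define W where "W = sqrt (D1 * D2 / u ^ 3)"
    have W0: "W > 0" unfolding W_def using D u0 by simp
    have W2: "W ^ 2 = D1 * D2 / u ^ 3" unfolding W_def using D u0 by simp
    have Wu: "W \<le> u ^ 3"
    proof (rule power2_le_imp_le)
      have "D1 * D2 \<le> u * u ^ 3" using G(3) by (simp add: power4_eq_xxxx power3_eq_cube)
      then have "W ^ 2 \<le> u ^ 1" unfolding W2 using u0 by (simp add: pos_divide_le_eq)
      also have "\<dots> \<le> u ^ 6" using D(2) by (intro power_increasing) auto
      finally show "W\<^sup>2 \<le> (u ^ 3)\<^sup>2" by (simp add: power_mult[symmetric])
    qed (use u0 in simp)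
    define \<mu> where "\<mu> = c0 * W / u ^ 3"
    have mu: "\<mu> > 0" unfolding \<mu>_def using c0 W0 u0 by simp
    define \<Lambda> where "\<Lambda> = \<mu> * (D1 / D2)"
    have L: "\<Lambda> > 0" unfolding \<Lambda>_def using mu D by simp
    define a0 where "a0 = D1 / (2 * D2)"
    define ix where "ix = (\<lambda>v::int\<times>int. \<lfloor>(real_of_int (fst v) / real_of_int (snd v) - a0) / \<Lambda>\<rfloor>)"
    define S' where "S' = {v\<in>S. \<not> (k = 2 \<and> line_point h e D2 (D1 * D2 / u ^ 3) v)}"
    have fib: "card {v\<in>S'. ix v = y} \<le> nat \<lfloor>C * u powr \<epsilon> * W\<rfloor>" for y
    proof -
      define T where "T = {v\<in>S. ix v = y}"
      have eq: "{v\<in>S'. ix v = y} = {v\<in>T. \<not> (k = 2 \<and> line_point h e D2 (D1 * D2 / u ^ 3) v)}"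
        unfolding S'_def T_def by auto
      have "real (card {v\<in>T. \<not> (k = 2 \<and> line_point h e D2 (D1 * D2 / u ^ 3) v)}) \<le> C * u powr \<epsilon> * W"
      proof (rule int[OF F W_def, where a = "a0 + real_of_int y * \<Lambda>"])
        show "T \<subseteq> S" unfolding T_def by auto
        fix v assume "v \<in> T"
        then have "\<lfloor>(real_of_int (fst v) / real_of_int (snd v) - a0) / \<Lambda>\<rfloor> = y" unfolding T_def ix_def by simp
        then have "real_of_int y \<le> (real_of_int (fst v) / real_of_int (snd v) - a0) / \<Lambda>"
          "(real_of_int (fst v) / real_of_int (snd v) - a0) / \<Lambda> \<le> real_of_int y + 1" by linarith+
        then have "real_of_int y * \<Lambda> \<le> real_of_int (fst v) / real_of_int (snd v) - a0"
          "real_of_int (fst v) / real_of_int (snd v) - a0 \<le> (real_of_int y + 1) * \<Lambda>"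
          using L by (simp_all only: pos_le_divide_eq pos_divide_le_eq)
        then show "a0 + real_of_int y * \<Lambda> \<le> real_of_int (fst v) / real_of_int (snd v) \<and>
          real_of_int (fst v) / real_of_int (snd v) \<le> a0 + real_of_int y * \<Lambda> + c0 * W / u ^ 3 * (D1 / D2)"
          unfolding \<Lambda>_def[unfolded \<mu>_def, symmetric] distrib_right by linarith
      qed
      then show ?thesis unfolding eq by (simp add: le_nat_floor)
    qed
    have fS: "finite S'" unfolding S'_def using D(1) by simp
    have im: "ix ` S' \<subseteq> {0..\<lfloor>3 / 2 / \<mu>\<rfloor>}"
    proof
      fix y assume "y \<in> ix ` S'"
      then obtain v where v: "v \<in> S" "y = ix v" unfolding S'_def by auto
      define r where "r = D1 / D2"
      define q where "q = real_of_int (fst v) / real_of_int (snd v)"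
      have y0: "real_of_int (snd v) > 0" using D(13)[OF v(1)] D(4) by linarith
      have "D1 / (2 * D2) \<le> q" unfolding q_def using D(3,4) D(11,14)[OF v(1)] y0 by (intro frac_le) linarith+
      moreover have "q \<le> (2 * D1) / D2" unfolding q_def using D(3,4) D(12,13)[OF v(1)] y0 by (intro frac_le) linarith+
      moreover have "a0 = r / 2" "D1 / (2 * D2) = r / 2" "(2 * D1) / D2 = 2 * r" unfolding a0_def r_def by simp_all
      ultimately have "0 \<le> q - a0" "q - a0 \<le> 3 / 2 * r" by linarith+
      moreover have "3 / 2 * r / \<Lambda> = 3 / 2 / \<mu>" unfolding \<Lambda>_def r_def using D(3,4) by simp
      ultimately have "0 \<le> (q - a0) / \<Lambda>" "(q - a0) / \<Lambda> \<le> 3 / 2 / \<mu>"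
        using L divide_right_mono[of "q - a0" "3 / 2 * r" \<Lambda>] by auto
      then have "0 \<le> \<lfloor>(q - a0) / \<Lambda>\<rfloor>" "\<lfloor>(q - a0) / \<Lambda>\<rfloor> \<le> \<lfloor>3 / 2 / \<mu>\<rfloor>" using floor_mono by auto
      then show "y \<in> {0..\<lfloor>3 / 2 / \<mu>\<rfloor>}" unfolding v(2) ix_def q_def by simp
    qed
    have "card S' \<le> nat \<lfloor>C * u powr \<epsilon> * W\<rfloor> * card (ix ` S')" by (rule card_le_fibres[OF fS fib])
    also have "\<dots> \<le> nat \<lfloor>C * u powr \<epsilon> * W\<rfloor> * card {0..\<lfloor>3 / 2 / \<mu>\<rfloor>}"
      by (intro mult_left_mono card_mono im) auto
    finally have "real (card S') \<le> real (nat \<lfloor>C * u powr \<epsilon> * W\<rfloor>) * real (card {0..\<lfloor>3 / 2 / \<mu>\<rfloor>})"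
      by (simp only: of_nat_le_iff of_nat_mult[symmetric])
    also have "\<dots> \<le> (C * u powr \<epsilon> * W) * (3 / 2 / \<mu> + 1)"
    proof (rule mult_mono)
      show "real (nat \<lfloor>C * u powr \<epsilon> * W\<rfloor>) \<le> C * u powr \<epsilon> * W" using C W0 by (simp add: of_nat_floor)
      have "3 / 2 / \<mu> \<ge> 0" using mu by simp
      then have "\<lfloor>3 / 2 / \<mu>\<rfloor> \<ge> 0" by simp
      then have "real (card {0..\<lfloor>3 / 2 / \<mu>\<rfloor>}) = real_of_int \<lfloor>3 / 2 / \<mu>\<rfloor> + 1" by simp
      then show "real (card {0..\<lfloor>3 / 2 / \<mu>\<rfloor>}) \<le> 3 / 2 / \<mu> + 1" using of_int_floor_le[of "3 / 2 / \<mu>"] by linarith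
    qed (use C W0 mu in auto)
    also have "\<dots> = C * u powr \<epsilon> * (3 / 2 / c0 * u ^ 3 + W)"
    proof -
      have "t * w * (3 / 2 / (c * w / z) + 1) = t * (3 / 2 / c * z + w)" if "w > 0" "c > 0" for t w c z :: real
        using that by (simp add: distrib_left)
      from this[OF W0 c0(1)] show ?thesis unfolding \<mu>_def .
    qed
    also have "\<dots> \<le> C * u powr \<epsilon> * (3 / 2 / c0 * u ^ 3 + u ^ 3)"
      using Wu C by (intro mult_left_mono add_left_mono) auto
    also have "\<dots> = C' * u ^ 3 * u powr \<epsilon>"
    proof -
      have "C * t * (s * z + z) = C * (s + 1) * z * t" for s z t :: real by (simp add: distrib_left distrib_right)
      then show ?thesis unfolding C'_def .
    qed
    finally show "real (card {v\<in>S. \<not> (k = 2 \<and> line_point h e D2 (D1 * D2 / u ^ 3) v)}) \<le> C' * u ^ 3 * u powr \<epsilon>"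
      unfolding S'_def .
  qed
qed

text \<open>A point is recovered from \<open>m2\<close>, \<open>m1\<close>, \<open>j\<close> and the
  quotient of \<open>snd v\<close> by \<open>m2\<close>. The cubic relation bounds \<open>m2\<close>
  by \<open>M\<close>, and for given \<open>m2\<close> there are of order
  \<open>m2 * D1 / D2\<close>, \<open>w\<close> and \<open>D2 / m2\<close> choices for the other
  three. The total is of order \<open>M * D1 * w = A * u\<^sup>2 * w\<^sup>2\<close>, whence the
  condition \<open>w\<^sup>2 \<le> u\<close>.\<close>

lemma dyadic_family_card_line:
  assumes F: "dyadic_family 2 h A u D1 D2 e f S" and h: "h \<noteq> 0" and A: "A \<ge> 1" and u: "u \<ge> 144"
    and w: "w = D1 * D2 / u ^ 3" "w\<^sup>2 \<le> u"
  shows "real (card {v\<in>S. line_point h e D2 w v}) \<le> 54 * A * u ^ 3"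
proof -
  note D = dyadic_familyD[OF F] and G = dyadic_family_ge[OF F]
  have u0: "u > 0" using D(2) by simp
  have w4: "w \<ge> 1/4" unfolding w using D(7) u0 by (simp add: pos_le_divide_eq)
  \<comment> \<open>From \<open>w\<^sup>2 \<le> u\<close> and \<open>u \<ge> 144\<close> follows
    \<open>12 * w \<le> u\<close>, and \<open>D1\<close> is at least \<open>u / 4\<close>.\<close>
  have wD: "3 * w \<le> D1"
  proof -
    have "(12 * w)\<^sup>2 = 144 * w\<^sup>2" by (simp add: power2_eq_square)
    also have "\<dots> \<le> u * u" using w u by (intro mult_mono) auto
    finally have "(12 * w)\<^sup>2 \<le> u\<^sup>2" by (simp add: power2_eq_square)
    then have "12 * w \<le> u" using less_imp_le[OF u0] by (rule power2_le_imp_le)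
    then show ?thesis using G(1) by simp
  qed
  define L where "L = {v\<in>S. line_point h e D2 w v}"
  define Pr where "Pr = (\<lambda>v m1 m2 j. coprime m1 m2 \<and> 0 < m2 \<and> real_of_int m2 \<le> D2 \<and> j \<noteq> 0 \<and> \<bar>real_of_int j\<bar> \<le> w \<and>
     m2 * fst v - m1 * snd v = j \<and> e v * j ^ 3 = h * m2 ^ 2 * (m2 * fst v - 3 * m1 * snd v))"
  have "\<forall>v\<in>L. \<exists>m1 m2 j. Pr v m1 m2 j" unfolding L_def line_point_def Pr_def by auto
  then obtain m1 m2 j where ch: "\<And>v. v \<in> L \<Longrightarrow> Pr v (m1 v) (m2 v) (j v)" by metis
  have LS: "v \<in> S" if "v \<in> L" for v using that unfolding L_def by simp
  \<comment> \<open>Comes from \<open>m2 ^ 3 * D1 \<le> \<bar>e v\<bar> * \<bar>j\<bar> ^ 3\<close>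
    and the bounds for \<open>e v\<close> and \<open>j\<close>, with \<open>A * u ^ 5\<close>
    enlarged to the cube \<open>A ^ 3 * u ^ 6\<close>.\<close>
  define M where "M = A * u\<^sup>2 * w / D1"
  have M0: "M > 0" unfolding M_def using A u0 w4 D(3) by simp
  define Ms where "Ms = {m::int. 1 \<le> m \<and> real_of_int m \<le> M \<and> real_of_int m \<le> D2}"
  have Ms: "Ms \<subseteq> {1..\<lfloor>M\<rfloor>}" unfolding Ms_def by (auto simp: le_floor_iff)
  have fMs: "finite Ms" using finite_subset[OF Ms] by simp
  have cMs: "real (card Ms) \<le> M"
  proof -
    have "card Ms \<le> card {1..\<lfloor>M\<rfloor>}" using Ms by (intro card_mono) auto
    then have "real (card Ms) \<le> real (nat \<lfloor>M\<rfloor>)" by simp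
    also have "\<dots> \<le> M" using M0 by (simp add: of_nat_floor)
    finally show ?thesis .
  qed
  define g where "g = (\<lambda>v. (m2 v, m1 v, j v, snd v div m2 v))"
  define B where "B = (\<lambda>m::int. {1..\<lfloor>3 * real_of_int m * D1 / D2\<rfloor>} \<times> ({i::int. \<bar>real_of_int i\<bar> \<le> w}
      \<times> {\<lfloor>D2 / real_of_int m\<rfloor>..\<lfloor>2 * D2 / real_of_int m\<rfloor>}))"
  have inj: "inj_on g L"
  proof (rule inj_onI)
    fix v v' assume v: "v \<in> L" "v' \<in> L" and eq: "g v = g v'"
    have p: "coprime (m1 v) (m2 v)" "0 < m2 v" "m2 v * fst v - m1 v * snd v = j v"
      "m2 v' * fst v' - m1 v' * snd v' = j v'" using ch[OF v(1)] ch[OF v(2)] unfolding Pr_def by blast+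
    have q: "m2 v' = m2 v" "m1 v' = m1 v" "j v' = j v" "snd v' div m2 v = snd v div m2 v" using eq unfolding g_def by auto
    \<comment> \<open>The line fixes \<open>snd v\<close> modulo \<open>m2 v\<close>; together with
      the quotient this fixes \<open>snd v\<close>, and then the line fixes
      \<open>fst v\<close>.\<close>
    have "m2 v * (fst v - fst v') = m1 v * (snd v - snd v')" using p(3,4) unfolding q by (simp add: algebra_simps)
    then have "m2 v dvd m1 v * (snd v - snd v')" by (metis dvd_triv_left)
    then have "m2 v dvd snd v - snd v'" using p(1) coprime_dvd_mult_right_iff coprime_commute by blast
    then have "snd v mod m2 v = snd v' mod m2 v" by (rule mod_eq_dvd_iff[THEN iffD2])
    then have s: "snd v = snd v'" using q(4) by (metis mult_div_mod_eq)
    have "m2 v * (fst v - fst v') = 0" using p(3,4) s unfolding q by (simp add: algebra_simps)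
    then show "v = v'" using s p(2) by (simp add: prod_eq_iff)
  qed
  have im: "g ` L \<subseteq> Sigma Ms B"
  proof
    fix y assume "y \<in> g ` L"
    then obtain v where v: "v \<in> L" "y = g v" by blast
    note vS = LS[OF v(1)]
    define a b m n i where "a = real_of_int (fst v)" "b = real_of_int (snd v)" "m = real_of_int (m2 v)" "n = real_of_int (m1 v)" "i = real_of_int (j v)"
    have p: "0 < m2 v" "m \<le> D2" "j v \<noteq> 0" "\<bar>i\<bar> \<le> w" "m2 v * fst v - m1 v * snd v = j v"
      "e v * j v ^ 3 = h * m2 v ^ 2 * (m2 v * fst v - 3 * m1 v * snd v)"
      using ch[OF v(1)] unfolding Pr_def a_b_m_n_i_def by blast+
    have ab: "D1 < a" "a \<le> 2 * D1" "D2 < b" "b \<le> 2 * D2" unfolding a_b_m_n_i_def using D(11-14)[OF vS] by auto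
    have m1: "1 \<le> m" unfolding a_b_m_n_i_def using p(1) by simp
    have line: "m * a - n * b = i" unfolding a_b_m_n_i_def p(5)[symmetric] by simp
    have cub: "real_of_int (e v) * i ^ 3 = real_of_int h * m ^ 2 * (m * a - 3 * n * b)"
      unfolding a_b_m_n_i_def using arg_cong[OF p(6), of real_of_int] by simp
    have mD: "D1 \<le> m * D1" using m1 D(3) by simp
    have ma: "m * D1 < m * a" using m1 ab by simp
    \<comment> \<open>On the line \<open>m * a - 3 * n * b\<close> equals
      \<open>3 * i - 2 * (m * a)\<close>, and \<open>3 * \<bar>i\<bar>\<close> is at most
      \<open>D1\<close>. So the last factor of the cubic relation cannot be small.\<close>
    have lower: "m * D1 \<le> \<bar>m * a - 3 * n * b\<bar>"
    proof -
      have "m * a - 3 * n * b = 3 * i - 2 * (m * a)" unfolding line[symmetric] by simp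
      then show ?thesis using ma mD wD p(4) by linarith
    qed
    have h1: "1 \<le> \<bar>real_of_int h\<bar>"
    proof -
      have "1 \<le> \<bar>h\<bar>" using h by linarith
      then have "real_of_int 1 \<le> real_of_int \<bar>h\<bar>" by (simp only: of_int_le_iff)
      then show ?thesis by simp
    qed
    have "m ^ 3 * D1 = 1 * m ^ 2 * (m * D1)" by (simp add: power2_eq_square power3_eq_cube)
    also have "\<dots> \<le> \<bar>real_of_int h\<bar> * m ^ 2 * \<bar>m * a - 3 * n * b\<bar>"
      using h1 lower m1 D(3) by (intro mult_mono) auto
    also have "\<dots> = \<bar>real_of_int (e v)\<bar> * \<bar>i\<bar> ^ 3" using arg_cong[OF cub, of abs] m1 by (simp add: abs_mult power_abs)
    also have "\<dots> \<le> (A * u ^ 5 / D1\<^sup>2) * w ^ 3"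
      using D(18)[OF vS] p(4) by (intro mult_mono power_mono) auto
    also have "\<dots> \<le> (A ^ 3 * u ^ 6 / D1\<^sup>2) * w ^ 3"
    proof -
      have "A ^ 1 * u ^ 5 \<le> A ^ 3 * u ^ 6" using A D(2) by (intro mult_mono power_increasing) auto
      then show ?thesis using D(3) w4 by (intro mult_right_mono divide_right_mono) auto
    qed
    also have "\<dots> = M ^ 3 * D1"
    proof -
      have "a * b / D1\<^sup>2 * c = a * b * c / D1 ^ 3 * D1" for a b c :: real using D(3) by (simp add: power2_eq_square power3_eq_cube)
      moreover have "M ^ 3 = A ^ 3 * u ^ 6 * w ^ 3 / D1 ^ 3" unfolding M_def power_divide power_mult_distrib power_mult[symmetric] by simp
      ultimately show ?thesis by (simp only:)
    qed
    finally have "m ^ 3 \<le> M ^ 3" using D(3) by simp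
    then have mM: "m \<le> M"
      using power_strict_mono[of M m 3] M0 by (force simp: not_le[symmetric])
    have inMs: "m2 v \<in> Ms" unfolding Ms_def using p(1,2) mM unfolding a_b_m_n_i_def by simp
    have nb: "n * b = m * a - i" using line by simp
    have nb0: "n * b > 0" unfolding nb using ma mD wD p(4) w4 by linarith
    have b0: "b > 0" using ab D(4) by linarith
    have n0: "n > 0" using nb0 b0 by (simp add: zero_less_mult_iff)
    have "n * D2 \<le> n * b" using n0 ab by simp
    also have "\<dots> \<le> m * (2 * D1) + w"
    proof -
      have "m * a \<le> m * (2 * D1)" using m1 ab by (intro mult_left_mono) auto
      then show ?thesis unfolding nb using p(4) by linarith
    qed
    also have "\<dots> \<le> 3 * m * D1"
    proof -
      have "m * (2 * D1) = 2 * (m * D1)" "3 * m * D1 = 3 * (m * D1)" by simp_all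
      then show ?thesis using mD wD w4 by linarith
    qed
    finally have "n \<le> 3 * m * D1 / D2" using D(4) by (simp add: pos_le_divide_eq)
    then have in1: "m1 v \<in> {1..\<lfloor>3 * m * D1 / D2\<rfloor>}" using n0 unfolding a_b_m_n_i_def by (simp add: le_floor_iff)
    have in2: "snd v div m2 v \<in> {\<lfloor>D2 / m\<rfloor>..\<lfloor>2 * D2 / m\<rfloor>}"
    proof -
      have "snd v div m2 v = \<lfloor>b / m\<rfloor>" unfolding a_b_m_n_i_def by (rule floor_divide_of_int_eq[symmetric])
      moreover have "D2 / m \<le> b / m" "b / m \<le> 2 * D2 / m" using ab m1 by (intro divide_right_mono; simp)+
      ultimately show ?thesis using floor_mono by auto
    qed
    show "y \<in> Sigma Ms B" unfolding v(2) g_def B_def using inMs in1 in2 p(4) unfolding a_b_m_n_i_def by auto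
  qed
  have finB: "finite (B m)" for m unfolding B_def using card_int_abs_le(1)[of w] w4 by auto
  have cB: "real (card (B m)) \<le> 54 * (D1 * w)" if "m \<in> Ms" for m
  proof -
    have m: "1 \<le> real_of_int m" "real_of_int m \<le> D2" using that unfolding Ms_def by auto
    have "real (card (B m)) = real (card {1..\<lfloor>3 * real_of_int m * D1 / D2\<rfloor>}) * (real (card {i::int. \<bar>real_of_int i\<bar> \<le> w})
      * real (card {\<lfloor>D2 / real_of_int m\<rfloor>..\<lfloor>2 * D2 / real_of_int m\<rfloor>}))"
      unfolding B_def card_cartesian_product of_nat_mult ..
    also have "\<dots> \<le> (3 * real_of_int m * D1 / D2) * ((6 * w) * (3 * D2 / real_of_int m))"
    proof (intro mult_mono)
      have "3 * real_of_int m * D1 / D2 \<ge> 0" using m D(3,4) by simp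
      then show "real (card {1..\<lfloor>3 * real_of_int m * D1 / D2\<rfloor>}) \<le> 3 * real_of_int m * D1 / D2"
        by (simp add: of_nat_floor)
      show "real (card {i::int. \<bar>real_of_int i\<bar> \<le> w}) \<le> 6 * w" using card_int_abs_le(2)[of w] w4 by linarith
      have d: "1 \<le> D2 / real_of_int m" using m by (simp add: pos_le_divide_eq)
      have "\<lfloor>D2 / real_of_int m\<rfloor> \<le> \<lfloor>2 * D2 / real_of_int m\<rfloor>" using d by (intro floor_mono) simp
      then have "real (card {\<lfloor>D2 / real_of_int m\<rfloor>..\<lfloor>2 * D2 / real_of_int m\<rfloor>}) = real_of_int \<lfloor>2 * D2 / real_of_int m\<rfloor> + 1 - real_of_int \<lfloor>D2 / real_of_int m\<rfloor>"
        by simp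
      moreover have "2 * D2 / real_of_int m = 2 * (D2 / real_of_int m)" "3 * D2 / real_of_int m = 3 * (D2 / real_of_int m)" by simp_all
      ultimately show "real (card {\<lfloor>D2 / real_of_int m\<rfloor>..\<lfloor>2 * D2 / real_of_int m\<rfloor>}) \<le> 3 * D2 / real_of_int m"
        using d by linarith
    qed (use m D(3,4) w4 in auto)
    also have "\<dots> = 54 * (D1 * w)" using m D(4) by simp
    finally show ?thesis .
  qed
  have "card L = card (g ` L)" by (rule card_image[OF inj, symmetric])
  also have "\<dots> \<le> card (Sigma Ms B)" by (intro card_mono im finite_SigmaI fMs finB)
  also have "\<dots> = (\<Sum>m\<in>Ms. card (B m))" using fMs finB by (intro card_SigmaI) auto
  finally have "real (card L) \<le> (\<Sum>m\<in>Ms. real (card (B m)))" by (simp only: of_nat_le_iff of_nat_sum[symmetric])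
  also have "\<dots> \<le> (\<Sum>m\<in>Ms. 54 * (D1 * w))" by (intro sum_mono cB)
  also have "\<dots> = real (card Ms) * (54 * (D1 * w))" by simp
  also have "\<dots> \<le> M * (54 * (D1 * w))" using cMs D(3) w4 by (intro mult_right_mono) auto
  also have "\<dots> = 54 * A * (u\<^sup>2 * w\<^sup>2)" unfolding M_def using D(3) by (simp add: power2_eq_square)
  also have "\<dots> \<le> 54 * A * (u\<^sup>2 * u)" using w A by (intro mult_left_mono) auto
  also have "\<dots> = 54 * A * u ^ 3" by (simp add: power2_eq_square power3_eq_cube)
  finally show ?thesis unfolding L_def .
qed

text \<open>For \<open>k \<ge> 3\<close> no point counts as a line point and the bound for the
  others is enough. For \<open>k = 2\<close> the line points have their own count, and families with
  large \<open>D1 * D2\<close> are handled as a whole by the trivial bound.\<close>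

lemma dyadic_family_card:
  fixes k :: nat and h :: int and A \<epsilon> :: real
  assumes k: "k \<ge> 2" and h: "h \<noteq> 0" and A: "A \<ge> 1" and \<epsilon>: "\<epsilon> > 0"
  obtains C :: real where "C > 0"
    "\<And>u D1 D2 e f S. u \<ge> 144 \<Longrightarrow> dyadic_family k h A u D1 D2 e f S \<Longrightarrow> real (card S) \<le> C * u ^ 3 * u powr \<epsilon>"
proof -
  obtain C where C: "C > 0" and nl: "\<And>u D1 D2 e f S. dyadic_family k h A u D1 D2 e f S \<Longrightarrow>
       real (card {v\<in>S. \<not> (k = 2 \<and> line_point h e D2 (D1 * D2 / u ^ 3) v)}) \<le> C * u ^ 3 * u powr \<epsilon>"
  proof (rule dyadic_family_card_nonline[OF k h A \<epsilon>], goal_cases)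
    case (1 C)
    show ?case by (rule 1(1)) (fact 1)+
  qed
  define C' where "C' = C + 54 * A + 9 * A\<^sup>2"
  have C': "C' > 0" unfolding C'_def using C A by (intro add_pos_pos) auto
  show ?thesis
  proof (rule that[OF C'])
    fix u D1 D2 :: real and e f S
    assume u: "u \<ge> 144" and F: "dyadic_family k h A u D1 D2 e f S"
    define N where "N = {v\<in>S. \<not> (k = 2 \<and> line_point h e D2 (D1 * D2 / u ^ 3) v)}"
    define L where "L = {v\<in>S. k = 2 \<and> line_point h e D2 (D1 * D2 / u ^ 3) v}"
    have p1: "1 \<le> u powr \<epsilon>" using u \<epsilon> by (intro ge_one_powr_ge_zero) auto
    define t where "t = u ^ 3 * u powr \<epsilon>"
    have t: "u ^ 3 \<le> t" unfolding t_def using mult_left_mono[OF p1, of "u ^ 3"] u by simp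
    have u30: "u ^ 3 \<ge> 0" using u by simp
    have Cs: "C * t \<le> C' * t" "9 * A\<^sup>2 * t \<le> C' * t" "C * t + 54 * A * t \<le> C' * t"

    proof -
      have t0: "0 \<le> t" using t u30 by linarith
      have "C * t \<ge> 0" "54 * A * t \<ge> 0" "9 * A\<^sup>2 * t \<ge> 0" using C A t0 by auto
      then show "C * t \<le> C' * t" "9 * A\<^sup>2 * t \<le> C' * t" "C * t + 54 * A * t \<le> C' * t"
        unfolding C'_def distrib_right by linarith+
    qed
    have "real (card S) \<le> C' * t"
    proof (cases "k = 2 \<and> (D1 * D2 / u ^ 3)\<^sup>2 \<ge> u")
      case True
      then have "real (card S) \<le> 9 * A\<^sup>2 * u ^ 3" using dyadic_family_card_trivial F A by blast
      also have "\<dots> \<le> 9 * A\<^sup>2 * t" using t by (intro mult_left_mono) auto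
      finally show ?thesis using Cs by linarith
    next
      case False
      have N: "real (card N) \<le> C * t" using nl[OF F] unfolding N_def t_def by (simp add: mult.assoc)
      have L: "real (card L) \<le> 54 * A * t"
      proof (cases "k = 2")
        case True
        then have "real (card L) \<le> 54 * A * u ^ 3"
          unfolding L_def using False dyadic_family_card_line[OF F[unfolded True] h A u refl] by simp
        also have "\<dots> \<le> 54 * A * t" using t A by (intro mult_left_mono) auto
        finally show ?thesis .
      next
        case False
        then have "L = {}" unfolding L_def by simp
        moreover have "0 \<le> A * t" using A t u30 by (intro mult_nonneg_nonneg) linarith+
        ultimately show ?thesis by simp
      qed
      have "S = N \<union> L" unfolding N_def L_def by auto
      then have "card S \<le> card N + card L" using card_Un_le by metis
      then show ?thesis using N L Cs(3) by linarith
    qed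
    then show "real (card S) \<le> C' * u ^ 3 * u powr \<epsilon>" unfolding t_def by (simp add: mult.assoc)
  qed
qed

section \<open>Elementary counts in residue classes\<close>

lemma card_linear_dvd_le:
  fixes a b m :: int and N :: real
  assumes m: "m > 0" and cop: "coprime m a" and N: "N \<ge> 0"
  shows "finite {n::nat. real n \<le> N \<and> m dvd a * int n + b}"
    "real (card {n::nat. real n \<le> N \<and> m dvd a * int n + b}) \<le> 1 + N / real_of_int m"
proof -
  define A where "A = {n::nat. real n \<le> N \<and> m dvd a * int n + b}"
  have "A \<subseteq> {..nat \<lfloor>N\<rfloor>}" unfolding A_def by (auto simp: le_nat_floor)
  then show fin: "finite {n::nat. real n \<le> N \<and> m dvd a * int n + b}" unfolding A_def[symmetric] by (rule finite_subset) simp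
  have "real (card (real ` A)) \<le> 1 + (N - 0) / real_of_int m"
  proof (rule card_spaced_le)
    show "finite (real ` A)" using fin unfolding A_def[symmetric] by simp
    show "0 \<le> x \<and> x \<le> N" if "x \<in> real ` A" for x using that unfolding A_def by auto
    fix x y assume "x \<in> real ` A" "y \<in> real ` A" "x \<noteq> y"
    then obtain n n' where n: "n \<in> A" "n' \<in> A" "x = real n" "y = real n'" "n \<noteq> n'" by auto
    have "m dvd (a * int n + b) - (a * int n' + b)" using n unfolding A_def by (intro dvd_diff) auto
    also have "(a * int n + b) - (a * int n' + b) = a * (int n - int n')" by (simp add: algebra_simps)
    finally have "m dvd int n - int n'" using cop coprime_dvd_mult_right_iff by blast
    then have "m \<le> \<bar>int n - int n'\<bar>" using n(5) by (intro zdvd_imp_le) (auto simp: dvd_abs_iff)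
    then have "real_of_int m \<le> real_of_int \<bar>int n - int n'\<bar>" by (simp only: of_int_le_iff)
    then show "\<bar>x - y\<bar> \<ge> real_of_int m" unfolding n(3,4) by simp
  qed (use N m in auto)
  moreover have "card (real ` A) = card A" by (rule card_image) (simp add: inj_on_def)
  ultimately show "real (card {n::nat. real n \<le> N \<and> m dvd a * int n + b}) \<le> 1 + N / real_of_int m"
    unfolding A_def by simp
qed

lemma sum_inverse_squares_le:
  assumes "m \<ge> 1"
  shows "(\<Sum>p\<in>{m<..M}. 1 / real p ^ 2) \<le> 1 / real m"
proof -
  have "(\<Sum>p\<in>{m<..M}. 1 / real p ^ 2) \<le> 1 / real m - 1 / real M" if "m \<le> M"
    using that
  proof (induction M rule: dec_induct)
    case (step M)
    have "{m<..Suc M} = insert (Suc M) {m<..M}" using step.hyps by auto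
    then have "(\<Sum>p\<in>{m<..Suc M}. 1 / real p ^ 2) = (\<Sum>p\<in>{m<..M}. 1 / real p ^ 2) + 1 / real (Suc M) ^ 2" by simp
    also have "\<dots> \<le> 1 / real m - 1 / real M + 1 / real (Suc M) ^ 2" using step.IH by simp
    also have "\<dots> \<le> 1 / real m - 1 / real (Suc M)"
    proof -
      have M: "real M > 0" using step.hyps assms by simp
      have "1 / (z + 1) ^ 2 \<le> 1 / z - 1 / (z + 1)" if "z > 0" for z :: real
      proof -
        have "1 / z - 1 / (z + 1) = 1 / (z * (z + 1))" using that by (simp add: field_simps)
        moreover have "1 / (z + 1) ^ 2 \<le> 1 / (z * (z + 1))"
          using that by (intro divide_left_mono) (auto simp: power2_eq_square)
        ultimately show ?thesis by simp
      qed
      from this[OF M] show ?thesis by (simp add: add.commute)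
    qed
    finally show ?case .
  qed simp
  then show ?thesis by (cases "m \<le> M") (auto intro: order_trans)
qed

text \<open>Disposes of the small \<open>n\<close>: for \<open>N\<close> of order
  \<open>u ^ 4\<close> the bound is of order \<open>u ^ 3\<close>. The primes exceed
  \<open>\<bar>a\<bar>\<close>, so each square contributes one residue class.\<close>

lemma card_square_divisible_le:
  fixes a b :: int and N u :: real
  assumes a: "a \<noteq> 0" "\<bar>real_of_int a\<bar> \<le> u" and u: "u \<ge> 2" and N: "N \<ge> 0"
  shows "real (card {n::nat. real n \<le> N \<and> (\<exists>p::nat. prime p \<and> u < real p \<and> real p \<le> u\<^sup>2 \<and> int p ^ 2 dvd a * int n + b)}) \<le> u\<^sup>2 + 2 * N / u"
proof -
  define m where "m = nat \<lfloor>u\<rfloor>"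
  have m: "real m > u - 1" "real m \<le> u" unfolding m_def using u by linarith+
  then have m1: "m \<ge> 1" using u by linarith
  define Ps where "Ps = {p \<in> {m<..nat \<lfloor>u\<^sup>2\<rfloor>}. prime p}"
  define B where "B = (\<lambda>p::nat. {n::nat. real n \<le> N \<and> int p ^ 2 dvd a * int n + b})"
  have sub: "{n::nat. real n \<le> N \<and> (\<exists>p::nat. prime p \<and> u < real p \<and> real p \<le> u\<^sup>2 \<and> int p ^ 2 dvd a * int n + b)} \<subseteq> (\<Union>p\<in>Ps. B p)"
  proof
    fix n assume "n \<in> {n::nat. real n \<le> N \<and> (\<exists>p::nat. prime p \<and> u < real p \<and> real p \<le> u\<^sup>2 \<and> int p ^ 2 dvd a * int n + b)}"
    then obtain p :: nat where p: "real n \<le> N" "prime p" "u < real p" "real p \<le> u\<^sup>2" "int p ^ 2 dvd a * int n + b" by blast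
    have "p \<in> Ps" unfolding Ps_def using p m by (auto simp: le_nat_floor)
    then show "n \<in> (\<Union>p\<in>Ps. B p)" unfolding B_def using p by auto
  qed
  have fP: "finite Ps" unfolding Ps_def by simp
  have Bp: "finite (B p)" "real (card (B p)) \<le> 1 + N / real p ^ 2" if "p \<in> Ps" for p
  proof -
    have p: "prime p" "u < real p" using that m unfolding Ps_def by auto
    have "\<not> int p dvd a"
    proof
      assume "int p dvd a"
      then have "int p \<le> \<bar>a\<bar>" using a(1) by (intro zdvd_imp_le) auto
      then have "real_of_int (int p) \<le> real_of_int \<bar>a\<bar>" by (simp only: of_int_le_iff)
      then show False using p(2) a(2) by simp
    qed
    then have "coprime (int p ^ 2) a" using p(1) by (simp add: prime_imp_coprime)
    moreover have "int p ^ 2 > 0" using p(1) prime_gt_0_nat by auto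
    ultimately show "finite (B p)" "real (card (B p)) \<le> 1 + N / real p ^ 2"
      unfolding B_def using card_linear_dvd_le[of "int p ^ 2" a N b] N by auto
  qed
  have "card {n::nat. real n \<le> N \<and> (\<exists>p::nat. prime p \<and> u < real p \<and> real p \<le> u\<^sup>2 \<and> int p ^ 2 dvd a * int n + b)} \<le> card (\<Union>p\<in>Ps. B p)"
    using fP Bp by (intro card_mono sub) auto
  also have "\<dots> \<le> (\<Sum>p\<in>Ps. card (B p))" by (rule card_UN_le[OF fP])
  finally have "real (card {n::nat. real n \<le> N \<and> (\<exists>p::nat. prime p \<and> u < real p \<and> real p \<le> u\<^sup>2 \<and> int p ^ 2 dvd a * int n + b)}) \<le> (\<Sum>p\<in>Ps. real (card (B p)))"
    by (simp only: of_nat_le_iff of_nat_sum[symmetric])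
  also have "\<dots> \<le> (\<Sum>p\<in>Ps. 1 + N / real p ^ 2)" using Bp by (intro sum_mono) auto
  also have "\<dots> \<le> (\<Sum>p\<in>{m<..nat \<lfloor>u\<^sup>2\<rfloor>}. 1 + N / real p ^ 2)" unfolding Ps_def using N by (intro sum_mono2) auto
  also have "\<dots> = real (card {m<..nat \<lfloor>u\<^sup>2\<rfloor>}) + N * (\<Sum>p\<in>{m<..nat \<lfloor>u\<^sup>2\<rfloor>}. 1 / real p ^ 2)"
    by (simp add: sum.distrib sum_distrib_left)
  also have "\<dots> \<le> u\<^sup>2 + N * (2 / u)"
  proof (intro add_mono mult_left_mono)
    have "real (nat \<lfloor>u\<^sup>2\<rfloor> - m) \<le> real (nat \<lfloor>u\<^sup>2\<rfloor>)" by (simp only: of_nat_le_iff diff_le_self)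
    also have "\<dots> \<le> u\<^sup>2" by (simp add: of_nat_floor)
    finally show "real (card {m<..nat \<lfloor>u\<^sup>2\<rfloor>}) \<le> u\<^sup>2" by simp
    have "1 / real m \<le> 1 / (u / 2)" using m u by (intro divide_left_mono) auto
    then show "(\<Sum>p\<in>{m<..nat \<lfloor>u\<^sup>2\<rfloor>}. 1 / real p ^ 2) \<le> 2 / u" using sum_inverse_squares_le[OF m1, of "nat \<lfloor>u\<^sup>2\<rfloor>"] by simp
  qed (use N in auto)
  finally show ?thesis by (simp add: mult.commute)
qed

section \<open>Two large primes\<close>

definition large_pair :: "nat \<Rightarrow> int \<Rightarrow> int \<Rightarrow> int \<Rightarrow> int \<Rightarrow> real \<Rightarrow> nat \<Rightarrow> nat \<Rightarrow> nat \<Rightarrow> bool" where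
  "large_pair k a1 b1 a2 b2 u n p q \<longleftrightarrow> prime p \<and> prime q \<and> u < real p \<and> real p \<le> u\<^sup>2 \<and> u < real q \<and> real q \<le> u\<^sup>2 \<and>
     u ^ 3 < real p * real q \<and> int p ^ k dvd a1 * int n + b1 \<and> int q ^ k dvd a2 * int n + b2 \<and>
     a1 * int n + b1 \<noteq> 0 \<and> a2 * int n + b2 \<noteq> 0"

text \<open>Both primes exceed the leading coefficients, so \<open>p ^ k * q ^ k\<close> divides
  \<open>n - n'\<close>; but it is larger than \<open>u ^ (3 * k)\<close> and so than
  \<open>u ^ (2 * k + 1)\<close>. Hence counting pairs counts the \<open>n\<close>.\<close>

lemma large_pair_unique:
  assumes k: "k \<ge> 1" and u: "u \<ge> 1" "u \<ge> \<bar>real_of_int a1\<bar>" "u \<ge> \<bar>real_of_int a2\<bar>" and a: "a1 \<noteq> 0" "a2 \<noteq> 0"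
    and n: "0 < n" "real n \<le> u ^ (2 * k + 1)" "0 < n'" "real n' \<le> u ^ (2 * k + 1)" and pq: "p \<noteq> q"
    and L: "large_pair k a1 b1 a2 b2 u n p q" "large_pair k a1 b1 a2 b2 u n' p q"
  shows "n = n'"
proof (rule ccontr)
  assume neq: "n \<noteq> n'"
  have gen: "int p ^ k dvd int n - int n'"
    if "prime p" "u < real p" "u \<ge> \<bar>real_of_int a\<bar>" "a \<noteq> 0" "int p ^ k dvd a * int n + b" "int p ^ k dvd a * int n' + b" for p a b
  proof -
    have "\<not> int p dvd a"
    proof
      assume "int p dvd a"
      then have "int p \<le> \<bar>a\<bar>" using that(4) by (intro zdvd_imp_le) auto
      then have "real_of_int (int p) \<le> real_of_int \<bar>a\<bar>" by (simp only: of_int_le_iff)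
      then show False using that(2,3) by simp
    qed
    then have cop: "coprime (int p ^ k) a" using that(1) by (simp add: prime_imp_coprime)
    have "int p ^ k dvd (a * int n + b) - (a * int n' + b)" using that by (intro dvd_diff) auto
    also have "(a * int n + b) - (a * int n' + b) = a * (int n - int n')" by (simp add: algebra_simps)
    finally show ?thesis using cop coprime_dvd_mult_right_iff by blast
  qed
  have d1: "int p ^ k dvd int n - int n'" by (rule gen[where a = a1 and b = b1]) (use L a u in \<open>auto simp: large_pair_def\<close>)
  have d2: "int q ^ k dvd int n - int n'" by (rule gen[where a = a2 and b = b2]) (use L a u in \<open>auto simp: large_pair_def\<close>)
  have "coprime (int p) (int q)" using L pq unfolding large_pair_def by (simp add: primes_coprime)
  then have "int p ^ k * int q ^ k dvd int n - int n'" using d1 d2 by (intro divides_mult) auto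
  then have "int p ^ k * int q ^ k \<le> \<bar>int n - int n'\<bar>" using neq by (intro zdvd_imp_le) auto
  then have "real_of_int (int p ^ k * int q ^ k) \<le> real_of_int \<bar>int n - int n'\<bar>" by (simp only: of_int_le_iff)
  then have "(real p * real q) ^ k \<le> \<bar>real n - real n'\<bar>" by (simp add: power_mult_distrib)
  also have "\<dots> < u ^ (2 * k + 1)" using n by linarith
  also have "\<dots> \<le> u ^ (3 * k)" using k u by (intro power_increasing) auto
  also have "\<dots> = (u ^ 3) ^ k" by (simp add: power_mult)
  also have "\<dots> \<le> (real p * real q) ^ k" using L u unfolding large_pair_def by (intro power_mono) auto
  finally show False by simp
qed

text \<open>Each \<open>n\<close> is assigned one of its pairs of primes, and the pairs are sorted
  into dyadic boxes. The number of boxes is of the order of a squared logarithm and disappears in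
  \<open>u powr \<epsilon>\<close>.\<close>

lemma card_large_pair_le:
  fixes k :: nat and a1 b1 a2 b2 :: int and \<epsilon> :: real
  assumes k: "k \<ge> 2" and a: "a1 \<noteq> 0" "a2 \<noteq> 0" and h: "a2 * b1 - a1 * b2 \<noteq> 0" and \<epsilon>: "\<epsilon> > 0"
  obtains C U :: real where "C > 0"
    "\<And>u. u \<ge> U \<Longrightarrow> real (card {n::nat. 0 < n \<and> real n \<le> u ^ (2 * k + 1) \<and> (\<exists>p q. large_pair k a1 b1 a2 b2 u n p q)})
      \<le> C * u ^ 3 * u powr \<epsilon>"
proof -
  \<comment> \<open>Multiplying the first form by \<open>a2\<close> and the second by
    \<open>a1\<close> makes their difference constant. The functions \<open>e\<close> and
    \<open>f\<close> below are the cofactors of these multiples.\<close>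
  define h where "h = a2 * b1 - a1 * b2"
  have h0: "h \<noteq> 0" unfolding h_def by (rule h)
  define A where "A = \<bar>real_of_int a2\<bar> * (\<bar>real_of_int a1\<bar> + \<bar>real_of_int b1\<bar>) + \<bar>real_of_int a1\<bar> * (\<bar>real_of_int a2\<bar> + \<bar>real_of_int b2\<bar>)"
  have ra: "\<bar>real_of_int a1\<bar> \<ge> 1" "\<bar>real_of_int a2\<bar> \<ge> 1" using a by linarith+
  have A1: "A \<ge> 1"
  proof -
    have "1 * 1 \<le> \<bar>real_of_int a2\<bar> * (\<bar>real_of_int a1\<bar> + \<bar>real_of_int b1\<bar>)" using ra by (intro mult_mono) auto
    moreover have "0 \<le> \<bar>real_of_int a1\<bar> * (\<bar>real_of_int a2\<bar> + \<bar>real_of_int b2\<bar>)" by simp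
    ultimately show ?thesis unfolding A_def by linarith
  qed
  \<comment> \<open>Half of \<open>\<epsilon>\<close> goes to the bound for one box, and
    \<open>\<delta>\<close> to the number of dyadic ranges for each of the two primes.\<close>
  define \<delta> where "\<delta> = \<epsilon> / 4"
  have \<delta>: "\<delta> > 0" "\<delta> + \<delta> \<le> \<epsilon>" "\<epsilon> / 2 > 0" "\<epsilon> / 2 + (\<delta> + \<delta>) = \<epsilon>" unfolding \<delta>_def using \<epsilon> by auto
  obtain C1 where C1: "C1 > 0" and dy: "\<And>u D1 D2 e f S. u \<ge> 144 \<Longrightarrow> dyadic_family k h A u D1 D2 e f S \<Longrightarrow>
      real (card S) \<le> C1 * u ^ 3 * u powr (\<epsilon> / 2)"
  proof (rule dyadic_family_card[OF k h0 A1 \<delta>(3)], goal_cases)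
    case (1 C)
    show ?case by (rule 1(1)) (fact 1)+
  qed
  define c where "c = 2 * \<bar>real_of_int h\<bar> * 4 ^ k + 1"
  have c1: "c \<ge> 1" unfolding c_def by simp
  define U where "U = 144 + \<bar>real_of_int a1\<bar> + \<bar>real_of_int a2\<bar> + \<bar>real_of_int h\<bar>"
  define C2 where "C2 = 2 / (\<delta> * ln 2) + 1"
  have C2: "C2 > 0" unfolding C2_def using \<delta> by (intro add_nonneg_pos) auto
  define C where "C = C1 * C2\<^sup>2 + (1 + 2 * c + 2 * \<bar>real_of_int b1\<bar>)"
  have Cpos: "C > 0" unfolding C_def using C1 C2 c1 by (intro add_pos_nonneg) auto
  show ?thesis
  proof (rule that[OF Cpos, of U])
    fix u :: real assume uU: "u \<ge> U"
    have u: "u \<ge> 144" "u \<ge> \<bar>real_of_int a1\<bar>" "u \<ge> \<bar>real_of_int a2\<bar>" "u \<ge> \<bar>real_of_int h\<bar>" using uU unfolding U_def by linarith+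
    define x where "x = u ^ (2 * k + 1)"
    \<comment> \<open>Beyond \<open>N0\<close> the first form exceeds \<open>c * u ^ 4\<close>,
      hence \<open>c * (D1 * D2)\<close>, which is the lower bound that \<open>dyadic_family\<close>
      asks for. Up to \<open>N0\<close> the elementary count suffices.\<close>
    define N0 where "N0 = c * u ^ 4 + \<bar>real_of_int b1\<bar>"
    have N0: "N0 \<ge> 0" unfolding N0_def using c1 by simp
    define G where "G = {n::nat. 0 < n \<and> real n \<le> x \<and> (\<exists>p q. large_pair k a1 b1 a2 b2 u n p q)}"
    define G1 where "G1 = {n\<in>G. real n \<le> N0}"
    define G2 where "G2 = {n\<in>G. N0 < real n}"
    have "G \<subseteq> {..nat \<lfloor>x\<rfloor>}" unfolding G_def by (auto simp: le_nat_floor)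
    then have fG: "finite G" by (rule finite_subset) simp
    have p1: "1 \<le> u powr \<epsilon>" using u \<epsilon> by (intro ge_one_powr_ge_zero) auto
    have u0: "u > 0" using u by simp
    have c1': "real (card G1) \<le> (1 + 2 * c + 2 * \<bar>real_of_int b1\<bar>) * (u ^ 3 * u powr \<epsilon>)"
    proof -
      have "G1 \<subseteq> {n::nat. real n \<le> N0 \<and> (\<exists>p::nat. prime p \<and> u < real p \<and> real p \<le> u\<^sup>2 \<and> int p ^ 2 dvd a1 * int n + b1)}" (is "_ \<subseteq> ?B")
        unfolding G1_def G_def large_pair_def using k by (auto intro: power_le_dvd)
      moreover have "finite ?B" by (rule finite_subset[of _ "{..nat \<lfloor>N0\<rfloor>}"]) (auto simp: le_nat_floor)
      ultimately have "card G1 \<le> card ?B" by (intro card_mono) auto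
      then have "real (card G1) \<le> real (card ?B)" by (simp only: of_nat_le_iff)
      also have "\<dots> \<le> u\<^sup>2 + 2 * N0 / u" by (rule card_square_divisible_le) (use a u N0 in auto)
      also have "2 * N0 / u = 2 * c * u ^ 3 + 2 * \<bar>real_of_int b1\<bar> / u"
        unfolding N0_def using u0 by (simp add: power4_eq_xxxx power3_eq_cube distrib_left add_divide_distrib)
      also have "u\<^sup>2 + (2 * c * u ^ 3 + 2 * \<bar>real_of_int b1\<bar> / u) \<le> u ^ 3 + (2 * c * u ^ 3 + 2 * \<bar>real_of_int b1\<bar> * u ^ 3)"
      proof (intro add_mono)
        show "u\<^sup>2 \<le> u ^ 3" using u by (intro power_increasing) auto
        have "2 * \<bar>real_of_int b1\<bar> / u \<le> 2 * \<bar>real_of_int b1\<bar> / 1" using u by (intro divide_left_mono) auto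
        also have "\<dots> \<le> 2 * \<bar>real_of_int b1\<bar> * u ^ 3" using u one_le_power[of u 3] by (simp add: mult_le_cancel_left1)
        finally show "2 * \<bar>real_of_int b1\<bar> / u \<le> 2 * \<bar>real_of_int b1\<bar> * u ^ 3" .
      qed simp
      also have "\<dots> = (1 + 2 * c + 2 * \<bar>real_of_int b1\<bar>) * (u ^ 3 * 1)" by (simp add: distrib_right)
      also have "\<dots> \<le> (1 + 2 * c + 2 * \<bar>real_of_int b1\<bar>) * (u ^ 3 * u powr \<epsilon>)"
        using p1 u0 c1 by (intro mult_left_mono) auto
      finally show ?thesis .
    qed
    have c2': "real (card G2) \<le> C1 * C2\<^sup>2 * (u ^ 3 * u powr \<epsilon>)"
    proof -
      have "\<forall>n\<in>G2. \<exists>p q. large_pair k a1 b1 a2 b2 u n p q" unfolding G2_def G_def by blast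
      then obtain p q where pq: "\<And>n. n \<in> G2 \<Longrightarrow> large_pair k a1 b1 a2 b2 u n (p n) (q n)" by metis
      have nG: "0 < n" "real n \<le> u ^ (2 * k + 1)" "N0 < real n" if "n \<in> G2" for n
        using that unfolding G2_def G_def x_def by auto
      \<comment> \<open>A common prime would divide \<open>h\<close>, although it is larger than
        \<open>u\<close> and so than \<open>\<bar>h\<bar>\<close>.\<close>
      have pneq: "p n \<noteq> q n" if "n \<in> G2" for n
      proof
        assume eq: "p n = q n"
        note L = pq[OF that]
        have "int (p n) dvd a1 * int n + b1" "int (p n) dvd a2 * int n + b2"
          using L eq k dvd_trans[OF dvd_power[of k "int (p n)"]] unfolding large_pair_def by (metis le_zero_eq not_numeral_le_zero zero_less_iff_neq_zero)+
        then have "int (p n) dvd a2 * (a1 * int n + b1) - a1 * (a2 * int n + b2)" by (intro dvd_diff dvd_mult)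
        also have "a2 * (a1 * int n + b1) - a1 * (a2 * int n + b2) = h" unfolding h_def by (simp add: algebra_simps)
        finally have "int (p n) \<le> \<bar>h\<bar>" using h0 by (intro zdvd_imp_le) auto
        then have "real_of_int (int (p n)) \<le> real_of_int \<bar>h\<bar>" by (simp only: of_int_le_iff)
        then show False using L u(4) unfolding large_pair_def by simp
      qed
      define g where "g = (\<lambda>n. (int (p n), int (q n)))"
      have inj: "inj_on g G2"
      proof (rule inj_onI)
        fix n n' assume n: "n \<in> G2" "n' \<in> G2" "g n = g n'"
        then have eq: "p n' = p n" "q n' = q n" unfolding g_def by auto
        show "n = n'"
          by (rule large_pair_unique[OF _ _ u(2,3) a nG(1,2)[OF n(1)] nG(1,2)[OF n(2)] pneq[OF n(1)] pq[OF n(1)] pq[OF n(2), unfolded eq]])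
            (use k u in auto)
      qed
      define gi where "gi = inv_into G2 g"
      have gi: "gi v \<in> G2" "g (gi v) = v" if "v \<in> g ` G2" for v
        using inv_into_into[OF that] f_inv_into_f[OF that] unfolding gi_def by auto
      define e f where "e = (\<lambda>v. (a2 * (a1 * int (gi v) + b1)) div fst v ^ k)" "f = (\<lambda>v. (a1 * (a2 * int (gi v) + b2)) div snd v ^ k)"
      have vv: "prime (fst v) \<and> prime (snd v) \<and> fst v \<noteq> snd v \<and> e v * fst v ^ k = a2 * (a1 * int (gi v) + b1) \<and>
          f v * snd v ^ k = a1 * (a2 * int (gi v) + b2) \<and> u < real_of_int (fst v) \<and> real_of_int (fst v) \<le> u\<^sup>2 \<and>
          u < real_of_int (snd v) \<and> real_of_int (snd v) \<le> u\<^sup>2 \<and> u ^ 3 < real_of_int (fst v) * real_of_int (snd v) \<and> e v \<noteq> 0 \<and> f v \<noteq> 0"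
        if "v \<in> g ` G2" for v
      proof -
        note L = pq[OF gi(1)[OF that]]
        have v: "fst v = int (p (gi v))" "snd v = int (q (gi v))" using arg_cong[OF gi(2)[OF that], of fst] arg_cong[OF gi(2)[OF that], of snd] by (simp_all add: g_def)
        have "e v * fst v ^ k = a2 * (a1 * int (gi v) + b1)" "f v * snd v ^ k = a1 * (a2 * int (gi v) + b2)"
          unfolding e_f_def v using L unfolding large_pair_def by simp_all
        moreover from this have "e v \<noteq> 0" "f v \<noteq> 0" using L a unfolding large_pair_def by auto
        ultimately show ?thesis using L pneq[OF gi(1)[OF that]] unfolding v large_pair_def by auto
      qed
      define V where "V = g ` G2"
      have fV: "finite V" unfolding V_def G2_def using fG by simp
      \<comment> \<open>The ranges are open on the left and closed on the right, like the box
        \<open>D1 < fst v\<close>, \<open>fst v \<le> 2 * D1\<close>.\<close>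
      have "\<exists>s. 2 ^ s < d \<and> d \<le> 2 ^ (s + 1)" if "d \<ge> 2" for d :: nat using ex_power_ivl2[of 2 d] that by simp
      then obtain s where s: "\<And>d::nat. d \<ge> 2 \<Longrightarrow> 2 ^ s d < d \<and> d \<le> 2 ^ (s d + 1)" by metis
      have sr: "2 ^ s (nat z) < real_of_int z" "real_of_int z \<le> 2 * 2 ^ s (nat z)" if "prime z" for z :: int
      proof -
        have z: "z \<ge> 2" using that prime_ge_2_int by blast
        then have "2 ^ s (nat z) < nat z" "nat z \<le> 2 ^ (s (nat z) + 1)" using s[of "nat z"] by auto
        then have "real (2 ^ s (nat z)) < real (nat z)" "real (nat z) \<le> real (2 ^ (s (nat z) + 1))"
          by (simp_all only: of_nat_less_iff of_nat_le_iff)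
        then show "2 ^ s (nat z) < real_of_int z" "real_of_int z \<le> 2 * 2 ^ s (nat z)" using z by simp_all
      qed
      define ix where "ix = (\<lambda>v::int \<times> int. (s (nat (fst v)), s (nat (snd v))))"
      define M where "M = nat \<lfloor>log 2 (u\<^sup>2)\<rfloor>"
      have sM: "s (nat z) \<le> M" if "prime z" "real_of_int z \<le> u\<^sup>2" for z :: int
      proof -
        have "2 ^ s (nat z) \<le> u\<^sup>2" using sr[OF that(1)] that(2) by linarith
        then have "2 powr real (s (nat z)) \<le> u\<^sup>2" by (simp add: powr_realpow)
        then have "real (s (nat z)) \<le> log 2 (u\<^sup>2)" using u0 by (subst le_log_iff) auto
        then show ?thesis unfolding M_def by (simp add: le_nat_floor)
      qed
      have im: "ix ` V \<subseteq> {..M} \<times> {..M}" unfolding ix_def V_def using vv sM by auto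
      have fib: "card {v\<in>V. ix v = y} \<le> nat \<lfloor>C1 * u ^ 3 * u powr (\<epsilon> / 2)\<rfloor>" if "y \<in> ix ` V" for y
      proof -
        obtain s1 s2 where y: "y = (s1, s2)" by fastforce
        from \<open>y \<in> ix ` V\<close> obtain v0 where v0: "v0 \<in> V" "ix v0 = y" by blast
        define D1 D2 :: real where "D1 = 2 ^ s1" "D2 = 2 ^ s2"
        have D0: "D1 > 0" "D2 > 0" unfolding D1_D2_def by auto
        have rng: "D1 < real_of_int (fst v)" "real_of_int (fst v) \<le> 2 * D1" "D2 < real_of_int (snd v)" "real_of_int (snd v) \<le> 2 * D2"
          if "v \<in> {v\<in>V. ix v = y}" for v
          using that vv[of v] sr[of "fst v"] sr[of "snd v"] unfolding V_def ix_def y D1_D2_def by auto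
        have "dyadic_family k h A u D1 D2 e f {v\<in>V. ix v = y}"
          unfolding dyadic_family_def
        proof (intro conjI ballI)
          have r0: "D1 < real_of_int (fst v0)" "real_of_int (fst v0) \<le> 2 * D1" "D2 < real_of_int (snd v0)" "real_of_int (snd v0) \<le> 2 * D2"
            using rng[of v0] v0 by auto
          note q0 = vv[OF v0(1)[unfolded V_def]]
          show "D1 \<le> u\<^sup>2" "D2 \<le> u\<^sup>2" using r0 q0 by linarith+
          have "real_of_int (fst v0) * real_of_int (snd v0) \<le> (2 * D1) * (2 * D2)" using r0 q0 u0 D0 by (intro mult_mono) auto
          then show "u ^ 3 / 4 \<le> D1 * D2" using q0 by simp
          fix v assume v: "v \<in> {v\<in>V. ix v = y}"
          then have vV: "v \<in> g ` G2" unfolding V_def by simp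
          note q = vv[OF vV] and r = rng[OF v] and n = nG[OF gi(1)[OF vV]]
          show "D1 < real_of_int (fst v)" "real_of_int (fst v) \<le> 2 * D1" "D2 < real_of_int (snd v)" "real_of_int (snd v) \<le> 2 * D2" by (fact r)+
          show "prime (fst v)" "prime (snd v)" "fst v \<noteq> snd v" "e v \<noteq> 0" "f v \<noteq> 0" using q by auto
          have q1: "e v * fst v ^ k = a2 * (a1 * int (gi v) + b1)" "f v * snd v ^ k = a1 * (a2 * int (gi v) + b2)" using q by auto
          show "e v * fst v ^ k - f v * snd v ^ k = h" unfolding q1 h_def by (simp add: algebra_simps)
          have up: "\<bar>real_of_int z\<bar> \<le> A * u ^ (2 * k + 1) / D ^ k"
            if "z * w ^ k = a * (a' * int (gi v) + b)" "D < real_of_int w" "D > 0" "\<bar>real_of_int a\<bar> * (\<bar>real_of_int a'\<bar> + \<bar>real_of_int b\<bar>) \<le> A"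
            for z w a a' b :: int and D :: real
          proof -
            have nn: "1 \<le> real (gi v)" using n(1) by simp
            have "\<bar>real_of_int z\<bar> * D ^ k \<le> \<bar>real_of_int z\<bar> * real_of_int w ^ k" using that by (intro mult_left_mono power_mono) auto
            also have "\<dots> = \<bar>real_of_int (z * w ^ k)\<bar>" using that(2,3) by (simp add: abs_mult power_abs)
            also have "\<dots> = \<bar>real_of_int a\<bar> * \<bar>real_of_int a' * real (gi v) + real_of_int b\<bar>" unfolding that(1) by (simp add: abs_mult)
            also have "\<dots> \<le> \<bar>real_of_int a\<bar> * (\<bar>real_of_int a'\<bar> * real (gi v) + \<bar>real_of_int b\<bar> * real (gi v))"
            proof (rule mult_left_mono)
              have "\<bar>real_of_int a' * real (gi v) + real_of_int b\<bar> \<le> \<bar>real_of_int a' * real (gi v)\<bar> + \<bar>real_of_int b\<bar>" by simp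
              also have "\<bar>real_of_int a' * real (gi v)\<bar> = \<bar>real_of_int a'\<bar> * real (gi v)" by (simp add: abs_mult)
              also have "\<bar>real_of_int b\<bar> \<le> \<bar>real_of_int b\<bar> * real (gi v)" using nn by (simp add: mult_le_cancel_left1)
              finally show "\<bar>real_of_int a' * real (gi v) + real_of_int b\<bar> \<le> \<bar>real_of_int a'\<bar> * real (gi v) + \<bar>real_of_int b\<bar> * real (gi v)"
                by simp
            qed simp
            also have "\<dots> = (\<bar>real_of_int a\<bar> * (\<bar>real_of_int a'\<bar> + \<bar>real_of_int b\<bar>)) * real (gi v)" by (simp add: algebra_simps)
            also have "\<dots> \<le> A * u ^ (2 * k + 1)" using that(4) n(2) A1 by (intro mult_mono) auto
            finally show ?thesis using that(3) by (simp add: pos_le_divide_eq)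
          qed
          show "\<bar>real_of_int (e v)\<bar> \<le> A * u ^ (2 * k + 1) / D1 ^ k"
            by (rule up[OF q1(1) r(1) D0(1)]) (simp add: A_def)
          show "\<bar>real_of_int (f v)\<bar> \<le> A * u ^ (2 * k + 1) / D2 ^ k"
            by (rule up[OF q1(2) r(3) D0(2)]) (simp add: A_def)
          have "D1 * D2 \<le> u\<^sup>2 * u\<^sup>2" using r q D0 by (intro mult_mono) auto
          also have "\<dots> = u ^ 4" by (simp add: power_add[symmetric])
          finally have "c * (D1 * D2) \<le> c * u ^ 4" using c1 by (intro mult_left_mono) auto
          also have "\<dots> \<le> 1 * \<bar>real_of_int (a1 * int (gi v) + b1)\<bar>"
          proof -
            have "real (gi v) \<le> \<bar>real_of_int a1\<bar> * real (gi v)" using ra by (simp add: mult_le_cancel_right1)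
            also have "\<dots> = \<bar>real_of_int a1 * real (gi v)\<bar>" by (simp add: abs_mult)
            finally have "real (gi v) - \<bar>real_of_int b1\<bar> \<le> \<bar>real_of_int a1 * real (gi v) + real_of_int b1\<bar>" by linarith
            then show ?thesis using n(3) unfolding N0_def by simp
          qed
          also have "\<dots> \<le> \<bar>real_of_int a2\<bar> * \<bar>real_of_int (a1 * int (gi v) + b1)\<bar>" using ra by (intro mult_right_mono) auto
          also have "\<dots> = \<bar>real_of_int (e v * fst v ^ k)\<bar>" unfolding q1 by (simp only: of_int_mult abs_mult)
          also have "\<dots> = \<bar>real_of_int (e v)\<bar> * real_of_int (fst v) ^ k" using r(1) D0 by (simp add: abs_mult power_abs)
          finally show "(2 * \<bar>real_of_int h\<bar> * 4 ^ k + 1) * (D1 * D2) \<le> \<bar>real_of_int (e v)\<bar> * real_of_int (fst v) ^ k"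
            unfolding c_def .
        qed (use fV u D0 in auto)
        then have "real (card {v\<in>V. ix v = y}) \<le> C1 * u ^ 3 * u powr (\<epsilon> / 2)" by (rule dy[OF u(1)])
        then show ?thesis by (simp add: le_nat_floor)
      qed
      have "card V \<le> nat \<lfloor>C1 * u ^ 3 * u powr (\<epsilon> / 2)\<rfloor> * card (ix ` V)" by (rule card_le_fibres[OF fV fib])
      also have "\<dots> \<le> nat \<lfloor>C1 * u ^ 3 * u powr (\<epsilon> / 2)\<rfloor> * card ({..M} \<times> {..M})" by (intro mult_left_mono card_mono im) auto
      also have "card ({..M} \<times> {..M}) = (M + 1)\<^sup>2" by (simp add: card_cartesian_product power2_eq_square)
      finally have "real (card V) \<le> real (nat \<lfloor>C1 * u ^ 3 * u powr (\<epsilon> / 2)\<rfloor> * (M + 1)\<^sup>2)" by (simp only: of_nat_le_iff)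
      also have "\<dots> = real (nat \<lfloor>C1 * u ^ 3 * u powr (\<epsilon> / 2)\<rfloor>) * (real M + 1)\<^sup>2" by simp
      also have "\<dots> \<le> (C1 * u ^ 3 * u powr (\<epsilon> / 2)) * (C2 * u powr \<delta>)\<^sup>2"
      proof (intro mult_mono power_mono)
        show "real (nat \<lfloor>C1 * u ^ 3 * u powr (\<epsilon> / 2)\<rfloor>) \<le> C1 * u ^ 3 * u powr (\<epsilon> / 2)" using C1 u0 by (simp add: of_nat_floor)
        have d1: "1 \<le> u powr \<delta>" using u \<delta> by (intro ge_one_powr_ge_zero) auto
        have lgeq: "log 2 (u\<^sup>2) = 2 * ln u / ln 2" unfolding log_def using u0 by (simp add: ln_realpow)
        have "ln u \<le> u powr \<delta> / \<delta>" using u \<delta> by (intro ln_powr_bound) auto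
        then have "2 * ln u / ln 2 \<le> 2 * (u powr \<delta> / \<delta>) / ln 2" by (intro divide_right_mono) auto
        then have lg: "log 2 (u\<^sup>2) \<le> 2 / (\<delta> * ln 2) * u powr \<delta>" unfolding lgeq by simp
        have "ln u \<ge> 0" using u by simp
        then have "log 2 (u\<^sup>2) \<ge> 0" unfolding lgeq by simp
        then have "real M \<le> log 2 (u\<^sup>2)" unfolding M_def by (simp add: of_nat_floor)
        then show "real M + 1 \<le> C2 * u powr \<delta>" using lg d1 unfolding C2_def distrib_right by linarith
      qed (use C1 u0 in auto)
      also have "\<dots> = C1 * C2\<^sup>2 * (u ^ 3 * (u powr (\<epsilon> / 2) * (u powr \<delta> * u powr \<delta>)))"
        unfolding power_mult_distrib power2_eq_square by (simp only: ac_simps)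
      also have "u powr (\<epsilon> / 2) * (u powr \<delta> * u powr \<delta>) = u powr \<epsilon>" unfolding powr_add[symmetric] \<delta>(4) ..
      also have "card V = card G2" unfolding V_def by (rule card_image[OF inj])
      finally show ?thesis .
    qed
    have "G = G1 \<union> G2" unfolding G1_def G2_def by auto
    then have "card G \<le> card G1 + card G2" using card_Un_le by metis
    then have "real (card G) \<le> real (card G1) + real (card G2)" by (simp only: of_nat_le_iff of_nat_add[symmetric])
    also have "\<dots> \<le> C * (u ^ 3 * u powr \<epsilon>)" using c1' c2' unfolding C_def distrib_right by linarith
    finally show "real (card {n::nat. 0 < n \<and> real n \<le> u ^ (2 * k + 1) \<and> (\<exists>p q. large_pair k a1 b1 a2 b2 u n p q)}) \<le> C * u ^ 3 * u powr \<epsilon>"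
      unfolding G_def x_def by (simp add: mult.assoc)
  qed
qed

section \<open>The sieve\<close>

text \<open>Squarefree numbers, encoded by their sets of prime factors;
  \<open>inj_on_Prod_prime_sets\<close> justifies the encoding. In the sieve
  \<open>(-1) ^ card S\<close> is the Moebius function.\<close>

definition prime_sets :: "nat set set" where
  "prime_sets = {S. finite S \<and> (\<forall>p\<in>S. prime p)}"

lemma prime_setsD:
  assumes "S \<in> prime_sets"
  shows "finite S" "\<And>p. p \<in> S \<Longrightarrow> prime p" "\<Prod>S > 0" "\<And>p. p \<in> S \<Longrightarrow> p \<le> \<Prod>S"
proof -
  show fin: "finite S" and pr: "\<And>p. p \<in> S \<Longrightarrow> prime p" using assms unfolding prime_sets_def by auto
  show pos: "\<Prod>S > 0" using pr by (intro prod_pos) (auto dest: prime_gt_0_nat)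
  show "p \<le> \<Prod>S" if "p \<in> S" for p using dvd_prodI[OF fin that, of "\<lambda>x. x"] pos by (auto intro: dvd_imp_le)
qed

lemma prime_dvd_Prod_prime_set:
  assumes "S \<in> prime_sets" "prime p"
  shows "p dvd \<Prod>S \<longleftrightarrow> p \<in> S"
  using prime_dvd_prod_iff[OF prime_setsD(1)[OF assms(1)] assms(2), of "\<lambda>x. x"] prime_setsD(2)[OF assms(1)] primes_dvd_imp_eq[OF assms(2)]
  by (metis dvd_refl)

lemma inj_on_Prod_prime_sets: "inj_on \<Prod> prime_sets"
proof (rule inj_onI)
  fix S T assume S: "S \<in> prime_sets" and T: "T \<in> prime_sets" and eq: "\<Prod>S = \<Prod>T"
  have "p \<in> S \<longleftrightarrow> p \<in> T" for p
    using prime_dvd_Prod_prime_set[OF S, of p] prime_dvd_Prod_prime_set[OF T, of p] prime_setsD(2)[OF S] prime_setsD(2)[OF T]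
    unfolding eq by blast
  then show "S = T" by blast
qed

lemma sum_prime_sets_le:
  fixes g :: "nat \<Rightarrow> real"
  assumes "F \<subseteq> prime_sets" "finite M" "\<And>S. S \<in> F \<Longrightarrow> \<Prod>S \<in> M" "\<And>m. m \<in> M \<Longrightarrow> g m \<ge> 0"
  shows "(\<Sum>S\<in>F. g (\<Prod>S)) \<le> (\<Sum>m\<in>M. g m)"
proof -
  have "(\<Sum>S\<in>F. g (\<Prod>S)) = (\<Sum>m\<in>\<Prod> ` F. g m)"
    by (rule sum.reindex_cong[symmetric, of \<Prod>]) (use inj_on_subset[OF inj_on_Prod_prime_sets assms(1)] in auto)
  also have "\<dots> \<le> (\<Sum>m\<in>M. g m)" using assms by (intro sum_mono2) auto
  finally show ?thesis .
qed

lemma finite_prime_sets_le: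
  fixes y :: real
  shows "finite {S\<in>prime_sets. real (\<Prod>S) \<le> y}"
proof (rule finite_subset[of _ "Pow {..nat \<lfloor>y\<rfloor>}"])
  show "{S\<in>prime_sets. real (\<Prod>S) \<le> y} \<subseteq> Pow {..nat \<lfloor>y\<rfloor>}"
  proof (intro subsetI PowI)
    fix S p assume "S \<in> {S\<in>prime_sets. real (\<Prod>S) \<le> y}" and p: "p \<in> S"
    then have S: "S \<in> prime_sets" "real (\<Prod>S) \<le> y" by blast+
    have "real p \<le> real (\<Prod>S)" using prime_setsD(4)[OF S(1) p] by (simp only: of_nat_le_iff)
    then have "p \<le> nat \<lfloor>y\<rfloor>" using S(2) by (intro le_nat_floor) linarith
    then show "p \<in> {..nat \<lfloor>y\<rfloor>}" by simp
  qed
qed simp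

lemma sum_powr_le:
  assumes "s < -1"
  obtains C where "C > 0" "\<And>M. finite M \<Longrightarrow> (\<Sum>m\<in>M. real m powr s) \<le> C"
proof -
  have summ: "summable (\<lambda>n. real n powr s)" using summable_real_powr_iff assms by blast
  define C where "C = 1 + (\<Sum>n. real n powr s)"
  have "C > 0" unfolding C_def using suminf_nonneg[OF summ] by (simp add: add_pos_nonneg)
  moreover have "(\<Sum>m\<in>M. real m powr s) \<le> C" if "finite M" for M
    using sum_le_suminf[OF summ that] unfolding C_def by simp
  ultimately show ?thesis by (rule that)
qed

section \<open>Counting in periodic sets\<close>

lemma card_periodic_window:
  fixes P :: "nat \<Rightarrow> bool"
  assumes per: "\<And>n. P (n + m) = P n"
  shows "card {n\<in>{X<..X + m}. P n} = card {n. n < m \<and> P n}"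
proof (cases "m = 0")
  case False
  show ?thesis
  proof (induction X)
    case 0
    have eq: "{n. n < m \<and> P n} = {n\<in>{0..<m}. P n}" by auto
    have "{0<..0 + m} = insert m {0<..<m}" "{0..<m} = insert 0 {0<..<m}" using False by auto
    then have "{n\<in>{0<..0 + m}. P n} = (if P m then {m} else {}) \<union> {n\<in>{0<..<m}. P n}"
      "{n\<in>{0..<m}. P n} = (if P 0 then {0} else {}) \<union> {n\<in>{0<..<m}. P n}" by auto
    moreover have "P m = P 0" using per[of 0] by simp
    moreover have "finite {n\<in>{0<..<m}. P n}" "m \<notin> {n\<in>{0<..<m}. P n}" "0 \<notin> {n\<in>{0<..<m}. P n}" by auto
    ultimately show ?case unfolding eq
      by (cases "P 0") (simp_all only: if_True if_False card_insert_disjoint Un_insert_left Un_empty_left not_False_eq_True)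
  next
    case (Suc X)
    have "{X<..X + m} = insert (Suc X) {Suc X<..X + m}" "{Suc X<..Suc X + m} = insert (Suc (X + m)) {Suc X<..X + m}" using False by auto
    then have "{n\<in>{X<..X + m}. P n} = (if P (Suc X) then {Suc X} else {}) \<union> {n\<in>{Suc X<..X + m}. P n}"
      "{n\<in>{Suc X<..Suc X + m}. P n} = (if P (Suc (X + m)) then {Suc (X + m)} else {}) \<union> {n\<in>{Suc X<..X + m}. P n}" by auto
    moreover have "P (Suc (X + m)) = P (Suc X)" using per[of "Suc X"] by simp
    moreover have "finite {n\<in>{Suc X<..X + m}. P n}" "Suc X \<notin> {n\<in>{Suc X<..X + m}. P n}" "Suc (X + m) \<notin> {n\<in>{Suc X<..X + m}. P n}" by auto
    ultimately have "card {n\<in>{Suc X<..Suc X + m}. P n} = card {n\<in>{X<..X + m}. P n}"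
      by (cases "P (Suc X)") (simp_all only: if_True if_False card_insert_disjoint Un_insert_left Un_empty_left not_False_eq_True)
    then show ?case using Suc.IH by (simp only:)
  qed
qed simp

text \<open>The error is measured by the number \<open>c\<close> of residue classes and not by the
  period: a full period contributes exactly \<open>c\<close>, and only the incomplete one is in
  error. In the application the period \<open>(\<Prod>S) ^ k\<close> can be far larger than
  \<open>x\<close>, while \<open>c\<close> stays below \<open>rho_bound ^ card S\<close>.\<close>

lemma card_periodic_le:
  fixes P :: "nat \<Rightarrow> bool" and x :: real
  assumes m: "m > 0" and per: "\<And>n. P (n + m) = P n" and x: "x \<ge> 0"
  defines "c \<equiv> card {n. n < m \<and> P n}"
  shows "\<bar>real (card {n. 0 < n \<and> real n \<le> x \<and> P n}) - x * real c / real m\<bar> \<le> 2 * real c"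
proof -
  define F where "F = (\<lambda>X. card {n\<in>{0<..X}. P n})"
  have step: "F (X + m) = F X + c" for X
  proof -
    have dis: "card (A \<union> B) = card A + card B" if "A = {n\<in>{0<..X}. P n}" "B = {n\<in>{X<..X + m}. P n}" for A B
      unfolding that by (rule card_Un_disjoint) auto
    have "{n\<in>{0<..X + m}. P n} = {n\<in>{0<..X}. P n} \<union> {n\<in>{X<..X + m}. P n}" by auto
    then have "F (X + m) = card ({n\<in>{0<..X}. P n} \<union> {n\<in>{X<..X + m}. P n})" unfolding F_def by (rule arg_cong)
    also have "\<dots> = F X + card {n\<in>{X<..X + m}. P n}" unfolding F_def by (rule dis) (rule refl)+
    also have "card {n\<in>{X<..X + m}. P n} = c" unfolding c_def by (rule card_periodic_window) (rule per)
    finally show ?thesis .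
  qed
  have mult: "F (s + q * m) = F s + q * c" for s q
  proof (induction q)
    case (Suc q)
    have "F (s + Suc q * m) = F ((s + q * m) + m)" by (simp add: algebra_simps)
    then show ?case unfolding step Suc.IH by simp
  qed simp
  define X where "X = nat \<lfloor>x\<rfloor>"
  have X: "real X \<le> x" "x < real X + 1" unfolding X_def using x by linarith+
  have set: "{n. 0 < n \<and> real n \<le> x \<and> P n} = {n\<in>{0<..X}. P n}"
  proof -
    have "real n \<le> x \<longleftrightarrow> n \<le> X" for n
    proof
      assume "real n \<le> x"
      then have "real n < real (X + 1)" using X by simp
      then show "n \<le> X" by (simp only: of_nat_less_iff)
    next
      assume "n \<le> X"
      then have "real n \<le> real X" by (simp only: of_nat_le_iff)
      then show "real n \<le> x" using X by linarith
    qed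
    then show ?thesis by auto
  qed
  define q s where "q = X div m" "s = X mod m"
  have Xq: "X = s + q * m" unfolding q_s_def by simp
  have sm: "s < m" unfolding q_s_def using m by simp
  have "F s \<le> F m" unfolding F_def using sm by (intro card_mono) auto
  also have "F m = c" using step[of 0] unfolding F_def by simp
  finally have Fs: "real (F s) \<le> real c" by simp
  have FX: "real (F X) = real (F s) + real q * real c" unfolding Xq mult by simp
  have "x * real c / real m = (x - real q * real m) / real m * real c + real q * real c"
    using m by (simp add: diff_divide_distrib left_diff_distrib)
  moreover have "0 \<le> (x - real q * real m) / real m" "(x - real q * real m) / real m \<le> 2"
  proof -
    have "real X = real s + real q * real m" unfolding Xq by simp
    then have "0 \<le> x - real q * real m" "x - real q * real m \<le> 2 * real m" using X sm m by linarith+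
    then show "0 \<le> (x - real q * real m) / real m" "(x - real q * real m) / real m \<le> 2"
      using m by (auto simp: pos_divide_le_eq)
  qed
  then have "0 \<le> (x - real q * real m) / real m * real c" "(x - real q * real m) / real m * real c \<le> 2 * real c"
    by (intro mult_nonneg_nonneg mult_right_mono; simp)+
  moreover have "card {n\<in>{0<..X}. P n} = F X" unfolding F_def ..
  ultimately show ?thesis unfolding set using Fs FX by (simp only:)
qed

text \<open>Chinese remainder theorem: reduction to the two moduli maps the residues below
  \<open>m * m'\<close> bijectively onto pairs of residues.\<close>

lemma card_coprime_periodic:
  fixes P Q :: "nat \<Rightarrow> bool"
  assumes m: "m > 0" "m' > 0" "coprime m m'" and per: "\<And>n. P (n mod m) = P n" "\<And>n. Q (n mod m') = Q n"
  shows "card {n. n < m * m' \<and> P n \<and> Q n} = card {n. n < m \<and> P n} * card {n. n < m' \<and> Q n}"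
proof -
  define g where "g = (\<lambda>n. (n mod m, n mod m'))"
  have inj: "inj_on g {..<m * m'}"
  proof (rule inj_onI)
    fix n n' assume n: "n \<in> {..<m * m'}" "n' \<in> {..<m * m'}" "g n = g n'"
    have "int m dvd int n - int n'" "int m' dvd int n - int n'"
      using n(3) unfolding g_def by (metis mod_eq_dvd_iff of_nat_mod prod.inject)+
    then have "int m * int m' dvd int n - int n'" using m(3) by (intro divides_mult) auto
    moreover have "\<bar>int n - int n'\<bar> < int m * int m'"
    proof -
      have "int n < int (m * m')" "int n' < int (m * m')" using n by (simp_all only: of_nat_less_iff lessThan_iff)
      then show ?thesis by simp
    qed
    ultimately have "int n - int n' = 0" using dvd_imp_le_int[of "int n - int n'" "int m * int m'"] by (cases "int n - int n' = 0") auto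
    then show "n = n'" by simp
  qed
  have im: "g ` {..<m * m'} = {..<m} \<times> {..<m'}"
  proof (rule card_subset_eq)
    show "g ` {..<m * m'} \<subseteq> {..<m} \<times> {..<m'}" unfolding g_def using m by auto
    show "card (g ` {..<m * m'}) = card ({..<m} \<times> {..<m'})" using card_image[OF inj] by (simp add: card_cartesian_product)
  qed simp
  have "g ` {n. n < m * m' \<and> P n \<and> Q n} = {n. n < m \<and> P n} \<times> {n. n < m' \<and> Q n}"
  proof (intro set_eqI iffI)
    fix y assume "y \<in> g ` {n. n < m * m' \<and> P n \<and> Q n}"
    then show "y \<in> {n. n < m \<and> P n} \<times> {n. n < m' \<and> Q n}" unfolding g_def using m per by auto
  next
    fix y assume y: "y \<in> {n. n < m \<and> P n} \<times> {n. n < m' \<and> Q n}"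
    then have "y \<in> g ` {..<m * m'}" unfolding im by auto
    then obtain n where n: "n < m * m'" "y = g n" by auto
    have "P n" "Q n" using y per[of n] unfolding n(2) g_def by auto
    then show "y \<in> g ` {n. n < m * m' \<and> P n \<and> Q n}" using n by auto
  qed
  then have "card (g ` {n. n < m * m' \<and> P n \<and> Q n}) = card {n. n < m \<and> P n} * card {n. n < m' \<and> Q n}"
    by (simp add: card_cartesian_product)
  moreover have "card (g ` {n. n < m * m' \<and> P n \<and> Q n}) = card {n. n < m * m' \<and> P n \<and> Q n}"
    by (intro card_image inj_on_subset[OF inj]) auto
  ultimately show ?thesis by simp
qed

text \<open>Factors are added one at a time. The first product to exceed \<open>y\<close> is at most
  \<open>u\<close> times its predecessor, which did not exceed \<open>y\<close>.\<close>

lemma greedy_subset: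
  fixes c u y :: real
  assumes "finite B" "c \<le> y" "y < c * real (\<Prod>B)" "\<And>b. b \<in> B \<Longrightarrow> real b \<le> u" "c \<ge> 0" "u \<ge> 0"
  obtains S where "S \<subseteq> B" "y < c * real (\<Prod>S)" "c * real (\<Prod>S) \<le> y * u"
proof -
  have "\<exists>S\<subseteq>B. y < c * real (\<Prod>S) \<and> c * real (\<Prod>S) \<le> y * u"
    using assms(1,3,4)
  proof (induction B rule: finite_induct)
    case empty
    then show ?case using assms(2) by simp
  next
    case (insert b B)
    show ?case
    proof (cases "y < c * real (\<Prod>B)")
      case True
      then show ?thesis using insert.IH insert.prems(2) by (meson insertCI subset_insertI2)
    next
      case False
      have "c * real (\<Prod>(insert b B)) = (c * real (\<Prod>B)) * real b" using insert.hyps by simp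
      also have "\<dots> \<le> y * u" using False insert.prems(2)[of b] assms(2,5,6) by (intro mult_mono) auto
      finally show ?thesis using insert.prems(1) by blast
    qed
  qed
  then show ?thesis using that by blast
qed

text \<open>The case depends on the primes above \<open>u\<close>. A prime above
  \<open>u\<^sup>2\<close> is a suitable \<open>S\<close> by itself. If at most one prime exceeds
  \<open>u\<close>, the greedy choice starting from it ends between \<open>u\<^sup>2\<close> and
  \<open>u ^ 3\<close>. Two primes above \<open>u\<close> have product above
  \<open>u\<^sup>2\<close> and thus form either \<open>S\<close> or the exceptional pair.\<close>

lemma prime_set_splitting:
  fixes u C :: real
  assumes B: "B \<in> prime_sets" and u: "u \<ge> 1" and C: "C \<ge> 1" and big: "u ^ 3 < real (\<Prod>B)"
    and le: "\<And>p. p \<in> B \<Longrightarrow> real p \<le> C * u ^ 3"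
  shows "(\<exists>S\<subseteq>B. u\<^sup>2 < real (\<Prod>S) \<and> real (\<Prod>S) \<le> C * u ^ 3) \<or>
    (\<exists>p\<in>B. \<exists>q\<in>B. p \<noteq> q \<and> u < real p \<and> real p \<le> u\<^sup>2 \<and> u < real q \<and> real q \<le> u\<^sup>2 \<and> u ^ 3 < real p * real q)"
proof -
  have fin: "finite B" by (rule prime_setsD(1)[OF B])
  have u3: "u ^ 3 \<le> C * u ^ 3" "u ^ 3 = u\<^sup>2 * u" "u\<^sup>2 \<le> u ^ 3" "1 \<le> u\<^sup>2" "u \<le> u\<^sup>2"
  proof -
    show "u ^ 3 \<le> C * u ^ 3" using C u by (simp add: mult_le_cancel_right1)
    show "u ^ 3 = u\<^sup>2 * u" by (simp add: power2_eq_square power3_eq_cube)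
    show "u\<^sup>2 \<le> u ^ 3" using u by (intro power_increasing) auto
    show "1 \<le> u\<^sup>2" using u by (simp add: one_le_power)
    show "u \<le> u\<^sup>2" using u by (simp add: power2_eq_square)
  qed
  consider (one) p where "p \<in> B" "u\<^sup>2 < real p"
    | (small) "\<And>p. p \<in> B \<Longrightarrow> real p \<le> u\<^sup>2" "\<And>p. p \<in> B \<Longrightarrow> real p \<le> u"
    | (single) p where "\<And>p. p \<in> B \<Longrightarrow> real p \<le> u\<^sup>2" "p \<in> B" "u < real p" "\<And>q. q \<in> B - {p} \<Longrightarrow> real q \<le> u"
    | (two) p q where "\<And>p. p \<in> B \<Longrightarrow> real p \<le> u\<^sup>2" "p \<in> B" "q \<in> B" "p \<noteq> q" "u < real p" "u < real q"
    by (metis DiffE insertCI not_less)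
  then show ?thesis
  proof cases
    case one
    then have "{p} \<subseteq> B" "u\<^sup>2 < real (\<Prod>{p})" "real (\<Prod>{p}) \<le> C * u ^ 3" using le by auto
    then show ?thesis by blast
  next
    case small
    have "u\<^sup>2 < 1 * real (\<Prod>B)" using big u3(3) by linarith
    then obtain S where "S \<subseteq> B" "u\<^sup>2 < 1 * real (\<Prod>S)" "1 * real (\<Prod>S) \<le> u\<^sup>2 * u"
      using greedy_subset[OF fin u3(4) _ small(2)] u by (metis order_trans zero_le_one)
    then have "S \<subseteq> B \<and> u\<^sup>2 < real (\<Prod>S) \<and> real (\<Prod>S) \<le> C * u ^ 3" using u3(1,2) by linarith
    then show ?thesis by blast
  next
    case single
    have "real (\<Prod>B) = real p * real (\<Prod>(B - {p}))" using fin single(2) by (metis of_nat_mult prod.remove)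
    then have gt: "u\<^sup>2 < real p * real (\<Prod>(B - {p}))" using big u3(3) by linarith
    obtain S where S: "S \<subseteq> B - {p}" "u\<^sup>2 < real p * real (\<Prod>S)" "real p * real (\<Prod>S) \<le> u\<^sup>2 * u"
      by (rule greedy_subset[OF _ single(1)[OF single(2)] gt single(4)]) (use fin u in auto)
    have "real (\<Prod>(insert p S)) = real p * real (\<Prod>S)"
      using S(1) finite_subset[OF S(1)] fin by (subst prod.insert) auto
    then have "insert p S \<subseteq> B" "u\<^sup>2 < real (\<Prod>(insert p S))" "real (\<Prod>(insert p S)) \<le> C * u ^ 3" using S(2,3) u3(1,2) single(2) S(1) by (blast, linarith+)
    then show ?thesis by blast
  next
    case two
    show ?thesis
    proof (cases "real p * real q \<le> u ^ 3")
      case True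
      have "u * u < real p * real q" using two u by (intro mult_strict_mono) auto
      moreover have "real (\<Prod>{p, q}) = real p * real q" using two by simp
      ultimately have "{p, q} \<subseteq> B" "u\<^sup>2 < real (\<Prod>{p, q})" "real (\<Prod>{p, q}) \<le> C * u ^ 3" using True two(2,3) u3(1) unfolding power2_eq_square by (blast, linarith+)
      then show ?thesis by blast
    next
      case False
      then have "p \<in> B \<and> q \<in> B \<and> p \<noteq> q \<and> u < real p \<and> real p \<le> u\<^sup>2 \<and> u < real q \<and> real q \<le> u\<^sup>2 \<and> u ^ 3 < real p * real q"
        using two(2-6) two(1)[OF two(2)] two(1)[OF two(3)] by simp
      then show ?thesis by blast
    qed
  qed
qed

text \<open>Two solutions \<open>n\<close>, \<open>n'\<close> satisfy
  \<open>int M dvd a * (int n - int n')\<close> and so are at least \<open>M / \<bar>a\<bar>\<close>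
  apart. The bound is uniform in \<open>M\<close>, common factors with \<open>a\<close>
  included.\<close>

lemma card_linear_residues_le:
  fixes a b :: int and M :: nat
  assumes a: "a \<noteq> 0" and M: "M > 0"
  shows "real (card {n::nat. n < M \<and> int M dvd a * int n + b}) \<le> 1 + \<bar>real_of_int a\<bar>"
proof -
  define A where "A = {n::nat. n < M \<and> int M dvd a * int n + b}"
  have a1: "\<bar>real_of_int a\<bar> > 0" using a by simp
  have "real (card (real ` A)) \<le> 1 + (real M - 0) / (real M / \<bar>real_of_int a\<bar>)"
  proof (rule card_spaced_le)
    show "finite (real ` A)" unfolding A_def by simp
    show "0 \<le> x \<and> x \<le> real M" if "x \<in> real ` A" for x using that unfolding A_def by auto
    fix x y assume "x \<in> real ` A" "y \<in> real ` A" "x \<noteq> y"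
    then obtain n n' where n: "n \<in> A" "n' \<in> A" "x = real n" "y = real n'" "n \<noteq> n'" by auto
    have "int M dvd (a * int n + b) - (a * int n' + b)" using n unfolding A_def by (intro dvd_diff) auto
    also have "(a * int n + b) - (a * int n' + b) = a * (int n - int n')" by (simp add: algebra_simps)
    finally have "int M \<le> \<bar>a * (int n - int n')\<bar>" using n(5) a by (intro zdvd_imp_le) (auto simp: dvd_abs_iff)
    then have "real_of_int (int M) \<le> real_of_int \<bar>a * (int n - int n')\<bar>" by (simp only: of_int_le_iff)
    then have "real M \<le> \<bar>real_of_int a\<bar> * \<bar>x - y\<bar>" unfolding n(3,4) by (simp add: abs_mult)
    then show "\<bar>x - y\<bar> \<ge> real M / \<bar>real_of_int a\<bar>" using a1 by (simp add: pos_divide_le_eq mult.commute)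
  qed (use a1 M in auto)
  moreover have "card (real ` A) = card A" by (rule card_image) (simp add: inj_on_def)
  ultimately show ?thesis unfolding A_def using M by simp
qed

lemma prime_set_Prod_ge_1:
  assumes "S \<in> prime_sets"
  shows "1 \<le> real (\<Prod>S)"
proof -
  have "1 \<le> \<Prod>S" using prime_setsD(3)[OF assms] by linarith
  then have "real 1 \<le> real (\<Prod>S)" by (simp only: of_nat_le_iff)
  then show ?thesis by (simp only: of_nat_1)
qed

lemma Prod_prime_set_dvd:
  fixes L :: int
  assumes "S \<in> prime_sets" "\<And>p. p \<in> S \<Longrightarrow> int p dvd L"
  shows "int (\<Prod>S) dvd L"
proof -
  have "finite S" "\<And>p. p \<in> S \<Longrightarrow> prime p" using prime_setsD[OF assms(1)] by auto
  then show ?thesis using assms(2)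
  proof (induction S rule: finite_induct)
    case (insert p S)
    have "S \<in> prime_sets" unfolding prime_sets_def using insert by auto
    then have "\<not> p dvd \<Prod>S" using prime_dvd_Prod_prime_set[of S p] insert by auto
    then have "coprime p (\<Prod>S)" using insert.prems(1) by (intro prime_imp_coprime) auto
    then have "coprime (int p) (int (\<Prod>S))" by (simp only: coprime_int_iff)
    then have "int p * int (\<Prod>S) dvd L" using insert by (intro divides_mult) auto
    then show ?case using insert.hyps by simp
  qed simp
qed

lemma sum_neg_one_power_card_Pow:
  assumes "finite B"
  shows "(\<Sum>S\<in>Pow B. (-1) ^ card S) = (if B = {} then 1 else (0::real))"
  using prod_diff_conv_sum[OF assms, of "\<lambda>_. 1::real" "\<lambda>_. 1"] assms by (auto simp: power_0_left card_gt_0_iff)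

section \<open>The linear forms, their bad primes and residue classes\<close>

locale linear_forms =
  fixes k r :: nat and a b :: "nat \<Rightarrow> int" and l :: "nat \<Rightarrow> int poly"
  assumes k: "k \<ge> 2" and r: "r \<ge> 2"
    and l: "\<And>i. i \<in> {1..r} \<Longrightarrow> l i = [:b i, a i:]"
    and a: "\<And>i. i \<in> {1..r} \<Longrightarrow> a i \<noteq> 0"
    and det: "\<And>i j. i \<in> {1..r} \<Longrightarrow> j \<in> {1..r} \<Longrightarrow> i \<noteq> j \<Longrightarrow> a i * b j - a j * b i \<noteq> 0"
begin

definition form :: "nat \<Rightarrow> nat \<Rightarrow> int" where
  "form i n = a i * int n + b i"

definition bad :: "nat \<Rightarrow> nat set" where
  "bad n = {p. prime p \<and> (\<exists>i\<in>{1..r}. int p ^ k dvd form i n)}"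

definition rho_bound :: real where
  "rho_bound = 1 + (\<Sum>i\<in>{1..r}. 1 + \<bar>real_of_int (a i)\<bar>)"

definition height :: real where
  "height = 1 + (\<Sum>i\<in>{1..r}. \<bar>real_of_int (a i)\<bar> + \<bar>real_of_int (b i)\<bar>)"

lemma k_free_iff_bad: "(\<forall>i\<in>{1..r}. k_free k (poly (l i) (int n))) \<longleftrightarrow> bad n = {}"
proof -
  have "poly (l i) (int n) = form i n" if "i \<in> {1..r}" for i using l[OF that] unfolding form_def by (simp add: algebra_simps)
  then show ?thesis unfolding k_free_def bad_def by auto
qed

lemma rho_eq: "rho k r l p = card {n. n < p ^ k \<and> (\<exists>i\<in>{1..r}. int p ^ k dvd form i n)}"
proof -
  define A where "A = {n. n < p ^ k \<and> (\<exists>i\<in>{1..r}. int p ^ k dvd form i n)}"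
  have pe: "poly (l i) (int n) = form i n" if "i \<in> {1..r}" for i n using l[OF that] unfolding form_def by (simp add: algebra_simps)
  have "{n \<in> {0..<int p ^ k}. \<exists>i\<in>{1..r}. int p ^ k dvd poly (l i) n} = int ` A"
  proof (intro set_eqI iffI)
    fix z assume z: "z \<in> {n \<in> {0..<int p ^ k}. \<exists>i\<in>{1..r}. int p ^ k dvd poly (l i) n}"
    then obtain n where n: "z = int n" using nonneg_int_cases[of z] by auto
    have "int n < int (p ^ k)" using z n by simp
    then have "n < p ^ k" by (simp only: of_nat_less_iff)
    then show "z \<in> int ` A" using z pe unfolding n A_def by auto
  next
    fix z assume "z \<in> int ` A"
    then obtain n where n: "z = int n" "n \<in> A" by auto
    then have "int n < int (p ^ k)" unfolding A_def by (simp only: of_nat_less_iff mem_Collect_eq)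
    then show "z \<in> {n \<in> {0..<int p ^ k}. \<exists>i\<in>{1..r}. int p ^ k dvd poly (l i) n}" using n pe unfolding A_def by auto
  qed
  then have "rho k r l p = card (int ` A)" unfolding rho_def by (rule arg_cong)
  also have "\<dots> = card A" by (rule card_image) simp
  finally show ?thesis unfolding A_def .
qed

lemma rho_bound_ge_1: "rho_bound \<ge> 1"
  unfolding rho_bound_def by (simp add: sum_nonneg)

lemma height_ge_1: "height \<ge> 1"
  unfolding height_def by (simp add: sum_nonneg)

lemma rho_le_rho_bound:
  assumes "p > 0"
  shows "real (rho k r l p) \<le> rho_bound"
proof -
  define B where "B = (\<lambda>i. {n. n < p ^ k \<and> int (p ^ k) dvd a i * int n + b i})"
  have "rho k r l p = card (\<Union>i\<in>{1..r}. B i)" unfolding rho_eq B_def form_def by (intro arg_cong[of _ _ card]) auto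
  also have "\<dots> \<le> (\<Sum>i\<in>{1..r}. card (B i))" by (rule card_UN_le) simp
  finally have "real (rho k r l p) \<le> (\<Sum>i\<in>{1..r}. real (card (B i)))" by (simp only: of_nat_le_iff of_nat_sum[symmetric])
  also have "\<dots> \<le> (\<Sum>i\<in>{1..r}. 1 + \<bar>real_of_int (a i)\<bar>)"
    unfolding B_def using a assms by (intro sum_mono card_linear_residues_le) auto
  finally show ?thesis unfolding rho_bound_def by simp
qed

lemma bad_mod:
  assumes "p ^ k dvd m"
  shows "p \<in> bad (n mod m) \<longleftrightarrow> p \<in> bad n"
proof -
  have "int p ^ k dvd form i n \<longleftrightarrow> int p ^ k dvd form i (n mod m)" for i
  proof -
    have "int n = int m * int (n div m) + int (n mod m)" by (simp only: of_nat_mult[symmetric] of_nat_add[symmetric] mult_div_mod_eq)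
    then have "form i n = a i * (int m * int (n div m)) + form i (n mod m)" unfolding form_def by (simp only: distrib_left add.assoc)
    moreover have "int (p ^ k) dvd int m" using assms by (simp only: of_nat_dvd_iff)
    then have "int p ^ k dvd a i * (int m * int (n div m))" by simp
    ultimately show ?thesis by (simp add: dvd_add_right_iff)
  qed
  then show ?thesis unfolding bad_def by simp
qed

lemma bad_subset_mod:
  assumes "S \<in> prime_sets"
  shows "S \<subseteq> bad (n mod (\<Prod>S) ^ k) \<longleftrightarrow> S \<subseteq> bad n"
proof -
  have "p \<in> bad (n mod (\<Prod>S) ^ k) \<longleftrightarrow> p \<in> bad n" if "p \<in> S" for p
    by (rule bad_mod) (use dvd_prodI[OF prime_setsD(1)[OF assms] that, of "\<lambda>x. x"] in \<open>simp add: dvd_power_same\<close>)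
  then show ?thesis by blast
qed

text \<open>The number of residue classes is multiplicative by the Chinese remainder theorem; the
  primes are added one at a time.\<close>

lemma card_bad_residues:
  assumes "S \<in> prime_sets"
  shows "card {n. n < (\<Prod>S) ^ k \<and> S \<subseteq> bad n} = (\<Prod>p\<in>S. rho k r l p)"
proof -
  have "finite S" using prime_setsD[OF assms] by auto
  then show ?thesis using assms
  proof (induction S rule: finite_induct)
    case empty
    have "{n::nat. n < 1} = {0}" by auto
    then show ?case by simp
  next
    case (insert p S)
    have S: "S \<in> prime_sets" and p: "prime p" using insert.prems unfolding prime_sets_def by auto
    have "\<not> p dvd \<Prod>S" using prime_dvd_Prod_prime_set[OF S p] insert.hyps by auto
    then have cop: "coprime (p ^ k) ((\<Prod>S) ^ k)" using prime_imp_coprime[OF p] by simp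
    have "{n. n < (\<Prod>(insert p S)) ^ k \<and> insert p S \<subseteq> bad n} = {n. n < p ^ k * (\<Prod>S) ^ k \<and> p \<in> bad n \<and> S \<subseteq> bad n}"
      using insert.hyps by (auto simp: power_mult_distrib)
    then have "card {n. n < (\<Prod>(insert p S)) ^ k \<and> insert p S \<subseteq> bad n} = card {n. n < p ^ k * (\<Prod>S) ^ k \<and> p \<in> bad n \<and> S \<subseteq> bad n}"
      by (rule arg_cong)
    also have "\<dots> = card {n. n < p ^ k \<and> p \<in> bad n} * card {n. n < (\<Prod>S) ^ k \<and> S \<subseteq> bad n}"
      using prime_setsD(3)[OF S] p prime_gt_0_nat
      by (intro card_coprime_periodic cop bad_mod bad_subset_mod[OF S]) auto
    also have "{n. n < p ^ k \<and> p \<in> bad n} = {n. n < p ^ k \<and> (\<exists>i\<in>{1..r}. int p ^ k dvd form i n)}" unfolding bad_def using p by auto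
    finally show ?case using insert.IH[OF S] insert.hyps unfolding rho_eq by simp
  qed
qed

lemma prod_rho_le:
  assumes "S \<in> prime_sets"
  shows "real (\<Prod>p\<in>S. rho k r l p) \<le> rho_bound ^ card S"
proof -
  have "(\<Prod>p\<in>S. real (rho k r l p)) \<le> (\<Prod>p\<in>S. rho_bound)"
    using prime_setsD(2)[OF assms] by (intro prod_mono conjI rho_le_rho_bound) (auto dest: prime_gt_0_nat)
  then show ?thesis by simp
qed

lemma card_bad_supset_le:
  fixes x :: real
  assumes S: "S \<in> prime_sets" and x: "x \<ge> 0"
  shows "\<bar>real (card {n. 0 < n \<and> real n \<le> x \<and> S \<subseteq> bad n}) - x * (\<Prod>p\<in>S. real (rho k r l p) / real p ^ k)\<bar> \<le> 2 * rho_bound ^ card S"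
proof -
  have per: "(S \<subseteq> bad (n + (\<Prod>S) ^ k)) = (S \<subseteq> bad n)" for n
    using bad_subset_mod[OF S, of "n + (\<Prod>S) ^ k"] bad_subset_mod[OF S, of n] by simp
  define c where "c = card {n. n < (\<Prod>S) ^ k \<and> S \<subseteq> bad n}"
  have "\<bar>real (card {n. 0 < n \<and> real n \<le> x \<and> S \<subseteq> bad n}) - x * real c / real ((\<Prod>S) ^ k)\<bar> \<le> 2 * real c"
    unfolding c_def by (rule card_periodic_le) (use per x prime_setsD(3)[OF S] in auto)
  moreover have c: "c = (\<Prod>p\<in>S. rho k r l p)" unfolding c_def by (rule card_bad_residues[OF S])
  moreover have "x * real c / real ((\<Prod>S) ^ k) = x * (\<Prod>p\<in>S. real (rho k r l p) / real p ^ k)"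
    unfolding c by (simp add: prod_dividef prod_power_distrib)
  ultimately show ?thesis using prod_rho_le[OF S] by linarith
qed

lemma form_bounds:
  assumes i: "i \<in> {1..r}" and n: "n > 0" "real n \<le> x"
  shows "\<bar>real_of_int (form i n)\<bar> \<le> height * x"
proof -
  have n1: "1 \<le> real n" using n by simp
  have "\<bar>real_of_int (form i n)\<bar> \<le> \<bar>real_of_int (a i) * real n\<bar> + \<bar>real_of_int (b i)\<bar>" unfolding form_def by simp
  also have "\<dots> \<le> \<bar>real_of_int (a i)\<bar> * real n + \<bar>real_of_int (b i)\<bar> * real n"
    using mult_left_mono[OF n1, of "\<bar>real_of_int (b i)\<bar>"] by (simp add: abs_mult)
  also have "\<dots> = (\<bar>real_of_int (a i)\<bar> + \<bar>real_of_int (b i)\<bar>) * real n" by (simp add: distrib_right)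
  also have "\<dots> \<le> height * x"
  proof (intro mult_mono n)
    have "\<bar>real_of_int (a i)\<bar> + \<bar>real_of_int (b i)\<bar> \<le> (\<Sum>i\<in>{1..r}. \<bar>real_of_int (a i)\<bar> + \<bar>real_of_int (b i)\<bar>)"
      using i by (intro member_le_sum) auto
    then show "\<bar>real_of_int (a i)\<bar> + \<bar>real_of_int (b i)\<bar> \<le> height" unfolding height_def by simp
  qed (use height_ge_1 in auto)
  finally show ?thesis .
qed

lemma prime_power_dvd_le:
  assumes "int p ^ m dvd z" "z \<noteq> 0"
  shows "real p ^ m \<le> \<bar>real_of_int z\<bar>"
proof -
  have "int p ^ m \<le> \<bar>z\<bar>" using assms by (intro zdvd_imp_le) auto
  then have "real_of_int (int p ^ m) \<le> real_of_int \<bar>z\<bar>" by (simp only: of_int_le_iff)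
  then show ?thesis by simp
qed

text \<open>A single prime is bounded through \<open>2 * k + 1 \<le> 3 * k\<close>. The product of
  all bad primes is squarefree and therefore divides the product of the forms.\<close>

lemma bad_bounds:
  fixes u :: real
  assumes nz: "\<And>i. i \<in> {1..r} \<Longrightarrow> form i n \<noteq> 0" and n: "n > 0" "real n \<le> u ^ (2 * k + 1)" and u: "u \<ge> 1"
  shows "bad n \<in> prime_sets" "\<And>p. p \<in> bad n \<Longrightarrow> real p \<le> height * u ^ 3"
    "real (\<Prod>(bad n)) \<le> (height * u ^ (2 * k + 1)) ^ r"
proof -
  show pl: "real p \<le> height * u ^ 3" if p: "p \<in> bad n" for p
  proof -
    obtain i where i: "i \<in> {1..r}" "int p ^ k dvd form i n" using p unfolding bad_def by auto
    have "real p ^ k \<le> \<bar>real_of_int (form i n)\<bar>" by (rule prime_power_dvd_le[OF i(2) nz[OF i(1)]])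
    also have "\<dots> \<le> height * u ^ (2 * k + 1)" by (rule form_bounds[OF i(1) n])
    also have "\<dots> \<le> height ^ k * u ^ (3 * k)"
    proof (intro mult_mono power_increasing)
      show "height \<le> height ^ k" using power_increasing[of 1 k height] height_ge_1 k by simp
    qed (use k u height_ge_1 in auto)
    also have "\<dots> = (height * u ^ 3) ^ k" by (simp add: power_mult_distrib power_mult)
    finally have le: "real p ^ k \<le> (height * u ^ 3) ^ k" .
    show ?thesis
    proof (rule ccontr)
      assume "\<not> real p \<le> height * u ^ 3"
      then have "(height * u ^ 3) ^ k < real p ^ k" using height_ge_1 u k by (intro power_strict_mono) auto
      then show False using le by linarith
    qed
  qed
  have "bad n \<subseteq> {..nat \<lfloor>height * u ^ 3\<rfloor>}" using pl by (auto simp: le_nat_floor)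
  then have "finite (bad n)" by (rule finite_subset) simp
  then show B: "bad n \<in> prime_sets" unfolding prime_sets_def bad_def by auto
  have fin: "finite {1..r}" by simp
  have "int (\<Prod>(bad n)) dvd (\<Prod>i\<in>{1..r}. form i n)"
  proof (rule Prod_prime_set_dvd[OF B])
    fix p assume "p \<in> bad n"
    then obtain i where i: "i \<in> {1..r}" "int p ^ k dvd form i n" unfolding bad_def by auto
    have "int p dvd int p ^ k" using k by (intro dvd_power) auto
    also note i(2)
    also have "form i n dvd (\<Prod>i\<in>{1..r}. form i n)" by (rule dvd_prodI[OF fin i(1)])
    finally show "int p dvd (\<Prod>i\<in>{1..r}. form i n)" .
  qed
  moreover have "(\<Prod>i\<in>{1..r}. form i n) \<noteq> 0" using nz by simp
  ultimately have "real (\<Prod>(bad n)) ^ 1 \<le> \<bar>real_of_int (\<Prod>i\<in>{1..r}. form i n)\<bar>" by (intro prime_power_dvd_le) simp_all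
  also have "\<dots> = (\<Prod>i\<in>{1..r}. \<bar>real_of_int (form i n)\<bar>)" by (simp add: abs_prod)
  also have "\<dots> \<le> (\<Prod>i\<in>{1..r}. height * u ^ (2 * k + 1))" by (intro prod_mono conjI form_bounds n) auto
  finally show "real (\<Prod>(bad n)) \<le> (height * u ^ (2 * k + 1)) ^ r" by simp
qed

section \<open>Truncation of the Euler product\<close>

definition euler_term :: "nat set \<Rightarrow> real" where
  "euler_term S = (-1) ^ card S * (\<Prod>p\<in>S. real (rho k r l p) / real p ^ k)"

lemma abs_euler_term_le:
  assumes "S \<in> prime_sets"
  shows "\<bar>euler_term S\<bar> \<le> rho_bound ^ card S / real (\<Prod>S) ^ k"
proof -
  have "\<bar>euler_term S\<bar> = real (\<Prod>p\<in>S. rho k r l p) / real (\<Prod>S) ^ k"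
    unfolding euler_term_def by (simp add: abs_mult abs_prod prod_dividef prod_power_distrib power_abs)
  also have "\<dots> \<le> rho_bound ^ card S / real (\<Prod>S) ^ k"
    by (rule divide_right_mono[OF prod_rho_le[OF assms] zero_le_power[OF of_nat_0_le_iff]])
  finally show ?thesis .
qed

text \<open>Allowing \<open>m powr (1/6)\<close> for \<open>rho_bound ^ card S\<close> and splitting
  off \<open>m powr (- (2 * real k - 2) / 3)\<close> leaves at most \<open>m powr (-7/6)\<close> for
  \<open>k \<ge> 2\<close>, which is summable. For \<open>m > u ^ 3\<close> the part split off is at
  most \<open>u\<^sup>2 / u ^ (2 * k)\<close>, and this times \<open>u ^ (2 * k + 1)\<close> is
  \<open>u ^ 3\<close>.\<close>

lemma sum_euler_term_tail_le:
  obtains C where "C > 0"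
    "\<And>u F. u \<ge> 1 \<Longrightarrow> finite F \<Longrightarrow> F \<subseteq> prime_sets \<Longrightarrow> (\<And>S. S \<in> F \<Longrightarrow> u ^ 3 < real (\<Prod>S)) \<Longrightarrow>
       (\<Sum>S\<in>F. \<bar>euler_term S\<bar>) \<le> C * u\<^sup>2 / u ^ (2 * k)"
proof -
  obtain C1 where C1: "C1 > 0" and c1: "\<And>S :: nat set. finite S \<Longrightarrow> (\<And>p. p \<in> S \<Longrightarrow> prime p) \<Longrightarrow> rho_bound ^ card S \<le> C1 * real (\<Prod>S) powr (1/6)"
    using power_card_primes_le[OF rho_bound_ge_1, of "1/6"] by (metis zero_less_divide_1_iff zero_less_numeral)
  obtain C2 where C2: "C2 > 0" and c2: "\<And>M. finite M \<Longrightarrow> (\<Sum>m\<in>M. real m powr (-7/6)) \<le> C2"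
    using sum_powr_le[of "-7/6"] by auto
  have pos: "C1 * C2 > 0" using C1 C2 by simp
  show ?thesis
  proof (rule that[OF pos])
    fix u :: real and F assume u: "u \<ge> 1" and F: "finite F" "F \<subseteq> prime_sets" and big: "\<And>S. S \<in> F \<Longrightarrow> u ^ 3 < real (\<Prod>S)"
    have u0: "u > 0" using u by simp
    define q where "q = u\<^sup>2 / u ^ (2 * k)"
    have q0: "q > 0" unfolding q_def using u0 by simp
    have q: "(u ^ 3) powr (- (2 * real k - 2) / 3) = q"
    proof -
      have "(u ^ 3) powr (- (2 * real k - 2) / 3) = u powr (3 * (- (2 * real k - 2) / 3))"
      proof -
        have u3: "u ^ 3 = u powr 3" using u0 by (simp add: powr_numeral)
        show ?thesis unfolding u3 powr_powr ..
      qed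
      also have "3 * (- (2 * real k - 2) / 3) = 2 - real (2 * k)" by simp
      also have "u powr (2 - real (2 * k)) = q" unfolding powr_diff q_def using u0 by (simp only: powr_realpow powr_numeral)
      finally show ?thesis .
    qed
    have tm: "\<bar>euler_term S\<bar> \<le> C1 * q * (real (\<Prod>S) powr (-7/6))" if "S \<in> F" for S
    proof -
      have S: "S \<in> prime_sets" using that F by blast
      define m where "m = real (\<Prod>S)"
      have m1: "m \<ge> 1" unfolding m_def by (rule prime_set_Prod_ge_1[OF S])
      have "\<bar>euler_term S\<bar> \<le> rho_bound ^ card S / m ^ k" unfolding m_def by (rule abs_euler_term_le[OF S])
      also have "\<dots> \<le> C1 * m powr (1/6) / m ^ k"
        using c1[OF prime_setsD(1)[OF S] prime_setsD(2)[OF S]] m1 unfolding m_def by (intro divide_right_mono) auto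
      also have "\<dots> = C1 * (m powr (1/6 - real k))" using m1 by (simp add: powr_diff powr_realpow)
      also have "1/6 - real k = - (2 * real k - 2) / 3 + (1/6 - real k / 3 - 2/3)" by (simp add: field_simps)
      also have "m powr \<dots> = m powr (- (2 * real k - 2) / 3) * m powr (1/6 - real k / 3 - 2/3)" by (rule powr_add)
      also have "C1 * \<dots> \<le> C1 * (q * m powr (-7/6))"
      proof (intro mult_left_mono mult_mono)
        have "m powr (- (2 * real k - 2) / 3) \<le> (u ^ 3) powr (- (2 * real k - 2) / 3)"
          using big[OF that] u0 k unfolding m_def by (intro powr_mono2') auto
        then show "m powr (- (2 * real k - 2) / 3) \<le> q" unfolding q .
        show "m powr (1/6 - real k / 3 - 2/3) \<le> m powr (-7/6)" using m1 k by (intro powr_mono) auto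
      qed (use q0 C1 in auto)
      finally show ?thesis unfolding m_def by (simp add: mult.assoc)
    qed
    have "(\<Sum>S\<in>F. \<bar>euler_term S\<bar>) \<le> (\<Sum>S\<in>F. C1 * q * (real (\<Prod>S) powr (-7/6)))" by (intro sum_mono tm)
    also have "\<dots> = C1 * q * (\<Sum>S\<in>F. real (\<Prod>S) powr (-7/6))" by (simp add: sum_distrib_left)
    also have "\<dots> \<le> C1 * q * (\<Sum>m\<in>\<Prod> ` F. real m powr (-7/6))"
      using C1 q0 F by (intro mult_left_mono sum_prime_sets_le) auto
    also have "\<dots> \<le> C1 * q * C2" using C1 q0 F by (intro mult_left_mono c2) auto
    finally show "(\<Sum>S\<in>F. \<bar>euler_term S\<bar>) \<le> C1 * C2 * u\<^sup>2 / u ^ (2 * k)" unfolding q_def by (simp add: ac_simps)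
  qed
qed

text \<open>The product over the primes up to \<open>n\<close> expands into the sum of
  \<open>euler_term\<close> over all sets of such primes. It differs from the truncated sum only by
  sets with product above \<open>u ^ 3\<close>, and the bound for those is uniform in
  \<open>n\<close>.\<close>

lemma density_const_approx:
  obtains C where "C > 0"
    "\<And>u. u \<ge> 1 \<Longrightarrow> \<bar>density_const k r l - (\<Sum>S | S \<in> prime_sets \<and> real (\<Prod>S) \<le> u ^ 3. euler_term S)\<bar> \<le> C * u\<^sup>2 / u ^ (2 * k)"
proof -
  obtain C where C: "C > 0" and tail: "\<And>u F. u \<ge> 1 \<Longrightarrow> finite F \<Longrightarrow> F \<subseteq> prime_sets \<Longrightarrow> (\<And>S. S \<in> F \<Longrightarrow> u ^ 3 < real (\<Prod>S)) \<Longrightarrow>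
       (\<Sum>S\<in>F. \<bar>euler_term S\<bar>) \<le> C * u\<^sup>2 / u ^ (2 * k)"
  proof (rule sum_euler_term_tail_le, goal_cases)
    case (1 C)
    show ?case by (rule 1(1)) (fact 1)+
  qed
  define f where "f = (\<lambda>p::nat. if prime p then 1 - real (rho k r l p) / real p ^ k else 1)"
  have "summable (\<lambda>i. norm (f i - 1))"
  proof (rule summable_comparison_test'[where N = 0])
    show "summable (\<lambda>n. rho_bound * real n powr (-2))" by (intro summable_mult) (simp add: summable_real_powr_iff)
    fix p :: nat
    show "norm (norm (f p - 1)) \<le> rho_bound * real p powr (-2)"
    proof (cases "prime p")
      case True
      then have p: "p > 0" "real p \<ge> 1" using prime_ge_1_nat[of p] prime_gt_0_nat by auto
      have "norm (norm (f p - 1)) = real (rho k r l p) * (1 / real p ^ k)" unfolding f_def using True by simp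
      also have "\<dots> \<le> rho_bound * (1 / real p ^ 2)"
        using rho_le_rho_bound[OF p(1)] p k rho_bound_ge_1 by (intro mult_mono divide_left_mono power_increasing) auto
      also have "1 / real p ^ 2 = real p powr (-2)" using p by (simp add: powr_minus_divide powr_numeral)
      finally show ?thesis .
    qed (use rho_bound_ge_1 in \<open>simp add: f_def\<close>)
  qed
  then have "abs_convergent_prod f" by (rule summable_imp_abs_convergent_prod)
  then have "convergent_prod f" by (rule abs_convergent_prod_imp_convergent_prod)
  then have lim: "(\<lambda>n. \<Prod>i\<le>n. f i) \<longlonglongrightarrow> density_const k r l"
    unfolding density_const_def f_def by (rule convergent_prod_LIMSEQ)
  show ?thesis
  proof (rule that[OF C])
    fix u :: real assume u: "u \<ge> 1"
    define F where "F = {S. S \<in> prime_sets \<and> real (\<Prod>S) \<le> u ^ 3}"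
    have fF: "finite F" unfolding F_def using finite_prime_sets_le[of "u ^ 3"] by simp
    have lim': "(\<lambda>n. \<bar>(\<Prod>i\<le>n. f i) - sum euler_term F\<bar>) \<longlonglongrightarrow> \<bar>density_const k r l - sum euler_term F\<bar>"
      by (intro tendsto_intros lim)
    have bnd: "\<bar>(\<Prod>i\<le>n. f i) - sum euler_term F\<bar> \<le> C * u\<^sup>2 / u ^ (2 * k)" if n: "n \<ge> nat \<lceil>u ^ 3\<rceil>" for n
    proof -
      define P where "P = {p. p \<le> n \<and> prime p}"
      have fP: "finite P" unfolding P_def by simp
      have un: "u ^ 3 \<le> real n" using n by linarith
      have PS: "Pow P \<subseteq> prime_sets" unfolding prime_sets_def P_def by (auto intro: finite_subset)
      have FP: "F \<subseteq> Pow P"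
      proof (intro subsetI PowI)
        fix S p assume "S \<in> F" and p: "p \<in> S"
        then have S: "S \<in> prime_sets" "real (\<Prod>S) \<le> u ^ 3" unfolding F_def by blast+
        have "real p \<le> real (\<Prod>S)" using prime_setsD(4)[OF S(1) p] by (simp only: of_nat_le_iff)
        then have "real p \<le> real n" using S(2) un by linarith
        then show "p \<in> P" unfolding P_def using prime_setsD(2)[OF S(1) p] by simp
      qed
      have "(\<Prod>i\<le>n. f i) = (\<Prod>p\<in>P. f p)" unfolding P_def f_def by (intro prod.mono_neutral_right) auto
      also have "\<dots> = (\<Prod>p\<in>P. 1 - real (rho k r l p) / real p ^ k)" unfolding f_def P_def by (intro prod.cong) auto
      also have "\<dots> = sum euler_term (Pow P)" unfolding prod_diff_conv_sum[OF fP] euler_term_def by simp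
      finally have "(\<Prod>i\<le>n. f i) - sum euler_term F = sum euler_term (Pow P - F)" using sum_diff[of "Pow P" F euler_term] fP FP by simp
      also have "\<bar>\<dots>\<bar> \<le> (\<Sum>S\<in>Pow P - F. \<bar>euler_term S\<bar>)" by (rule sum_abs)
      also have "\<dots> \<le> C * u\<^sup>2 / u ^ (2 * k)"
        by (rule tail[OF u]) (use fP PS in \<open>auto simp: F_def not_le\<close>)
      finally show ?thesis .
    qed
    have "\<bar>density_const k r l - sum euler_term F\<bar> \<le> C * u\<^sup>2 / u ^ (2 * k)"
      by (rule LIMSEQ_le_const2[OF lim']) (use bnd in blast)
    then show "\<bar>density_const k r l - (\<Sum>S | S \<in> prime_sets \<and> real (\<Prod>S) \<le> u ^ 3. euler_term S)\<bar> \<le> C * u\<^sup>2 / u ^ (2 * k)"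
      unfolding F_def .
  qed
qed

section \<open>Integers at which the product of the bad primes is large\<close>

definition degenerate :: "nat set" where
  "degenerate = {n. \<exists>i\<in>{1..r}. form i n = 0}"

text \<open>Where a form vanishes every prime is bad, so \<open>bad n\<close> is infinite and
  \<open>\<Prod>(bad n)\<close> has the default value 1. Such \<open>n\<close> have to be kept
  apart; each form has at most one root.\<close>

lemma degenerate_card: "finite degenerate" "card degenerate \<le> r"
proof -
  define B where "B = (\<lambda>i. {n. form i n = 0})"
  have B: "finite (B i) \<and> card (B i) \<le> 1" if i: "i \<in> {1..r}" for i
  proof -
    have "n = n'" if "n \<in> B i" "n' \<in> B i" for n n'
    proof -
      have "form i n = form i n'" using that unfolding B_def by simp
      then show ?thesis unfolding form_def using a[OF i] by simp
    qed
    then have "B i = {} \<or> (\<exists>n. B i = {n})" by blast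
    then show ?thesis by auto
  qed
  have eq: "degenerate = (\<Union>i\<in>{1..r}. B i)" unfolding degenerate_def B_def by auto
  show "finite degenerate" unfolding eq using B by auto
  have "card degenerate \<le> (\<Sum>i\<in>{1..r}. card (B i))" unfolding eq by (rule card_UN_le) simp
  also have "\<dots> \<le> (\<Sum>i\<in>{1..r}. 1)" using B by (intro sum_mono) auto
  finally show "card degenerate \<le> r" by simp
qed

text \<open>Each product \<open>m\<close> between \<open>u\<^sup>2\<close> and
  \<open>height * u ^ 3\<close> accounts for \<open>x / m ^ k + 2\<close> integers, up to
  \<open>u powr \<epsilon>\<close>. The sum of the first terms is governed by its lower end and the
  sum of the second by the upper end; both are of order \<open>u ^ 3\<close>.\<close>

lemma card_medium_bad_le:
  fixes \<epsilon> :: real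
  assumes \<epsilon>: "\<epsilon> > 0"
  obtains C where "C > 0"
    "\<And>u. u \<ge> 2 \<Longrightarrow> real (card {n. 0 < n \<and> real n \<le> u ^ (2 * k + 1) \<and> (\<exists>S\<in>prime_sets. S \<subseteq> bad n \<and> u\<^sup>2 < real (\<Prod>S) \<and> real (\<Prod>S) \<le> height * u ^ 3)})
       \<le> C * u ^ 3 * u powr \<epsilon>"
proof -
  have e3: "\<epsilon> / 3 > 0" using \<epsilon> by simp
  obtain C1 where C1: "C1 > 0" and c1: "\<And>S :: nat set. finite S \<Longrightarrow> (\<And>p. p \<in> S \<Longrightarrow> prime p) \<Longrightarrow> rho_bound ^ card S \<le> C1 * real (\<Prod>S) powr (\<epsilon> / 3)"
    using power_card_primes_le[OF rho_bound_ge_1 e3] by metis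
  define C where "C = C1 * height powr (\<epsilon> / 3) * (2 + 2 * height)"
  have C: "C > 0" unfolding C_def using C1 height_ge_1 by (intro mult_pos_pos) auto
  show ?thesis
  proof (rule that[OF C])
    fix u :: real assume u: "u \<ge> 2"
    have u0: "u > 0" using u by simp
    define x where "x = u ^ (2 * k + 1)"
    have x0: "x \<ge> 0" unfolding x_def using u0 by simp
    define F where "F = {S\<in>prime_sets. u\<^sup>2 < real (\<Prod>S) \<and> real (\<Prod>S) \<le> height * u ^ 3}"
    have fF: "finite F" by (rule finite_subset[OF _ finite_prime_sets_le[of "height * u ^ 3"]]) (auto simp: F_def)
    have FP: "F \<subseteq> prime_sets" unfolding F_def by auto
    define B where "B = (\<lambda>S. {n. 0 < n \<and> real n \<le> x \<and> S \<subseteq> bad n})"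
    have fB: "finite (B S)" for S by (rule finite_subset[of _ "{..nat \<lfloor>x\<rfloor>}"]) (auto simp: B_def le_nat_floor)
    define K where "K = C1 * (height * u ^ 3) powr (\<epsilon> / 3)"
    have K0: "K \<ge> 0" unfolding K_def using C1 by simp
    define m0 M0 where "m0 = nat \<lfloor>u\<^sup>2\<rfloor>" "M0 = nat \<lfloor>height * u ^ 3\<rfloor>"
    have u2: "u\<^sup>2 \<ge> 4" using power_mono[OF u, of 2] by simp
    have m0: "real m0 > u\<^sup>2 - 1" "real m0 \<le> u\<^sup>2" unfolding m0_M0_def using u2 by linarith+
    have m01: "m0 \<ge> 1" "real m0 \<ge> u\<^sup>2 / 2" using m0 u2 by linarith+
    have card_B: "real (card (B S)) \<le> K * (x / real (\<Prod>S) ^ k + 2)" if "S \<in> F" for S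
    proof -
      have S: "S \<in> prime_sets" "real (\<Prod>S) \<le> height * u ^ 3" using that unfolding F_def by auto
      have m1: "real (\<Prod>S) \<ge> 1" by (rule prime_set_Prod_ge_1[OF S(1)])
      have rb: "rho_bound ^ card S \<le> K"
      proof -
        have "rho_bound ^ card S \<le> C1 * real (\<Prod>S) powr (\<epsilon> / 3)" by (rule c1[OF prime_setsD(1)[OF S(1)] prime_setsD(2)[OF S(1)]])
        also have "\<dots> \<le> K" unfolding K_def using C1 S m1 e3 by (intro mult_left_mono powr_mono2) auto
        finally show ?thesis .
      qed
      have "(\<Prod>p\<in>S. real (rho k r l p) / real p ^ k) = real (\<Prod>p\<in>S. rho k r l p) / real (\<Prod>S) ^ k"
        by (simp add: prod_dividef prod_power_distrib)
      also have "\<dots> \<le> K / real (\<Prod>S) ^ k"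
        by (rule divide_right_mono[OF order_trans[OF prod_rho_le[OF S(1)] rb] zero_le_power[OF of_nat_0_le_iff]])
      finally have "x * (\<Prod>p\<in>S. real (rho k r l p) / real p ^ k) \<le> x * (K / real (\<Prod>S) ^ k)" using x0 by (rule mult_left_mono)
      moreover have "\<bar>real (card (B S)) - x * (\<Prod>p\<in>S. real (rho k r l p) / real p ^ k)\<bar> \<le> 2 * rho_bound ^ card S"
        unfolding B_def by (rule card_bad_supset_le[OF S(1) x0])
      ultimately have "real (card (B S)) \<le> x * (K / real (\<Prod>S) ^ k) + 2 * K" using rb by linarith
      then show ?thesis by (simp add: distrib_left mult.commute)
    qed
    have "{n. 0 < n \<and> real n \<le> x \<and> (\<exists>S\<in>prime_sets. S \<subseteq> bad n \<and> u\<^sup>2 < real (\<Prod>S) \<and> real (\<Prod>S) \<le> height * u ^ 3)} = (\<Union>S\<in>F. B S)" (is "?E = _")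
      unfolding F_def B_def by auto
    then have "card ?E \<le> (\<Sum>S\<in>F. card (B S))" using card_UN_le[OF fF, of B] by (simp only:)
    then have "real (card ?E) \<le> (\<Sum>S\<in>F. real (card (B S)))" by (simp only: of_nat_le_iff of_nat_sum[symmetric])
    also have "\<dots> \<le> (\<Sum>S\<in>F. K * (x / real (\<Prod>S) ^ k + 2))" by (intro sum_mono card_B)
    also have "\<dots> = K * (\<Sum>S\<in>F. x / real (\<Prod>S) ^ k + 2)" by (simp add: sum_distrib_left)
    finally have "real (card ?E) \<le> K * (\<Sum>S\<in>F. x / real (\<Prod>S) ^ k + 2)" .
    also have "\<dots> \<le> K * (\<Sum>m\<in>{m0<..M0}. x / real m ^ k + 2)"
    proof (intro mult_left_mono sum_prime_sets_le[OF FP] K0)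
      fix S assume "S \<in> F"
      then have S: "u\<^sup>2 < real (\<Prod>S)" "real (\<Prod>S) \<le> height * u ^ 3" unfolding F_def by auto
      have "real m0 < real (\<Prod>S)" using S m0 by linarith
      then have "m0 < \<Prod>S" by (simp only: of_nat_less_iff)
      moreover have "\<Prod>S \<le> M0" unfolding m0_M0_def using S(2) by (rule le_nat_floor)
      ultimately show "\<Prod>S \<in> {m0<..M0}" by simp
    qed (use x0 in auto)
    finally have le: "real (card ?E) \<le> K * (\<Sum>m\<in>{m0<..M0}. x / real m ^ k + 2)" .
    have "(\<Sum>m\<in>{m0<..M0}. x / real m ^ k + 2) \<le> (\<Sum>m\<in>{m0<..M0}. u ^ 5 * (1 / real m ^ 2) + 2)"
    proof (intro sum_mono add_right_mono)
      fix m assume m: "m \<in> {m0<..M0}"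
      have "real m \<ge> real (m0 + 1)" using m by (intro of_nat_mono) auto
      then have mu: "real m \<ge> u\<^sup>2" using m0 by simp
      \<comment> \<open>Reduction to the exponent 2: every further factor \<open>u\<^sup>2\<close>
        of \<open>x\<close> is matched by a factor \<open>m \<ge> u\<^sup>2\<close> of the
        denominator.\<close>
      have "u ^ (2 * k + 1) = u ^ 5 * (u\<^sup>2) ^ (k - 2)"
        unfolding power_mult[symmetric] power_add[symmetric] using k by (intro arg_cong[of _ _ "\<lambda>n. u ^ n"]) auto
      also have "\<dots> \<le> u ^ 5 * real m ^ (k - 2)" using mu u0 by (intro mult_left_mono power_mono) auto
      finally have "x / real m ^ k \<le> u ^ 5 * real m ^ (k - 2) / real m ^ k" unfolding x_def by (intro divide_right_mono) auto
      also have mk: "real m ^ k = real m ^ (k - 2) * real m ^ 2"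
      proof -
        have "k - 2 + 2 = k" using k by simp
        then show ?thesis by (simp only: power_add[symmetric])
      qed
      also have "u ^ 5 * real m ^ (k - 2) / (real m ^ (k - 2) * real m ^ 2) = u ^ 5 * (1 / real m ^ 2)" using m by simp
      finally show "x / real m ^ k \<le> u ^ 5 * (1 / real m ^ 2)" unfolding mk .
    qed
    also have "\<dots> = u ^ 5 * (\<Sum>m\<in>{m0<..M0}. 1 / real m ^ 2) + 2 * real (M0 - m0)"
      by (simp add: sum.distrib sum_distrib_left)
    also have "\<dots> \<le> u ^ 5 * (2 / u\<^sup>2) + 2 * (height * u ^ 3)"
    proof (intro add_mono mult_left_mono)
      have "1 / real m0 \<le> 1 / (u\<^sup>2 / 2)" using m01 u2 by (intro divide_left_mono mult_pos_pos) linarith+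
      then show "(\<Sum>m\<in>{m0<..M0}. 1 / real m ^ 2) \<le> 2 / u\<^sup>2" using sum_inverse_squares_le[OF m01(1), of M0] by simp
      have "real (M0 - m0) \<le> real M0" by (simp only: of_nat_le_iff diff_le_self)
      also have "\<dots> \<le> height * u ^ 3" unfolding m0_M0_def using height_ge_1 u0 by (intro of_nat_floor) auto
      finally show "real (M0 - m0) \<le> height * u ^ 3" .
    qed (use u0 in auto)
    also have "u ^ 5 * (2 / u\<^sup>2) = 2 * u ^ 3" using u0 by (simp add: eval_nat_numeral)
    finally have "(\<Sum>m\<in>{m0<..M0}. x / real m ^ k + 2) \<le> 2 * u ^ 3 + 2 * (height * u ^ 3)" .
    from mult_left_mono[OF this K0] le have "real (card ?E) \<le> K * (2 * u ^ 3 + 2 * (height * u ^ 3))" by linarith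
    also have "K = C1 * (height powr (\<epsilon> / 3) * u powr \<epsilon>)"
    proof -
      have u3: "u ^ 3 = u powr 3" using u0 by (simp add: powr_numeral)
      have "(u ^ 3) powr (\<epsilon> / 3) = u powr \<epsilon>" unfolding u3 powr_powr by simp
      then show ?thesis unfolding K_def powr_mult by simp
    qed
    also have "C1 * (height powr (\<epsilon> / 3) * u powr \<epsilon>) * (2 * u ^ 3 + 2 * (height * u ^ 3)) = C * u ^ 3 * u powr \<epsilon>"
      unfolding C_def by (simp add: algebra_simps)
    finally show "real (card {n. 0 < n \<and> real n \<le> u ^ (2 * k + 1) \<and> (\<exists>S\<in>prime_sets. S \<subseteq> bad n \<and> u\<^sup>2 < real (\<Prod>S) \<and> real (\<Prod>S) \<le> height * u ^ 3)})
       \<le> C * u ^ 3 * u powr \<epsilon>" unfolding x_def .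
  qed
qed

text \<open>The two large primes cannot belong to the same form: \<open>(p * q) ^ k\<close> would
  exceed \<open>u ^ (3 * k)\<close> and so \<open>u ^ (2 * k + 2)\<close>, whereas the form is at
  most \<open>height * u ^ (2 * k + 1)\<close> with \<open>height < u\<close>.\<close>

lemma large_bad_cases:
  assumes u: "u \<ge> 1" "u > height" and n: "n > 0" "real n \<le> u ^ (2 * k + 1)" "n \<notin> degenerate"
    and big: "u ^ 3 < real (\<Prod>(bad n))"
  shows "(\<exists>S\<in>prime_sets. S \<subseteq> bad n \<and> u\<^sup>2 < real (\<Prod>S) \<and> real (\<Prod>S) \<le> height * u ^ 3) \<or>
    (\<exists>i\<in>{1..r}. \<exists>j\<in>{1..r} - {i}. \<exists>p q. large_pair k (a i) (b i) (a j) (b j) u n p q)"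
proof -
  have nz: "form i n \<noteq> 0" if "i \<in> {1..r}" for i using n(3) that unfolding degenerate_def by auto
  have B: "bad n \<in> prime_sets" "\<And>p. p \<in> bad n \<Longrightarrow> real p \<le> height * u ^ 3"
    "real (\<Prod>(bad n)) \<le> (height * u ^ (2 * k + 1)) ^ r"
    using bad_bounds[of n u] nz n(1,2) u(1) by blast+
  from prime_set_splitting[OF B(1) u(1) height_ge_1 big B(2)]
  consider (med) S where "S \<subseteq> bad n" "u\<^sup>2 < real (\<Prod>S)" "real (\<Prod>S) \<le> height * u ^ 3"
    | (pair) p q where "p \<in> bad n" "q \<in> bad n" "p \<noteq> q" "u < real p" "real p \<le> u\<^sup>2" "u < real q" "real q \<le> u\<^sup>2" "u ^ 3 < real p * real q"
    by blast
  then show ?thesis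
  proof cases
    case med
    have "S \<in> prime_sets" using B(1) med(1) unfolding prime_sets_def by (auto intro: finite_subset)
    then show ?thesis using med by blast
  next
    case pair
    obtain i where i: "i \<in> {1..r}" "int p ^ k dvd form i n" "prime p" using pair(1) unfolding bad_def by auto
    obtain j where j: "j \<in> {1..r}" "int q ^ k dvd form j n" "prime q" using pair(2) unfolding bad_def by auto
    have "i \<noteq> j"
    proof
      assume "i = j"
      then have "int q ^ k dvd form i n" using j by simp
      moreover have "coprime (int p) (int q)" using i(3) j(3) pair(3) by (simp add: primes_coprime)
      ultimately have "int p ^ k * int q ^ k dvd form i n" using i(2) by (intro divides_mult) auto
      then have "int (p * q) ^ k dvd form i n" by (simp add: power_mult_distrib)
      then have "real (p * q) ^ k \<le> \<bar>real_of_int (form i n)\<bar>" using nz[OF i(1)] by (rule prime_power_dvd_le)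
      also have "\<dots> \<le> height * u ^ (2 * k + 1)" by (rule form_bounds[OF i(1) n(1,2)])
      also have "\<dots> < u * u ^ (2 * k + 1)" using u by (intro mult_strict_right_mono) auto
      also have "\<dots> = u ^ (2 * k + 2)" by simp
      also have "\<dots> \<le> u ^ (3 * k)" using k u by (intro power_increasing) auto
      also have "\<dots> = (u ^ 3) ^ k" by (simp add: power_mult)
      also have "\<dots> \<le> real (p * q) ^ k" using pair(8) u by (intro power_mono) auto
      finally show False by simp
    qed
    moreover have "large_pair k (a i) (b i) (a j) (b j) u n p q"
      unfolding large_pair_def using i j pair nz[OF i(1)] nz[OF j(1)] unfolding form_def by blast
    ultimately show ?thesis using i(1) j(1) by blast
  qed
qed

lemma card_large_bad_le:
  fixes \<epsilon> :: real
  assumes \<epsilon>: "\<epsilon> > 0"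
  obtains C U where "C > 0"
    "\<And>u. u \<ge> U \<Longrightarrow> real (card {n. 0 < n \<and> real n \<le> u ^ (2 * k + 1) \<and> n \<notin> degenerate \<and> u ^ 3 < real (\<Prod>(bad n))})
       \<le> C * u ^ 3 * u powr \<epsilon>"
proof -
  obtain C1 where C1: "C1 > 0" and med: "\<And>u. u \<ge> 2 \<Longrightarrow> real (card {n. 0 < n \<and> real n \<le> u ^ (2 * k + 1) \<and>
      (\<exists>S\<in>prime_sets. S \<subseteq> bad n \<and> u\<^sup>2 < real (\<Prod>S) \<and> real (\<Prod>S) \<le> height * u ^ 3)}) \<le> C1 * u ^ 3 * u powr \<epsilon>"
  proof (rule card_medium_bad_le[OF \<epsilon>], goal_cases)
    case (1 C)
    show ?case by (rule 1(1)) (fact 1)+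
  qed
  define Pr where "Pr = (\<lambda>i j u. {n::nat. 0 < n \<and> real n \<le> u ^ (2 * k + 1) \<and> (\<exists>p q. large_pair k (a i) (b i) (a j) (b j) u n p q)})"
  have "\<exists>C U. C > 0 \<and> (\<forall>u\<ge>U. real (card (Pr i j u)) \<le> C * u ^ 3 * u powr \<epsilon>)" if ij: "i \<in> {1..r}" "j \<in> {1..r}" "i \<noteq> j" for i j
  proof -
    have d: "a j * b i - a i * b j \<noteq> 0" using det[OF ij(2,1)] ij(3) by simp
    show ?thesis
    proof (rule card_large_pair_le[OF k a[OF ij(1)] a[OF ij(2)] d \<epsilon>], goal_cases)
      case (1 C U)
      then show ?case unfolding Pr_def by blast
    qed
  qed
  then obtain C U where CU: "\<And>i j. i \<in> {1..r} \<Longrightarrow> j \<in> {1..r} \<Longrightarrow> i \<noteq> j \<Longrightarrow>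
      C i j > 0 \<and> (\<forall>u\<ge>U i j. real (card (Pr i j u)) \<le> C i j * u ^ 3 * u powr \<epsilon>)" by metis
  define C2 where "C2 = (\<Sum>i\<in>{1..r}. \<Sum>j\<in>{1..r} - {i}. C i j)"
  define U2 where "U2 = 2 + height + (\<Sum>i\<in>{1..r}. \<Sum>j\<in>{1..r} - {i}. \<bar>U i j\<bar>)"
  have C20: "C2 \<ge> 0" unfolding C2_def using CU by (intro sum_nonneg) (auto intro: less_imp_le)
  have C: "C1 + C2 > 0" using C1 C20 by simp
  have s0: "(\<Sum>j\<in>{1..r} - {i}. \<bar>U i j\<bar>) \<ge> 0" for i by (intro sum_nonneg) auto
  have U2: "\<bar>U i j\<bar> \<le> U2" if ij: "i \<in> {1..r}" "j \<in> {1..r} - {i}" for i j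
  proof -
    have "\<bar>U i j\<bar> \<le> (\<Sum>j\<in>{1..r} - {i}. \<bar>U i j\<bar>)" using ij by (intro member_le_sum) auto
    also have "\<dots> \<le> (\<Sum>i\<in>{1..r}. \<Sum>j\<in>{1..r} - {i}. \<bar>U i j\<bar>)" using ij s0 by (intro member_le_sum) auto
    finally show ?thesis unfolding U2_def using height_ge_1 by linarith
  qed
  have U2h: "U2 \<ge> 2 + height" unfolding U2_def using s0 by (simp add: sum_nonneg)
  show ?thesis
  proof (rule that[OF C, of U2])
    fix u :: real assume uU: "u \<ge> U2"
    have u: "u \<ge> 2" "u \<ge> 1" "u > height" using uU U2h height_ge_1 by linarith+
    define M where "M = {n. 0 < n \<and> real n \<le> u ^ (2 * k + 1) \<and>
      (\<exists>S\<in>prime_sets. S \<subseteq> bad n \<and> u\<^sup>2 < real (\<Prod>S) \<and> real (\<Prod>S) \<le> height * u ^ 3)}"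
    define E where "E = {n. 0 < n \<and> real n \<le> u ^ (2 * k + 1) \<and> n \<notin> degenerate \<and> u ^ 3 < real (\<Prod>(bad n))}"
    have finI: "finite {n. 0 < n \<and> real n \<le> u ^ (2 * k + 1) \<and> Q n}" for Q
      by (rule finite_subset[of _ "{..nat \<lfloor>u ^ (2 * k + 1)\<rfloor>}"]) (auto simp: le_nat_floor)
    have sub: "E \<subseteq> M \<union> (\<Union>i\<in>{1..r}. \<Union>j\<in>{1..r} - {i}. Pr i j u)"
    proof
      fix n assume "n \<in> E"
      then have n: "0 < n" "real n \<le> u ^ (2 * k + 1)" "n \<notin> degenerate" "u ^ 3 < real (\<Prod>(bad n))" unfolding E_def by blast+
      show "n \<in> M \<union> (\<Union>i\<in>{1..r}. \<Union>j\<in>{1..r} - {i}. Pr i j u)"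
        using large_bad_cases[OF u(2,3) n] n(1,2) unfolding M_def Pr_def by blast
    qed
    have "finite M" unfolding M_def by (rule finI)
    moreover have "finite (Pr i j u)" for i j unfolding Pr_def by (rule finI)
    ultimately have "card E \<le> card (M \<union> (\<Union>i\<in>{1..r}. \<Union>j\<in>{1..r} - {i}. Pr i j u))" by (intro card_mono sub) auto
    also have "\<dots> \<le> card M + card (\<Union>i\<in>{1..r}. \<Union>j\<in>{1..r} - {i}. Pr i j u)" by (rule card_Un_le)
    also have "card (\<Union>i\<in>{1..r}. \<Union>j\<in>{1..r} - {i}. Pr i j u) \<le> (\<Sum>i\<in>{1..r}. card (\<Union>j\<in>{1..r} - {i}. Pr i j u))" by (rule card_UN_le) simp
    also have "\<dots> \<le> (\<Sum>i\<in>{1..r}. \<Sum>j\<in>{1..r} - {i}. card (Pr i j u))" by (intro sum_mono card_UN_le) simp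
    finally have "card E \<le> card M + (\<Sum>i\<in>{1..r}. \<Sum>j\<in>{1..r} - {i}. card (Pr i j u))" by simp
    then have "real (card E) \<le> real (card M + (\<Sum>i\<in>{1..r}. \<Sum>j\<in>{1..r} - {i}. card (Pr i j u)))" by (simp only: of_nat_le_iff)
    also have "\<dots> = real (card M) + (\<Sum>i\<in>{1..r}. \<Sum>j\<in>{1..r} - {i}. real (card (Pr i j u)))" by simp
    also have "\<dots> \<le> C1 * u ^ 3 * u powr \<epsilon> + (\<Sum>i\<in>{1..r}. \<Sum>j\<in>{1..r} - {i}. C i j * u ^ 3 * u powr \<epsilon>)"
    proof (intro add_mono sum_mono)
      show "real (card M) \<le> C1 * u ^ 3 * u powr \<epsilon>" unfolding M_def by (rule med[OF u(1)])
      fix i j assume ij: "i \<in> {1..r}" "j \<in> {1..r} - {i}"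
      have "u \<ge> U i j" using U2[OF ij] uU by linarith
      then show "real (card (Pr i j u)) \<le> C i j * u ^ 3 * u powr \<epsilon>" using CU[of i j] ij by blast
    qed
    also have "\<dots> = (C1 + C2) * u ^ 3 * u powr \<epsilon>" unfolding C2_def by (simp add: distrib_right sum_distrib_right)
    finally show "real (card {n. 0 < n \<and> real n \<le> u ^ (2 * k + 1) \<and> n \<notin> degenerate \<and> u ^ 3 < real (\<Prod>(bad n))}) \<le> (C1 + C2) * u ^ 3 * u powr \<epsilon>"
      unfolding E_def .
  qed
qed

text \<open>Bounds the number of terms of the truncated Moebius sum at an exceptional
  \<open>n\<close>. The product of the bad primes is at most of the order of a fixed power of
  \<open>u\<close>, so \<open>power_card_primes_le\<close> applies.\<close>

lemma two_power_card_bad_le: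
  fixes \<epsilon> :: real
  assumes \<epsilon>: "\<epsilon> > 0"
  obtains C where "C > 0"
    "\<And>u n. u \<ge> 1 \<Longrightarrow> n > 0 \<Longrightarrow> real n \<le> u ^ (2 * k + 1) \<Longrightarrow> n \<notin> degenerate \<Longrightarrow> bad n \<in> prime_sets \<and> 2 ^ card (bad n) \<le> C * u powr \<epsilon>"
proof -
  \<comment> \<open>The product of all forms is of order at most
    \<open>u ^ ((2 * k + 1) * r)\<close>, and this power raised to \<open>\<delta>\<close> is
    \<open>u powr \<epsilon>\<close>.\<close>
  define \<delta> where "\<delta> = \<epsilon> / (real (2 * k + 1) * real r)"
  have \<delta>: "\<delta> > 0" "real (2 * k + 1) * real r * \<delta> = \<epsilon>" unfolding \<delta>_def using \<epsilon> r by auto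
  obtain C1 where C1: "C1 > 0" and c1: "\<And>S :: nat set. finite S \<Longrightarrow> (\<And>p. p \<in> S \<Longrightarrow> prime p) \<Longrightarrow> 2 ^ card S \<le> C1 * real (\<Prod>S) powr \<delta>"
    using power_card_primes_le[of 2 \<delta>] \<delta>(1) by (metis one_le_numeral)
  define C where "C = C1 * height powr (real r * \<delta>)"
  have C: "C > 0" unfolding C_def using C1 height_ge_1 by simp
  show ?thesis
  proof (rule that[OF C])
    fix u :: real and n assume u: "u \<ge> 1" and n: "n > 0" "real n \<le> u ^ (2 * k + 1)" "n \<notin> degenerate"
    have u0: "u > 0" using u by simp
    have nz: "form i n \<noteq> 0" if "i \<in> {1..r}" for i using n(3) that unfolding degenerate_def by auto
    have B: "bad n \<in> prime_sets" "\<And>p. p \<in> bad n \<Longrightarrow> real p \<le> height * u ^ 3"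
    "real (\<Prod>(bad n)) \<le> (height * u ^ (2 * k + 1)) ^ r"
    using bad_bounds[of n u] nz n(1,2) u by blast+
    have "2 ^ card (bad n) \<le> C1 * real (\<Prod>(bad n)) powr \<delta>" by (rule c1[OF prime_setsD(1)[OF B(1)] prime_setsD(2)[OF B(1)]])
    also have "\<dots> \<le> C1 * ((height * u ^ (2 * k + 1)) ^ r) powr \<delta>"
      by (rule mult_left_mono[OF powr_mono2[OF less_imp_le[OF \<delta>(1)] of_nat_0_le_iff B(3)]]) (rule less_imp_le[OF C1])
    also have "((height * u ^ (2 * k + 1)) ^ r) powr \<delta> = height powr (real r * \<delta>) * u powr \<epsilon>"
    proof -
      have h: "height ^ r = height powr real r" using height_ge_1 by (simp add: powr_realpow)
      have uu: "(u ^ (2 * k + 1)) ^ r = u powr (real (2 * k + 1) * real r)"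
        unfolding power_mult[symmetric] of_nat_mult[symmetric] using powr_realpow[OF u0] by (rule sym)
      show ?thesis unfolding power_mult_distrib powr_mult h uu powr_powr \<delta>(2) ..
    qed
    finally show "bad n \<in> prime_sets \<and> 2 ^ card (bad n) \<le> C * u powr \<epsilon>" using B(1) unfolding C_def by (simp add: mult.assoc)
  qed
qed

text \<open>The truncated Moebius sum \<open>T n\<close> equals the indicator of
  \<open>bad n = {}\<close> whenever the bad primes have product at most \<open>u ^ 3\<close>,
  because then no subset is cut off. This leaves the degenerate \<open>n\<close>, at most
  \<open>r\<close> of them with at most \<open>card F \<le> u ^ 3\<close> terms each, and the set
  \<open>E\<close>, for which half of \<open>\<epsilon>\<close> bounds the number of
  \<open>n\<close> and half the number of terms.\<close>

lemma count_k_free_approx: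
  fixes \<epsilon> :: real
  assumes \<epsilon>: "\<epsilon> > 0"
  obtains C U where "C > 0"
    "\<And>u. u \<ge> U \<Longrightarrow> \<bar>real (count_k_free k r l (u ^ (2 * k + 1))) - density_const k r l * u ^ (2 * k + 1)\<bar> \<le> C * u ^ 3 * u powr \<epsilon>"
proof -
  have e2: "\<epsilon> / 2 > 0" and e3: "\<epsilon> / 3 > 0" using \<epsilon> by simp_all
  obtain C1 U1 where C1: "C1 > 0" and large: "\<And>u. u \<ge> U1 \<Longrightarrow> real (card {n. 0 < n \<and> real n \<le> u ^ (2 * k + 1) \<and> n \<notin> degenerate \<and> u ^ 3 < real (\<Prod>(bad n))})
       \<le> C1 * u ^ 3 * u powr (\<epsilon> / 2)"
  proof (rule card_large_bad_le[OF e2], goal_cases)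
    case (1 C U)
    show ?case by (rule 1(1)) (fact 1)+
  qed
  obtain C2 where C2: "C2 > 0" and two: "\<And>u n. u \<ge> 1 \<Longrightarrow> n > 0 \<Longrightarrow> real n \<le> u ^ (2 * k + 1) \<Longrightarrow> n \<notin> degenerate \<Longrightarrow>
      bad n \<in> prime_sets \<and> 2 ^ card (bad n) \<le> C2 * u powr (\<epsilon> / 2)"
  proof (rule two_power_card_bad_le[OF e2], goal_cases)
    case (1 C)
    show ?case by (rule 1(1)) (fact 1)+
  qed
  obtain C3 where C3: "C3 > 0" and dens: "\<And>u. u \<ge> 1 \<Longrightarrow> \<bar>density_const k r l - (\<Sum>S | S \<in> prime_sets \<and> real (\<Prod>S) \<le> u ^ 3. euler_term S)\<bar> \<le> C3 * u\<^sup>2 / u ^ (2 * k)"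
  proof (rule density_const_approx, goal_cases)
    case (1 C)
    show ?case by (rule 1(1)) (fact 1)+
  qed
  \<comment> \<open>The exponent \<open>\<epsilon> / 3\<close> is meant for products up to
    \<open>u ^ 3\<close>.\<close>
  obtain C4 where C4: "C4 > 0" and c4: "\<And>S :: nat set. finite S \<Longrightarrow> (\<And>p. p \<in> S \<Longrightarrow> prime p) \<Longrightarrow> rho_bound ^ card S \<le> C4 * real (\<Prod>S) powr (\<epsilon> / 3)"
    using power_card_primes_le[OF rho_bound_ge_1 e3] by metis
  \<comment> \<open>One summand for each source of error: the degenerate \<open>n\<close>, the set
    \<open>E\<close>, the incomplete periods in the counts, and the tail of the Euler
    product.\<close>
  define C where "C = 2 * real r + C1 * C2 + 2 * C4 + C3"
  have C: "C > 0" unfolding C_def using C1 C2 C3 C4 by (intro add_nonneg_pos add_nonneg_nonneg) auto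
  show ?thesis
  proof (rule that[OF C, of "max 1 U1"])
    fix u :: real assume "u \<ge> max 1 U1"
    then have u: "u \<ge> 1" "u \<ge> U1" by auto
    have u0: "u > 0" using u by simp
    have u31: "u ^ 3 \<ge> 1" using u by (simp add: one_le_power)
    have p1: "1 \<le> u powr \<epsilon>" using u \<epsilon> by (intro ge_one_powr_ge_zero) auto
    define t where "t = u ^ 3 * u powr \<epsilon>"
    have t: "u ^ 3 \<le> t" "0 \<le> t" unfolding t_def using mult_left_mono[OF p1, of "u ^ 3"] u31 u0 by auto
    define x where "x = u ^ (2 * k + 1)"
    have x0: "x \<ge> 0" unfolding x_def using u0 by simp
    define I where "I = {n. 0 < n \<and> real n \<le> x}"
    have fI: "finite I" unfolding I_def by (rule finite_subset[of _ "{..nat \<lfloor>x\<rfloor>}"]) (auto simp: le_nat_floor)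
    define F where "F = {S. S \<in> prime_sets \<and> real (\<Prod>S) \<le> u ^ 3}"
    have fF: "finite F" unfolding F_def using finite_prime_sets_le[of "u ^ 3"] by simp
    have cF: "real (card F) \<le> u ^ 3"
    proof -
      have "card F = card (\<Prod> ` F)" by (rule card_image[symmetric]) (rule inj_on_subset[OF inj_on_Prod_prime_sets], auto simp: F_def)
      also have "\<dots> \<le> card {1..nat \<lfloor>u ^ 3\<rfloor>}"
      proof (intro card_mono)
        show "\<Prod> ` F \<subseteq> {1..nat \<lfloor>u ^ 3\<rfloor>}"
        proof
          fix m assume "m \<in> \<Prod> ` F"
          then obtain S where S: "S \<in> prime_sets" "real (\<Prod>S) \<le> u ^ 3" "m = \<Prod>S" unfolding F_def by blast
          have "1 \<le> m" using prime_setsD(3)[OF S(1)] unfolding S(3) by linarith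
          moreover have "m \<le> nat \<lfloor>u ^ 3\<rfloor>" unfolding S(3) by (rule le_nat_floor[OF S(2)])
          ultimately show "m \<in> {1..nat \<lfloor>u ^ 3\<rfloor>}" by simp
        qed
      qed simp
      finally have "real (card F) \<le> real (nat \<lfloor>u ^ 3\<rfloor>)" by simp
      also have "\<dots> \<le> u ^ 3" using u31 u0 by (intro of_nat_floor) simp
      finally show ?thesis .
    qed
    define T where "T = (\<lambda>n. \<Sum>S | S \<in> F \<and> S \<subseteq> bad n. (-1::real) ^ card S)"
    define ind where "ind = (\<lambda>n. if bad n = {} then 1 else (0::real))"
    define E where "E = {n. 0 < n \<and> real n \<le> x \<and> n \<notin> degenerate \<and> u ^ 3 < real (\<Prod>(bad n))}"
    have fE: "finite E" by (rule finite_subset[OF _ fI]) (auto simp: E_def I_def)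
    have "count_k_free k r l x = card {n\<in>I. bad n = {}}"
      unfolding count_k_free_def k_free_iff_bad I_def by (rule arg_cong[of _ _ card]) auto
    then have count: "real (count_k_free k r l x) = (\<Sum>n\<in>I. ind n)"
      unfolding ind_def using fI by (simp add: sum.If_cases Int_def)
    have Tabs: "\<bar>T n\<bar> \<le> real (card {S. S \<in> F \<and> S \<subseteq> bad n})" for n
    proof -
      have "\<bar>T n\<bar> \<le> (\<Sum>S | S \<in> F \<and> S \<subseteq> bad n. \<bar>(-1::real) ^ card S\<bar>)" unfolding T_def by (rule sum_abs)
      then show ?thesis by (simp add: power_abs)
    qed
    have diff: "\<bar>ind n - T n\<bar> \<le> (if n \<in> degenerate then 2 * u ^ 3 else 0) + (if n \<in> E then C2 * u powr (\<epsilon> / 2) else 0)"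
      if nI: "n \<in> I" for n
    proof (cases "n \<in> degenerate")
      case True
      have "card {S. S \<in> F \<and> S \<subseteq> bad n} \<le> card F" by (intro card_mono fF) auto
      then have "real (card {S. S \<in> F \<and> S \<subseteq> bad n}) \<le> u ^ 3" using cF by simp
      then have "\<bar>T n\<bar> \<le> u ^ 3" using Tabs[of n] by linarith
      moreover have "\<bar>ind n\<bar> \<le> u ^ 3" unfolding ind_def using u31 u0 by simp
      moreover have "n \<notin> E" unfolding E_def using True by simp
      ultimately show ?thesis using True by simp
    next
      case False
      have n: "0 < n" "real n \<le> u ^ (2 * k + 1)" using nI unfolding I_def x_def by auto
      have B: "bad n \<in> prime_sets" "2 ^ card (bad n) \<le> C2 * u powr (\<epsilon> / 2)" using two[OF u(1) n False] by auto
      have fb: "finite (bad n)" by (rule prime_setsD(1)[OF B(1)])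
      show ?thesis
      proof (cases "n \<in> E")
        case True
        have "bad n \<noteq> {}"
        proof
          assume "bad n = {}"
          then have "u ^ 3 < 1" using True unfolding E_def by simp
          then show False using u31 by linarith
        qed
        then have "ind n = 0" unfolding ind_def by simp
        have "card {S. S \<in> F \<and> S \<subseteq> bad n} \<le> card (Pow (bad n))" using fb by (intro card_mono) auto
        then have "card {S. S \<in> F \<and> S \<subseteq> bad n} \<le> 2 ^ card (bad n)" using fb by (simp add: card_Pow)
        then have "real (card {S. S \<in> F \<and> S \<subseteq> bad n}) \<le> real (2 ^ card (bad n))" by (simp only: of_nat_le_iff)
        then have "\<bar>T n\<bar> \<le> 2 ^ card (bad n)" using Tabs[of n] unfolding of_nat_power of_nat_numeral by linarith
        then show ?thesis using B(2) True False \<open>ind n = 0\<close> by simp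
      next
        case notE: False
        have le: "real (\<Prod>(bad n)) \<le> u ^ 3" using notE n False unfolding E_def x_def by (simp add: not_less)
        have "{S. S \<in> F \<and> S \<subseteq> bad n} = Pow (bad n)"
        proof (intro set_eqI iffI)
          fix S assume "S \<in> Pow (bad n)"
          then have S: "S \<subseteq> bad n" by simp
          have SP: "S \<in> prime_sets" using S B(1) fb unfolding prime_sets_def by (auto intro: finite_subset)
          have "\<Prod>S dvd \<Prod>(bad n)" using prod_dvd_prod_subset[OF fb S, of "\<lambda>x. x"] .
          then have "\<Prod>S \<le> \<Prod>(bad n)" using prime_setsD(3)[OF B(1)] by (rule dvd_imp_le)
          then have "real (\<Prod>S) \<le> real (\<Prod>(bad n))" by (simp only: of_nat_le_iff)
          then have "real (\<Prod>S) \<le> u ^ 3" using le by linarith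
          then show "S \<in> {S. S \<in> F \<and> S \<subseteq> bad n}" unfolding F_def using SP S by blast
        qed simp
        then have "T n = ind n" unfolding T_def ind_def using sum_neg_one_power_card_Pow[OF fb] by simp
        then show ?thesis using False notE by simp
      qed
    qed
    have part1: "\<bar>(\<Sum>n\<in>I. ind n) - (\<Sum>n\<in>I. T n)\<bar> \<le> 2 * real r * t + C1 * C2 * t"
    proof -
      have "\<bar>(\<Sum>n\<in>I. ind n) - (\<Sum>n\<in>I. T n)\<bar> \<le> (\<Sum>n\<in>I. \<bar>ind n - T n\<bar>)"
        unfolding sum_subtractf[symmetric] by (rule sum_abs)
      also have "\<dots> \<le> (\<Sum>n\<in>I. (if n \<in> degenerate then 2 * u ^ 3 else 0) + (if n \<in> E then C2 * u powr (\<epsilon> / 2) else 0))"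
        by (intro sum_mono diff)
      also have "\<dots> = real (card (I \<inter> degenerate)) * (2 * u ^ 3) + real (card (I \<inter> E)) * (C2 * u powr (\<epsilon> / 2))"
        using fI by (simp add: sum.distrib sum.If_cases Int_def)
      also have "\<dots> \<le> real r * (2 * t) + (C1 * u ^ 3 * u powr (\<epsilon> / 2)) * (C2 * u powr (\<epsilon> / 2))"
      proof (intro add_mono mult_mono)
        have "card (I \<inter> degenerate) \<le> card degenerate" by (intro card_mono degenerate_card(1)) auto
        then show "real (card (I \<inter> degenerate)) \<le> real r" using degenerate_card(2) by simp
        have "card (I \<inter> E) \<le> card E" by (intro card_mono fE) auto
        then have "real (card (I \<inter> E)) \<le> real (card E)" by (simp only: of_nat_le_iff)
        also have "\<dots> \<le> C1 * u ^ 3 * u powr (\<epsilon> / 2)" unfolding E_def x_def by (rule large[OF u(2)])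
        finally show "real (card (I \<inter> E)) \<le> C1 * u ^ 3 * u powr (\<epsilon> / 2)" .
      qed (use t u0 C1 C2 in auto)
      also have "(C1 * u ^ 3 * u powr (\<epsilon> / 2)) * (C2 * u powr (\<epsilon> / 2)) = C1 * C2 * (u ^ 3 * (u powr (\<epsilon> / 2) * u powr (\<epsilon> / 2)))"
        by (simp only: ac_simps)
      also have "u powr (\<epsilon> / 2) * u powr (\<epsilon> / 2) = u powr \<epsilon>" unfolding powr_add[symmetric] by simp
      finally show ?thesis unfolding t_def by simp
    qed
    have swap: "(\<Sum>n\<in>I. T n) = (\<Sum>S\<in>F. (-1) ^ card S * real (card {n\<in>I. S \<subseteq> bad n}))"
    proof -
      have "(\<Sum>n\<in>I. T n) = (\<Sum>n\<in>I. \<Sum>S\<in>F. if S \<subseteq> bad n then (-1) ^ card S else 0)"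
        unfolding T_def by (rule sum.cong[OF refl], rule sum.inter_filter[OF fF])
      also have "\<dots> = (\<Sum>S\<in>F. \<Sum>n\<in>I. if S \<subseteq> bad n then (-1) ^ card S else 0)" by (rule sum.swap)
      also have "\<dots> = (\<Sum>S\<in>F. (-1) ^ card S * real (card {n\<in>I. S \<subseteq> bad n}))"
        by (rule sum.cong[OF refl]) (simp add: sum.inter_filter[OF fI, symmetric])
      finally show ?thesis .
    qed
    have part2: "\<bar>(\<Sum>n\<in>I. T n) - x * (\<Sum>S\<in>F. euler_term S)\<bar> \<le> 2 * C4 * t"
    proof -
      have "(\<Sum>n\<in>I. T n) - x * (\<Sum>S\<in>F. euler_term S) = (\<Sum>S\<in>F. (-1) ^ card S * (real (card {n\<in>I. S \<subseteq> bad n}) - x * (\<Prod>p\<in>S. real (rho k r l p) / real p ^ k)))"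
      proof -
        have alg: "p * c - x * (p * e) = p * (c - x * e)" for p c e :: real by (simp add: algebra_simps)
        show ?thesis unfolding swap sum_distrib_left[of x] sum_subtractf[symmetric]
          by (rule sum.cong[OF refl]) (simp only: euler_term_def alg)
      qed
      then have "\<bar>(\<Sum>n\<in>I. T n) - x * (\<Sum>S\<in>F. euler_term S)\<bar> = \<bar>\<Sum>S\<in>F. (-1) ^ card S * (real (card {n\<in>I. S \<subseteq> bad n}) - x * (\<Prod>p\<in>S. real (rho k r l p) / real p ^ k))\<bar>"
        by (rule arg_cong)
      also have "\<dots> \<le> (\<Sum>S\<in>F. \<bar>(-1) ^ card S * (real (card {n\<in>I. S \<subseteq> bad n}) - x * (\<Prod>p\<in>S. real (rho k r l p) / real p ^ k))\<bar>)"
        by (rule sum_abs)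
      also have "\<dots> \<le> (\<Sum>S\<in>F. 2 * C4 * u powr \<epsilon>)"
      proof (rule sum_mono)
        fix S assume "S \<in> F"
        then have S: "S \<in> prime_sets" "real (\<Prod>S) \<le> u ^ 3" unfolding F_def by blast+
        have eq: "{n\<in>I. S \<subseteq> bad n} = {n. 0 < n \<and> real n \<le> x \<and> S \<subseteq> bad n}" unfolding I_def by blast
        have sg: "\<bar>(-1) ^ i * z\<bar> = \<bar>z\<bar>" for i and z :: real by (simp add: abs_mult power_abs)
        have "\<bar>(-1) ^ card S * (real (card {n\<in>I. S \<subseteq> bad n}) - x * (\<Prod>p\<in>S. real (rho k r l p) / real p ^ k))\<bar> \<le> 2 * rho_bound ^ card S"
          unfolding sg eq by (rule card_bad_supset_le[OF S(1) x0])
        moreover have "rho_bound ^ card S \<le> C4 * u powr \<epsilon>"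
        proof -
          have "rho_bound ^ card S \<le> C4 * real (\<Prod>S) powr (\<epsilon> / 3)" by (rule c4[OF prime_setsD(1)[OF S(1)] prime_setsD(2)[OF S(1)]])
          also have "\<dots> \<le> C4 * (u ^ 3) powr (\<epsilon> / 3)"
            by (rule mult_left_mono[OF powr_mono2[OF less_imp_le[OF e3] of_nat_0_le_iff S(2)] less_imp_le[OF C4]])
          also have "(u ^ 3) powr (\<epsilon> / 3) = u powr \<epsilon>"
          proof -
            have u3: "u ^ 3 = u powr 3" using u0 by (simp add: powr_numeral)
            show ?thesis unfolding u3 powr_powr by simp
          qed
          finally show ?thesis .
        qed
        ultimately show "\<bar>(-1) ^ card S * (real (card {n\<in>I. S \<subseteq> bad n}) - x * (\<Prod>p\<in>S. real (rho k r l p) / real p ^ k))\<bar> \<le> 2 * C4 * u powr \<epsilon>"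
          by linarith
      qed
      also have "\<dots> = real (card F) * (2 * C4 * u powr \<epsilon>)" by simp
      also have "\<dots> \<le> u ^ 3 * (2 * C4 * u powr \<epsilon>)" using cF C4 by (intro mult_right_mono) auto
      also have "\<dots> = 2 * C4 * t" unfolding t_def by simp
      finally show ?thesis .
    qed
    have part3: "\<bar>x * (\<Sum>S\<in>F. euler_term S) - density_const k r l * x\<bar> \<le> C3 * t"
    proof -
      have "x * (\<Sum>S\<in>F. euler_term S) - density_const k r l * x = - (x * (density_const k r l - (\<Sum>S\<in>F. euler_term S)))"
        by (simp add: algebra_simps)
      then have "\<bar>x * (\<Sum>S\<in>F. euler_term S) - density_const k r l * x\<bar> = x * \<bar>density_const k r l - (\<Sum>S\<in>F. euler_term S)\<bar>"
        using x0 by (simp add: abs_mult)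
      also have "\<dots> \<le> x * (C3 * u\<^sup>2 / u ^ (2 * k))" using dens[OF u(1)] x0 unfolding F_def by (intro mult_left_mono) auto
      also have "\<dots> = C3 * u ^ 3"
      proof -
        have "x = u ^ (2 * k) * u" unfolding x_def by simp
        then show ?thesis using u0 by (simp add: power2_eq_square power3_eq_cube)
      qed
      also have "\<dots> \<le> C3 * t" using t C3 by (intro mult_left_mono) auto
      finally show ?thesis .
    qed
    have "\<bar>real (count_k_free k r l x) - density_const k r l * x\<bar> \<le> (2 * real r * t + C1 * C2 * t) + 2 * C4 * t + C3 * t"
      unfolding count using part1 part2 part3 by linarith
    also have "\<dots> = C * t" unfolding C_def by (simp add: distrib_right)
    finally show "\<bar>real (count_k_free k r l (u ^ (2 * k + 1))) - density_const k r l * u ^ (2 * k + 1)\<bar> \<le> C * u ^ 3 * u powr \<epsilon>"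
      unfolding x_def t_def by (simp add: mult.assoc)
  qed
qed

end

theorem theorem3:
  fixes k r :: nat and a b :: "nat \<Rightarrow> int" and l :: "nat \<Rightarrow> int poly" and \<epsilon> :: real
  assumes "k \<ge> 2" and "r \<ge> 2"
    and "\<And>i. i \<in> {1..r} \<Longrightarrow> l i = [:b i, a i:]"
    and "\<And>i. i \<in> {1..r} \<Longrightarrow> a i \<noteq> 0"
    and "\<And>i j. i \<in> {1..r} \<Longrightarrow> j \<in> {1..r} \<Longrightarrow> i \<noteq> j \<Longrightarrow> a i * b j - a j * b i \<noteq> 0"
    and "\<epsilon> > 0"
  shows "(\<lambda>x::real. real (count_k_free k r l x) - density_const k r l * x)
           \<in> O[at_top](\<lambda>x. x powr (3 / (2 * real k + 1) + \<epsilon>))"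
proof -
  interpret linear_forms k r a b l using assms by unfold_locales
  define m where "m = real (2 * k + 1)"
  have m: "m > 0" "m = 2 * real k + 1" unfolding m_def by simp_all
  \<comment> \<open>The estimate in \<open>u\<close> is used with \<open>m * \<epsilon>\<close> in
    place of \<open>\<epsilon>\<close>, because
    \<open>u powr (m * \<epsilon>) = x powr \<epsilon>\<close> for
    \<open>u = x powr (1 / m)\<close>.\<close>
  have "m * \<epsilon> > 0" using m assms by simp
  then obtain C U where C: "C > 0" and main: "\<And>u. u \<ge> U \<Longrightarrow>
      \<bar>real (count_k_free k r l (u ^ (2 * k + 1))) - density_const k r l * u ^ (2 * k + 1)\<bar> \<le> C * u ^ 3 * u powr (m * \<epsilon>)"
    by (rule count_k_free_approx) blast
  show ?thesis
  proof (rule bigoI[where c = C])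
    show "eventually (\<lambda>x. norm (real (count_k_free k r l x) - density_const k r l * x) \<le> C * norm (x powr (3 / (2 * real k + 1) + \<epsilon>))) at_top"
      using eventually_ge_at_top[of "(max 1 U) powr m"]
    proof eventually_elim
      case (elim x)
      define u where "u = x powr (1 / m)"
      have x1: "x > 0" using elim order_less_le_trans[of 0 "max 1 U powr m" x] by simp
      have "max 1 U = (max 1 U powr m) powr (1 / m)" using m by (simp add: powr_powr)
      also have "\<dots> \<le> u" unfolding u_def using elim m by (intro powr_mono2) auto
      finally have u: "u \<ge> U" "u > 0" by auto
      have "u ^ (2 * k + 1) = u powr m" unfolding m_def by (rule powr_realpow[symmetric, OF u(2)])
      also have "\<dots> = x" unfolding u_def powr_powr using m(1) x1 by simp
      finally have ux: "u ^ (2 * k + 1) = x" .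
      have "u ^ 3 * u powr (m * \<epsilon>) = u powr 3 * u powr (m * \<epsilon>)" using u(2) by (simp add: powr_numeral)
      also have "\<dots> = x powr (1 / m * (3 + m * \<epsilon>))" unfolding powr_add[symmetric] u_def powr_powr by (simp only: distrib_left)
      also have "1 / m * (3 + m * \<epsilon>) = 3 / (2 * real k + 1) + \<epsilon>" unfolding m(2)[symmetric] using m(1) by (simp add: distrib_left)
      finally have "u ^ 3 * u powr (m * \<epsilon>) = x powr (3 / (2 * real k + 1) + \<epsilon>)" .
      then show ?case using main[OF u(1)] unfolding ux by (simp add: mult.assoc)
    qed
  qed
qed

end
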